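(* Let $(X_k)_{k\ge1}$ be i.i.d. real random variables with unit variance and symmetric Pareto density $f(x)=\dfrac{a_f}{b_f+|x|^{\alpha+1}}$, $x\in\mathbb R$, where $a_f,b_f>0$ are constants and the real number $\alpha$ is not an even integer. Let $S_n=X_1+\dots+X_n$ and let $f_{S_n/n^{1/2}}$ be the density of $S_n/n^{1/2}$. Then, as $n\to\infty$, $$f_{S_n/n^{1/2}}(x)=\eta(x)\Big[1+\sum_{\substack{3\le j<\alpha\\ j\text{ even}}}\frac{G_j(x)}{n^{j/2-1}}\Big]+\frac{a_f\,G_\alpha(x)}{n^{\alpha/2-1}}+o\Big(\frac{G_\alpha(x)}{n^{\alpha/2-1}}\Big)$$ uniformly over $x\le\sqrt{(\alpha-2)\log n}$, where $G_j$ ($j<\alpha$) are the ordinary Edgeworth coefficients and $$G_\alpha(x)=\begin{cases}-\dfrac{\sqrt2}{\Gamma(\alpha+1)}\dfrac{d^\alpha}{dx^\alpha}D\big(\tfrac{x}{\sqrt2}\big)&\text{if }\alpha\text{ is an odd integer},\\[1.5ex]-\sqrt{\dfrac{\pi}{2}}\,\dfrac{e^{-x^2/4}}{\Gamma(\alpha+1)\sin(\alpha\pi)}\big[D_\alpha(x)+D_\alpha(-x)\big]&\text{if }\alpha\text{ is not an integer}.\end{cases}$$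
   Context: Unit (finite) variance forces $\alpha>2$. $\eta(x)=e^{-x^2/2}/\sqrt{2\pi}$. $H_k$ is the $k$-th (probabilists') Hermite polynomial, defined by $\frac{d^k}{dx^k}\eta(x)=(-1)^kH_k(x)\eta(x)$. Dawson's integral is $D(z)=e^{-z^2}\int_0^z e^{t^2}\,dt$. The classical parabolic cylinder function with parameter $\nu>-1$ is $$D_\nu(z)=\sqrt{\tfrac{2}{\pi}}\,e^{z^2/4}\int_0^\infty e^{-t^2/2}t^\nu\cos\big(zt-\tfrac{\nu\pi}{2}\big)\,dt.$$ The notation $\frac{d^\alpha}{dx^\alpha}D(\frac{x}{\sqrt2})$ means the $\alpha$-th derivative of $x\mapsto D(x/\sqrt2)$. Ordinary Edgeworth coefficients: let $\kappa_l$ be the $l$-th cumulant of $X_k$. For an integer $3\le j<\alpha$ let $\xi_{k,j}(\theta)$ be the coefficient of $n^{-(j/2-1)}$ in the expansion of $\big(\sum_{l=3}^{j}\frac{\kappa_l(i\theta)^l}{l!\,n^{l/2-1}}\big)^k$ in powers of $n^{-1/2}$. Then $G_j$ is the polynomial defined by $$\eta(x)G_j(x)=\frac1{2\pi}\int_{-\infty}^\infty e^{-i\theta x-\theta^2/2}\sum_{k=1}^{j}\frac1{k!}\xi_{k,j}(\theta)\,d\theta,$$ i.e. $G_j$ is obtained from $\sum_{k=1}^j\frac{1}{k!}\xi_{k,j}(\theta)$ by replacing each $(i\theta)^l$ by $H_l(x)$.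
   Formalization: The error o(G_α(x)/n^{α/2-1}) is claimed uniformly only for x at distance at least δ from the zeros of G_α, for each δ>0; near those zeros, where the literal bound fails (e.g. α=3), it is o(1/n^{α/2-1}) uniformly over the range. *)

theory Defs
  imports
    "HOL-Probability.Probability"
    "HOL-Computational_Algebra.Formal_Power_Series"
begin

definition pareto_density :: "real \<Rightarrow> real \<Rightarrow> real \<Rightarrow> real \<Rightarrow> real" where
  "pareto_density a b \<alpha> x = a / (b + \<bar>x\<bar> powr (\<alpha> + 1))"

text \<open>
  Cumulants are the coefficients of the formal logarithm of the exponential generating series of
  the moments. The \<open>l\<close>-th one depends on the moments of order at most \<open>l\<close> only, so it is
  meaningful as soon as the \<open>l\<close>-th moment exists; the value \<open>0\<close> that the Bochner integral assigns
  to non-existing higher moments does not influence it.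
\<close>

definition cumulant :: "'a measure \<Rightarrow> ('a \<Rightarrow> real) \<Rightarrow> nat \<Rightarrow> real" where
  "cumulant M Y l =
     fact l * fps_nth (fps_ln 1 oo (Abs_fps (\<lambda>k. (\<integral>\<omega>. Y \<omega> ^ k \<partial>M) / fact k) - 1)) l"

text \<open>
  With \<open>t = n\<^sup>-\<^sup>1\<^sup>/\<^sup>2\<close> the \<open>l\<close>-th summand carries \<open>t ^ (l - 2)\<close>, and the coefficient of
  \<open>n\<^sup>-\<^sup>(\<^sup>j\<^sup>/\<^sup>2\<^sup>-\<^sup>1\<^sup>)\<close> is the coefficient of \<open>t ^ (j - 2)\<close>.
\<close>

definition edgeworth_xi :: "(nat \<Rightarrow> real) \<Rightarrow> nat \<Rightarrow> nat \<Rightarrow> real \<Rightarrow> complex" where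
  "edgeworth_xi \<kappa> k j \<theta> =
     poly.coeff ((\<Sum>l=3..j. monom (of_real (\<kappa> l) * (\<i> * of_real \<theta>) ^ l / fact l) (l - 2)) ^ k) (j - 2)"

text \<open>The integral below is real; \<open>Re\<close> only changes its type.\<close>

definition edgeworth_G :: "(nat \<Rightarrow> real) \<Rightarrow> nat \<Rightarrow> real \<Rightarrow> real" where
  "edgeworth_G \<kappa> j x =
     Re (1 / (2 * of_real pi) *
         (LINT \<theta>|lborel. exp (- \<i> * of_real \<theta> * of_real x - (of_real \<theta>)\<^sup>2 / 2) *
            (\<Sum>k=1..j. edgeworth_xi \<kappa> k j \<theta> / fact k)))
     / std_normal_density x"

definition dawson :: "real \<Rightarrow> real" where
  "dawson z = exp (- z\<^sup>2) * (LBINT t=0..z. exp (t\<^sup>2))"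

definition parabolic_cylinder :: "real \<Rightarrow> real \<Rightarrow> real" where
  "parabolic_cylinder \<nu> z =
     sqrt (2 / pi) * exp (z\<^sup>2 / 4) *
       (LBINT t:{0<..}. exp (- t\<^sup>2 / 2) * t powr \<nu> * cos (z * t - \<nu> * pi / 2))"

text \<open>Only used when \<open>\<alpha>\<close> is an odd integer or not an integer.\<close>

definition pareto_G :: "real \<Rightarrow> real \<Rightarrow> real" where
  "pareto_G \<alpha> x =
     (if \<alpha> \<in> \<int>
      then - (sqrt 2 / Gamma (\<alpha> + 1)) * (deriv ^^ nat \<lfloor>\<alpha>\<rfloor>) (\<lambda>y. dawson (y / sqrt 2)) x
      else - sqrt (pi / 2) * (exp (- x\<^sup>2 / 4) / (Gamma (\<alpha> + 1) * sin (\<alpha> * pi))) *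
             (parabolic_cylinder \<alpha> x + parabolic_cylinder \<alpha> (- x)))"

text \<open>
  The expansion without its error term. Since the Fourier transform of \<open>pareto_G \<alpha>\<close> is a multiple of
  \<open>\<bar>\<theta>\<bar> powr \<alpha> * exp (- \<theta>\<^sup>2 / 2)\<close>, which vanishes at \<open>0\<close>, the function \<open>pareto_G \<alpha>\<close> integrates
  to \<open>0\<close> and has real zeros. A bound on the error by \<open>\<epsilon> * \<bar>pareto_G \<alpha> x\<bar> / n powr (\<alpha> / 2 - 1)\<close> at every
  \<open>x\<close> would force the expansion to be exact at these zeros, so the error has to be measured relative
  to \<open>pareto_G \<alpha> x\<close> away from the zeros and relative to \<open>1\<close> near them.
\<close>

definition pareto_expansion ::
    "(nat \<Rightarrow> real) \<Rightarrow> real \<Rightarrow> real \<Rightarrow> nat \<Rightarrow> real \<Rightarrow> real" where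
  "pareto_expansion \<kappa> a \<alpha> n x =
     std_normal_density x *
       (1 + (\<Sum>j | 3 \<le> j \<and> real j < \<alpha> \<and> even j. edgeworth_G \<kappa> j x / real n powr (real j / 2 - 1)))
     + a * pareto_G \<alpha> x / real n powr (\<alpha> / 2 - 1)"

end

theory Submission
  imports Defs "HOL-Real_Asymp.Real_Asymp"
begin

text \<open>
  Let \<open>N\<close> be the smallest even integer above \<open>\<alpha>\<close>. The characteristic function \<open>\<phi>\<close> of a summand is the
  Taylor polynomial given by its moments plus \<open>c \<bar>s\<bar>\<^sup>\<alpha> + O(\<bar>s\<bar>\<^sup>N)\<close>: replacing the density by its leading
  power \<open>a \<bar>x\<bar>\<^sup>-\<^sup>\<alpha>\<^sup>-\<^sup>1\<close> leaves a remainder with finite moment of order \<open>N\<close>, and the leading power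
  scales. Expanding \<open>\<phi> (\<theta> / \<surd>n)\<^sup>n\<close> and inverting the Fourier transform gives the expansion with
  an error \<open>n powr (1 - \<alpha> / 2 - \<delta>)\<close>, uniformly in \<open>x\<close>; the singular term becomes the cosine transform
  of \<open>t\<^sup>\<alpha> exp (- t\<^sup>2 / 2)\<close>, which is a multiple of \<open>pareto_G \<alpha>\<close>.

  This is not yet small relative to \<open>pareto_G \<alpha>\<close>, which decays like \<open>\<bar>x\<bar>\<^sup>-\<^sup>\<alpha>\<^sup>-\<^sup>1\<close>. For \<open>\<bar>x\<bar>\<close> beyond a
  small power of \<open>n\<close> a truncation argument shows that the sum is large because of exactly one large
  summand, so that its density is asymptotic to \<open>n\<close> times the density of one summand. The two
  descriptions overlap; together they yield the decay of \<open>pareto_G \<alpha>\<close> and the relative error bound.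
\<close>

unbundle no vec_syntax
unbundle fps_syntax

section \<open>Coefficients of exponentials and formal logarithms\<close>

text \<open>Symmetry dictates that \<open>N\<close> is even: odd terms vanish throughout, and the
  strict inequalities \<open>N - 2 < \<alpha> < N\<close> make the leading power times the
  Taylor-subtracted cosine integrable at 0 and at infinity at once. Odd integers and non-integers
  \<alpha> then run in parallel: both formulas for \<open>pareto_G\<close> equal minus a cosine
  transform over \<open>Gamma (\<alpha> + 1) * sin (\<alpha> * pi / 2)\<close>, whose sine vanishes
  only at even integers. The characteristic function has finitely many derivatives at 0, so its
  logarithm is taken formally: a truncation of the formal logarithm of the moment series is
  exponentiated, and the singular power sits in a separate factor \<open>1 + \<rho>\<close>. In the
  n-th power it enters linearly to first order; its square and its product with the first Edgeworth
  correction limit the exponent \<open>gain\<close>. Inversion saves only some unspecified power of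
  n, hence controls the relative error only for \<bar>x\<bar> up to a small power of n; the one-jump
  estimate starts at any positive power, however small, so the two ranges meet. Away from its zeros,
  continuity and the tail of \<open>pareto_G\<close> bound it below by \<open>weight\<close>, which
  turns a weighted error into a relative one.\<close>

definition poly_l1 :: "complex poly \<Rightarrow> real" where
  "poly_l1 p = (\<Sum>i\<le>degree p. norm (coeff p i))"

lemma poly_l1_eq: "degree p \<le> n \<Longrightarrow> poly_l1 p = (\<Sum>i\<le>n. norm (coeff p i))"
  unfolding poly_l1_def by (rule sum.mono_neutral_left) (auto simp: coeff_eq_0)

lemma poly_l1_nonneg: "0 \<le> poly_l1 p"
  by (simp add: poly_l1_def sum_nonneg)

lemma poly_l1_0 [simp]: "poly_l1 0 = 0" by (simp add: poly_l1_def)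
lemma poly_l1_1 [simp]: "poly_l1 1 = 1" by (simp add: poly_l1_def)

lemma poly_l1_add: "poly_l1 (p + q) \<le> poly_l1 p + poly_l1 q"
proof -
  let ?n = "max (degree p) (degree q)"
  have "poly_l1 (p + q) = (\<Sum>i\<le>?n. norm (coeff (p + q) i))"
    by (rule poly_l1_eq) (rule degree_add_le_max)
  also have "\<dots> \<le> (\<Sum>i\<le>?n. norm (coeff p i) + norm (coeff q i))"
    by (rule sum_mono) (simp add: norm_triangle_ineq)
  finally show ?thesis
    by (simp add: sum.distrib poly_l1_eq[of p ?n] poly_l1_eq[of q ?n])
qed

lemma poly_l1_smult: "poly_l1 (smult a p) = norm a * poly_l1 p"
  by (subst poly_l1_eq[OF degree_smult_le]) (simp add: poly_l1_def norm_mult sum_distrib_left)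

lemma poly_l1_pCons: "poly_l1 (pCons a p) = norm a + poly_l1 p"
  by (subst poly_l1_eq[OF degree_pCons_le])
     (simp add: poly_l1_def sum.atMost_Suc_shift del: sum.atMost_Suc)

lemma poly_l1_mult: "poly_l1 (p * q) \<le> poly_l1 p * poly_l1 q"
proof (induction p)
  case (pCons a p)
  have "poly_l1 (pCons a p * q) \<le> norm a * poly_l1 q + poly_l1 (p * q)"
    using poly_l1_add[of "smult a q" "pCons 0 (p * q)"]
    by (simp add: poly_l1_smult poly_l1_pCons)
  with pCons show ?case by (simp add: poly_l1_pCons algebra_simps)
qed simp

lemma poly_l1_power: "poly_l1 (p ^ k) \<le> poly_l1 p ^ k"
proof (induction k)
  case (Suc k)
  have "poly_l1 (p ^ Suc k) \<le> poly_l1 p * poly_l1 (p ^ k)" using poly_l1_mult[of p "p ^ k"] by simp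
  also have "\<dots> \<le> poly_l1 p * poly_l1 p ^ k" by (rule mult_left_mono[OF Suc poly_l1_nonneg])
  finally show ?case by simp
qed simp

lemma poly_l1_sum: "poly_l1 (sum f I) \<le> (\<Sum>i\<in>I. poly_l1 (f i))"
  by (induction I rule: infinite_finite_induct) (auto intro: order_trans[OF poly_l1_add])

lemma poly_l1_monom: "poly_l1 (monom c k) = norm c"
  by (induction k) (simp_all add: monom_0 monom_Suc poly_l1_pCons)

text \<open>Every discarded term carries at least the power \<open>M\<close> of t, and norm t is at
  most 1. Measuring by the coefficient norm \<open>poly_l1\<close> keeps the bound uniform when the
  coefficients later depend on the frequency \<theta>.\<close>

lemma poly_truncation:
  assumes "norm t \<le> 1"
  shows "norm (poly p t - (\<Sum>m<M. coeff p m * t ^ m)) \<le> norm t ^ M * poly_l1 p"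
proof -
  let ?n = "max (degree p) M"
  have "poly p t = (\<Sum>i\<le>?n. coeff p i * t ^ i)"
    unfolding poly_altdef by (rule sum.mono_neutral_left) (auto simp: coeff_eq_0)
  also have "{..?n} = {..<M} \<union> {M..?n}" by auto
  also have "(\<Sum>i\<in>{..<M} \<union> {M..?n}. coeff p i * t ^ i)
      = (\<Sum>m<M. coeff p m * t ^ m) + (\<Sum>i=M..?n. coeff p i * t ^ i)"
    by (rule sum.union_disjoint) auto
  finally have "norm (poly p t - (\<Sum>m<M. coeff p m * t ^ m)) = norm (\<Sum>i=M..?n. coeff p i * t ^ i)"
    by simp
  also have "\<dots> \<le> (\<Sum>i=M..?n. norm t ^ M * norm (coeff p i))"
    using assms
    by (intro sum_norm_le)
       (auto simp: norm_mult norm_power mult.commute intro!: mult_right_mono power_decreasing)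
  also have "\<dots> \<le> (\<Sum>i\<le>?n. norm t ^ M * norm (coeff p i))"
    by (rule sum_mono2) auto
  also have "\<dots> = norm t ^ M * poly_l1 p"
    by (simp add: sum_distrib_left poly_l1_eq[of p ?n])
  finally show ?thesis .
qed

text \<open>Two truncations are made: the exponential series is cut after the power
  \<open>M\<close>, and each power of w is cut below degree \<open>M\<close> in t. Because w has no
  constant term, powers of w beyond the m-th do not reach degree m, so the coefficients shown are
  those of the full exponential. The constant 4 is 3 (a bound for exp 1) from the first cut plus 1
  from the second.\<close>

lemma exp_poly_truncation:
  fixes w :: "complex poly"
  assumes w0: "coeff w 0 = 0" and t: "norm t \<le> 1" "norm t * poly_l1 w \<le> 1"
  shows "norm (poly w t) \<le> norm t * poly_l1 w"
    and "norm (exp (poly w t) - (\<Sum>m<M. (\<Sum>k\<le>M. coeff (w ^ k) m / fact k) * t ^ m))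
      \<le> 4 * norm t ^ M * (1 + poly_l1 w) ^ Suc M"
proof -
  define A where "A = poly_l1 w"
  have A: "A \<ge> 0" by (simp add: A_def poly_l1_nonneg)
  show le: "norm (poly w t) \<le> norm t * poly_l1 w"
    using poly_truncation[OF t(1), of w 1] w0 by simp
  have le1: "norm (poly w t) \<le> 1" using le t(2) by simp
  have "norm (exp (poly w t) - (\<Sum>k\<le>M. poly w t ^ k / fact k))
      \<le> exp (norm (poly w t)) * norm (poly w t) ^ Suc M / fact M"
    by (rule Taylor_exp_field)
  also have "\<dots> \<le> exp (norm (poly w t)) * norm (poly w t) ^ Suc M"
    using mult_right_mono[of 1 "fact M" "exp (norm (poly w t)) * norm (poly w t) ^ Suc M"]
    by (simp add: divide_le_eq fact_ge_1 mult.commute)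
  also have "\<dots> \<le> 3 * (norm t ^ M * A ^ Suc M)"
  proof (rule mult_mono)
    show "exp (norm (poly w t)) \<le> 3"
      using order_trans[OF _ exp_le, of "exp (norm (poly w t))"] le1 by simp
    have "norm (poly w t) ^ Suc M \<le> (norm t * A) ^ Suc M"
      using le by (intro power_mono) (auto simp: A_def)
    also have "\<dots> = norm t ^ Suc M * A ^ Suc M" by (rule power_mult_distrib)
    also have "\<dots> \<le> norm t ^ M * A ^ Suc M"
      using t(1) A by (intro mult_right_mono power_decreasing) auto
    finally show "norm (poly w t) ^ Suc M \<le> norm t ^ M * A ^ Suc M" .
  qed auto
  also have "\<dots> \<le> 3 * (norm t ^ M * (1 + A) ^ Suc M)"
    using A by (intro mult_left_mono power_mono) auto
  finally have 1: "norm (exp (poly w t) - (\<Sum>k\<le>M. poly w t ^ k / fact k)) \<le> 3 * (norm t ^ M * (1 + A) ^ Suc M)" .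
  have "(\<Sum>m<M. (\<Sum>k\<le>M. coeff (w ^ k) m / fact k) * t ^ m)
      = (\<Sum>k\<le>M. (\<Sum>m<M. coeff (w ^ k) m * t ^ m) / fact k)"
    by (simp only: sum_distrib_right sum_divide_distrib, subst sum.swap) simp
  then have "norm ((\<Sum>k\<le>M. poly w t ^ k / fact k) - (\<Sum>m<M. (\<Sum>k\<le>M. coeff (w ^ k) m / fact k) * t ^ m))
      = norm (\<Sum>k\<le>M. (poly (w ^ k) t - (\<Sum>m<M. coeff (w ^ k) m * t ^ m)) / fact k)"
    by (simp add: sum_subtractf diff_divide_distrib poly_power)
  \<comment> \<open>Binomial coefficients, all at least 1, are inserted only to sum the powers of
    \<open>A\<close> in closed form.\<close>
  also have "\<dots> \<le> (\<Sum>k\<le>M. norm t ^ M * (of_nat (M choose k) * A ^ k * 1 ^ (M - k)))"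
  proof (rule sum_norm_le)
    fix k assume k: "k \<in> {..M}"
    have "norm (poly (w ^ k) t - (\<Sum>m<M. coeff (w ^ k) m * t ^ m)) \<le> norm t ^ M * poly_l1 (w ^ k)"
      by (rule poly_truncation[OF t(1)])
    also have "\<dots> \<le> norm t ^ M * A ^ k"
      unfolding A_def by (intro mult_left_mono poly_l1_power) auto
    finally have *: "norm (poly (w ^ k) t - (\<Sum>m<M. coeff (w ^ k) m * t ^ m)) \<le> norm t ^ M * A ^ k" .
    have "norm ((poly (w ^ k) t - (\<Sum>m<M. coeff (w ^ k) m * t ^ m)) / fact k)
        \<le> norm (poly (w ^ k) t - (\<Sum>m<M. coeff (w ^ k) m * t ^ m)) / 1"
      by (simp only: norm_divide norm_fact, rule divide_left_mono) (auto simp: fact_ge_1)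
    also have "\<dots> \<le> norm t ^ M * A ^ k" using * by simp
    also have "\<dots> \<le> norm t ^ M * (of_nat (M choose k) * A ^ k)"
      using k A mult_right_mono[of 1 "real (M choose k)" "A ^ k"]
      by (intro mult_left_mono) (auto simp: Suc_le_eq)
    finally show "norm ((poly (w ^ k) t - (\<Sum>m<M. coeff (w ^ k) m * t ^ m)) / fact k)
      \<le> norm t ^ M * (of_nat (M choose k) * A ^ k * 1 ^ (M - k))" by simp
  qed
  also have "\<dots> = norm t ^ M * (A + 1) ^ M"
    by (simp only: binomial_ring[of A 1 M] sum_distrib_left)
  also have "\<dots> \<le> norm t ^ M * (1 + A) ^ Suc M"
    using A by (intro mult_left_mono) (auto simp: add.commute)
  finally have 2: "norm ((\<Sum>k\<le>M. poly w t ^ k / fact k) - (\<Sum>m<M. (\<Sum>k\<le>M. coeff (w ^ k) m / fact k) * t ^ m))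
    \<le> norm t ^ M * (1 + A) ^ Suc M" .
  show "norm (exp (poly w t) - (\<Sum>m<M. (\<Sum>k\<le>M. coeff (w ^ k) m / fact k) * t ^ m))
      \<le> 4 * norm t ^ M * (1 + poly_l1 w) ^ Suc M"
    using norm_triangle_ineq[of "exp (poly w t) - (\<Sum>k\<le>M. poly w t ^ k / fact k)"
       "(\<Sum>k\<le>M. poly w t ^ k / fact k) - (\<Sum>m<M. (\<Sum>k\<le>M. coeff (w ^ k) m / fact k) * t ^ m)"] 1 2
    by (simp add: A_def)
qed

lemma coeff_power_cong:
  assumes "\<And>i. i \<le> m \<Longrightarrow> coeff p i = coeff q i"
  shows "coeff (p ^ k) m = coeff (q ^ k) m"
  using assms
proof (induction k arbitrary: m)
  case (Suc k)
  show ?case unfolding power_Suc coeff_mult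
    by (intro sum.cong refl arg_cong2[where f="(*)"] Suc) (use Suc.prems in auto)
qed simp

lemma coeff_power_low:
  assumes "coeff p 0 = 0" "m < k"
  shows "coeff (p ^ k) m = 0"
  using assms(2)
proof (induction k arbitrary: m)
  case (Suc k)
  have "coeff p i * coeff (p ^ k) (m - i) = 0" if "i \<le> m" for i
    by (cases "i = 0") (use that Suc assms(1) in auto)
  then show ?case by (simp add: coeff_mult)
qed simp

lemma coeff_power_odd:
  fixes p :: "'a :: idom poly"
  assumes "\<And>i. odd i \<Longrightarrow> coeff p i = 0" "odd m"
  shows "coeff (p ^ k) m = 0"
  using assms(2)
proof (induction k arbitrary: m)
  case (Suc k)
  have "coeff p i * coeff (p ^ k) (m - i) = 0" if "i \<le> m" for i
    by (cases "odd i") (use that Suc assms(1) in auto)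
  then show ?case unfolding power_Suc coeff_mult by (intro sum.neutral) auto
qed (auto simp: odd_pos)

lemma coeff_power_fps:
  fixes F :: "real fps"
  assumes "\<And>i. i \<le> m \<Longrightarrow> coeff p i = complex_of_real (F $ i)"
  shows "coeff (p ^ k) m = complex_of_real ((F ^ k) $ m)"
  using assms
proof (induction k arbitrary: m)
  case (Suc k)
  have "coeff (p ^ Suc k) m = (\<Sum>i\<le>m. complex_of_real (F $ i * (F ^ k) $ (m - i)))"
    unfolding power_Suc coeff_mult using Suc by (intro sum.cong refl) simp
  also have "\<dots> = complex_of_real ((F ^ Suc k) $ m)"
    by (simp add: fps_mult_nth atLeast0AtMost)
  finally show ?case .
qed simp

section \<open>Formal logarithms of power series\<close>

definition formal_log :: "real fps \<Rightarrow> real fps" where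
  "formal_log F = fps_ln 1 oo (F - 1)"

lemma formal_log_0 [simp]: "formal_log F $ 0 = 0"
  by (simp add: formal_log_def)

text \<open>\<open>fps_exp 1 - 1\<close> and \<open>fps_ln 1\<close> are inverse under composition.
  Constant coefficient 1 is what makes composition with \<open>F - 1\<close> associative.\<close>

lemma exp_formal_log:
  assumes "F $ 0 = 1"
  shows "fps_exp 1 oo formal_log F = F"
proof -
  have "(fps_exp 1 - 1) oo (fps_ln 1 oo (F - 1)) = ((fps_exp 1 - 1) oo fps_ln 1) oo (F - 1)"
    by (rule fps_compose_assoc) (simp_all add: assms)
  also have "(fps_exp 1 - 1) oo fps_ln (1::real) = fps_X"
    by (simp add: fps_ln_fps_exp_inv fps_inv_fps_exp_compose)
  also have "fps_X oo (F - 1) = F - 1"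
    by (rule fps_X_fps_compose_startby0) (simp add: assms)
  finally have "(fps_exp 1 oo formal_log F) - (1 oo formal_log F) = F - 1"
    by (simp add: formal_log_def fps_compose_sub_distrib)
  then show ?thesis by simp
qed

text \<open>Substituting \<open>- fps_X\<close> fixes \<open>F - 1\<close> and therefore its
  logarithm, while it flips the sign of the odd coefficients. This is the vanishing of odd cumulants
  for a symmetric law.\<close>

lemma formal_log_odd:
  assumes "F $ 0 = 1" "\<And>k. odd k \<Longrightarrow> F $ k = 0" "odd k"
  shows "formal_log F $ k = 0"
proof -
  have "(F - 1) oo (- fps_X) = F - 1"
    by (rule fps_ext) (use assms(2) in \<open>auto simp: fps_compose_uminus' minus_one_power_iff\<close>)
  then have "formal_log F oo (- fps_X) = formal_log F"
    unfolding formal_log_def using assms(1)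
    by (subst fps_compose_assoc[symmetric]) auto
  then have "(formal_log F oo (- fps_X)) $ k = formal_log F $ k" by simp
  then show ?thesis using assms(3) by (simp add: fps_compose_uminus')
qed

text \<open>Compare degree 2 in exp (log F) = F: with no linear term only the first power of the
  logarithm contributes. For moment series this says that the second cumulant of a centred law is
  its variance.\<close>

lemma formal_log_2:
  assumes "F $ 0 = 1" "F $ 1 = 0"
  shows "formal_log F $ 2 = F $ 2"
proof -
  have "F $ 2 = (\<Sum>i=0..2. 1 / fact i * (formal_log F ^ i) $ 2)"
    using fps_compose_nth[of "fps_exp 1" "formal_log F" 2] exp_formal_log[OF assms(1)] by simp
  moreover have "formal_log F $ 1 = 0"
    using fps_compose_nth[of "fps_exp 1" "formal_log F" 1] exp_formal_log[OF assms(1)] assms(2)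
    by simp
  ultimately show ?thesis
    by (simp add: numeral_2_eq_2 fps_mult_nth)
qed

text \<open>Coefficient m of a power of the logarithm uses only coefficients up to m, so cutting the
  logarithm at degree \<open>N\<close> is invisible below \<open>N\<close>; powers beyond m
  contribute nothing. Hence a polynomial can stand in for the logarithm of a function with finitely
  many moments.\<close>

lemma exp_formal_log_coeff:
  assumes "F $ 0 = 1" "m < N"
  shows "(\<Sum>k\<le>N. coeff ((\<Sum>l<N. monom (complex_of_real (formal_log F $ l)) l) ^ k) m / fact k)
    = complex_of_real (F $ m)"
proof -
  let ?w = "\<Sum>l<N. monom (complex_of_real (formal_log F $ l)) l"
  have c: "coeff ?w i = complex_of_real (formal_log F $ i)" if "i < N" for i
    using that by (simp add: coeff_sum if_distrib cong: if_cong)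
  have w0: "coeff ?w 0 = 0" using c[of 0] assms(2) by simp
  have "(\<Sum>k\<le>N. coeff (?w ^ k) m / fact k) = (\<Sum>k\<le>m. coeff (?w ^ k) m / fact k)"
    using assms(2) by (intro sum.mono_neutral_right) (auto simp: coeff_power_low[OF w0])
  also have "\<dots> = (\<Sum>k\<le>m. complex_of_real ((1 / fact k) * (formal_log F ^ k) $ m))"
    using assms(2)
    by (intro sum.cong refl, subst coeff_power_fps[where F="formal_log F"]) (auto simp: c)
  also have "\<dots> = complex_of_real ((fps_exp 1 oo formal_log F) $ m)"
    unfolding fps_compose_nth by (simp add: atLeast0AtMost)
  finally show ?thesis by (simp add: exp_formal_log[OF assms(1)])
qed

section \<open>The constant of the singular term\<close>

text \<open>Carries gauge integrals from the library (powers, Beta, Gamma) over to Lebesgue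
  integrals; nonnegativity supplies the absolute integrability.\<close>

lemma has_integral_nonneg_lborel:
  fixes g :: "real \<Rightarrow> real"
  assumes "g \<in> borel_measurable borel" "S \<in> sets borel" "\<And>x. x \<in> S \<Longrightarrow> g x \<ge> 0"
    and "(g has_integral I) S"
  shows "set_integrable lborel S g" "(LBINT x:S. g x) = I"
proof -
  have "g absolutely_integrable_on S"
    using assms by (intro nonnegative_absolutely_integrable_1) auto
  then have "integrable (completion lborel) (\<lambda>x. indicator S x *\<^sub>R g x)"
    by (simp add: set_integrable_def)
  moreover have "(\<lambda>x. indicator S x *\<^sub>R g x) \<in> borel_measurable lborel"
    using assms(1,2) by measurable
  ultimately show *: "set_integrable lborel S g"
    by (simp add: set_integrable_def integrable_completion)
  show "(LBINT x:S. g x) = I"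
    using set_borel_integral_eq_integral(2)[OF *] assms(4) by (simp add: integral_unique)
qed

lemma integral_even:
  fixes g :: "real \<Rightarrow> real"
  assumes "set_integrable lborel {0..} g"
  shows "integrable lborel (\<lambda>x. g \<bar>x\<bar>)" "(LINT x|lborel. g \<bar>x\<bar>) = 2 * (LBINT x:{0..}. g x)"
proof -
  let ?h = "\<lambda>x. indicator {0..} x *\<^sub>R g x :: real"
  have h: "integrable lborel ?h"
    using assms by (simp add: set_integrable_def)
  have h': "integrable lborel (\<lambda>x. ?h (- x))"
    using lborel_integrable_real_affine[OF h, of "-1" 0] by simp
  have s: "integrable lborel (\<lambda>x. ?h x + ?h (- x))"
    using h h' by simp
  have ae: "AE x in lborel. g \<bar>x\<bar> = ?h x + ?h (- x)"
    using AE_lborel_singleton[of "0::real"] by eventually_elim (auto simp: indicator_def abs_if)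
  have "{0..} = insert 0 {0::real<..}" by auto
  have m: "(\<lambda>x. g \<bar>x\<bar>) \<in> borel_measurable lborel"
  proof -
    have "(\<lambda>x. ?h \<bar>x\<bar>) \<in> borel_measurable lborel"
      using borel_measurable_integrable[OF h] by measurable
    moreover have "?h \<bar>x\<bar> = g \<bar>x\<bar>" for x by simp
    ultimately show ?thesis by simp
  qed
  show "integrable lborel (\<lambda>x. g \<bar>x\<bar>)"
    using s m ae by (subst integrable_cong_AE[where g="\<lambda>x. ?h x + ?h (- x)"]) auto
  have "(LINT x|lborel. g \<bar>x\<bar>) = (LINT x|lborel. ?h x + ?h (- x))"
    using s m ae by (intro integral_cong_AE) auto
  also have "\<dots> = (LINT x|lborel. ?h x) + (LINT x|lborel. ?h (- x))"
    using h h' by simp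
  also have "(LINT x|lborel. ?h (- x)) = (LINT x|lborel. ?h x)"
    using lborel_integral_real_affine[of "-1" ?h 0] by simp
  finally show "(LINT x|lborel. g \<bar>x\<bar>) = 2 * (LBINT x:{0..}. g x)"
    by (simp add: set_lebesgue_integral_def)
qed

lemma integrable_powr_majorant:
  fixes p q :: real
  assumes "p > -1" "q < -1"
  shows "integrable lborel (\<lambda>x. if \<bar>x\<bar> \<le> 1 then \<bar>x\<bar> powr p else \<bar>x\<bar> powr q)"
proof -
  have 1: "set_integrable lborel {0..1} (\<lambda>x::real. x powr p)"
    using has_integral_powr_from_0[OF assms(1), of 1] by (intro has_integral_nonneg_lborel(1)) auto
  have 2: "set_integrable lborel {1..} (\<lambda>x::real. x powr q)"
    using has_integral_powr_to_inf[OF assms(2), of 1] by (intro has_integral_nonneg_lborel(1)) auto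
  have "set_integrable lborel {1<..} (\<lambda>x::real. x powr q)"
    by (rule set_integrable_subset[OF 2]) auto
  then have 3: "set_integrable lborel {1<..} (\<lambda>x::real. if x \<le> 1 then x powr p else x powr q)"
    by (rule set_integrable_cong[THEN iffD1, rotated -1]) auto
  have 4: "set_integrable lborel {0..1} (\<lambda>x::real. if x \<le> 1 then x powr p else x powr q)"
    using 1 by (rule set_integrable_cong[THEN iffD1, rotated -1]) auto
  have "{0..} = {0..1} \<union> {1::real<..}" by auto
  then have "set_integrable lborel {0..} (\<lambda>x::real. if x \<le> 1 then x powr p else x powr q)"
    using set_integrable_Un[OF 4 3] by simp
  from integral_even(1)[OF this] show ?thesis by simp
qed

lemma integrable_dominated_powr:
  fixes g :: "real \<Rightarrow> real"
  assumes "p > -1" "q < -1" and [measurable]: "g \<in> borel_measurable borel"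
    and "\<And>x. \<bar>x\<bar> \<le> 1 \<Longrightarrow> \<bar>g x\<bar> \<le> A * \<bar>x\<bar> powr p" "\<And>x. \<bar>x\<bar> > 1 \<Longrightarrow> \<bar>g x\<bar> \<le> A * \<bar>x\<bar> powr q"
  shows "integrable lborel g"
  by (rule Bochner_Integration.integrable_bound[OF integrable_mult_right[OF integrable_powr_majorant[OF assms(1,2)], of A]])
     (use assms in \<open>force simp: not_le intro: order_trans[OF _ abs_ge_self]\<close>)+

section \<open>The Taylor-subtracted cosine against a power\<close>

definition cos_taylor :: "nat \<Rightarrow> real \<Rightarrow> real" where
  "cos_taylor N u = (\<Sum>m<N. cos_coeff m * u ^ m)"

lemma cos_coeff_odd: "odd m \<Longrightarrow> cos_coeff m = 0"
  by (simp add: cos_coeff_def)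

lemma cos_taylor_even: "cos_taylor N (- u) = cos_taylor N u"
  unfolding cos_taylor_def by (rule sum.cong) (auto simp: cos_coeff_def)

lemma cos_taylor_measurable [measurable]: "cos_taylor N \<in> borel_measurable borel"
  unfolding cos_taylor_def by measurable

lemma cos_taylor_error:
  shows "\<bar>cos u - cos_taylor N u\<bar> \<le> \<bar>u\<bar> ^ N"
proof -
  have *: "\<bar>cos u - cos_taylor N u\<bar> \<le> \<bar>u\<bar> ^ N" if u: "u > 0" "N > 0" for u
  proof -
    obtain t where "cos u = cos_taylor N u + (cos (t + 1/2 * real N * pi) / fact N) * u ^ N"
      using Maclaurin_cos_expansion2[OF u] unfolding cos_taylor_def by blast
    then have "\<bar>cos u - cos_taylor N u\<bar> = \<bar>cos (t + 1/2 * real N * pi)\<bar> / fact N * \<bar>u\<bar> ^ N"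
      by (simp add: abs_mult power_abs)
    also have "\<dots> \<le> 1 / 1 * \<bar>u\<bar> ^ N"
      by (intro mult_right_mono frac_le) (auto simp: fact_ge_1)
    finally show ?thesis by simp
  qed
  show ?thesis
  proof (cases "N = 0")
    case True then show ?thesis by (simp add: cos_taylor_def)
  next
    case False
    consider "u = 0" | "u > 0" | "- u > 0" by linarith
    then show ?thesis
    proof cases
      case 1
      have "cos_taylor N 0 = (\<Sum>m<N. if m = 0 then 1 else 0)"
        unfolding cos_taylor_def by (rule sum.cong) (auto simp: cos_coeff_def power_0_left)
      with 1 False show ?thesis by (simp add: power_0_left)
    next
      case 3 then show ?thesis using *[of "-u"] False by (simp add: cos_taylor_even)
    qed (use * False in auto)
  qed
qed

text \<open>The bound for large arguments. Since \<open>N\<close> is even, the last nonzero Taylor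
  term has degree \<open>N - 2\<close>; it is moved into the error.\<close>

lemma cos_taylor_error':
  assumes "even N" "N \<ge> 2"
  shows "\<bar>cos u - cos_taylor N u\<bar> \<le> 2 * \<bar>u\<bar> ^ (N - 2)"
proof -
  obtain K where N: "N = Suc (Suc K)" using assms(2) by (metis add_2_eq_Suc le_Suc_ex)
  have "cos_taylor N u = cos_taylor K u + cos_coeff K * u ^ K"
    using assms(1) by (simp add: cos_taylor_def N cos_coeff_odd)
  moreover have "\<bar>cos_coeff K * u ^ K\<bar> \<le> 1 * \<bar>u\<bar> ^ K"
    unfolding abs_mult power_abs
    by (intro mult_right_mono) (auto simp: cos_coeff_def fact_ge_1 divide_le_eq)
  ultimately show ?thesis using cos_taylor_error[of u K] by (simp add: N)
qed

text \<open>The error of order \<open>N\<close> leaves the exponent N - \<alpha> - 1 > -1 at 0, and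
  the error of order \<open>N - 2\<close> leaves N - 2 - \<alpha> - 1 < -1 at infinity.\<close>

lemma integrable_cos_kernel:
  assumes "even N" "N \<ge> 2" "real N - 2 < \<alpha>" "\<alpha> < real N"
  shows "integrable lborel (\<lambda>u. \<bar>u\<bar> powr (- \<alpha> - 1) * (cos (s * u) - cos_taylor N (s * u)))"
proof (rule integrable_dominated_powr[where p="real N - \<alpha> - 1" and q="real N - 2 - \<alpha> - 1" and A="\<bar>s\<bar> ^ N + 2 * \<bar>s\<bar> ^ (N - 2)"])
  fix x :: real
  have "\<bar>\<bar>x\<bar> powr (- \<alpha> - 1) * (cos (s * x) - cos_taylor N (s * x))\<bar> \<le> \<bar>x\<bar> powr (- \<alpha> - 1) * (\<bar>s\<bar> ^ N * \<bar>x\<bar> ^ N)"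
    unfolding abs_mult using cos_taylor_error[of "s * x" N]
    by (intro mult_mono) (auto simp: abs_mult power_mult_distrib)
  also have "\<dots> = \<bar>s\<bar> ^ N * \<bar>x\<bar> powr (real N - \<alpha> - 1)"
    using assms(2)
    by (cases "x = 0") (auto simp: powr_realpow[symmetric] powr_add[symmetric] algebra_simps)
  also have "\<dots> \<le> (\<bar>s\<bar> ^ N + 2 * \<bar>s\<bar> ^ (N - 2)) * \<bar>x\<bar> powr (real N - \<alpha> - 1)"
    by (intro mult_right_mono) auto
  finally show "\<bar>\<bar>x\<bar> powr (- \<alpha> - 1) * (cos (s * x) - cos_taylor N (s * x))\<bar>
    \<le> (\<bar>s\<bar> ^ N + 2 * \<bar>s\<bar> ^ (N - 2)) * \<bar>x\<bar> powr (real N - \<alpha> - 1)" .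
  have "\<bar>\<bar>x\<bar> powr (- \<alpha> - 1) * (cos (s * x) - cos_taylor N (s * x))\<bar> \<le> \<bar>x\<bar> powr (- \<alpha> - 1) * (2 * \<bar>s\<bar> ^ (N - 2) * \<bar>x\<bar> ^ (N - 2))"
    unfolding abs_mult using cos_taylor_error'[OF assms(1,2), of "s * x"]
    by (intro mult_mono) (auto simp: abs_mult power_mult_distrib)
  also have "\<dots> = 2 * \<bar>s\<bar> ^ (N - 2) * \<bar>x\<bar> powr (real N - 2 - \<alpha> - 1)"
    using assms(2) by (cases "x = 0") (auto simp: powr_realpow[symmetric] powr_add[symmetric] of_nat_diff algebra_simps)
  also have "\<dots> \<le> (\<bar>s\<bar> ^ N + 2 * \<bar>s\<bar> ^ (N - 2)) * \<bar>x\<bar> powr (real N - 2 - \<alpha> - 1)"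
    by (intro mult_right_mono) auto
  finally show "\<bar>\<bar>x\<bar> powr (- \<alpha> - 1) * (cos (s * x) - cos_taylor N (s * x))\<bar>
    \<le> (\<bar>s\<bar> ^ N + 2 * \<bar>s\<bar> ^ (N - 2)) * \<bar>x\<bar> powr (real N - 2 - \<alpha> - 1)" .
qed (use assms in auto)

text \<open>The value at 1 of the Fourier transform of the homogeneous kernel
  \<bar>u\<bar>^(-\<alpha>-1), regularised by removing the Taylor polynomial. By scaling it is the
  coefficient of \<bar>s\<bar>^\<alpha>, up to the factor \<open>a\<close>.\<close>

definition cos_kernel_const :: "nat \<Rightarrow> real \<Rightarrow> real" where
  "cos_kernel_const N \<alpha> = (LINT u|lborel. \<bar>u\<bar> powr (- \<alpha> - 1) * (cos u - cos_taylor N u))"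

text \<open>A general g is kept because the substitution serves both the subtracted cosine and its
  absolute value in the Fubini argument.\<close>

lemma integral_powr_kernel_scale:
  fixes g :: "real \<Rightarrow> real"
  assumes "s \<noteq> 0"
  shows "(LINT u|lborel. \<bar>u\<bar> powr (- \<alpha> - 1) * g (s * u))
    = \<bar>s\<bar> powr \<alpha> * (LINT u|lborel. \<bar>u\<bar> powr (- \<alpha> - 1) * g u)"
proof -
  have "(LINT u|lborel. \<bar>u\<bar> powr (- \<alpha> - 1) * g u)
      = \<bar>s\<bar> * (LINT u|lborel. \<bar>s * u\<bar> powr (- \<alpha> - 1) * g (s * u))"
    using lborel_integral_real_affine[OF assms, of "\<lambda>u. \<bar>u\<bar> powr (- \<alpha> - 1) * g u" 0] by simp
  also have "(LINT u|lborel. \<bar>s * u\<bar> powr (- \<alpha> - 1) * g (s * u))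
      = \<bar>s\<bar> powr (- \<alpha> - 1) * (LINT u|lborel. \<bar>u\<bar> powr (- \<alpha> - 1) * g (s * u))"
    by (subst integral_mult_right_zero[symmetric])
       (simp add: abs_mult powr_mult mult.assoc del: integral_mult_right_zero)
  finally have "(LINT u|lborel. \<bar>u\<bar> powr (- \<alpha> - 1) * g u)
    = (\<bar>s\<bar> powr 1 * \<bar>s\<bar> powr (- \<alpha> - 1)) * (LINT u|lborel. \<bar>u\<bar> powr (- \<alpha> - 1) * g (s * u))"
    using assms by simp
  also have "\<bar>s\<bar> powr 1 * \<bar>s\<bar> powr (- \<alpha> - 1) = \<bar>s\<bar> powr (-\<alpha>)"
    by (simp only: powr_add[symmetric]) simp
  finally show ?thesis using assms by (simp add: powr_minus)
qed

lemma cos_kernel_scale: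
  assumes "s \<noteq> 0"
  shows "(LINT u|lborel. \<bar>u\<bar> powr (- \<alpha> - 1) * (cos (s * u) - cos_taylor N (s * u)))
    = \<bar>s\<bar> powr \<alpha> * cos_kernel_const N \<alpha>"
  unfolding cos_kernel_const_def
  using integral_powr_kernel_scale[OF assms, of \<alpha> "\<lambda>u. cos u - cos_taylor N u"] by simp

text \<open>The substitution t = u^2 / (1 + u^2) maps the half line to (0, 1) and turns the integral
  into half of \<open>Beta (p/2) (1 - p/2)\<close>; the reflection formula of the Gamma function
  gives the sine.\<close>

lemma Beta_integral_square:
  assumes "0 < p" "p < 2"
  shows "set_integrable lborel {0..} (\<lambda>u::real. u powr (p - 1) / (1 + u\<^sup>2))"
    and "(LBINT u:{0..}. u powr (p - 1) / (1 + u\<^sup>2)) = pi / (2 * sin (pi * p / 2))"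
proof -
  define B where "B = (\<lambda>t::real. t powr (p/2 - 1) * (1 - t) powr (- p/2))"
  define g where "g = (\<lambda>u::real. u\<^sup>2 / (1 + u\<^sup>2))"
  define g' where "g' = (\<lambda>u::real. 2 * u / (1 + u\<^sup>2)\<^sup>2)"
  have pos: "1 + u\<^sup>2 > 0" for u :: real by (smt (verit) zero_le_power2)
  have bi: "(B has_integral Beta (p/2) (1 - p/2)) {0..1}"
    using has_integral_Beta_real[of "p/2" "1 - p/2"] assms by (simp add: B_def)
  have "(B has_integral Beta (p/2) (1 - p/2)) {0<..<1}"
    using bi by (simp add: has_integral_Icc_iff_Ioo)
  then have "B absolutely_integrable_on {0<..<1} \<and> integral {0<..<1} B = Beta (p/2) (1 - p/2)"
    by (auto intro!: nonnegative_absolutely_integrable_1 simp: B_def integral_unique)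
  moreover have "g ` {0<..} = {0<..<1}"
  proof -
    have "t \<in> g ` {0<..}" if "0 < t" "t < 1" for t
    proof -
      have "g (sqrt (t / (1 - t))) = t" using that by (simp add: g_def field_simps)
      then show ?thesis using that by (intro image_eqI[of _ _ "sqrt (t / (1 - t))"]) auto
    qed
    then show ?thesis using pos by (auto simp: g_def)
  qed
  ultimately have *: "B absolutely_integrable_on (g ` {0<..}) \<and> integral (g ` {0<..}) B = Beta (p/2) (1 - p/2)"
    by simp
  have der: "(g has_field_derivative g' u) (at u within {0<..})" for u
    unfolding g_def g'_def using pos[of u]
    by (auto intro!: derivative_eq_intros simp: power2_eq_square field_simps)
  have inj: "inj_on g {0<..}"
  proof (rule inj_onI)
    fix x y :: real assume "x \<in> {0<..}" "y \<in> {0<..}" "g x = g y"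
    then have "x\<^sup>2 = y\<^sup>2" using pos[of x] pos[of y] by (simp add: g_def field_simps)
    then show "x = y" using \<open>x \<in> _\<close> \<open>y \<in> _\<close> by (simp add: power2_eq_iff_nonneg)
  qed
  have "(\<lambda>u. \<bar>g' u\<bar> *\<^sub>R B (g u)) absolutely_integrable_on {0<..} \<and>
       integral {0<..} (\<lambda>u. \<bar>g' u\<bar> *\<^sub>R B (g u)) = Beta (p/2) (1 - p/2)"
    using has_absolute_integral_change_of_variables_1'[of "{0<..}" g g' B, OF _ der inj] * by auto
  then have 1: "((\<lambda>u. \<bar>g' u\<bar> *\<^sub>R B (g u)) has_integral Beta (p/2) (1 - p/2)) {0<..}"
    using absolutely_integrable_on_def has_integral_integral by metis
  have e: "\<bar>g' u\<bar> *\<^sub>R B (g u) = 2 * (u powr (p - 1) / (1 + u\<^sup>2))" if "u \<in> {0<..}" for u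
  proof -
    have u: "u > 0" using that by simp
    have "1 - g u = 1 / (1 + u\<^sup>2)" using pos[of u] by (simp add: g_def field_simps)
    then have "B (g u) = (u powr 2) powr (p/2 - 1) / (1 + u\<^sup>2) powr (p/2-1) * (1 / (1 + u\<^sup>2) powr (-p/2))"
      using u pos[of u] by (simp add: B_def g_def powr_divide)
    also have "\<dots> = u powr (p - 2) / ((1 + u\<^sup>2) powr (p/2-1) * (1 + u\<^sup>2) powr (-p/2))"
      by (simp add: powr_powr algebra_simps)
    also have "(1 + u\<^sup>2) powr (p/2-1) * (1 + u\<^sup>2) powr (-p/2) = (1 + u\<^sup>2) powr (-1)"
      by (simp only: powr_add[symmetric]) simp
    also have "\<dots> = 1 / (1 + u\<^sup>2)"
      using pos[of u] by (simp add: powr_minus_divide)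
    finally have "B (g u) = u powr (p - 2) * (1 + u\<^sup>2)" by simp
    moreover have "\<bar>g' u\<bar> = 2 * u powr 1 / (1 + u\<^sup>2)\<^sup>2" using u by (simp add: g'_def)
    ultimately have "\<bar>g' u\<bar> *\<^sub>R B (g u) = 2 * (u powr 1 * u powr (p - 2)) / (1 + u\<^sup>2)"
      using pos[of u] by (simp add: power2_eq_square)
    also have "u powr 1 * u powr (p - 2) = u powr (p - 1)"
      by (simp only: powr_add[symmetric]) simp
    finally show ?thesis by simp
  qed
  have 2: "((\<lambda>u. 2 * (u powr (p - 1) / (1 + u\<^sup>2))) has_integral Beta (p/2) (1 - p/2)) {0<..}"
    by (rule has_integral_eq[OF e 1]) 
  have "((\<lambda>u. u powr (p - 1) / (1 + u\<^sup>2)) has_integral Beta (p/2) (1 - p/2) / 2) {0<..}"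
    using has_integral_mult_right[OF 2, of "1/2"] by simp
  then have "((\<lambda>u. if u \<in> {0<..} then u powr (p - 1) / (1 + u\<^sup>2) else 0) has_integral Beta (p/2) (1 - p/2) / 2) {0..}"
    by (subst has_integral_restrict) auto
  then have 3: "((\<lambda>u. u powr (p - 1) / (1 + u\<^sup>2)) has_integral Beta (p/2) (1 - p/2) / 2) {0..}"
    by (rule has_integral_spike[of "{0}", rotated 2]) auto
  have "complex_of_real (Gamma (p/2) * Gamma (1 - p/2)) = complex_of_real (pi / sin (pi * (p/2)))"
    using Gamma_reflection_complex[of "complex_of_real (p/2)"]
    by (simp add: Gamma_complex_of_real[symmetric] sin_of_real[symmetric])
  then have "Beta (p/2) (1 - p/2) = pi / sin (pi * p / 2)"
    unfolding Beta_def by (simp only: of_real_eq_iff) simp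
  with has_integral_nonneg_lborel[OF _ _ _ 3] pos
  show "set_integrable lborel {0..} (\<lambda>u::real. u powr (p - 1) / (1 + u\<^sup>2))"
    and "(LBINT u:{0..}. u powr (p - 1) / (1 + u\<^sup>2)) = pi / (2 * sin (pi * p / 2))"
    by (auto simp: less_imp_le)
qed

section \<open>Laplace transforms and the value of the constant\<close>

lemma Laplace_powr:
  assumes "\<nu> > -1"
  shows "set_integrable lborel {0<..} (\<lambda>z::real. exp (- z) * z powr \<nu>)"
    and "(LBINT z::real:{0<..}. exp (- z) * z powr \<nu>) = Gamma (\<nu> + 1)"
proof -
  have h: "((\<lambda>t. exp (- t) * t powr \<nu>) has_integral Gamma (\<nu> + 1)) {0..}"
    using Gamma_integral_real[of "\<nu> + 1"] assms by (simp add: exp_minus field_simps)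
  then have "((\<lambda>t. if t \<in> {0<..} then exp (- t) * t powr \<nu> else 0) has_integral Gamma (\<nu> + 1)) {0..}"
    by (rule has_integral_spike[of "{0}", rotated 2]) auto
  then have "((\<lambda>t. exp (- t) * t powr \<nu>) has_integral Gamma (\<nu> + 1)) {0<..}"
    by (subst (asm) has_integral_restrict) auto
  from has_integral_nonneg_lborel[OF _ _ _ this]
  show "set_integrable lborel {0<..} (\<lambda>z::real. exp (- z) * z powr \<nu>)"
    and "(LBINT z::real:{0<..}. exp (- z) * z powr \<nu>) = Gamma (\<nu> + 1)" by auto
qed

lemma Laplace_power:
  shows "set_integrable lborel {0<..} (\<lambda>z::real. exp (- z) * z ^ k)"
    and "(LBINT z::real:{0<..}. exp (- z) * z ^ k) = fact k"
proof -
  have eq: "indicator {0<..} z *\<^sub>R (exp (- z) * z ^ k) = indicator {0<..} z *\<^sub>R (exp (- z) * z powr real k)" for z :: real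
    by (cases "z > 0") (simp_all add: powr_realpow)
  show "set_integrable lborel {0<..} (\<lambda>z::real. exp (- z) * z ^ k)"
    using Laplace_powr(1)[of "real k"] unfolding set_integrable_def eq by simp
  have "(LBINT z::real:{0<..}. exp (- z) * z ^ k) = (LBINT z::real:{0<..}. exp (- z) * z powr real k)"
    by (rule set_lebesgue_integral_cong) (auto simp: powr_realpow)
  then show "(LBINT z::real:{0<..}. exp (- z) * z ^ k) = fact k"
    using Laplace_powr(2)[of "real k"] Gamma_fact[where 'a=real, of k] by (simp add: add.commute)
qed

lemma Laplace_cos:
  fixes u :: real
  shows "set_integrable lborel {0<..} (\<lambda>z::real. exp (- z) * cos (z * u))"
    and "(LBINT z::real:{0<..}. exp (- z) * cos (z * u)) = 1 / (1 + u\<^sup>2)"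
proof -
  have pos: "1 + u\<^sup>2 > 0" by (smt (verit) zero_le_power2)
  have e: "set_integrable lborel {0<..} (\<lambda>z::real. exp (- z))"
    using Laplace_power(1)[of 0] by simp
  show int: "set_integrable lborel {0<..} (\<lambda>z::real. exp (- z) * cos (z * u))"
    by (rule set_integrable_bound[OF e])
       (auto simp: set_borel_measurable_def abs_mult mult_left_le)
  have "(LBINT z=0..\<infinity>. exp (- z) * cos (z * u)) = 0 - (- 1 / (1 + u\<^sup>2))"
  proof (rule interval_integral_FTC_integrable[where F="\<lambda>z. exp (- z) * (u * sin (z * u) - cos (z * u)) / (1 + u\<^sup>2)"])
    show "((\<lambda>z. exp (- z) * (u * sin (z * u) - cos (z * u)) / (1 + u\<^sup>2)) has_vector_derivative exp (- x) * cos (x * u)) (at x)" for x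
    proof -
      have "((\<lambda>z. exp (- z) * (u * sin (z * u) - cos (z * u))) has_field_derivative
          exp (- x) * cos (x * u) * (1 + u\<^sup>2)) (at x)"
        by (auto intro!: derivative_eq_intros simp: algebra_simps power2_eq_square)
      from DERIV_cdivide[OF this, of "1 + u\<^sup>2"] show ?thesis
        unfolding has_real_derivative_iff_has_vector_derivative[symmetric] using pos by simp
    qed
    show "set_integrable lborel (einterval 0 \<infinity>) (\<lambda>z. exp (- z) * cos (z * u))"
      using int by (simp add: zero_ereal_def)
    show "(((\<lambda>z. exp (- z) * (u * sin (z * u) - cos (z * u)) / (1 + u\<^sup>2)) \<circ> real_of_ereal) \<longlongrightarrow> - 1 / (1 + u\<^sup>2)) (at_right 0)"
      unfolding zero_ereal_def ereal_tendsto_simps using pos by (auto intro!: tendsto_eq_intros)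
    show "(((\<lambda>z. exp (- z) * (u * sin (z * u) - cos (z * u)) / (1 + u\<^sup>2)) \<circ> real_of_ereal) \<longlongrightarrow> 0) (at_left \<infinity>)"
      unfolding ereal_tendsto_simps
    proof (rule Lim_null_comparison)
      show "\<forall>\<^sub>F z in at_top. norm (exp (- z) * (u * sin (z * u) - cos (z * u)) / (1 + u\<^sup>2)) \<le> exp (- z) * ((\<bar>u\<bar> + 1) / (1 + u\<^sup>2))"
      proof (rule always_eventually, rule allI)
        fix z
        have "\<bar>u * sin (z * u) - cos (z * u)\<bar> \<le> \<bar>u\<bar> * 1 + 1"
          by (rule order_trans[OF abs_triangle_ineq4 add_mono]) (use mult_left_mono[OF abs_sin_le_one, of "\<bar>u\<bar>" "z * u"] in \<open>auto simp: abs_mult\<close>)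
        then show "norm (exp (- z) * (u * sin (z * u) - cos (z * u)) / (1 + u\<^sup>2)) \<le> exp (- z) * ((\<bar>u\<bar> + 1) / (1 + u\<^sup>2))"
          using pos by (simp add: abs_mult divide_right_mono)
      qed
      show "((\<lambda>z. exp (- z) * ((\<bar>u\<bar> + 1) / (1 + u\<^sup>2))) \<longlongrightarrow> 0) at_top"
        by real_asymp
    qed
  qed (auto intro!: continuous_intros)
  then show "(LBINT z::real:{0<..}. exp (- z) * cos (z * u)) = 1 / (1 + u\<^sup>2)"
    by (simp add: interval_lebesgue_integral_def zero_ereal_def)
qed

text \<open>The factor \<open>fact m\<close> is the integral of exp (- z) z^m. It cancels the
  factorials of the cosine series, so the Taylor polynomial becomes a partial sum of the geometric
  series of 1 / (1 + u^2).\<close>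

lemma geometric_cos_coeff:
  "(\<Sum>m<2 * h. cos_coeff m * fact m * u ^ m) = (\<Sum>k<h. (- u\<^sup>2) ^ k)"
proof (induction h)
  case (Suc h)
  have "(- u\<^sup>2) ^ h = (-1) ^ h * u ^ (2 * h)"
    by (simp add: power_mult[symmetric] power_minus[of "u\<^sup>2"])
  then show ?case using Suc by (simp add: cos_coeff_def)
qed simp

text \<open>Averaging the scaled integral against \<open>exp (- z)\<close> turns the Taylor-subtracted cosine into the
  tail of a geometric series, which leaves a Beta integral.\<close>

lemma cos_kernel_const_eq:
  assumes "even N" "N \<ge> 2" "real N - 2 < \<alpha>" "\<alpha> < real N" "\<alpha> > 0"
  shows "cos_kernel_const N \<alpha> = - pi / (Gamma (\<alpha> + 1) * sin (\<alpha> * pi / 2))"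
proof -
  obtain h where N: "N = 2 * h" using assms(1) by blast
  let ?c = "\<lambda>u. cos u - cos_taylor N u"
  let ?F = "\<lambda>(z, u). indicator {0<..} z * exp (- z) * (\<bar>u\<bar> powr (- \<alpha> - 1) * ?c (z * u)) :: real"
  have m: "?F \<in> borel_measurable (lborel \<Otimes>\<^sub>M lborel)" by measurable
  define A where "A = (LINT u|lborel. \<bar>u\<bar> powr (- \<alpha> - 1) * \<bar>?c u\<bar>)"
  \<comment> \<open>The scaling law also applies to the absolute value, so the inner norm integrals
    are a constant times exp (- z) z^\<alpha>: Fubini needs no further estimate.\<close>
  have inn: "(LINT u|lborel. norm (?F (z, u))) = indicator {0<..} z * (exp (- z) * z powr \<alpha>) * A" for z
  proof (cases "z > 0")
    case True
    have "(LINT u|lborel. norm (?F (z, u))) = (LINT u|lborel. exp (- z) * (\<bar>u\<bar> powr (- \<alpha> - 1) * \<bar>?c (z * u)\<bar>))"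
      using True by (simp add: abs_mult)
    also have "\<dots> = exp (- z) * (\<bar>z\<bar> powr \<alpha> * A)"
      using True unfolding A_def
      by (subst integral_mult_right_zero, subst integral_powr_kernel_scale) auto
    finally show ?thesis using True by simp
  qed simp
  have int: "integrable (lborel \<Otimes>\<^sub>M lborel) ?F"
  proof (rule lborel_pair.Fubini_integrable[OF m])
    show "integrable lborel (\<lambda>z. LINT u|lborel. norm (?F (z, u)))"
      using Laplace_powr(1)[of \<alpha>] assms(5) unfolding inn set_integrable_def
      by (intro integrable_mult_left) auto
    have "integrable lborel (\<lambda>u. ?F (z, u))" for z
      using integrable_cos_kernel[OF assms(1-4), of z] by simp
    then show "AE z in lborel. integrable lborel (\<lambda>u. ?F (z, u))" by simp
  qed
  \<comment> \<open>Integrating over u first gives z^\<alpha> times the constant, whence the Gamma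
    factor; integrating over z first gives the Beta integral.\<close>
  have "Gamma (\<alpha> + 1) * cos_kernel_const N \<alpha> = (LINT z|lborel. (indicator {0<..} z * (exp (- z) * z powr \<alpha>)) * cos_kernel_const N \<alpha>)"
    using Laplace_powr(2)[of \<alpha>] assms(5) by (simp add: set_lebesgue_integral_def)
  also have "\<dots> = (LINT z|lborel. LINT u|lborel. ?F (z, u))"
  proof (rule Bochner_Integration.integral_cong[OF refl])
    fix z :: real
    show "(indicator {0<..} z * (exp (- z) * z powr \<alpha>)) * cos_kernel_const N \<alpha> = (LINT u|lborel. ?F (z, u))"
    proof (cases "z > 0")
      case True then show ?thesis using cos_kernel_scale[of z \<alpha> N] by simp
    qed simp
  qed
  also have "\<dots> = (LINT u|lborel. LINT z|lborel. ?F (z, u))"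
    by (rule lborel_pair.Fubini_integral[symmetric]) (use int in simp)
  also have "\<dots> = (LINT u|lborel. (-1) ^ h * (\<bar>u\<bar> powr (real N - \<alpha> - 1) / (1 + \<bar>u\<bar>\<^sup>2)))"
  proof (rule Bochner_Integration.integral_cong[OF refl])
    fix u :: real
    have pos: "1 + u\<^sup>2 > 0" by (smt (verit) zero_le_power2)
    have "(LINT z|lborel. ?F (z, u)) = \<bar>u\<bar> powr (- \<alpha> - 1) * (LBINT z::real:{0<..}. exp (- z) * ?c (z * u))"
      unfolding set_lebesgue_integral_def
      by (subst integral_mult_right_zero[symmetric]) (simp add: algebra_simps del: integral_mult_right_zero)
    also have "(LBINT z::real:{0<..}. exp (- z) * ?c (z * u)) = (LBINT z::real:{0<..}. exp (- z) * cos (z * u) - (\<Sum>m<N. (cos_coeff m * u ^ m) * (exp (- z) * z ^ m)))"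
      by (simp add: cos_taylor_def right_diff_distrib sum_distrib_left power_mult_distrib mult_ac)
    also have "\<dots> = 1 / (1 + u\<^sup>2) - (\<Sum>m<N. (cos_coeff m * u ^ m) * fact m)"
    proof -
      have i: "set_integrable lborel {0<..} (\<lambda>z. (cos_coeff m * u ^ m) * (exp (- z) * z ^ m))" for m
        using Laplace_power(1)[of m] by (rule set_integrable_mult_right)
      have "(LBINT z:{0<..}. \<Sum>m<N. (cos_coeff m * u ^ m) * (exp (- z) * z ^ m))
          = (\<Sum>m<N. LBINT z:{0<..}. (cos_coeff m * u ^ m) * (exp (- z) * z ^ m))"
        using i unfolding set_lebesgue_integral_def set_integrable_def
        by (simp only: scaleR_sum_right Bochner_Integration.integral_sum)
      moreover have "set_integrable lborel {0<..} (\<lambda>z. \<Sum>m<N. (cos_coeff m * u ^ m) * (exp (- z) * z ^ m))"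
        using i unfolding set_integrable_def
        by (simp only: scaleR_sum_right) (rule Bochner_Integration.integrable_sum)
      ultimately show ?thesis
        using Laplace_cos[of u] Laplace_power(2) by (subst set_integral_diff) simp_all
    qed
    also have "(\<Sum>m<N. (cos_coeff m * u ^ m) * fact m) = (\<Sum>k<h. (- u\<^sup>2) ^ k)"
      using geometric_cos_coeff[of u h] by (simp add: N mult_ac)
    also have "1 / (1 + u\<^sup>2) - (\<Sum>k<h. (- u\<^sup>2) ^ k) = (- u\<^sup>2) ^ h / (1 + u\<^sup>2)"
      using pos one_diff_power_eq[of "- u\<^sup>2" h] by (simp add: field_simps)
    also have "(- u\<^sup>2) ^ h = (-1) ^ h * \<bar>u\<bar> ^ N"
      by (simp add: N power_mult power_minus[of "u\<^sup>2"])
    also have "\<bar>u\<bar> powr (- \<alpha> - 1) * ((-1) ^ h * \<bar>u\<bar> ^ N / (1 + u\<^sup>2)) = (-1) ^ h * ((\<bar>u\<bar> powr (- \<alpha> - 1) * \<bar>u\<bar> ^ N) / (1 + \<bar>u\<bar>\<^sup>2))"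
      by simp
    also have "\<bar>u\<bar> powr (- \<alpha> - 1) * \<bar>u\<bar> ^ N = \<bar>u\<bar> powr (real N - \<alpha> - 1)"
      using assms(2) by (cases "u = 0") (auto simp: powr_realpow[symmetric] powr_add[symmetric] algebra_simps)
    finally show "(LINT z|lborel. ?F (z, u)) = (-1) ^ h * (\<bar>u\<bar> powr (real N - \<alpha> - 1) / (1 + \<bar>u\<bar>\<^sup>2))" .
  qed
  also have "\<dots> = (-1) ^ h * (LINT u|lborel. \<bar>u\<bar> powr (real N - \<alpha> - 1) / (1 + \<bar>u\<bar>\<^sup>2))"
    by (rule integral_mult_right_zero)
  also have "\<dots> = (-1) ^ h * (2 * (pi / (2 * sin (pi * (real N - \<alpha>) / 2))))"
    using integral_even(2)[OF Beta_integral_square(1)[of "real N - \<alpha>"]] Beta_integral_square(2)[of "real N - \<alpha>"] assms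
    by simp
  also have "sin (pi * (real N - \<alpha>) / 2) = - ((-1) ^ h * sin (\<alpha> * pi / 2))"
  proof -
    have "pi * (real N - \<alpha>) / 2 = pi * real h - \<alpha> * pi / 2" by (simp add: N field_simps)
    then show ?thesis by (simp only: sin_diff) simp
  qed
  also have "(-1) ^ h * (2 * (pi / (2 * - ((-1) ^ h * sin (\<alpha> * pi / 2))))) = - pi / sin (\<alpha> * pi / 2)"
    by (cases "even h") auto
  finally have "Gamma (\<alpha> + 1) * cos_kernel_const N \<alpha> = - pi / sin (\<alpha> * pi / 2)" .
  moreover have "Gamma (\<alpha> + 1) > 0" by (rule Gamma_real_pos) (use assms(5) in simp)
  then have "Gamma (\<alpha> + 1) \<noteq> 0" by simp
  ultimately have "cos_kernel_const N \<alpha> = - pi / sin (\<alpha> * pi / 2) / Gamma (\<alpha> + 1)"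
    by (metis nonzero_mult_div_cancel_left)
  then show ?thesis by (simp add: mult.commute)
qed

section \<open>The correction term as a cosine transform\<close>

text \<open>The Gaussian beats two additional powers of t, which leaves an integrable t^(-2) at
  infinity; near 0 it is at most 1.\<close>

lemma gaussian_powr_integrable:
  assumes "\<nu> > -1" "c > 0"
  shows "set_integrable lborel {0<..} (\<lambda>t::real. exp (- c * t\<^sup>2) * t powr \<nu>)"
proof -
  have lim: "((\<lambda>t::real. exp (- c * t\<^sup>2) * t powr (\<nu> + 2)) \<longlongrightarrow> 0) at_top"
    using assms by real_asymp
  then have "\<forall>\<^sub>F t in at_top. exp (- c * t\<^sup>2) * t powr (\<nu> + 2) < 1"
    by (rule order_tendstoD) simp
  then obtain T where T: "\<And>t. t \<ge> T \<Longrightarrow> exp (- c * t\<^sup>2) * t powr (\<nu> + 2) < 1"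
    unfolding eventually_at_top_linorder by blast
  define S where "S = max 1 T"
  define A where "A = max 1 (S powr (\<bar>\<nu>\<bar> + 2))"
  have "integrable lborel (\<lambda>t. indicator {0<..} t *\<^sub>R (exp (- c * t\<^sup>2) * t powr \<nu>) :: real)"
  proof (rule integrable_dominated_powr[where p=\<nu> and q="-2" and A=A])
    fix x :: real
    have A1: "A \<ge> 1" by (simp add: A_def)
    have S1: "S \<ge> 1" by (simp add: S_def)
    have e: "exp (- c * x\<^sup>2) \<le> 1" using assms by simp
    show "\<bar>indicator {0<..} x *\<^sub>R (exp (- c * x\<^sup>2) * x powr \<nu>)\<bar> \<le> A * \<bar>x\<bar> powr \<nu>"
      using mult_mono[OF order_trans[OF e A1] order_refl, of "x powr \<nu>"] A1
      by (auto simp: indicator_def)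
    assume x: "\<bar>x\<bar> > 1"
    show "\<bar>indicator {0<..} x *\<^sub>R (exp (- c * x\<^sup>2) * x powr \<nu>)\<bar> \<le> A * \<bar>x\<bar> powr - 2"
    proof (cases "x > 0")
      case True
      have "exp (- c * x\<^sup>2) * x powr (\<nu> + 2) \<le> A"
      proof (cases "x \<ge> S")
        case True
        then show ?thesis using T[of x] A1 by (auto simp: S_def)
      next
        case False
        have "exp (- c * x\<^sup>2) * x powr (\<nu> + 2) \<le> 1 * x powr (\<nu> + 2)"
          by (intro mult_right_mono e) auto
        also have "\<dots> \<le> x powr (\<bar>\<nu>\<bar> + 2)" using x True by (auto intro!: powr_mono)
        also have "\<dots> \<le> S powr (\<bar>\<nu>\<bar> + 2)" using False \<open>x > 0\<close> by (intro powr_mono2) auto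
        finally show ?thesis by (simp add: A_def)
      qed
      then have "(exp (- c * x\<^sup>2) * x powr (\<nu> + 2)) * x powr -2 \<le> A * x powr -2"
        by (rule mult_right_mono) simp
      also have "(exp (- c * x\<^sup>2) * x powr (\<nu> + 2)) * x powr -2 = exp (- c * x\<^sup>2) * x powr \<nu>"
        by (simp only: mult.assoc powr_add[symmetric]) simp
      finally show ?thesis using True by simp
    qed (use A1 in auto)
  qed (use assms in auto)
  then show ?thesis by (simp add: set_integrable_def)
qed

section \<open>Derivatives of sine transforms and the Dawson integral\<close>

lemma sin_taylor2:
  fixes u v :: real
  shows "\<bar>sin (v + u) - sin v - u * cos v\<bar> \<le> u\<^sup>2"
proof -
  have "sin (v + u) - sin v - u * cos v = sin v * (cos u - 1) + cos v * (sin u - u)"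
    by (simp add: sin_add algebra_simps)
  also have "\<bar>\<dots>\<bar> \<le> \<bar>cos u - 1\<bar> + \<bar>sin u - u\<bar>"
    by (rule order_trans[OF abs_triangle_ineq add_mono])
       (auto simp: abs_mult intro!: mult_left_le_one_le)
  also have "\<bar>cos u - 1\<bar> \<le> u\<^sup>2 / 2"
  proof -
    have "1 - cos u = 2 * (sin (u / 2))\<^sup>2" using cos_double_sin[of "u/2"] by simp
    also have "(sin (u / 2))\<^sup>2 \<le> (u / 2)\<^sup>2"
      using abs_sin_x_le_abs_x[of "u/2"] by (simp only: abs_le_square_iff)
    finally show ?thesis by (simp add: power2_eq_square)
  qed
  also have "\<bar>sin u - u\<bar> \<le> u\<^sup>2 / 2"
    using Maclaurin_sin_bound[of u 2] by (simp add: numeral_2_eq_2 sin_coeff_def)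
  finally show ?thesis by simp
qed

text \<open>The phase \<open>k * pi / 2\<close> makes differentiation raise \<open>k\<close> by one.\<close>

definition sin_transform :: "(real \<Rightarrow> real) \<Rightarrow> nat \<Rightarrow> real \<Rightarrow> real" where
  "sin_transform g k y = (LINT t|lborel. g t * t ^ k * sin (y * t + real k * pi / 2))"

lemma integrable_mult_bounded:
  fixes g b :: "real \<Rightarrow> real"
  assumes "integrable lborel g" "b \<in> borel_measurable borel" "\<And>x. \<bar>b x\<bar> \<le> 1"
  shows "integrable lborel (\<lambda>x. g x * b x)"
proof (rule Bochner_Integration.integrable_bound[OF assms(1)])
  have [measurable]: "g \<in> borel_measurable borel" "b \<in> borel_measurable borel"
    using borel_measurable_integrable[OF assms(1)] assms(2) by simp_all
  show "(\<lambda>x. g x * b x) \<in> borel_measurable lborel" by measurable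
  show "AE x in lborel. norm (g x * b x) \<le> norm (g x)"
    using assms(3) by (simp add: abs_mult mult_left_le)
qed

text \<open>The quadratic remainder of sine, uniform in the phase, gives a difference quotient error
  of at most \<bar>h\<bar> times the absolute moment of order \<open>k + 2\<close>. This replaces a
  dominated convergence argument.\<close>

lemma sin_transform_deriv:
  assumes int: "\<And>k. integrable lborel (\<lambda>t. g t * t ^ k)"
  shows "(sin_transform g k has_field_derivative sin_transform g (Suc k) y) (at y)"
proof -
  define B where "B = (LINT t|lborel. \<bar>g t * t ^ (k + 2)\<bar>)"
  have B: "\<bar>sin_transform g k (y + h) - sin_transform g k y - h * sin_transform g (Suc k) y\<bar> \<le> h\<^sup>2 * B" for h
  proof -
    have i: "integrable lborel (\<lambda>t. g t * t ^ j * sin (x * t + c))" for j x c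
      by (rule integrable_mult_bounded[OF int]) auto
    have eq: "sin_transform g k (y + h) - sin_transform g k y - h * sin_transform g (Suc k) y =
       (LINT t|lborel. g t * t ^ k * sin ((y + h) * t + real k * pi / 2) - g t * t ^ k * sin (y * t + real k * pi / 2)
          - h * (g t * t ^ Suc k * sin (y * t + real (Suc k) * pi / 2)))"
      unfolding sin_transform_def
      using i by (simp del: power_Suc)
    have "\<bar>sin_transform g k (y + h) - sin_transform g k y - h * sin_transform g (Suc k) y\<bar>
        \<le> (LINT t|lborel. h\<^sup>2 * \<bar>g t * t ^ (k + 2)\<bar>)"
      unfolding eq
    proof (rule order_trans[OF integral_abs_bound], rule integral_mono)
      show "integrable lborel (\<lambda>t. \<bar>g t * t ^ k * sin ((y + h) * t + real k * pi / 2) - g t * t ^ k * sin (y * t + real k * pi / 2)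
          - h * (g t * t ^ Suc k * sin (y * t + real (Suc k) * pi / 2))\<bar>)"
        using i by (intro integrable_abs Bochner_Integration.integrable_diff integrable_mult_right)
      show "integrable lborel (\<lambda>t. h\<^sup>2 * \<bar>g t * t ^ (k + 2)\<bar>)"
        using int by (intro integrable_abs integrable_mult_right)
      fix t
      define v where "v = y * t + real k * pi / 2"
      have "y * t + real (Suc k) * pi / 2 = v + pi / 2" by (simp add: v_def field_simps)
      then have "sin (y * t + real (Suc k) * pi / 2) = cos v" by (simp only: sin_add) simp
      moreover have "(y + h) * t + real k * pi / 2 = v + h * t" by (simp add: v_def algebra_simps)
      ultimately have eq': "g t * t ^ k * sin ((y + h) * t + real k * pi / 2) - g t * t ^ k * sin (y * t + real k * pi / 2)
          - h * (g t * t ^ Suc k * sin (y * t + real (Suc k) * pi / 2))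
          = g t * t ^ k * (sin (v + h * t) - sin v - (h * t) * cos v)"
        by (simp add: v_def algebra_simps)
      have "\<bar>g t * t ^ k * (sin (v + h * t) - sin v - (h * t) * cos v)\<bar> \<le> \<bar>g t * t ^ k\<bar> * (h * t)\<^sup>2"
        unfolding abs_mult[of "g t * t ^ k"] by (rule mult_left_mono[OF sin_taylor2]) simp
      also have "\<dots> = h\<^sup>2 * \<bar>g t * t ^ (k + 2)\<bar>"
        by (simp add: abs_mult power_add power_mult_distrib power2_eq_square)
      finally show "\<bar>g t * t ^ k * sin ((y + h) * t + real k * pi / 2) - g t * t ^ k * sin (y * t + real k * pi / 2)
          - h * (g t * t ^ Suc k * sin (y * t + real (Suc k) * pi / 2))\<bar> \<le> h\<^sup>2 * \<bar>g t * t ^ (k + 2)\<bar>"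
        unfolding eq' .
    qed
    also have "\<dots> = h\<^sup>2 * B" unfolding B_def by (rule integral_mult_right_zero)
    finally show ?thesis .
  qed
  have "((\<lambda>h. (sin_transform g k (y + h) - sin_transform g k y) / h - sin_transform g (Suc k) y) \<longlongrightarrow> 0) (at 0)"
  proof (rule Lim_null_comparison)
    show "\<forall>\<^sub>F h in at 0. norm ((sin_transform g k (y + h) - sin_transform g k y) / h - sin_transform g (Suc k) y) \<le> \<bar>h\<bar> * B"
    proof (rule eventually_mono[OF eventually_neq_at_within[of 0]])
      fix h :: real assume h: "h \<noteq> 0"
      have "(sin_transform g k (y + h) - sin_transform g k y) / h - sin_transform g (Suc k) y
        = (sin_transform g k (y + h) - sin_transform g k y - h * sin_transform g (Suc k) y) / h"
        using h by (simp add: field_simps)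
      then have "norm ((sin_transform g k (y + h) - sin_transform g k y) / h - sin_transform g (Suc k) y) \<le> h\<^sup>2 * B / \<bar>h\<bar>"
        using B[of h] by (simp add: divide_right_mono)
      also have "\<dots> = \<bar>h\<bar> * B" using h by (simp add: power2_eq_square abs_if)
      finally show "norm ((sin_transform g k (y + h) - sin_transform g k y) / h - sin_transform g (Suc k) y) \<le> \<bar>h\<bar> * B" .
    qed
    show "((\<lambda>h. \<bar>h\<bar> * B) \<longlongrightarrow> 0) (at 0)" by (auto intro!: tendsto_eq_intros)
  qed
  then show ?thesis unfolding DERIV_def by (simp add: LIM_zero_iff)
qed

lemma deriv_funpow_sin_transform:
  assumes int: "\<And>k. integrable lborel (\<lambda>t. g t * t ^ k)"
  shows "(deriv ^^ k) (sin_transform g 0) = sin_transform g k"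
proof (induction k)
  case (Suc k)
  have "deriv (sin_transform g k) = sin_transform g (Suc k)"
    using DERIV_imp_deriv[OF sin_transform_deriv[OF int]] by blast
  then show ?case using Suc by simp
qed simp

definition half_gauss :: "real \<Rightarrow> real" where
  "half_gauss t = indicator {0<..} t * exp (- t\<^sup>2 / 2)"

lemma half_gauss_measurable [measurable]: "half_gauss \<in> borel_measurable borel"
  unfolding half_gauss_def by measurable

lemma half_gauss_integrable_powr:
  assumes "\<nu> > -1"
  shows "integrable lborel (\<lambda>t. half_gauss t * t powr \<nu>)"
  using gaussian_powr_integrable[OF assms, of "1/2"]
  by (simp add: set_integrable_def half_gauss_def mult.assoc)

lemma half_gauss_integrable: "integrable lborel (\<lambda>t. half_gauss t * t ^ k)"
proof -
  have eq: "half_gauss t * t ^ k = half_gauss t * t powr real k" for t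
    by (cases "t > 0") (auto simp: half_gauss_def powr_realpow)
  show ?thesis unfolding eq by (rule half_gauss_integrable_powr) simp
qed

text \<open>Integration by parts with the antiderivative - exp (- t^2 / 2) cos (y t). As the order-1
  transform is the derivative of the order-0 one, this is the differential equation of the rescaled
  Dawson integral.\<close>

lemma sin_transform_half_gauss_1: "sin_transform half_gauss 1 y = 1 - y * sin_transform half_gauss 0 y"
proof -
  have i0: "set_integrable lborel {0<..} (\<lambda>t. exp (- t\<^sup>2 / 2) * sin (y * t))"
    using integrable_mult_bounded[OF half_gauss_integrable[of 0], of "\<lambda>t. sin (y * t)"]
    by (simp add: set_integrable_def half_gauss_def mult_ac)
  have i1: "set_integrable lborel {0<..} (\<lambda>t. exp (- t\<^sup>2 / 2) * t * cos (y * t))"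
    using integrable_mult_bounded[OF half_gauss_integrable[of 1], of "\<lambda>t. cos (y * t)"]
    by (simp add: set_integrable_def half_gauss_def mult_ac)
  have i: "set_integrable lborel {0<..} (\<lambda>t. exp (- t\<^sup>2 / 2) * t * cos (y * t) + y * (exp (- t\<^sup>2 / 2) * sin (y * t)))"
    using i0 i1 by (intro set_integral_add set_integrable_mult_right)
  have "(LBINT t=0..\<infinity>. exp (- t\<^sup>2 / 2) * t * cos (y * t) + y * (exp (- t\<^sup>2 / 2) * sin (y * t))) = 0 - (-1)"
  proof (rule interval_integral_FTC_integrable[where F="\<lambda>t. - exp (- t\<^sup>2 / 2) * cos (y * t)"])
    show "((\<lambda>t. - exp (- t\<^sup>2 / 2) * cos (y * t)) has_vector_derivative
        exp (- x\<^sup>2 / 2) * x * cos (y * x) + y * (exp (- x\<^sup>2 / 2) * sin (y * x))) (at x)" for x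
      unfolding has_real_derivative_iff_has_vector_derivative[symmetric]
      by (auto intro!: derivative_eq_intros simp: algebra_simps)
    show "set_integrable lborel (einterval 0 \<infinity>) (\<lambda>t. exp (- t\<^sup>2 / 2) * t * cos (y * t) + y * (exp (- t\<^sup>2 / 2) * sin (y * t)))"
      using i by (simp add: zero_ereal_def)
    show "(((\<lambda>t. - exp (- t\<^sup>2 / 2) * cos (y * t)) \<circ> real_of_ereal) \<longlongrightarrow> -1) (at_right 0)"
      unfolding zero_ereal_def ereal_tendsto_simps by (auto intro!: tendsto_eq_intros)
    show "(((\<lambda>t. - exp (- t\<^sup>2 / 2) * cos (y * t)) \<circ> real_of_ereal) \<longlongrightarrow> 0) (at_left \<infinity>)"
      unfolding ereal_tendsto_simps
    proof (rule Lim_null_comparison)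
      show "\<forall>\<^sub>F t in at_top. norm (- exp (- t\<^sup>2 / 2) * cos (y * t)) \<le> exp (- t\<^sup>2 / 2)"
        by (auto simp: abs_mult mult_left_le)
      show "((\<lambda>t::real. exp (- t\<^sup>2 / 2)) \<longlongrightarrow> 0) at_top" by real_asymp
    qed
  qed (auto intro!: continuous_intros)
  then have "(LBINT t:{0<..}. exp (- t\<^sup>2 / 2) * t * cos (y * t) + y * (exp (- t\<^sup>2 / 2) * sin (y * t))) = 1"
    by (simp add: interval_lebesgue_integral_def zero_ereal_def)
  then have "(LBINT t:{0<..}. exp (- t\<^sup>2 / 2) * t * cos (y * t)) + y * (LBINT t:{0<..}. exp (- t\<^sup>2 / 2) * sin (y * t)) = 1"
    using i0 i1 by (subst (asm) set_integral_add) auto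
  moreover have "sin_transform half_gauss 0 y = (LBINT t:{0<..}. exp (- t\<^sup>2 / 2) * sin (y * t))"
    by (simp add: sin_transform_def half_gauss_def set_lebesgue_integral_def mult_ac)
  moreover have "sin_transform half_gauss 1 y = (LBINT t:{0<..}. exp (- t\<^sup>2 / 2) * t * cos (y * t))"
    by (simp add: sin_transform_def half_gauss_def set_lebesgue_integral_def sin_add mult_ac)
  ultimately show ?thesis by simp
qed

lemma dawson_deriv: "(dawson has_field_derivative 1 - 2 * z * dawson z) (at z)"
proof -
  \<comment> \<open>The interval from -b to b contains 0 and has z in its interior, so the
    derivative within the interval is a full derivative.\<close>
  define b where "b = \<bar>z\<bar> + 1"
  have b: "-b \<le> 0" "0 \<le> b" "-b \<le> z" "z \<le> b" by (auto simp: b_def)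
  have "continuous_on {-b..b} (\<lambda>t::real. exp (t\<^sup>2))" by (intro continuous_intros)
  from interval_integral_FTC2[OF b(1,2) this b(3,4)]
  have "((\<lambda>u. LBINT t=0..u. exp (t\<^sup>2)) has_vector_derivative exp (z\<^sup>2)) (at z within {-b..b})"
    by (simp add: zero_ereal_def)
  then have "((\<lambda>u. LBINT t=0..u. exp (t\<^sup>2)) has_field_derivative exp (z\<^sup>2)) (at z within {-b..b})"
    by (simp add: has_real_derivative_iff_has_vector_derivative)
  moreover have "at z within {-b..b} = at z"
    by (rule at_within_interior) (auto simp: b_def)
  ultimately have *: "((\<lambda>u. LBINT t=0..ereal u. exp (t\<^sup>2)) has_field_derivative exp (z\<^sup>2)) (at z)"
    by simp
  have "((\<lambda>u. exp (- u\<^sup>2) * (LBINT t=0..ereal u. exp (t\<^sup>2))) has_field_derivative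
     exp (- z\<^sup>2) * (- 2 * z) * (LBINT t=0..ereal z. exp (t\<^sup>2)) + exp (z\<^sup>2) * exp (- z\<^sup>2)) (at z)"
    by (rule DERIV_mult[OF _ *]) (auto intro!: derivative_eq_intros)
  moreover have "exp (z\<^sup>2) * exp (- z\<^sup>2) = 1" by (simp add: exp_minus)
  ultimately show ?thesis
    unfolding dawson_def[abs_def] by (simp add: algebra_simps)
qed

lemma dawson_0: "dawson 0 = 0"
  by (simp add: dawson_def zero_ereal_def)

text \<open>Both sides solve \<open>F' = 1 - y * F\<close> with \<open>F 0 = 0\<close>.\<close>

lemma dawson_eq_sin_transform: "sqrt 2 * dawson (y / sqrt 2) = sin_transform half_gauss 0 y"
proof -
  let ?F = "sin_transform half_gauss 0" and ?d = "\<lambda>y. sqrt 2 * dawson (y / sqrt 2)"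
  have F: "(?F has_field_derivative 1 - y * ?F y) (at y)" for y
    using sin_transform_deriv[OF half_gauss_integrable, of 0 y] sin_transform_half_gauss_1[of y] by simp
  have d: "(?d has_field_derivative 1 - y * ?d y) (at y)" for y
  proof -
    have "((\<lambda>y. dawson (y / sqrt 2)) has_field_derivative (1 - 2 * (y / sqrt 2) * dawson (y / sqrt 2)) * (1 / sqrt 2)) (at y)"
      by (rule DERIV_chain'[OF DERIV_cdivide[OF DERIV_ident] dawson_deriv])
    from DERIV_cmult[OF this, of "sqrt 2"] show ?thesis
      by (simp add: algebra_simps)
  qed
  \<comment> \<open>The integrating factor of the homogeneous equation D' = - y D, which the
    difference of the two solutions satisfies.\<close>
  have "((\<lambda>y. exp (y\<^sup>2 / 2) * (?d y - ?F y)) has_field_derivative 0) (at y)" for y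
  proof -
    have "((\<lambda>y. exp (y\<^sup>2 / 2)) has_field_derivative exp (y\<^sup>2 / 2) * y) (at y)"
      by (auto intro!: derivative_eq_intros)
    from DERIV_mult[OF this DERIV_diff[OF d F]] show ?thesis by (simp add: algebra_simps)
  qed
  then have "exp (y\<^sup>2 / 2) * (?d y - ?F y) = exp (0\<^sup>2 / 2) * (?d 0 - ?F 0)"
    by (intro DERIV_isconst_all) blast
  also have "?F 0 = 0" by (simp add: sin_transform_def)
  finally show ?thesis by (simp add: dawson_0)
qed

text \<open>The cosine transform to which both branches of \<open>pareto_G\<close> reduce. It is
  also what the inversion of the singular term produces.\<close>

definition cos_gauss :: "real \<Rightarrow> real \<Rightarrow> real" where
  "cos_gauss \<alpha> x = (LINT t|lborel. half_gauss t * t powr \<alpha> * cos (x * t))"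

text \<open>For odd \<alpha> the derivative of the sine transform contributes the factor sin
  (\<alpha> pi / 2). Otherwise adding the cylinder functions at x and -x leaves the even part with
  the factor 2 cos (\<alpha> pi / 2), which cancels against the double-angle formula for sin
  (\<alpha> pi).\<close>

lemma pareto_G_eq:
  assumes "\<alpha> > 0" and "\<not> (\<exists>m::int. even m \<and> \<alpha> = of_int m)"
  shows "pareto_G \<alpha> x = - cos_gauss \<alpha> x / (Gamma (\<alpha> + 1) * sin (\<alpha> * pi / 2))"
proof (cases "\<alpha> \<in> \<int>")
  case True
  then obtain m where m: "\<alpha> = of_int m" by (auto elim: Ints_cases)
  define k where "k = nat m"
  have k: "\<alpha> = real k" "odd k" using m assms by (auto simp: k_def even_nat_iff)
  have "(\<lambda>y. dawson (y / sqrt 2)) = (\<lambda>y. sin_transform (\<lambda>t. half_gauss t / sqrt 2) 0 y)"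
  proof
    fix y
    have "sin_transform (\<lambda>t. half_gauss t / sqrt 2) 0 y = sin_transform half_gauss 0 y / sqrt 2"
      by (simp add: sin_transform_def)
    then show "dawson (y / sqrt 2) = sin_transform (\<lambda>t. half_gauss t / sqrt 2) 0 y"
      by (simp add: dawson_eq_sin_transform[symmetric])
  qed
  then have "(deriv ^^ k) (\<lambda>y. dawson (y / sqrt 2)) x = sin_transform (\<lambda>t. half_gauss t / sqrt 2) k x"
    using deriv_funpow_sin_transform[of "\<lambda>t. half_gauss t / sqrt 2" k] half_gauss_integrable by simp
  also have "\<dots> = sin_transform half_gauss k x / sqrt 2"
    by (simp add: sin_transform_def)
  also have "sin_transform half_gauss k x = (LINT t|lborel. sin (real k * pi / 2) * (half_gauss t * t powr \<alpha> * cos (x * t)))"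
    unfolding sin_transform_def
  proof (rule Bochner_Integration.integral_cong[OF refl])
    fix t
    have "cos (real k * pi / 2) = 0"
      using k(2) by (auto elim!: oddE simp: cos_add add_divide_distrib distrib_right)
    then show "half_gauss t * t ^ k * sin (x * t + real k * pi / 2) = sin (real k * pi / 2) * (half_gauss t * t powr \<alpha> * cos (x * t))"
      by (cases "t > 0") (auto simp: half_gauss_def sin_add k powr_realpow)
  qed
  also have "\<dots> = sin (\<alpha> * pi / 2) * cos_gauss \<alpha> x"
    by (simp add: cos_gauss_def k)
  finally have "(deriv ^^ nat \<lfloor>\<alpha>\<rfloor>) (\<lambda>y. dawson (y / sqrt 2)) x = sin (\<alpha> * pi / 2) * cos_gauss \<alpha> x / sqrt 2"
    by (simp add: k)
  then have 1: "pareto_G \<alpha> x = - (sin (\<alpha> * pi / 2) * cos_gauss \<alpha> x) / Gamma (\<alpha> + 1)"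
    using True by (simp add: pareto_G_def)
  \<comment> \<open>At odd integers this sine is 1 or -1, hence its own inverse; it can therefore
    move to the denominator and match the non-integer formula.\<close>
  have "(sin (\<alpha> * pi / 2))\<^sup>2 = 1"
    using k by (auto elim!: oddE simp: sin_add add_divide_distrib distrib_right power2_eq_square)
  then have "sin (\<alpha> * pi / 2) = 1 / sin (\<alpha> * pi / 2)"
    by (auto simp: power2_eq_1_iff)
  then show ?thesis using 1 by (metis (no_types, lifting) divide_divide_eq_left minus_divide_left mult.commute times_divide_eq_left mult_1)
next
  case False
  have sa: "sin (\<alpha> * pi) \<noteq> 0"
    using False by (auto simp: sin_zero_iff_int2)
  have sin2: "sin (\<alpha> * pi) = 2 * sin (\<alpha> * pi / 2) * cos (\<alpha> * pi / 2)"
    using sin_double[of "\<alpha> * pi / 2"] by simp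
  have pc: "parabolic_cylinder \<alpha> z = sqrt (2 / pi) * exp (z\<^sup>2 / 4) * (LINT t|lborel. half_gauss t * t powr \<alpha> * cos (z * t - \<alpha> * pi / 2))" for z
    by (simp add: parabolic_cylinder_def half_gauss_def set_lebesgue_integral_def mult_ac)
  have i: "integrable lborel (\<lambda>t. half_gauss t * t powr \<alpha> * cos (z * t - \<alpha> * pi / 2))" for z
    by (rule integrable_mult_bounded[OF half_gauss_integrable_powr]) (use assms in auto)
  have "parabolic_cylinder \<alpha> x + parabolic_cylinder \<alpha> (- x) =
     sqrt (2 / pi) * exp (x\<^sup>2 / 4) * (LINT t|lborel. half_gauss t * t powr \<alpha> * cos (x * t - \<alpha> * pi / 2) + half_gauss t * t powr \<alpha> * cos (- x * t - \<alpha> * pi / 2))"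
    using i[of x] i[of "-x"] by (subst Bochner_Integration.integral_add) (simp_all add: pc distrib_left)
  also have "(LINT t|lborel. half_gauss t * t powr \<alpha> * cos (x * t - \<alpha> * pi / 2) + half_gauss t * t powr \<alpha> * cos (- x * t - \<alpha> * pi / 2))
    = (LINT t|lborel. (2 * cos (\<alpha> * pi / 2)) * (half_gauss t * t powr \<alpha> * cos (x * t)))"
    by (rule Bochner_Integration.integral_cong[OF refl]) (simp add: cos_diff algebra_simps)
  also have "\<dots> = 2 * cos (\<alpha> * pi / 2) * cos_gauss \<alpha> x" by (simp add: cos_gauss_def)
  finally have *: "parabolic_cylinder \<alpha> x + parabolic_cylinder \<alpha> (- x) = sqrt (2 / pi) * exp (x\<^sup>2 / 4) * (2 * cos (\<alpha> * pi / 2) * cos_gauss \<alpha> x)" .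
  have e: "exp (- x\<^sup>2 / 4) * exp (x\<^sup>2 / 4) = 1" by (simp add: exp_minus)
  have sq: "sqrt (pi / 2) * sqrt (2 / pi) = 1" by (simp add: real_sqrt_mult[symmetric])
  have "pareto_G \<alpha> x = - ((sqrt (pi / 2) * sqrt (2 / pi)) * (exp (- x\<^sup>2 / 4) * exp (x\<^sup>2 / 4))) * (2 * cos (\<alpha> * pi / 2) * cos_gauss \<alpha> x) / (Gamma (\<alpha> + 1) * sin (\<alpha> * pi))"
    using False by (simp add: pareto_G_def *)
  also have "\<dots> = - cos_gauss \<alpha> x / (Gamma (\<alpha> + 1) * sin (\<alpha> * pi / 2))"
    using sa unfolding e sq sin2 by simp
  finally show ?thesis .
qed

section \<open>Fourier inversion\<close>

text \<open>Levy inversion gives the mass of an interval from x to x + h. Divided by h, the mass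
  tends to f x by continuity and the kernel tends to the inverse Fourier kernel under a bound by 1.
  The identity holds at every point, not only almost everywhere.\<close>

lemma (in real_distribution) continuous_density_inversion:
  fixes f :: "real \<Rightarrow> real"
  assumes M: "M = density lborel (\<lambda>x. ennreal (f x))" and nonneg: "\<And>x. f x \<ge> 0"
    and cont: "continuous_on UNIV f" and int: "integrable lborel (char M)"
  shows "complex_of_real (f x) = 1 / (2 * pi) * (CLINT t|lborel. iexp (- (t * x)) * char M t)"
proof -
  have [measurable]: "f \<in> borel_measurable borel"
    using cont by (rule borel_measurable_continuous_onI)
  have [measurable]: "char M \<in> borel_measurable borel"
    using int by (simp add: borel_measurable_integrable)
  have meas: "measure M A = (LINT x|lborel. f x * indicator A x)" if [measurable]: "A \<in> sets borel" for A
  proof -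
    have "measure M A = (LINT x|M. indicator A x)" by simp
    also have "\<dots> = (LINT x|lborel. f x * indicator A x)"
      by (subst M, subst integral_density) (auto simp: nonneg)
    finally show ?thesis .
  qed
  have null: "measure M {a} = 0" for a
  proof -
    have "(LINT x|lborel. f x * indicator {a} x) = 0"
      by (rule integral_eq_zero_AE) (rule eventually_mono[OF AE_lborel_singleton[of a]], simp)
    then show ?thesis by (simp add: meas)
  qed
  let ?F = "\<lambda>a b t. (iexp (-(t * a)) - iexp (-(t * b))) / (\<i> * complex_of_real t)"
  have F_bound: "cmod (?F a b t) \<le> b - a" if "a \<le> b" for a b t
  proof (cases "t = 0")
    case False
    then show ?thesis
      using Levy_Inversion_aux2[of "-b" "-a" t] that by simp
  qed (use that in simp)
  have step: "(CLINT t|lborel. ?F a b t * char M t) / (2 * pi) = complex_of_real (LBINT y=a..b. f y)" if ab: "a \<le> b" for a b :: real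
  proof -
    have i: "integrable lborel (\<lambda>t. ?F a b t * char M t)"
    proof (rule Bochner_Integration.integrable_bound[OF integrable_mult_right[OF integrable_norm[OF int], of "b - a"]])
      show "AE t in lborel. norm (?F a b t * char M t) \<le> norm ((b - a) * norm (char M t))"
      proof (rule AE_I2)
        fix t
        have "norm (?F a b t * char M t) \<le> (b - a) * norm (char M t)"
          unfolding norm_mult by (rule mult_right_mono[OF F_bound[OF ab]]) simp
        then show "norm (?F a b t * char M t) \<le> norm ((b - a) * norm (char M t))"
          using ab by simp
      qed
    qed measurable
    \<comment> \<open>Levy inversion speaks of a limit of symmetric truncations; integrability of
      \<open>char M\<close> makes it an ordinary integral.\<close>
    have "(\<lambda>T::nat. CLBINT t=-real T..real T. ?F a b t * char M t) \<longlonglongrightarrow> (CLINT t|lborel. ?F a b t * char M t)"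
    proof -
      have "(\<lambda>T::nat. CLINT t|lborel. indicator {-real T..real T} t *\<^sub>R (?F a b t * char M t)) \<longlonglongrightarrow> (CLINT t|lborel. ?F a b t * char M t)"
      proof (rule integral_dominated_convergence[where w="\<lambda>t. norm (?F a b t * char M t)"])
        show "AE t in lborel. (\<lambda>T. indicator {-real T..real T} t *\<^sub>R (?F a b t * char M t)) \<longlonglongrightarrow> ?F a b t * char M t"
        proof (rule AE_I2)
          fix t :: real
          obtain N :: nat where N: "\<bar>t\<bar> \<le> real N" using real_arch_simple by blast
          have "\<forall>\<^sub>F T in sequentially. indicator {-real T..real T} t *\<^sub>R (?F a b t * char M t) = ?F a b t * char M t"
            using eventually_ge_at_top[of N] by eventually_elim (use N in \<open>auto simp: indicator_def\<close>)
          then show "(\<lambda>T. indicator {-real T..real T} t *\<^sub>R (?F a b t * char M t)) \<longlonglongrightarrow> ?F a b t * char M t"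
            by (rule tendsto_eventually)
        qed
        show "AE t in lborel. norm (indicator {-real T..real T} t *\<^sub>R (?F a b t * char M t)) \<le> norm (?F a b t * char M t)" for T
          by (auto simp: indicator_def)
        show "integrable lborel (\<lambda>t. norm (?F a b t * char M t))" using i by (rule integrable_norm)
      qed measurable
      then show ?thesis
        by (simp add: interval_integral_Icc set_lebesgue_integral_def)
    qed
    then have "(\<lambda>T::nat. 1 / (2 * pi) * (CLBINT t=-real T..real T. ?F a b t * char M t)) \<longlonglongrightarrow> 1 / (2 * pi) * (CLINT t|lborel. ?F a b t * char M t)"
      by (intro tendsto_mult tendsto_const)
    then have "1 / (2 * pi) * (CLINT t|lborel. ?F a b t * char M t) = complex_of_real (measure M {a<..b})"
    proof (rule LIMSEQ_unique)
      show "(\<lambda>T::nat. 1 / (2 * pi) * (CLBINT t=-real T..real T. ?F a b t * char M t)) \<longlonglongrightarrow> complex_of_real (measure M {a<..b})"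
        using Levy_Inversion[OF ab null null] by simp
    qed
    also have "measure M {a<..b} = (LBINT y=a..b. f y)"
      using ab by (simp add: meas interval_integral_Ioc set_lebesgue_integral_def mult.commute)
    finally show ?thesis by simp
  qed
  let ?h = "\<lambda>n. 1 / real (Suc n)"
  have "((\<lambda>u. LBINT y=x..u. f y) has_vector_derivative f x) (at x within {x..x+1})"
    using interval_integral_FTC2[of x x "x+1" f x] continuous_on_subset[OF cont] by auto
  then have "((\<lambda>u. LBINT y=x..u. f y) has_field_derivative f x) (at x within {x..x+1})"
    by (simp add: has_real_derivative_iff_has_vector_derivative)
  then have d: "((\<lambda>u. ((LBINT y=x..ereal u. f y) - (LBINT y=x..ereal x. f y)) / (u - x)) \<longlongrightarrow> f x) (at x within {x..x+1})"
    by (simp add: has_field_derivative_iff)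
  have "filterlim (\<lambda>n. x + ?h n) (at x within {x..x+1}) sequentially"
    unfolding filterlim_at
    using tendsto_add[OF tendsto_const[of x] LIMSEQ_inverse_real_of_nat]
    by (auto simp: inverse_eq_divide divide_le_eq)
  from filterlim_compose[OF d this]
  have L1: "(\<lambda>n. (LBINT y=x..x + ?h n. f y) / ?h n) \<longlonglongrightarrow> f x" by simp
  have L2: "(\<lambda>n. CLINT t|lborel. (?F x (x + ?h n) t / ?h n) * char M t) \<longlonglongrightarrow> (CLINT t|lborel. iexp (- (t * x)) * char M t)"
  proof (rule integral_dominated_convergence[where w="\<lambda>t. norm (char M t)"])
    show "AE t in lborel. norm ((?F x (x + ?h n) t / ?h n) * char M t) \<le> norm (char M t)" for n
    proof (rule AE_I2)
      fix t
      have aux: "cmod (z / complex_of_real h) \<le> 1" if "cmod z \<le> h" "h > 0" for z h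
        using that by (simp add: norm_divide)
      have "cmod (?F x (x + ?h n) t) \<le> x + ?h n - x" by (rule F_bound) simp
      also have "x + ?h n - x = ?h n" by simp
      finally have "cmod (?F x (x + ?h n) t / ?h n) \<le> 1"
        by (rule aux) simp
      then show "norm ((?F x (x + ?h n) t / ?h n) * char M t) \<le> norm (char M t)"
        unfolding norm_mult by (rule mult_left_le_one_le[rotated 2]) auto
    qed
    show "AE t in lborel. (\<lambda>n. (?F x (x + ?h n) t / ?h n) * char M t) \<longlonglongrightarrow> iexp (- (t * x)) * char M t"
      using AE_lborel_singleton[of "0::real"]
    proof eventually_elim
      fix t :: real assume t: "t \<noteq> 0"
      \<comment> \<open>An antiderivative of the exponential: the inversion kernel over h is its
        difference quotient. This needs t nonzero, which excludes only a null set.\<close>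
      let ?G = "\<lambda>z. - exp (\<i> * - (complex_of_real t * z)) / (\<i> * t)"
      have "(?G has_field_derivative exp (\<i> * - (t * complex_of_real x))) (at (complex_of_real x))"
        using t by (auto intro!: derivative_eq_intros simp: field_simps)
      then have d: "((\<lambda>z. (?G z - ?G (complex_of_real x)) / (z - complex_of_real x)) \<longlongrightarrow> exp (\<i> * - (t * complex_of_real x))) (at (complex_of_real x))"
        by (simp only: has_field_derivative_iff)
      have "(\<lambda>n. complex_of_real (x + ?h n)) \<longlonglongrightarrow> complex_of_real (x + 0)"
        using LIMSEQ_inverse_real_of_nat by (intro tendsto_of_real tendsto_add tendsto_const) (simp add: inverse_eq_divide)
      then have "filterlim (\<lambda>n. complex_of_real (x + ?h n)) (at (complex_of_real x)) sequentially"
        unfolding filterlim_at by (auto simp del: of_nat_Suc of_real_add simp: of_real_eq_iff)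
      from filterlim_compose[OF d this]
      have "(\<lambda>n. (?G (complex_of_real (x + ?h n)) - ?G (complex_of_real x)) / (complex_of_real (x + ?h n) - complex_of_real x)) \<longlonglongrightarrow> exp (\<i> * - (t * complex_of_real x))" .
      moreover have "(?G (complex_of_real (x + ?h n)) - ?G (complex_of_real x)) / (complex_of_real (x + ?h n) - complex_of_real x) = ?F x (x + ?h n) t / ?h n" for n
      proof -
        have aux: "(- p / c - (- q) / c) / (complex_of_real (x + h) - complex_of_real x) = (q - p) / c / complex_of_real h"
          for p q c :: complex and h :: real
          by (simp add: diff_divide_distrib)
        show ?thesis by (simp only: aux) simp
      qed
      ultimately have "(\<lambda>n. ?F x (x + ?h n) t / ?h n) \<longlonglongrightarrow> iexp (- (t * x))"
        by simp
      then show "(\<lambda>n. (?F x (x + ?h n) t / ?h n) * char M t) \<longlonglongrightarrow> iexp (- (t * x)) * char M t"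
        by (intro tendsto_mult tendsto_const)
    qed
    show "integrable lborel (\<lambda>t. norm (char M t))" using int by (rule integrable_norm)
  qed measurable
  have eq: "1 / (2 * pi) * (CLINT t|lborel. (?F x (x + ?h n) t / ?h n) * char M t) = complex_of_real ((LBINT y=x..x + ?h n. f y) / ?h n)" for n
  proof -
    have "(CLINT t|lborel. (?F x (x + ?h n) t / ?h n) * char M t) = (CLINT t|lborel. ?F x (x + ?h n) t * char M t) / ?h n"
    proof -
      have "(CLINT t|lborel. (g t / c) * u t) = (CLINT t|lborel. g t * u t) / c" for g u :: "real \<Rightarrow> complex" and c
        by (subst integral_divide_zero[symmetric]) (simp del: integral_divide_zero)
      then show ?thesis .
    qed
    moreover have "(CLINT t|lborel. ?F x (x + ?h n) t * char M t) / (2 * pi) = complex_of_real (LBINT y=x..x + ?h n. f y)"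
      by (rule step) simp
    moreover have "1 / (2 * pi) * I1 = complex_of_real (J / h)"
      if "I1 = I2 / complex_of_real h" "I2 / (2 * pi) = complex_of_real J" for I1 I2 :: complex and J h :: real
      using that by (simp add: field_simps)
    ultimately show ?thesis by blast
  qed
  have "(\<lambda>n. complex_of_real ((LBINT y=x..x + ?h n. f y) / ?h n)) \<longlonglongrightarrow> 1 / (2 * pi) * (CLINT t|lborel. iexp (- (t * x)) * char M t)"
    using tendsto_mult[OF tendsto_const[of "complex_of_real (1 / (2 * pi))"] L2] unfolding eq .
  moreover have "(\<lambda>n. complex_of_real ((LBINT y=x..x + ?h n. f y) / ?h n)) \<longlonglongrightarrow> complex_of_real (f x)"
    using L1 by (rule tendsto_of_real)
  ultimately show ?thesis by (rule LIMSEQ_unique[symmetric])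
qed

section \<open>Convolution powers and the one big jump\<close>

text \<open>Values in \<open>ennreal\<close> let Tonelli reorder all integrals without integrability
  conditions.\<close>

definition conv :: "(real \<Rightarrow> ennreal) \<Rightarrow> (real \<Rightarrow> ennreal) \<Rightarrow> real \<Rightarrow> ennreal" where
  "conv f g y = (\<integral>\<^sup>+x. f x * g (y - x) \<partial>lborel)"

lemma conv_measurable [measurable]:
  assumes [measurable]: "f \<in> borel_measurable borel" "g \<in> borel_measurable borel"
  shows "conv f g \<in> borel_measurable borel"
  unfolding conv_def by measurable

lemma nn_integral_reflect:
  fixes g :: "real \<Rightarrow> ennreal"
  assumes [measurable]: "g \<in> borel_measurable borel"
  shows "(\<integral>\<^sup>+x. g (y - x) \<partial>lborel) = (\<integral>\<^sup>+x. g x \<partial>lborel)"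
  using nn_integral_real_affine[of g "-1" y] by simp

lemma conv_commute:
  assumes [measurable]: "f \<in> borel_measurable borel" "g \<in> borel_measurable borel"
  shows "conv f g = conv g f"
proof
  fix y
  show "conv f g y = conv g f y"
    unfolding conv_def using nn_integral_reflect[of "\<lambda>x. f x * g (y - x)" y]
    by (simp add: mult.commute)
qed

lemma conv_left_commute:
  assumes [measurable]: "f \<in> borel_measurable borel" "g \<in> borel_measurable borel" "u \<in> borel_measurable borel"
  shows "conv f (conv g u) = conv g (conv f u)"
proof
  fix y
  have "conv f (conv g u) y = (\<integral>\<^sup>+x. \<integral>\<^sup>+z. f x * (g z * u (y - x - z)) \<partial>lborel \<partial>lborel)"
    unfolding conv_def by (simp add: nn_integral_cmult)
  also have "\<dots> = (\<integral>\<^sup>+z. \<integral>\<^sup>+x. f x * (g z * u (y - x - z)) \<partial>lborel \<partial>lborel)"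
    by (rule lborel_pair.Fubini'[symmetric]) measurable
  also have "\<dots> = (\<integral>\<^sup>+z. \<integral>\<^sup>+x. g z * (f x * u (y - z - x)) \<partial>lborel \<partial>lborel)"
    by (simp add: algebra_simps)
  also have "\<dots> = conv g (conv f u) y"
    unfolding conv_def by (simp add: nn_integral_cmult)
  finally show "conv f (conv g u) y = conv g (conv f u) y" .
qed

lemma conv_mono: "(\<And>x. f x \<le> f' x) \<Longrightarrow> (\<And>x. g x \<le> g' x) \<Longrightarrow> conv f g y \<le> conv f' g' y"
  unfolding conv_def by (intro nn_integral_mono mult_mono) auto

lemma conv_add_right:
  assumes [measurable]: "f \<in> borel_measurable borel" "g \<in> borel_measurable borel" "u \<in> borel_measurable borel"
  shows "conv f (\<lambda>x. g x + u x) y = conv f g y + conv f u y"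
  unfolding conv_def by (simp add: nn_integral_add distrib_left)

lemma conv_add_left:
  assumes [measurable]: "f \<in> borel_measurable borel" "g \<in> borel_measurable borel" "u \<in> borel_measurable borel"
  shows "conv (\<lambda>x. f x + g x) u y = conv f u y + conv g u y"
  unfolding conv_def by (simp add: nn_integral_add distrib_right)

lemma conv_cmult_right:
  assumes [measurable]: "f \<in> borel_measurable borel" "g \<in> borel_measurable borel"
  shows "conv f (\<lambda>x. c * g x) y = c * conv f g y"
  unfolding conv_def by (subst nn_integral_cmult[symmetric]) (auto simp: mult_ac)

lemma nn_integral_conv:
  assumes [measurable]: "f \<in> borel_measurable borel" "g \<in> borel_measurable borel"
  shows "(\<integral>\<^sup>+y. conv f g y \<partial>lborel) = (\<integral>\<^sup>+x. f x \<partial>lborel) * (\<integral>\<^sup>+x. g x \<partial>lborel)"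
proof -
  have "(\<integral>\<^sup>+y. conv f g y \<partial>lborel) = (\<integral>\<^sup>+x. \<integral>\<^sup>+y. f x * g (y - x) \<partial>lborel \<partial>lborel)"
    unfolding conv_def by (rule lborel_pair.Fubini') measurable
  also have "\<dots> = (\<integral>\<^sup>+x. f x * (\<integral>\<^sup>+y. g y \<partial>lborel) \<partial>lborel)"
  proof (rule nn_integral_cong)
    fix x
    have "(\<integral>\<^sup>+y. g (y - x) \<partial>lborel) = (\<integral>\<^sup>+y. g y \<partial>lborel)"
      using nn_integral_real_affine[of g 1 "-x"] by simp
    then show "(\<integral>\<^sup>+y. f x * g (y - x) \<partial>lborel) = f x * (\<integral>\<^sup>+y. g y \<partial>lborel)"
      by (simp add: nn_integral_cmult)
  qed
  finally show ?thesis by (simp add: nn_integral_multc)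
qed

text \<open>The index is one less than the number of factors: \<open>conv_pow f k\<close> is the
  density of \<open>k + 1\<close> summands. The empty sum is a point mass and has no
  density.\<close>

primrec conv_pow :: "(real \<Rightarrow> ennreal) \<Rightarrow> nat \<Rightarrow> real \<Rightarrow> ennreal" where
  "conv_pow f 0 = f"
| "conv_pow f (Suc k) = conv f (conv_pow f k)"

lemma conv_pow_measurable [measurable]:
  "f \<in> borel_measurable borel \<Longrightarrow> conv_pow f k \<in> borel_measurable borel"
  by (induction k) auto

lemma conv_pow_mono: "(\<And>x. f x \<le> g x) \<Longrightarrow> conv_pow f k y \<le> conv_pow g k y"
  by (induction k arbitrary: y) (auto intro: conv_mono)

lemma nn_integral_conv_pow:
  "f \<in> borel_measurable borel \<Longrightarrow>
    (\<integral>\<^sup>+y. conv_pow f k y \<partial>lborel) = (\<integral>\<^sup>+x. f x \<partial>lborel) ^ Suc k"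
  by (induction k) (simp_all add: nn_integral_conv)

text \<open>The parts of a convolution power of \<open>g + h\<close> that contain exactly one factor \<open>h\<close>, and at
  least two factors \<open>h\<close>.\<close>

primrec one_jump :: "(real \<Rightarrow> ennreal) \<Rightarrow> (real \<Rightarrow> ennreal) \<Rightarrow> nat \<Rightarrow> real \<Rightarrow> ennreal" where
  "one_jump g h 0 = h"
| "one_jump g h (Suc k) = (\<lambda>y. conv g (one_jump g h k) y + conv h (conv_pow g k) y)"

primrec more_jumps :: "(real \<Rightarrow> ennreal) \<Rightarrow> (real \<Rightarrow> ennreal) \<Rightarrow> nat \<Rightarrow> real \<Rightarrow> ennreal" where
  "more_jumps g h 0 = (\<lambda>y. 0)"
| "more_jumps g h (Suc k) = (\<lambda>y. conv (\<lambda>x. g x + h x) (more_jumps g h k) y + conv h (one_jump g h k) y)"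

context
  fixes g h :: "real \<Rightarrow> ennreal"
  assumes mg [measurable]: "g \<in> borel_measurable borel" and mh [measurable]: "h \<in> borel_measurable borel"
begin

lemma one_jump_measurable [measurable]: "one_jump g h k \<in> borel_measurable borel"
  by (induction k) auto

lemma more_jumps_measurable [measurable]: "more_jumps g h k \<in> borel_measurable borel"
  by (induction k) auto

lemma conv_pow_split:
  "conv_pow (\<lambda>x. g x + h x) k = (\<lambda>y. conv_pow g k y + one_jump g h k y + more_jumps g h k y)"
proof (induction k)
  case (Suc k)
  show ?case by (rule ext) (simp add: Suc conv_add_right conv_add_left add_ac)
qed simp

text \<open>Convolution commutes, so the \<open>k + 2\<close> possible positions of the jump
  contribute equally; \<open>conv_pow g k\<close> holds the other \<open>k + 1\<close>
  factors.\<close>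

lemma one_jump_eq: "one_jump g h (Suc k) = (\<lambda>y. of_nat (k + 2) * conv h (conv_pow g k) y)"
proof (induction k)
  case 0
  then show ?case by (rule ext) (simp add: conv_commute[OF mh mg] mult_2)
next
  case (Suc k)
  have "one_jump g h (Suc (Suc k)) = (\<lambda>y. conv g (one_jump g h (Suc k)) y + conv h (conv_pow g (Suc k)) y)"
    by (rule one_jump.simps)
  also have "\<dots> = (\<lambda>y. of_nat (k + 2) * conv h (conv_pow g (Suc k)) y + conv h (conv_pow g (Suc k)) y)"
    unfolding Suc by (simp add: conv_cmult_right conv_left_commute[OF mg mh])
  also have "\<dots> = (\<lambda>y. of_nat (Suc k + 2) * conv h (conv_pow g (Suc k)) y)"
    by (rule ext) (simp add: distrib_right add_ac)
  finally show ?case .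
qed

text \<open>Among \<open>k + 3\<close> factors some pair consists of jumps, and there are at most
  \<open>(k + 3)^2\<close> pairs. The other \<open>k + 1\<close> factors are relaxed from g or h to
  g + h.\<close>

lemma more_jumps_le:
  "more_jumps g h (k + 2) y \<le> of_nat ((k + 3)\<^sup>2) * conv h (conv h (conv_pow (\<lambda>x. g x + h x) k)) y"
proof (induction k arbitrary: y)
  case 0
  let ?f = "\<lambda>x. g x + h x"
  have "more_jumps g h 2 y = conv ?f (\<lambda>y. conv ?f (\<lambda>y. 0) y + conv h h y) y + conv h (\<lambda>y. conv g h y + conv h g y) y"
    by (simp add: numeral_2_eq_2)
  also have "conv ?f (\<lambda>y. 0) = (\<lambda>y. 0)" by (rule ext) (simp add: conv_def)
  also have "(\<lambda>y. 0 + conv h h y) = conv h h" by simp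
  also have "conv ?f (conv h h) = conv h (conv h ?f)"
    by (simp add: conv_left_commute[of ?f h h] conv_commute[of ?f h])
  also have "conv h (conv h ?f) y + conv h (\<lambda>y. conv g h y + conv h g y) y \<le>
      conv h (conv h ?f) y + (conv h (conv h ?f) y + conv h (conv h ?f) y)"
    by (subst conv_add_right)
       (auto simp: conv_commute[of g h] intro!: add_mono conv_mono)
  also have "\<dots> = 3 * conv h (conv h ?f) y"
  proof -
    have "(3::ennreal) = 1 + (1 + 1)" by simp
    then show ?thesis by (simp only: distrib_right mult_1)
  qed
  also have "\<dots> \<le> of_nat ((0 + 3)\<^sup>2) * conv h (conv h ?f) y"
    by (intro mult_right_mono) auto
  finally show ?case by (simp only: add_0_left conv_pow.simps)
next
  case (Suc k)
  let ?f = "\<lambda>x. g x + h x"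
  let ?p = "conv_pow ?f"
  have "more_jumps g h (Suc k + 2) y = conv ?f (more_jumps g h (k + 2)) y + conv h (one_jump g h (k + 2)) y"
    by simp
  also have "conv ?f (more_jumps g h (k + 2)) y \<le> conv ?f (\<lambda>y. of_nat ((k + 3)\<^sup>2) * conv h (conv h (?p k)) y) y"
    by (intro conv_mono Suc order_refl)
  also have "\<dots> = of_nat ((k + 3)\<^sup>2) * conv h (conv h (?p (Suc k))) y"
    by (simp add: conv_cmult_right conv_left_commute[of ?f h])
  also have "conv h (one_jump g h (k + 2)) y = of_nat (k + 3) * conv h (conv h (conv_pow g (Suc k))) y"
  proof -
    have "k + 2 = Suc (Suc k)" "k + 3 = Suc k + 2" by simp_all
    then show ?thesis
      by (simp only: one_jump_eq conv_cmult_right mh mg conv_measurable conv_pow_measurable)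
  qed
  also have "\<dots> \<le> of_nat (k + 3) * conv h (conv h (?p (Suc k))) y"
    by (intro mult_left_mono conv_mono conv_pow_mono) auto
  finally have "more_jumps g h (Suc k + 2) y
      \<le> of_nat ((k + 3)\<^sup>2) * conv h (conv h (?p (Suc k))) y + of_nat (k + 3) * conv h (conv h (?p (Suc k))) y"
    by (simp add: add_mono)
  also have "\<dots> = of_nat ((k + 3)\<^sup>2 + (k + 3)) * conv h (conv h (?p (Suc k))) y"
    by (simp only: distrib_right of_nat_add)
  also have "\<dots> \<le> of_nat ((Suc k + 3)\<^sup>2) * conv h (conv h (?p (Suc k))) y"
    by (intro mult_right_mono of_nat_mono) (auto simp: power2_eq_square algebra_simps)
  finally show ?case .
qed

end

text \<open>Variances add. The cross term is removed without signed integrals: by evenness x may be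
  replaced by -x, and the two squares add up to 2 x^2 + 2 z^2.\<close>

lemma nn_integral_square_conv:
  assumes [measurable]: "f \<in> borel_measurable borel" "p \<in> borel_measurable borel"
    and even: "\<And>x. f (- x) = f x"
    and f: "(\<integral>\<^sup>+x. f x \<partial>lborel) = 1" "(\<integral>\<^sup>+x. ennreal (x\<^sup>2) * f x \<partial>lborel) = 1"
    and p: "(\<integral>\<^sup>+x. p x \<partial>lborel) = 1" "(\<integral>\<^sup>+x. ennreal (x\<^sup>2) * p x \<partial>lborel) = ennreal s" "s \<ge> 0"
  shows "(\<integral>\<^sup>+y. ennreal (y\<^sup>2) * conv f p y \<partial>lborel) = ennreal (1 + s)"
proof -
  define I where "I = (\<integral>\<^sup>+y. ennreal (y\<^sup>2) * conv f p y \<partial>lborel)"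
  have "I = (\<integral>\<^sup>+y. \<integral>\<^sup>+x. ennreal (y\<^sup>2) * (f x * p (y - x)) \<partial>lborel \<partial>lborel)"
    unfolding I_def conv_def by (simp add: nn_integral_cmult)
  also have "\<dots> = (\<integral>\<^sup>+x. \<integral>\<^sup>+y. ennreal (y\<^sup>2) * (f x * p (y - x)) \<partial>lborel \<partial>lborel)"
    by (rule lborel_pair.Fubini') measurable
  also have "\<dots> = (\<integral>\<^sup>+x. f x * (\<integral>\<^sup>+z. ennreal ((z + x)\<^sup>2) * p z \<partial>lborel) \<partial>lborel)"
  proof (rule nn_integral_cong)
    fix x
    have "(\<integral>\<^sup>+y. ennreal (y\<^sup>2) * (f x * p (y - x)) \<partial>lborel) = (\<integral>\<^sup>+y. f x * (ennreal (y\<^sup>2) * p (y - x)) \<partial>lborel)"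
      by (simp add: mult_ac)
    also have "\<dots> = f x * (\<integral>\<^sup>+y. ennreal (y\<^sup>2) * p (y - x) \<partial>lborel)"
      by (simp add: nn_integral_cmult)
    also have "(\<integral>\<^sup>+y. ennreal (y\<^sup>2) * p (y - x) \<partial>lborel) = (\<integral>\<^sup>+z. ennreal ((z + x)\<^sup>2) * p z \<partial>lborel)"
      using nn_integral_real_affine[of "\<lambda>y. ennreal (y\<^sup>2) * p (y - x)" 1 x] by (simp add: add.commute)
    finally show "(\<integral>\<^sup>+y. ennreal (y\<^sup>2) * (f x * p (y - x)) \<partial>lborel) = f x * (\<integral>\<^sup>+z. ennreal ((z + x)\<^sup>2) * p z \<partial>lborel)" .
  qed
  finally have I1: "I = (\<integral>\<^sup>+x. f x * (\<integral>\<^sup>+z. ennreal ((z + x)\<^sup>2) * p z \<partial>lborel) \<partial>lborel)" .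
  have I2: "I = (\<integral>\<^sup>+x. f x * (\<integral>\<^sup>+z. ennreal ((z - x)\<^sup>2) * p z \<partial>lborel) \<partial>lborel)"
    unfolding I1 using nn_integral_reflect[of "\<lambda>x. f x * (\<integral>\<^sup>+z. ennreal ((z + x)\<^sup>2) * p z \<partial>lborel)" 0]
    by (simp add: even)
  have "2 * I = (\<integral>\<^sup>+x. f x * (\<integral>\<^sup>+z. ennreal ((z + x)\<^sup>2) * p z \<partial>lborel) + f x * (\<integral>\<^sup>+z. ennreal ((z - x)\<^sup>2) * p z \<partial>lborel) \<partial>lborel)"
    unfolding mult_2 by (subst nn_integral_add) (auto simp: I1[symmetric] I2[symmetric])
  also have "\<dots> = (\<integral>\<^sup>+x. 2 * (ennreal (x\<^sup>2) * f x) + ennreal (2 * s) * f x \<partial>lborel)"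
  proof (rule nn_integral_cong)
    fix x
    have "(\<integral>\<^sup>+z. ennreal ((z + x)\<^sup>2) * p z \<partial>lborel) + (\<integral>\<^sup>+z. ennreal ((z - x)\<^sup>2) * p z \<partial>lborel)
       = (\<integral>\<^sup>+z. ennreal (2 * x\<^sup>2) * p z + 2 * (ennreal (z\<^sup>2) * p z) \<partial>lborel)"
    proof (subst nn_integral_add[symmetric]; (measurable)?)
      show "(\<integral>\<^sup>+z. ennreal ((z + x)\<^sup>2) * p z + ennreal ((z - x)\<^sup>2) * p z \<partial>lborel) = (\<integral>\<^sup>+z. ennreal (2 * x\<^sup>2) * p z + 2 * (ennreal (z\<^sup>2) * p z) \<partial>lborel)"
      proof (rule nn_integral_cong)
        fix z
        have "ennreal ((z + x)\<^sup>2) + ennreal ((z - x)\<^sup>2) = ennreal (2 * x\<^sup>2) + ennreal (2 * z\<^sup>2)"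
        proof -
          have "ennreal ((z + x)\<^sup>2) + ennreal ((z - x)\<^sup>2) = ennreal ((z + x)\<^sup>2 + (z - x)\<^sup>2)"
            by simp
          also have "(z + x)\<^sup>2 + (z - x)\<^sup>2 = 2 * x\<^sup>2 + 2 * z\<^sup>2"
            by (simp add: power2_eq_square algebra_simps)
          finally show ?thesis by simp
        qed
        then show "ennreal ((z + x)\<^sup>2) * p z + ennreal ((z - x)\<^sup>2) * p z = ennreal (2 * x\<^sup>2) * p z + 2 * (ennreal (z\<^sup>2) * p z)"
          unfolding distrib_right[symmetric] by (simp add: distrib_right ennreal_mult mult.assoc)
      qed
    qed
    also have "\<dots> = ennreal (2 * x\<^sup>2) + ennreal (2 * s)"
      using p(3) by (simp add: nn_integral_add nn_integral_cmult p ennreal_mult)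
    finally show "f x * (\<integral>\<^sup>+z. ennreal ((z + x)\<^sup>2) * p z \<partial>lborel) + f x * (\<integral>\<^sup>+z. ennreal ((z - x)\<^sup>2) * p z \<partial>lborel)
       = 2 * (ennreal (x\<^sup>2) * f x) + ennreal (2 * s) * f x"
      by (simp add: distrib_left[symmetric] distrib_right[symmetric] ennreal_mult mult_ac)
  qed
  also have "\<dots> = 2 + ennreal (2 * s)"
    by (simp add: nn_integral_add nn_integral_cmult f)
  also have "\<dots> = 2 * ennreal (1 + s)"
    using p(3) by (simp add: ennreal_mult distrib_left)
  finally have "2 * I = 2 * ennreal (1 + s)" .
  then have "I = ennreal (1 + s)"
    by (simp add: ennreal_mult_cancel_left)
  then show ?thesis by (simp add: I_def)
qed

lemma nn_integral_square_conv_pow: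
  assumes [measurable]: "f \<in> borel_measurable borel"
    and even: "\<And>x. f (- x) = f x"
    and f: "(\<integral>\<^sup>+x. f x \<partial>lborel) = 1" "(\<integral>\<^sup>+x. ennreal (x\<^sup>2) * f x \<partial>lborel) = 1"
  shows "(\<integral>\<^sup>+y. ennreal (y\<^sup>2) * conv_pow f k y \<partial>lborel) = ennreal (real (Suc k))"
proof (induction k)
  case (Suc k)
  then show ?case
    using nn_integral_square_conv[OF _ _ even f, of "conv_pow f k" "real (Suc k)"]
    by (simp add: nn_integral_conv_pow f)
qed (simp add: f)

lemma nn_integral_Chebyshev:
  assumes [measurable]: "p \<in> borel_measurable borel" and "t > 0"
    and "(\<integral>\<^sup>+y. ennreal (y\<^sup>2) * p y \<partial>lborel) \<le> ennreal s" "s \<ge> 0"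
  shows "(\<integral>\<^sup>+y. indicator {y. \<bar>y\<bar> > t} y * p y \<partial>lborel) \<le> ennreal (s / t\<^sup>2)"
proof -
  have "(\<integral>\<^sup>+y. indicator {y. \<bar>y\<bar> > t} y * p y \<partial>lborel) \<le> (\<integral>\<^sup>+y. ennreal (1 / t\<^sup>2) * (ennreal (y\<^sup>2) * p y) \<partial>lborel)"
  proof (rule nn_integral_mono)
    fix y
    show "indicator {y. \<bar>y\<bar> > t} y * p y \<le> ennreal (1 / t\<^sup>2) * (ennreal (y\<^sup>2) * p y)"
    proof (cases "\<bar>y\<bar> > t")
      case True
      then have "t\<^sup>2 \<le> y\<^sup>2" using assms(2) by (simp add: abs_le_square_iff[symmetric])
      then have "1 \<le> 1 / t\<^sup>2 * y\<^sup>2" using assms(2) by (simp add: field_simps)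
      then have "ennreal 1 \<le> ennreal (1 / t\<^sup>2) * ennreal (y\<^sup>2)"
        by (subst ennreal_mult[symmetric]) (auto intro: ennreal_leI)
      from mult_right_mono[OF this, of "p y"] True show ?thesis by (simp add: mult.assoc)
    qed simp
  qed
  also have "\<dots> \<le> ennreal (1 / t\<^sup>2) * ennreal s"
    by (subst nn_integral_cmult) (auto intro: mult_left_mono assms(3))
  also have "\<dots> = ennreal (s / t\<^sup>2)"
    by (subst ennreal_mult[symmetric]) (use assms in auto)
  finally show ?thesis .
qed

text \<open>The linear terms cancel and each exponential leaves a remainder of at most 3 s^2. The
  quadratic size is what makes tilting at scale 1 / L affordable.\<close>

lemma exp_add_exp_minus_le:
  fixes s :: real
  assumes "\<bar>s\<bar> \<le> 1"
  shows "exp s + exp (- s) \<le> 2 + 6 * s\<^sup>2"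
proof -
  have *: "exp t \<le> 1 + t + 3 * t\<^sup>2" if "\<bar>t\<bar> \<le> 1" for t :: real
  proof -
    have "\<bar>exp t - (1 + t)\<bar> \<le> exp \<bar>t\<bar> * t\<^sup>2"
      using Taylor_exp_field[of t 1] by (simp add: power2_eq_square)
    also have "\<dots> \<le> 3 * t\<^sup>2"
      using order_trans[OF _ exp_le, of "exp \<bar>t\<bar>"] that by (intro mult_right_mono) auto
    finally show ?thesis by linarith
  qed
  show ?thesis using *[of s] *[of "-s"] assms by simp
qed

lemma powr_neg_flip: "x > 0 \<Longrightarrow> (1 / x :: real) powr p = x powr - p"
  by (simp add: powr_divide powr_minus_divide)

lemma powr_neg_mult_le: "c > 0 \<Longrightarrow> u \<le> c powr p * v \<Longrightarrow> c powr - p * u \<le> (v :: real)"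
  by (simp add: powr_minus_divide divide_le_eq mult.commute)

section \<open>The Pareto density, its truncation and exponential tilting\<close>

locale pareto =
  fixes a b \<alpha> :: real
  assumes a_pos: "a > 0" and b_pos: "b > 0" and alpha_gt_2: "\<alpha> > 2"
    and mass: "(\<integral>\<^sup>+x. ennreal (pareto_density a b \<alpha> x) \<partial>lborel) = 1"
    and second_moment: "(\<integral>\<^sup>+x. ennreal (x\<^sup>2) * ennreal (pareto_density a b \<alpha> x) \<partial>lborel) = 1"
begin

definition f :: "real \<Rightarrow> real" where "f = pareto_density a b \<alpha>"

abbreviation F :: "real \<Rightarrow> ennreal" where "F x \<equiv> ennreal (f x)"

lemma denominator_pos: "b + \<bar>x\<bar> powr (\<alpha> + 1) > 0"
  using b_pos by (simp add: add_pos_nonneg)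

lemma f_pos: "f x > 0"
  using a_pos denominator_pos by (simp add: f_def pareto_density_def)

lemma f_nonneg: "f x \<ge> 0" using f_pos[of x] by simp

lemma f_even: "f (- x) = f x" by (simp add: f_def pareto_density_def)

lemma f_measurable [measurable]: "f \<in> borel_measurable borel"
  unfolding f_def pareto_density_def[abs_def] by measurable

lemma f_mono: "\<bar>x\<bar> \<le> \<bar>y\<bar> \<Longrightarrow> f y \<le> f x"
  unfolding f_def pareto_density_def using alpha_gt_2 a_pos b_pos denominator_pos
  by (intro divide_left_mono add_left_mono powr_mono2 mult_pos_pos) auto

lemma f_le: "f x \<le> a / b"
  unfolding f_def pareto_density_def using a_pos b_pos denominator_pos
  by (intro divide_left_mono mult_pos_pos) auto

lemma f_le_powr: "x \<noteq> 0 \<Longrightarrow> f x \<le> a * \<bar>x\<bar> powr (- (\<alpha> + 1))"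
  unfolding f_def pareto_density_def using a_pos b_pos denominator_pos[of x]
  by (subst powr_minus_divide) (auto intro!: divide_left_mono mult_pos_pos)

lemma f_ge_powr: "\<bar>x\<bar> \<ge> 1 \<Longrightarrow> f x \<ge> a / (b + 1) * \<bar>x\<bar> powr (- (\<alpha> + 1))"
proof -
  assume x: "\<bar>x\<bar> \<ge> 1"
  then have "\<bar>x\<bar> powr (\<alpha> + 1) \<ge> 1" using alpha_gt_2 by (intro ge_one_powr_ge_zero) auto
  then have "b + \<bar>x\<bar> powr (\<alpha> + 1) \<le> (b + 1) * \<bar>x\<bar> powr (\<alpha> + 1)"
    using b_pos mult_left_mono[of 1 "\<bar>x\<bar> powr (\<alpha> + 1)" b] by (simp add: distrib_right)
  then have "a / ((b + 1) * \<bar>x\<bar> powr (\<alpha> + 1)) \<le> f x"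
    unfolding f_def pareto_density_def using a_pos b_pos x denominator_pos[of x]
    by (intro divide_left_mono mult_pos_pos) auto
  then show ?thesis by (simp only: powr_minus_divide) simp
qed

text \<open>A non-asymptotic form of regular variation: enlarging the argument by a factor c costs
  at most c^(\<alpha>+1), for every x.\<close>

lemma f_scale: "c \<ge> 1 \<Longrightarrow> f x \<le> c powr (\<alpha> + 1) * f (c * x)"
proof -
  assume c: "c \<ge> 1"
  have 1: "c powr (\<alpha> + 1) \<ge> 1" using c alpha_gt_2 by (intro ge_one_powr_ge_zero) auto
  have "b + \<bar>c * x\<bar> powr (\<alpha> + 1) \<le> c powr (\<alpha> + 1) * (b + \<bar>x\<bar> powr (\<alpha> + 1))"
    using mult_right_mono[OF 1, of b] b_pos c by (simp add: abs_mult powr_mult distrib_left)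
  then have "a * (b + \<bar>c * x\<bar> powr (\<alpha> + 1)) \<le> a * (c powr (\<alpha> + 1) * (b + \<bar>x\<bar> powr (\<alpha> + 1)))"
    using a_pos by (intro mult_left_mono) auto
  then show ?thesis
    unfolding f_def pareto_density_def using denominator_pos[of x] denominator_pos[of "c * x"]
    by (simp add: field_simps)
qed

lemma F_mass: "(\<integral>\<^sup>+x. F x \<partial>lborel) = 1"
  using mass by (simp add: f_def)

lemma F_second_moment: "(\<integral>\<^sup>+x. ennreal (x\<^sup>2) * F x \<partial>lborel) = 1"
  using second_moment by (simp add: f_def)

definition small :: "real \<Rightarrow> real \<Rightarrow> ennreal" where
  "small L x = F x * indicator {-L..L} x"

definition large :: "real \<Rightarrow> real \<Rightarrow> ennreal" where
  "large L x = F x * indicator {x. \<bar>x\<bar> > L} x"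

lemma small_measurable [measurable]: "small L \<in> borel_measurable borel"
  unfolding small_def by measurable

lemma large_measurable [measurable]: "large L \<in> borel_measurable borel"
  unfolding large_def by measurable

lemma small_add_large: "(\<lambda>x. small L x + large L x) = F"
  by (rule ext) (auto simp: small_def large_def indicator_def)

lemma small_le: "small L x \<le> F x" by (auto simp: small_def indicator_def)

lemma large_le: "large L x \<le> F x" by (auto simp: large_def indicator_def)

lemma large_mass:
  assumes "L > 0" shows "(\<integral>\<^sup>+x. large L x \<partial>lborel) \<le> ennreal (1 / L\<^sup>2)"
  using nn_integral_Chebyshev[of F L 1] F_second_moment assms
  by (simp add: large_def mult.commute)

lemma small_mass:
  assumes "L \<ge> 1" shows "ennreal (1 - 1 / L\<^sup>2) \<le> (\<integral>\<^sup>+x. small L x \<partial>lborel)"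
proof -
  have "ennreal 1 = (\<integral>\<^sup>+x. small L x + large L x \<partial>lborel)"
    unfolding small_add_large F_mass by simp
  also have "\<dots> = (\<integral>\<^sup>+x. small L x \<partial>lborel) + (\<integral>\<^sup>+x. large L x \<partial>lborel)"
    by (rule nn_integral_add) auto
  also have "\<dots> \<le> (\<integral>\<^sup>+x. small L x \<partial>lborel) + ennreal (1 / L\<^sup>2)"
    using large_mass[of L] assms by (intro add_left_mono) auto
  finally show ?thesis
    by (subst ennreal_minus[symmetric]) (auto simp: ennreal_minus_le_iff add.commute)
qed

text \<open>Symmetry equates the two signs of the tilt, so each is the mean of both and the linear
  term disappears. On the truncated range the exponent is at most 1 in absolute value, and unit
  variance turns the quadratic term into 3 / L^2.\<close>

lemma tilted_small_mass:
  assumes "L > 0" "\<bar>\<sigma>\<bar> = (1::real)"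
  shows "(\<integral>\<^sup>+x. small L x * ennreal (exp (\<sigma> * x / L)) \<partial>lborel) \<le> ennreal (1 + 3 / L\<^sup>2)"
proof -
  define I where "I = (\<lambda>\<sigma>. \<integral>\<^sup>+x. small L x * ennreal (exp (\<sigma> * x / L)) \<partial>lborel)"
  have "small L (- x) = small L x" for x by (auto simp: small_def f_even indicator_def)
  then have refl: "I (- 1) = I 1"
    unfolding I_def using nn_integral_reflect[of "\<lambda>x. small L x * ennreal (exp (x / L))" 0] by simp
  have "2 * I 1 = (\<integral>\<^sup>+x. small L x * ennreal (exp (x / L)) + small L x * ennreal (exp (- x / L)) \<partial>lborel)"
    unfolding mult_2 by (subst (2) refl[symmetric]) (simp add: I_def nn_integral_add)
  also have "\<dots> \<le> (\<integral>\<^sup>+x. 2 * F x + ennreal (6 / L\<^sup>2) * (ennreal (x\<^sup>2) * F x) \<partial>lborel)"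
  proof (rule nn_integral_mono)
    fix x
    show "small L x * ennreal (exp (x / L)) + small L x * ennreal (exp (- x / L))
      \<le> 2 * F x + ennreal (6 / L\<^sup>2) * (ennreal (x\<^sup>2) * F x)"
    proof (cases "x \<in> {-L..L}")
      case True
      then have "\<bar>x / L\<bar> \<le> 1" using assms by (auto simp: abs_le_iff field_simps)
      from exp_add_exp_minus_le[OF this]
      have "f x * (exp (x / L) + exp (- x / L)) \<le> f x * (2 + 6 * (x / L)\<^sup>2)"
        using f_nonneg by (intro mult_left_mono) auto
      also have "\<dots> = 2 * f x + 6 / L\<^sup>2 * (x\<^sup>2 * f x)"
        by (simp add: power_divide algebra_simps)
      finally have le: "ennreal (f x * (exp (x / L) + exp (- x / L))) \<le> ennreal (2 * f x + 6 / L\<^sup>2 * (x\<^sup>2 * f x))"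
        by (rule ennreal_leI)
      have "ennreal (2 * v + r * (w * v)) = 2 * ennreal v + ennreal r * (ennreal w * ennreal v)"
        if "v \<ge> 0" "r \<ge> 0" "w \<ge> 0" for v r w :: real
        using that by (simp add: ennreal_mult)
      from le[unfolded this[OF f_nonneg[of x] divide_nonneg_nonneg[OF zero_le_numeral zero_le_power2] zero_le_power2]]
      have "ennreal (f x * (exp (x / L) + exp (- x / L))) \<le> 2 * F x + ennreal (6 / L\<^sup>2) * (ennreal (x\<^sup>2) * F x)" .
      moreover have "ennreal (f x * (exp (x / L) + exp (- x / L))) = F x * ennreal (exp (x / L)) + F x * ennreal (exp (- x / L))"
        using f_nonneg[of x] by (simp add: distrib_left ennreal_mult)
      ultimately show ?thesis using True by (simp add: small_def)
    qed (simp add: small_def)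
  qed
  also have "\<dots> = 2 + ennreal (6 / L\<^sup>2)"
    by (simp add: nn_integral_add nn_integral_cmult F_mass F_second_moment)
  also have "\<dots> = 2 * ennreal (1 + 3 / L\<^sup>2)"
    by (subst ennreal_plus) (auto simp: distrib_left ennreal_mult[symmetric] ennreal_numeral[symmetric] simp del: ennreal_numeral)
  finally have "2 * I 1 \<le> 2 * ennreal (1 + 3 / L\<^sup>2)" .
  then have "I 1 \<le> ennreal (1 + 3 / L\<^sup>2)"
    by (subst (asm) ennreal_mult_le_mult_iff) auto
  moreover have "\<sigma> = 1 \<or> \<sigma> = -1" using assms(2) by linarith
  ultimately have "I \<sigma> \<le> ennreal (1 + 3 / L\<^sup>2)" using refl by auto
  then show ?thesis by (simp add: I_def)
qed

text \<open>Exponential tilting at scale \<open>1 / L\<close>: the powers of the tilted mass stay bounded as long as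
  \<open>k \<le> L\<^sup>2\<close>.\<close>

lemma conv_pow_small_tilt:
  assumes "L > 0" "\<bar>\<sigma>\<bar> = (1::real)"
  shows "conv_pow (small L) k y \<le> ennreal (exp 1 * (a / b) * exp (- \<sigma> * y / L) * (1 + 3 / L\<^sup>2) ^ k)"
proof (induction k arbitrary: y)
  case 0
  show ?case
  proof (cases "y \<in> {-L..L}")
    case True
    have "\<sigma> * y \<le> \<bar>\<sigma>\<bar> * \<bar>y\<bar>" by (simp add: abs_mult[symmetric])
    also have "\<dots> \<le> L" using True assms by auto
    finally have "\<sigma> * y / L \<le> 1" using assms by simp
    then have "1 \<le> exp (1 + (- \<sigma> * y / L))" by simp
    then have "(a / b) * 1 \<le> (a / b) * exp (1 + (- \<sigma> * y / L))"
      using a_pos b_pos by (intro mult_left_mono) auto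
    also have "exp (1 + (- \<sigma> * y / L)) = exp 1 * exp (- \<sigma> * y / L)" by (rule exp_add)
    finally have "f y \<le> exp 1 * (a / b) * exp (- \<sigma> * y / L)"
      using f_le[of y] by (simp only: mult_ac mult_1_right)
    then show ?thesis using True by (simp add: small_def ennreal_leI)
  qed (simp add: small_def)
next
  case (Suc k)
  let ?K = "exp 1 * (a / b) * (1 + 3 / L\<^sup>2) ^ k"
  have K: "?K \<ge> 0" using a_pos b_pos by simp
  have "conv_pow (small L) (Suc k) y \<le> (\<integral>\<^sup>+x. ennreal (?K * exp (- \<sigma> * y / L)) * (small L x * ennreal (exp (\<sigma> * x / L))) \<partial>lborel)"
    unfolding conv_pow.simps conv_def
  proof (rule nn_integral_mono)
    fix x
    have "small L x * conv_pow (small L) k (y - x) \<le> small L x * ennreal (exp 1 * (a / b) * exp (- \<sigma> * (y - x) / L) * (1 + 3 / L\<^sup>2) ^ k)"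
      by (rule mult_left_mono[OF Suc]) simp
    also have "exp (- \<sigma> * (y - x) / L) = exp (- \<sigma> * y / L) * exp (\<sigma> * x / L)"
      by (subst exp_add[symmetric], rule arg_cong[where f=exp]) (simp add: algebra_simps diff_divide_distrib)
    also have "exp 1 * (a / b) * (exp (- \<sigma> * y / L) * exp (\<sigma> * x / L)) * (1 + 3 / L\<^sup>2) ^ k = (?K * exp (- \<sigma> * y / L)) * exp (\<sigma> * x / L)"
      by (simp only: mult_ac)
    also have "small L x * ennreal ((?K * exp (- \<sigma> * y / L)) * exp (\<sigma> * x / L)) = ennreal (?K * exp (- \<sigma> * y / L)) * (small L x * ennreal (exp (\<sigma> * x / L)))"
      by (subst ennreal_mult[OF mult_nonneg_nonneg[OF K exp_ge_zero] exp_ge_zero]) (simp only: mult_ac)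
    finally show "small L x * conv_pow (small L) k (y - x) \<le> ennreal (?K * exp (- \<sigma> * y / L)) * (small L x * ennreal (exp (\<sigma> * x / L)))" .
  qed
  also have "\<dots> \<le> ennreal (?K * exp (- \<sigma> * y / L)) * ennreal (1 + 3 / L\<^sup>2)"
    using mult_left_mono[OF tilted_small_mass[OF assms]] by (subst nn_integral_cmult) auto
  also have "\<dots> = ennreal (exp 1 * (a / b) * exp (- \<sigma> * y / L) * (1 + 3 / L\<^sup>2) ^ Suc k)"
    by (subst ennreal_mult[OF mult_nonneg_nonneg[OF K exp_ge_zero], symmetric]) (simp_all add: mult_ac)
  finally show ?case .
qed

text \<open>Here exp 4 is exp 1, lost where a single summand is compared with its tilt, times exp 3,
  the bound on the accumulated tilted mass.\<close>

definition small_bound :: real where "small_bound = exp 4 * (a / b)"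

lemma small_bound_pos: "small_bound > 0" using a_pos b_pos by (simp add: small_bound_def)

text \<open>The tilt is taken in the direction of y, and k \<le> L^2 keeps (1 + 3 / L^2)^k below exp
  3.\<close>

lemma conv_pow_small_le:
  assumes "L > 0" "real k \<le> L\<^sup>2"
  shows "conv_pow (small L) k y \<le> ennreal (small_bound * exp (- \<bar>y\<bar> / L))"
proof -
  define \<sigma> :: real where "\<sigma> = (if y \<ge> 0 then 1 else -1)"
  have \<sigma>: "\<bar>\<sigma>\<bar> = 1" "\<sigma> * y = \<bar>y\<bar>" by (auto simp: \<sigma>_def)
  have "(1 + 3 / L\<^sup>2) ^ k \<le> exp (3 / L\<^sup>2) ^ k"
    by (intro power_mono exp_ge_add_one_self) simp
  also have "\<dots> = exp (3 * (real k / L\<^sup>2))" by (simp add: exp_of_nat_mult[symmetric] mult_ac)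
  also have "\<dots> \<le> exp 3" using assms by (simp add: divide_le_eq)
  finally have p: "(1 + 3 / L\<^sup>2) ^ k \<le> exp 3" .
  have "conv_pow (small L) k y \<le> ennreal (exp 1 * (a / b) * exp (- \<sigma> * y / L) * (1 + 3 / L\<^sup>2) ^ k)"
    by (rule conv_pow_small_tilt) (use assms \<sigma> in auto)
  also have "\<dots> \<le> ennreal (exp 1 * (a / b) * exp (- \<sigma> * y / L) * exp 3)"
    using p a_pos b_pos by (intro ennreal_leI mult_left_mono) auto
  also have "exp 1 * (a / b) * exp (- \<sigma> * y / L) * exp 3 = small_bound * exp (- \<bar>y\<bar> / L)"
    using \<sigma>(2) exp_add[of 1 "3::real"] by (simp add: small_bound_def)
  finally show ?thesis .
qed

text \<open>If the jump x lies within \<epsilon> y of y, its density is at most a constant near 1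
  times f y, and the small part integrates to at most 1. Otherwise the small summands have to cover
  more than \<epsilon> y, which is exponentially unlikely.\<close>

lemma conv_large_small_le:
  assumes "L > 0" "real k \<le> L\<^sup>2" "y > 0" "0 < \<epsilon>" "\<epsilon> < 1"
  shows "conv (large L) (conv_pow (small L) k) y
    \<le> ennreal ((1 - \<epsilon>) powr - (\<alpha> + 1) * f y) + ennreal (small_bound * exp (- \<epsilon> * y / L))"
proof -
  let ?u = "conv_pow (small L) k"
  have "conv (large L) ?u y \<le> (\<integral>\<^sup>+x. ennreal ((1 - \<epsilon>) powr - (\<alpha> + 1) * f y) * ?u (y - x) + ennreal (small_bound * exp (- \<epsilon> * y / L)) * F x \<partial>lborel)"
    unfolding conv_def
  proof (rule nn_integral_mono)
    fix x
    show "large L x * ?u (y - x) \<le> ennreal ((1 - \<epsilon>) powr - (\<alpha> + 1) * f y) * ?u (y - x) + ennreal (small_bound * exp (- \<epsilon> * y / L)) * F x"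
    proof (cases "\<bar>y - x\<bar> \<le> \<epsilon> * y")
      case True
      have "f x \<le> f ((1 - \<epsilon>) * y)"
        using True assms by (intro f_mono) (auto simp: abs_le_iff abs_mult algebra_simps)
      also have "\<dots> \<le> (1 / (1 - \<epsilon>)) powr (\<alpha> + 1) * f (1 / (1 - \<epsilon>) * ((1 - \<epsilon>) * y))"
        using assms by (intro f_scale) auto
      also have "\<dots> = (1 - \<epsilon>) powr - (\<alpha> + 1) * f y"
        using assms by (subst powr_neg_flip) auto
      finally have "large L x \<le> ennreal ((1 - \<epsilon>) powr - (\<alpha> + 1) * f y)"
        by (intro order_trans[OF large_le] ennreal_leI)
      then show ?thesis by (intro add_increasing2 mult_right_mono) auto
    next
      case False
      have "?u (y - x) \<le> ennreal (small_bound * exp (- \<bar>y - x\<bar> / L))"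
        by (rule conv_pow_small_le) (use assms in auto)
      also have "\<dots> \<le> ennreal (small_bound * exp (- \<epsilon> * y / L))"
        using False assms small_bound_pos by (intro ennreal_leI mult_left_mono) (auto simp: divide_right_mono)
      finally show ?thesis
        by (intro add_increasing) (auto simp: mult.commute intro!: mult_mono large_le)
    qed
  qed
  also have "\<dots> = ennreal ((1 - \<epsilon>) powr - (\<alpha> + 1) * f y) * (\<integral>\<^sup>+x. ?u x \<partial>lborel) + ennreal (small_bound * exp (- \<epsilon> * y / L))"
    by (simp add: nn_integral_add nn_integral_cmult F_mass nn_integral_reflect)
  also have "(\<integral>\<^sup>+x. ?u x \<partial>lborel) \<le> 1"
    using nn_integral_mono[of lborel "small L" F] F_mass small_le
    unfolding nn_integral_conv_pow[OF small_measurable] by (intro power_le_one) auto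
  finally show ?thesis
    by (simp add: add_mono mult_left_mono order_trans[OF _ add_right_mono])
qed

text \<open>Only small sums of size at most \<epsilon> y are kept. Bernoulli's inequality bounds the
  mass lost by truncation and Chebyshev's the mass beyond \<epsilon> y; (1 - \<epsilon>) y > L
  guarantees that the remaining jump really counts as large.\<close>

lemma conv_large_small_ge:
  assumes "L \<ge> 1" "y > 0" "0 < \<epsilon>" "\<epsilon> < 1" "(1 - \<epsilon>) * y > L"
  shows "ennreal ((1 + \<epsilon>) powr - (\<alpha> + 1) * f y) * ennreal (1 - real (Suc k) / L\<^sup>2 - real (Suc k) / (\<epsilon> * y)\<^sup>2)
    \<le> conv (large L) (conv_pow (small L) k) y"
proof -
  let ?u = "conv_pow (small L) k"
  let ?A = "{z. \<bar>z\<bar> > \<epsilon> * y}"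
  have "ennreal (1 - real (Suc k) / L\<^sup>2) \<le> ennreal ((1 - 1 / L\<^sup>2) ^ Suc k)"
  proof (rule ennreal_leI)
    have "1 / L\<^sup>2 \<le> 1" using assms by (simp add: divide_le_eq)
    then show "1 - real (Suc k) / L\<^sup>2 \<le> (1 - 1 / L\<^sup>2) ^ Suc k"
      using Bernoulli_inequality[of "- (1 / L\<^sup>2)" "Suc k"] by simp
  qed
  also have "\<dots> = ennreal (1 - 1 / L\<^sup>2) ^ Suc k"
    using assms by (subst ennreal_power) (auto simp: divide_le_eq)
  also have "\<dots> \<le> (\<integral>\<^sup>+x. small L x \<partial>lborel) ^ Suc k"
    by (intro power_mono small_mass assms) auto
  also have "\<dots> = (\<integral>\<^sup>+x. indicator (- ?A) x * ?u x + indicator ?A x * ?u x \<partial>lborel)"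
    by (subst nn_integral_conv_pow[symmetric]) (auto simp: indicator_def intro!: nn_integral_cong)
  also have "\<dots> = (\<integral>\<^sup>+x. indicator (- ?A) x * ?u x \<partial>lborel) + (\<integral>\<^sup>+x. indicator ?A x * ?u x \<partial>lborel)"
    by (rule nn_integral_add) auto
  also have "(\<integral>\<^sup>+x. indicator ?A x * ?u x \<partial>lborel) \<le> (\<integral>\<^sup>+x. indicator ?A x * conv_pow F k x \<partial>lborel)"
    by (intro nn_integral_mono mult_left_mono conv_pow_mono small_le) auto
  also have "\<dots> \<le> ennreal (real (Suc k) / (\<epsilon> * y)\<^sup>2)"
    using assms f_even F_mass F_second_moment
    by (intro nn_integral_Chebyshev) (auto simp: nn_integral_square_conv_pow simp del: of_nat_Suc)
  finally have "ennreal (1 - real (Suc k) / L\<^sup>2) \<le> (\<integral>\<^sup>+x. indicator (- ?A) x * ?u x \<partial>lborel) + ennreal (real (Suc k) / (\<epsilon> * y)\<^sup>2)"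
    by (simp add: add_left_mono order_trans)
  then have mass: "ennreal (1 - real (Suc k) / L\<^sup>2 - real (Suc k) / (\<epsilon> * y)\<^sup>2) \<le> (\<integral>\<^sup>+x. indicator (- ?A) x * ?u x \<partial>lborel)"
    by (subst ennreal_minus[symmetric]) (auto simp: ennreal_minus_le_iff add.commute)
  have "ennreal ((1 + \<epsilon>) powr - (\<alpha> + 1) * f y) * ennreal (1 - real (Suc k) / L\<^sup>2 - real (Suc k) / (\<epsilon> * y)\<^sup>2)
     \<le> ennreal ((1 + \<epsilon>) powr - (\<alpha> + 1) * f y) * (\<integral>\<^sup>+x. indicator (- ?A) (y - x) * ?u (y - x) \<partial>lborel)"
    using mass by (subst nn_integral_reflect[of "\<lambda>z. indicator (- ?A) z * ?u z" y]) (auto intro: mult_left_mono)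
  also have "\<dots> = (\<integral>\<^sup>+x. ennreal ((1 + \<epsilon>) powr - (\<alpha> + 1) * f y) * (indicator (- ?A) (y - x) * ?u (y - x)) \<partial>lborel)"
    by (subst nn_integral_cmult) auto
  also have "\<dots> \<le> conv (large L) ?u y"
    unfolding conv_def
  proof (rule nn_integral_mono)
    fix x
    show "ennreal ((1 + \<epsilon>) powr - (\<alpha> + 1) * f y) * (indicator (- ?A) (y - x) * ?u (y - x)) \<le> large L x * ?u (y - x)"
    proof (cases "\<bar>y - x\<bar> \<le> \<epsilon> * y")
      case True
      have "f y \<le> (1 + \<epsilon>) powr (\<alpha> + 1) * f ((1 + \<epsilon>) * y)" using assms by (intro f_scale) auto
      also have "f ((1 + \<epsilon>) * y) \<le> f x"
        using True assms by (intro f_mono) (auto simp: abs_le_iff abs_mult algebra_simps)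
      finally have "(1 + \<epsilon>) powr - (\<alpha> + 1) * f y \<le> f x"
        using assms by (intro powr_neg_mult_le) (auto simp: mult_left_mono)
      moreover have "\<bar>x\<bar> > L"
      proof -
        have "y - x \<le> \<epsilon> * y" using True by linarith
        then have "x > L" using assms(5) by (simp add: algebra_simps)
        then show ?thesis by simp
      qed
      ultimately have "ennreal ((1 + \<epsilon>) powr - (\<alpha> + 1) * f y) \<le> large L x"
        by (simp add: large_def ennreal_leI)
      then show ?thesis using True by (simp add: mult_right_mono)
    qed simp
  qed
  finally show ?thesis .
qed

text \<open>With jumps x and z, at least one of \<bar>x\<bar> \<ge> y / 4, \<bar>z\<bar> \<ge> y /
  4, \<bar>y - x - z\<bar> > y / 2 holds. In the first two cases one jump has density comparable to
  f y and the other costs 1 / L^2. In the third, jump densities are at most f L and the rest is rare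
  by Chebyshev.\<close>

lemma conv_large_large_le:
  assumes "L > 0" "y > 0"
  shows "conv (large L) (conv (large L) (conv_pow F k)) y
    \<le> ennreal (2 * 4 powr (\<alpha> + 1) * f y / L\<^sup>2 + f L / L\<^sup>2 * (4 * real (Suc k) / y\<^sup>2))"
proof -
  let ?p = "conv_pow F k" and ?h = "large L"
  let ?A = "{w. \<bar>w\<bar> > y / 2}"
  let ?c = "ennreal (4 powr (\<alpha> + 1) * f y)"
  have far: "?h x \<le> ?c" if "\<bar>x\<bar> \<ge> y / 4" for x
  proof -
    have "f x \<le> f (y / 4)" using that assms by (intro f_mono) auto
    also have "\<dots> \<le> 4 powr (\<alpha> + 1) * f (4 * (y / 4))" by (rule f_scale) simp
    finally show ?thesis by (intro order_trans[OF large_le] ennreal_leI) simp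
  qed
  have top: "?h x \<le> F L" for x
    using assms by (auto simp: large_def indicator_def intro!: ennreal_leI f_mono)
  have P: "(\<integral>\<^sup>+w. indicator ?A w * ?p w \<partial>lborel) \<le> ennreal (4 * real (Suc k) / y\<^sup>2)"
    using assms f_even F_mass F_second_moment nn_integral_Chebyshev[of ?p "y / 2" "real (Suc k)"]
    by (simp add: nn_integral_square_conv_pow power_divide mult_ac del: of_nat_Suc)
  have P1: "(\<integral>\<^sup>+w. ?p w \<partial>lborel) = 1" by (simp add: nn_integral_conv_pow F_mass)
  have "conv ?h (conv ?h ?p) y = (\<integral>\<^sup>+x. \<integral>\<^sup>+z. ?h x * (?h z * ?p (y - x - z)) \<partial>lborel \<partial>lborel)"
    unfolding conv_def by (simp add: nn_integral_cmult)
  also have "\<dots> \<le> (\<integral>\<^sup>+x. \<integral>\<^sup>+z. ?c * (?h z * ?p (y - z - x)) + (?c * (?h x * ?p (y - x - z))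
      + F L * (?h x * (indicator ?A (y - x - z) * ?p (y - x - z)))) \<partial>lborel \<partial>lborel)"
  proof (intro nn_integral_mono)
    fix x z :: real
    have eq: "y - z - x = y - x - z" by simp
    consider "\<bar>x\<bar> \<ge> y / 4" | "\<bar>z\<bar> \<ge> y / 4" | "\<bar>y - x - z\<bar> > y / 2"
      by linarith
    then show "?h x * (?h z * ?p (y - x - z)) \<le> ?c * (?h z * ?p (y - z - x)) + (?c * (?h x * ?p (y - x - z))
      + F L * (?h x * (indicator ?A (y - x - z) * ?p (y - x - z))))"
    proof cases
      case 1
      show ?thesis unfolding eq
        by (intro add_increasing2 mult_right_mono far 1) auto
    next
      case 2
      have "?h x * (?h z * ?p (y - x - z)) = ?h z * (?h x * ?p (y - x - z))" by (simp add: mult_ac)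
      also have "\<dots> \<le> ?c * (?h x * ?p (y - x - z))" by (intro mult_right_mono far 2) auto
      finally show ?thesis by (intro add_increasing add_increasing2) auto
    next
      case 3
      have "?h x * (?h z * ?p (y - x - z)) = ?h z * (?h x * ?p (y - x - z))" by (simp add: mult_ac)
      also have "\<dots> \<le> F L * (?h x * ?p (y - x - z))" by (intro mult_right_mono top) auto
      finally show ?thesis using 3 by (intro add_increasing) auto
    qed
  qed
  also have "\<dots> = (\<integral>\<^sup>+x. \<integral>\<^sup>+z. ?c * (?h z * ?p (y - z - x)) \<partial>lborel \<partial>lborel) + ((\<integral>\<^sup>+x. \<integral>\<^sup>+z. ?c * (?h x * ?p (y - x - z)) \<partial>lborel \<partial>lborel)
      + (\<integral>\<^sup>+x. \<integral>\<^sup>+z. F L * (?h x * (indicator ?A (y - x - z) * ?p (y - x - z))) \<partial>lborel \<partial>lborel))"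
    by (simp add: nn_integral_add)
  also have "(\<integral>\<^sup>+x. \<integral>\<^sup>+z. ?c * (?h z * ?p (y - z - x)) \<partial>lborel \<partial>lborel) = (\<integral>\<^sup>+z. \<integral>\<^sup>+x. ?c * (?h z * ?p (y - z - x)) \<partial>lborel \<partial>lborel)"
    by (rule lborel_pair.Fubini'[symmetric]) measurable
  also have "(\<integral>\<^sup>+z. \<integral>\<^sup>+x. ?c * (?h z * ?p (y - z - x)) \<partial>lborel \<partial>lborel) = ?c * (\<integral>\<^sup>+z. ?h z \<partial>lborel)"
    by (simp add: nn_integral_cmult nn_integral_reflect P1)
  also have "(\<integral>\<^sup>+x. \<integral>\<^sup>+z. F L * (?h x * (indicator ?A (y - x - z) * ?p (y - x - z))) \<partial>lborel \<partial>lborel)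
      = F L * ((\<integral>\<^sup>+x. ?h x \<partial>lborel) * (\<integral>\<^sup>+w. indicator ?A w * ?p w \<partial>lborel))"
  proof -
    have "(\<integral>\<^sup>+z. indicator ?A (y - x - z) * ?p (y - x - z) \<partial>lborel) = (\<integral>\<^sup>+w. indicator ?A w * ?p w \<partial>lborel)" for x
      by (rule nn_integral_reflect[of "\<lambda>w. indicator ?A w * ?p w"]) measurable
    then show ?thesis by (simp add: nn_integral_cmult nn_integral_multc)
  qed
  also have "?c * (\<integral>\<^sup>+z. ?h z \<partial>lborel) + (?c * (\<integral>\<^sup>+z. ?h z \<partial>lborel) + F L * ((\<integral>\<^sup>+x. ?h x \<partial>lborel) * (\<integral>\<^sup>+w. indicator ?A w * ?p w \<partial>lborel)))
    \<le> ?c * ennreal (1 / L\<^sup>2) + (?c * ennreal (1 / L\<^sup>2) + F L * (ennreal (1 / L\<^sup>2) * ennreal (4 * real (Suc k) / y\<^sup>2)))"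
    by (intro add_mono mult_left_mono mult_mono large_mass P assms) auto
  also have "\<dots> = ennreal (4 powr (\<alpha> + 1) * f y * (1 / L\<^sup>2) + (4 powr (\<alpha> + 1) * f y * (1 / L\<^sup>2) + f L * (1 / L\<^sup>2 * (4 * real (Suc k) / y\<^sup>2))))"
  proof -
    have "ennreal p * ennreal r + (ennreal p * ennreal r + ennreal q * (ennreal r * ennreal s)) = ennreal (p * r + (p * r + q * (r * s)))"
      if "p \<ge> 0" "r \<ge> 0" "q \<ge> 0" "s \<ge> 0" for p q r s :: real
      using that by (simp only: ennreal_plus ennreal_mult mult_nonneg_nonneg add_nonneg_nonneg)
    then show ?thesis using f_nonneg by simp
  qed
  also have "4 powr (\<alpha> + 1) * f y * (1 / L\<^sup>2) + (4 powr (\<alpha> + 1) * f y * (1 / L\<^sup>2) + f L * (1 / L\<^sup>2 * (4 * real (Suc k) / y\<^sup>2)))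
     = 2 * 4 powr (\<alpha> + 1) * f y / L\<^sup>2 + f L / L\<^sup>2 * (4 * real (Suc k) / y\<^sup>2)"
    by (simp del: of_nat_Suc)
  finally show ?thesis by (simp add: P1 nn_integral_cmult nn_integral_reflect del: of_nat_Suc)
qed

end

lemma eventually_powr_less:
  fixes c d r :: real
  assumes "r > 0" "d > 0"
  shows "\<forall>\<^sub>F y in at_top. c * y powr - r \<le> d"
proof -
  have "((\<lambda>y::real. c * y powr - r) \<longlongrightarrow> c * 0) at_top"
    using assms by (intro tendsto_mult tendsto_const tendsto_neg_powr filterlim_ident) auto
  then have "\<forall>\<^sub>F y in at_top. c * y powr - r < d"
    by (rule order_tendstoD) (use assms in simp)
  then show ?thesis by (rule eventually_mono) simp
qed

section \<open>The density of the sum far out\<close>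

context pareto
begin

text \<open>The number of summands is n = k + 3, and n \<le> y^(2-\<kappa>) places y beyond sqrt n
  by a power. There the single-jump term of the decomposition dominates and the jump itself is close
  to y.\<close>

lemma big_jump_density:
  assumes \<kappa>: "0 < \<kappa>" "\<kappa> < 2" and e: "0 < e" "e < 1"
  shows "\<exists>Y\<ge>1. \<forall>y\<ge>Y. \<forall>k. real (k + 3) \<le> y powr (2 - \<kappa>) \<longrightarrow>
    ennreal ((1 - e) * (real (k + 3) * f y)) \<le> conv_pow F (k + 2) y \<and>
    conv_pow F (k + 2) y \<le> ennreal ((1 + e) * (real (k + 3) * f y))"
proof -
  have "((\<lambda>\<epsilon>. (1 - \<epsilon>) powr - (\<alpha> + 1)) \<longlongrightarrow> (1 - 0) powr - (\<alpha> + 1)) (at_right 0)"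
    by (intro tendsto_intros) auto
  then have 1: "\<forall>\<^sub>F \<epsilon> in at_right 0. (1 - \<epsilon>) powr - (\<alpha> + 1) < 1 + e / 2"
    by (rule order_tendstoD) (use e in auto)
  have "((\<lambda>\<epsilon>. (1 + \<epsilon>) powr - (\<alpha> + 1)) \<longlongrightarrow> (1 + 0) powr - (\<alpha> + 1)) (at_right 0)"
    by (intro tendsto_intros) auto
  then have 2: "\<forall>\<^sub>F \<epsilon> in at_right 0. (1 + \<epsilon>) powr - (\<alpha> + 1) > 1 - e / 2"
    by (rule order_tendstoD) (use e in auto)
  have 3: "\<forall>\<^sub>F \<epsilon> in at_right 0. 0 < \<epsilon> \<and> \<epsilon> < (1::real)"
    by (auto simp: eventually_at_right_field intro!: exI[of _ 1])
  from eventually_happens'[OF _ eventually_conj[OF 1 eventually_conj[OF 2 3]]]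
  obtain \<epsilon> where \<epsilon>: "(1 - \<epsilon>) powr - (\<alpha> + 1) < 1 + e / 2" "(1 + \<epsilon>) powr - (\<alpha> + 1) > 1 - e / 2" "0 < \<epsilon>" "\<epsilon> < 1"
    by auto
  \<comment> \<open>Chosen so that, in the two-jump term where the density at L meets Chebyshev, the
    exponents add up to exactly -\<kappa> beside the power of f y; it also gives 2 \<eta> <
    \<kappa>, so that n / L^2 tends to 0.\<close>
  define \<eta> where "\<eta> = \<kappa> / (\<alpha> + 3)"
  have \<eta>: "0 < \<eta>" "\<eta> < 1" "2 * \<eta> < \<kappa>" "\<eta> * (\<alpha> + 3) = \<kappa>"
    using \<kappa> alpha_gt_2 mult_strict_left_mono[of 2 "\<alpha> + 3" \<kappa>] by (auto simp: \<eta>_def field_simps)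
  \<comment> \<open>Summands of size at most \<open>L y\<close> cannot add up to \<open>\<epsilon> * y\<close>, while \<open>L y\<close> is large enough for two
    larger ones to be much rarer than one.\<close>
  define L where "L = (\<lambda>y::real. y powr (1 - \<eta>))"
  have L2: "1 / (L y)\<^sup>2 = y powr (2 * \<eta> - 2)" if "y \<ge> 1" for y
    using that by (simp add: L_def powr_powr powr_minus_divide[symmetric] algebra_simps flip: powr_numeral)
  \<comment> \<open>The relative error e is shared out here. Above: e/2 for the inexact jump size,
    e/6 for small sums, e/6 for each part of the two-jump bound. Below: losses of e/4 by truncation
    and e/4 by Chebyshev, then (1 - e/2)^2 \<ge> 1 - e.\<close>
  have c1: "\<forall>\<^sub>F y in at_top. y \<ge> (1::real)" by (rule eventually_ge_at_top)
  have c2: "\<forall>\<^sub>F y in at_top. 2 / (1 - \<epsilon>) * y powr - \<eta> \<le> 1" by (rule eventually_powr_less) (use \<eta> in auto)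
  have "((\<lambda>y. y powr (\<alpha> + 1) * exp (- \<epsilon> * y powr \<eta>)) \<longlongrightarrow> 0) at_top"
    using \<epsilon>(3) \<eta>(1) alpha_gt_2 by real_asymp
  then have c3: "\<forall>\<^sub>F y in at_top. y powr (\<alpha> + 1) * exp (- \<epsilon> * y powr \<eta>) < e / 12 / small_bound * (a / (b + 1))"
    by (rule order_tendstoD) (use e small_bound_pos a_pos b_pos in auto)
  have c4: "\<forall>\<^sub>F y in at_top. 2 * 4 powr (\<alpha> + 1) * y powr - (\<kappa> - 2 * \<eta>) \<le> e / 6"
    by (rule eventually_powr_less) (use \<eta> e in auto)
  have c5: "\<forall>\<^sub>F y in at_top. 4 * (b + 1) * y powr - \<kappa> \<le> e / 6"
    by (rule eventually_powr_less) (use \<kappa> e in auto)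
  have c6: "\<forall>\<^sub>F y in at_top. 1 * y powr - (\<kappa> - 2 * \<eta>) \<le> e / 4"
    by (rule eventually_powr_less) (use \<eta> e in auto)
  have c7: "\<forall>\<^sub>F y in at_top. 1 / \<epsilon>\<^sup>2 * y powr - \<kappa> \<le> e / 4"
    by (rule eventually_powr_less) (use \<kappa> e in auto)
  from eventually_conj[OF c1 eventually_conj[OF c2 eventually_conj[OF c3 eventually_conj[OF c4 eventually_conj[OF c5 eventually_conj[OF c6 c7]]]]]]
  obtain Y where Y: "\<And>y. y \<ge> Y \<Longrightarrow> y \<ge> 1 \<and> 2 / (1 - \<epsilon>) * y powr - \<eta> \<le> 1 \<and>
      y powr (\<alpha> + 1) * exp (- \<epsilon> * y powr \<eta>) < e / 12 / small_bound * (a / (b + 1)) \<and>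
      2 * 4 powr (\<alpha> + 1) * y powr - (\<kappa> - 2 * \<eta>) \<le> e / 6 \<and> 4 * (b + 1) * y powr - \<kappa> \<le> e / 6 \<and>
      1 * y powr - (\<kappa> - 2 * \<eta>) \<le> e / 4 \<and> 1 / \<epsilon>\<^sup>2 * y powr - \<kappa> \<le> e / 4"
    unfolding eventually_at_top_linorder by blast
  have "ennreal ((1 - e) * (real (k + 3) * f y)) \<le> conv_pow F (k + 2) y \<and>
    conv_pow F (k + 2) y \<le> ennreal ((1 + e) * (real (k + 3) * f y))"
    if y: "y \<ge> Y" and n: "real (k + 3) \<le> y powr (2 - \<kappa>)" for y k
  proof -
    note c = Y[OF y]
    have y1: "y \<ge> 1" using c by simp
    have L1: "L y \<ge> 1" unfolding L_def using y1 \<eta> by (intro ge_one_powr_ge_zero) auto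
    have yL: "y / L y = y powr \<eta>" using y1 by (simp add: L_def powr_diff)
    have Ly: "L y = y * y powr - \<eta>" using y1 by (simp add: L_def powr_diff powr_minus_divide)
    have small: "(1 - \<epsilon>) * y > L y"
    proof -
      have "2 * y powr - \<eta> \<le> 1 - \<epsilon>" using c \<epsilon> by (simp add: field_simps)
      moreover have "y powr - \<eta> > 0" using y1 by simp
      ultimately have "y powr - \<eta> < 1 - \<epsilon>" by linarith
      then show ?thesis using y1 unfolding Ly by (simp add: mult.commute)
    qed
    define n where "n = real (k + 3)"
    have n1: "n \<ge> 1" "n \<le> y powr (2 - \<kappa>)" using n by (auto simp: n_def)
    have nL: "n * (1 / (L y)\<^sup>2) \<le> y powr - (\<kappa> - 2 * \<eta>)"
    proof -
      have "n * (1 / (L y)\<^sup>2) \<le> y powr (2 - \<kappa>) * y powr (2 * \<eta> - 2)"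
        unfolding L2[OF y1] using n1 by (intro mult_right_mono) auto
      also have "\<dots> = y powr - (\<kappa> - 2 * \<eta>)" by (simp add: powr_add[symmetric])
      finally show ?thesis .
    qed
    have ny: "n / y\<^sup>2 \<le> y powr - \<kappa>"
    proof -
      have "n / y\<^sup>2 \<le> y powr (2 - \<kappa>) / y powr 2"
        using n1 y1 by (simp add: divide_right_mono)
      also have "\<dots> = y powr - \<kappa>" by (simp add: powr_diff[symmetric])
      finally show ?thesis .
    qed
    have "y powr - (\<kappa> - 2 * \<eta>) \<le> 1" using c e by linarith
    then have "n * (1 / (L y)\<^sup>2) \<le> 1" using nL by linarith
    then have nL2: "n \<le> (L y)\<^sup>2" using L1 by (simp add: divide_le_eq)
    have fy: "a / (b + 1) * y powr - (\<alpha> + 1) \<le> f y" using f_ge_powr[of y] y1 by simp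
    define E where "E = small_bound * exp (- \<epsilon> * y / L y)"
    have E0: "E \<ge> 0" using small_bound_pos by (simp add: E_def)
    have E: "2 * E \<le> e / 6 * f y"
    proof -
      have "exp (- \<epsilon> * y powr \<eta>) = y powr - (\<alpha> + 1) * (y powr (\<alpha> + 1) * exp (- \<epsilon> * y powr \<eta>))"
        using y1 by (simp add: powr_minus_divide del: minus_add_distrib)
      also have "\<dots> \<le> y powr - (\<alpha> + 1) * (e / 12 / small_bound * (a / (b + 1)))"
        using c by (intro mult_left_mono) auto
      finally have "E \<le> small_bound * (y powr - (\<alpha> + 1) * (e / 12 / small_bound * (a / (b + 1))))"
        unfolding E_def using small_bound_pos yL by (intro mult_left_mono) (auto simp: times_divide_eq_right[symmetric] simp del: times_divide_eq_right)
      also have "\<dots> = e / 12 * (a / (b + 1) * y powr - (\<alpha> + 1))" using small_bound_pos by simp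
      also have "\<dots> \<le> e / 12 * f y" using fy e by (intro mult_left_mono) auto
      finally show ?thesis by simp
    qed
    let ?g = "small (L y)" and ?h = "large (L y)"
    have m: "?g \<in> borel_measurable borel" "?h \<in> borel_measurable borel" by measurable
    have split: "conv_pow F (k + 2) y = conv_pow ?g (k + 2) y + one_jump ?g ?h (k + 2) y + more_jumps ?g ?h (k + 2) y"
      using conv_pow_split[OF m, of "k + 2"] unfolding small_add_large by (rule fun_cong)
    have one: "one_jump ?g ?h (k + 2) y = of_nat (k + 3) * conv ?h (conv_pow ?g (Suc k)) y"
    proof -
      have "k + 2 = Suc (Suc k)" "k + 3 = Suc k + 2" by simp_all
      then show ?thesis by (simp only: one_jump_eq[OF m])
    qed
    have up: "conv_pow F (k + 2) y \<le> ennreal ((1 + e) * (n * f y))"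
    proof -
      have u: "conv_pow ?g (k + 2) y \<le> ennreal E"
      proof -
        have "conv_pow ?g (k + 2) y \<le> ennreal (small_bound * exp (- \<bar>y\<bar> / L y))"
          by (rule conv_pow_small_le) (use L1 nL2 in \<open>auto simp: n_def\<close>)
        also have "\<dots> \<le> ennreal E"
          unfolding E_def using y1 L1 small_bound_pos \<epsilon> by (intro ennreal_leI mult_left_mono) (auto intro!: divide_right_mono mult_left_le_one_le)
        finally show ?thesis .
      qed
      have v: "one_jump ?g ?h (k + 2) y \<le> ennreal n * (ennreal ((1 - \<epsilon>) powr - (\<alpha> + 1) * f y) + ennreal E)"
        unfolding one E_def n_def ennreal_of_nat_eq_real_of_nat
        by (intro mult_left_mono conv_large_small_le) (use L1 nL2 y1 \<epsilon> in \<open>auto simp: n_def\<close>)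
      have w: "more_jumps ?g ?h (k + 2) y \<le> ennreal (n\<^sup>2) * ennreal (2 * 4 powr (\<alpha> + 1) * f y / (L y)\<^sup>2 + f (L y) / (L y)\<^sup>2 * (4 * real (Suc k) / y\<^sup>2))"
      proof -
        have "more_jumps ?g ?h (k + 2) y \<le> of_nat ((k + 3)\<^sup>2) * conv ?h (conv ?h (conv_pow F k)) y"
          using more_jumps_le[OF m, of k y] unfolding small_add_large .
        also have "\<dots> \<le> ennreal (n\<^sup>2) * ennreal (2 * 4 powr (\<alpha> + 1) * f y / (L y)\<^sup>2 + f (L y) / (L y)\<^sup>2 * (4 * real (Suc k) / y\<^sup>2))"
          unfolding n_def of_nat_power[symmetric] ennreal_of_nat_eq_real_of_nat
          by (intro mult_left_mono conv_large_large_le) (use L1 y1 in auto)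
        finally show ?thesis .
      qed
      have "conv_pow F (k + 2) y \<le> ennreal E + ennreal n * (ennreal ((1 - \<epsilon>) powr - (\<alpha> + 1) * f y) + ennreal E)
         + ennreal (n\<^sup>2) * ennreal (2 * 4 powr (\<alpha> + 1) * f y / (L y)\<^sup>2 + f (L y) / (L y)\<^sup>2 * (4 * real (Suc k) / y\<^sup>2))"
        unfolding split by (intro add_mono u v w)
      also have "\<dots> = ennreal (E + n * ((1 - \<epsilon>) powr - (\<alpha> + 1) * f y + E)
         + n\<^sup>2 * (2 * 4 powr (\<alpha> + 1) * f y / (L y)\<^sup>2 + f (L y) / (L y)\<^sup>2 * (4 * real (Suc k) / y\<^sup>2)))"
      proof -
        have "ennreal E + ennreal n * (ennreal p + ennreal E) + ennreal (n\<^sup>2) * ennreal q = ennreal (E + n * (p + E) + n\<^sup>2 * q)"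
          if "p \<ge> 0" "q \<ge> 0" for p q
          using that E0 n1 by (simp only: ennreal_plus[symmetric] ennreal_mult[symmetric] mult_nonneg_nonneg add_nonneg_nonneg zero_le_power2 order_trans[OF zero_le_one])
        then show ?thesis by this (use f_nonneg in auto)
      qed
      also have "\<dots> \<le> ennreal ((1 + e) * (n * f y))"
      proof (rule ennreal_leI)
        have i: "E + n * E \<le> n * (e / 6 * f y)"
        proof -
          have "E + n * E \<le> n * (2 * E)" using n1 E0 mult_right_mono[of 1 n E] by (simp add: algebra_simps)
          also have "\<dots> \<le> n * (e / 6 * f y)" using E n1 by (intro mult_left_mono) auto
          finally show ?thesis .
        qed
        have ii: "n * ((1 - \<epsilon>) powr - (\<alpha> + 1) * f y) \<le> n * ((1 + e / 2) * f y)"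
          using \<epsilon> n1 f_nonneg by (intro mult_left_mono mult_right_mono) auto
        have iii: "n\<^sup>2 * (2 * 4 powr (\<alpha> + 1) * f y / (L y)\<^sup>2) \<le> n * (e / 6 * f y)"
        proof -
          have "n\<^sup>2 * (2 * 4 powr (\<alpha> + 1) * f y / (L y)\<^sup>2) = n * ((2 * 4 powr (\<alpha> + 1) * (n * (1 / (L y)\<^sup>2))) * f y)"
            by (simp add: power2_eq_square)
          also have "\<dots> \<le> n * ((2 * 4 powr (\<alpha> + 1) * y powr - (\<kappa> - 2 * \<eta>)) * f y)"
            using n1 f_nonneg nL by (intro mult_left_mono mult_right_mono) auto
          also have "\<dots> \<le> n * (e / 6 * f y)"
            using n1 f_nonneg c by (intro mult_left_mono mult_right_mono) auto
          finally show ?thesis .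
        qed
        have iv: "n\<^sup>2 * (f (L y) / (L y)\<^sup>2 * (4 * real (Suc k) / y\<^sup>2)) \<le> n * (e / 6 * f y)"
        proof -
          have "real (Suc k) \<le> n" by (simp add: n_def)
          then have "n\<^sup>2 * (f (L y) / (L y)\<^sup>2 * (4 * real (Suc k) / y\<^sup>2)) \<le> n\<^sup>2 * (f (L y) / (L y)\<^sup>2 * (4 * n / y\<^sup>2))"
            using f_nonneg by (intro mult_left_mono divide_right_mono) auto
          also have "\<dots> = n * (4 * f (L y) * (1 / (L y)\<^sup>2) * n * (n / y\<^sup>2))"
            by (simp add: power2_eq_square)
          also have "\<dots> \<le> n * (4 * (a * L y powr - (\<alpha> + 1)) * y powr (2 * \<eta> - 2) * y powr (2 - \<kappa>) * y powr - \<kappa>)"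
            using n1 f_nonneg ny f_le_powr[of "L y"] L1 a_pos y1 unfolding L2[OF y1]
            by (intro mult_left_mono mult_mono) auto
          also have "L y powr - (\<alpha> + 1) = y powr - (\<alpha> + 1) * y powr (\<eta> * (\<alpha> + 1))"
            using y1 by (simp add: L_def powr_powr powr_add[symmetric] algebra_simps)
          also have "n * (4 * (a * (y powr - (\<alpha> + 1) * y powr (\<eta> * (\<alpha> + 1)))) * y powr (2 * \<eta> - 2) * y powr (2 - \<kappa>) * y powr - \<kappa>)
             = n * (4 * (a * y powr - (\<alpha> + 1)) * (y powr (\<eta> * (\<alpha> + 1)) * y powr (2 * \<eta> - 2) * y powr (2 - \<kappa>) * y powr - \<kappa>))"
            by (simp only: mult_ac)
          also have "y powr (\<eta> * (\<alpha> + 1)) * y powr (2 * \<eta> - 2) * y powr (2 - \<kappa>) * y powr - \<kappa> = y powr - \<kappa>"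
          proof -
            have "\<eta> * (\<alpha> + 1) + (2 * \<eta> - 2) + (2 - \<kappa>) + - \<kappa> = - \<kappa>"
              using \<eta>(4) by (simp add: algebra_simps)
            then show ?thesis by (simp only: powr_add[symmetric])
          qed
          also have "n * (4 * (a * y powr - (\<alpha> + 1)) * y powr - \<kappa>) = n * ((4 * (b + 1) * y powr - \<kappa>) * (a / (b + 1) * y powr - (\<alpha> + 1)))"
          proof -
            have "n * (4 * (a * p) * q) = n * ((4 * (b + 1) * q) * (a / (b + 1) * p))" for p q
              using b_pos by (simp add: field_simps)
            then show ?thesis .
          qed
          also have "\<dots> \<le> n * (e / 6 * f y)"
            using n1 c fy a_pos b_pos e by (intro mult_left_mono mult_mono) auto
          finally show ?thesis .
        qed
        show "E + n * ((1 - \<epsilon>) powr - (\<alpha> + 1) * f y + E)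
           + n\<^sup>2 * (2 * 4 powr (\<alpha> + 1) * f y / (L y)\<^sup>2 + f (L y) / (L y)\<^sup>2 * (4 * real (Suc k) / y\<^sup>2)) \<le> (1 + e) * (n * f y)"
        proof -
          have arr: "E + n * (P + E) + n\<^sup>2 * (Q + R) = (E + n * E) + n * P + n\<^sup>2 * Q + n\<^sup>2 * R" for P Q R
            by (simp add: algebra_simps)
          have tot: "n * (e / 6 * f y) + n * ((1 + e / 2) * f y) + n * (e / 6 * f y) + n * (e / 6 * f y) = (1 + e) * (n * f y)"
            by (simp add: field_simps)
          show ?thesis
            using add_mono[OF add_mono[OF add_mono[OF i ii] iii] iv] unfolding tot arr .
        qed
      qed
      finally show ?thesis .
    qed
    have low: "ennreal ((1 - e) * (n * f y)) \<le> conv_pow F (k + 2) y"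
    proof -
      have q: "1 - e / 2 \<le> 1 - real (Suc (Suc k)) / (L y)\<^sup>2 - real (Suc (Suc k)) / (\<epsilon> * y)\<^sup>2"
      proof -
        have le: "real (Suc (Suc k)) \<le> n" by (simp add: n_def)
        have "real (Suc (Suc k)) / (L y)\<^sup>2 \<le> n * (1 / (L y)\<^sup>2)"
          using le by (simp add: divide_right_mono del: of_nat_Suc)
        also have "\<dots> \<le> e / 4" using nL c by linarith
        finally have 1: "real (Suc (Suc k)) / (L y)\<^sup>2 \<le> e / 4" .
        have "real (Suc (Suc k)) / (\<epsilon> * y)\<^sup>2 \<le> n / (\<epsilon> * y)\<^sup>2"
          using le by (intro divide_right_mono) auto
        also have "\<dots> = 1 / \<epsilon>\<^sup>2 * (n / y\<^sup>2)" by (simp add: power_mult_distrib)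
        also have "\<dots> \<le> 1 / \<epsilon>\<^sup>2 * y powr - \<kappa>" using ny by (intro mult_left_mono) auto
        also have "\<dots> \<le> e / 4" using c by simp
        finally show ?thesis using 1 by linarith
      qed
      have "ennreal ((1 - e) * (n * f y)) \<le> ennreal (n * (((1 - e / 2) * f y) * (1 - e / 2)))"
      proof (rule ennreal_leI)
        have "(1 - e) * (n * f y) \<le> (1 - e + e * e / 4) * (n * f y)"
          using n1 f_nonneg e by (intro mult_right_mono) auto
        then show "(1 - e) * (n * f y) \<le> n * (((1 - e / 2) * f y) * (1 - e / 2))"
          by (simp add: algebra_simps)
      qed
      also have "\<dots> \<le> ennreal (n * (((1 + \<epsilon>) powr - (\<alpha> + 1) * f y) * (1 - real (Suc (Suc k)) / (L y)\<^sup>2 - real (Suc (Suc k)) / (\<epsilon> * y)\<^sup>2)))"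
        using q \<epsilon> e n1 f_nonneg by (intro ennreal_leI mult_left_mono mult_mono mult_right_mono mult_nonneg_nonneg) auto
      also have "\<dots> = ennreal n * (ennreal ((1 + \<epsilon>) powr - (\<alpha> + 1) * f y) * ennreal (1 - real (Suc (Suc k)) / (L y)\<^sup>2 - real (Suc (Suc k)) / (\<epsilon> * y)\<^sup>2))"
      proof -
        have "ennreal (n * (p * r)) = ennreal n * (ennreal p * ennreal r)" if "p \<ge> 0" "r \<ge> 0" for p r
          using that n1 by (simp add: ennreal_mult)
        then show ?thesis by this (use f_nonneg q e in auto)
      qed
      also have "\<dots> \<le> ennreal n * conv ?h (conv_pow ?g (Suc k)) y"
        by (intro mult_left_mono conv_large_small_ge) (use L1 y1 \<epsilon> small in auto)
      also have "\<dots> = one_jump ?g ?h (k + 2) y" unfolding one n_def ennreal_of_nat_eq_real_of_nat ..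
      also have "\<dots> \<le> conv_pow F (k + 2) y" unfolding split by (intro add_increasing2 add_increasing) auto
      finally show ?thesis .
    qed
    show ?thesis using up low by (simp add: n_def)
  qed
  then show ?thesis by (intro exI[of _ "max 1 Y"]) auto
qed

end

section \<open>Edgeworth polynomials\<close>

lemma power_le_fact_exp: "0 \<le> x \<Longrightarrow> x ^ d \<le> fact d * exp (x :: real)"
proof -
  assume x: "0 \<le> x"
  have "(\<Sum>n\<in>{d}. inverse (fact n) * x ^ n) \<le> (\<Sum>n. inverse (fact n) * x ^ n)"
    using summable_exp[of x] x by (intro sum_le_suminf) auto
  then have "inverse (fact d) * x ^ d \<le> exp x" by (simp add: exp_def divide_inverse mult.commute)
  then show ?thesis by (simp add: field_simps)
qed

text \<open>From the square of \<bar>x\<bar> / 2 - 1 one gets 1 + \<bar>x\<bar> - x^2 / 4 \<le> 2,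
  and a power is at most a factorial times an exponential. Half of a Gaussian thus absorbs any
  polynomial while the other half remains.\<close>

lemma power_gauss_bound: "(1 + \<bar>x\<bar>) ^ d * exp (- x\<^sup>2 / 4) \<le> fact d * exp (2 :: real)"
proof -
  have "0 \<le> (\<bar>x\<bar> / 2 - 1)\<^sup>2" by simp
  then have "1 + \<bar>x\<bar> + - x\<^sup>2 / 4 \<le> 2" by (simp add: power2_eq_square algebra_simps)
  then have "exp (1 + \<bar>x\<bar>) * exp (- x\<^sup>2 / 4) \<le> exp 2" by (simp add: exp_add[symmetric])
  then have "fact d * (exp (1 + \<bar>x\<bar>) * exp (- x\<^sup>2 / 4)) \<le> fact d * exp 2"
    by (intro mult_left_mono) auto
  moreover have "(1 + \<bar>x\<bar>) ^ d * exp (- x\<^sup>2 / 4) \<le> (fact d * exp (1 + \<bar>x\<bar>)) * exp (- x\<^sup>2 / 4)"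
    by (intro mult_right_mono power_le_fact_exp) auto
  ultimately show ?thesis by (simp only: mult.assoc)
qed

text \<open>An existential notion: the Edgeworth terms are polynomial in \<theta> by closure
  properties, so growth and integrability follow without explicit coefficients.\<close>

definition poly_fun :: "(real \<Rightarrow> complex) \<Rightarrow> bool" where
  "poly_fun g \<longleftrightarrow> (\<exists>P. \<forall>\<theta>. g \<theta> = poly P (of_real \<theta>))"

lemma poly_fun_const: "poly_fun (\<lambda>\<theta>. c)"
  unfolding poly_fun_def by (intro exI[of _ "[:c:]"]) simp

lemma poly_fun_id: "poly_fun of_real"
  unfolding poly_fun_def by (intro exI[of _ "[:0, 1:]"]) simp

lemma poly_fun_add: "poly_fun g \<Longrightarrow> poly_fun h \<Longrightarrow> poly_fun (\<lambda>\<theta>. g \<theta> + h \<theta>)"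
  unfolding poly_fun_def by (metis poly_add)

lemma poly_fun_mult: "poly_fun g \<Longrightarrow> poly_fun h \<Longrightarrow> poly_fun (\<lambda>\<theta>. g \<theta> * h \<theta>)"
  unfolding poly_fun_def by (metis poly_mult)

lemma poly_fun_power: "poly_fun g \<Longrightarrow> poly_fun (\<lambda>\<theta>. g \<theta> ^ k)"
  by (induction k) (simp_all add: poly_fun_const poly_fun_mult)

lemma poly_fun_sum: "(\<And>i. i \<in> I \<Longrightarrow> poly_fun (g i)) \<Longrightarrow> poly_fun (\<lambda>\<theta>. \<Sum>i\<in>I. g i \<theta>)"
  by (induction I rule: infinite_finite_induct) (simp_all add: poly_fun_const poly_fun_add)

lemma poly_fun_coeff_power:
  assumes "\<And>i. poly_fun (\<lambda>\<theta>. coeff (w \<theta>) i)"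
  shows "poly_fun (\<lambda>\<theta>. coeff (w \<theta> ^ k) m)"
proof (induction k arbitrary: m)
  case 0
  then show ?case by (simp add: poly_fun_const)
next
  case (Suc k)
  show ?case unfolding power_Suc coeff_mult
    by (intro poly_fun_sum poly_fun_mult assms Suc)
qed

lemma poly_fun_bound:
  assumes "poly_fun g"
  shows "\<exists>C d. C \<ge> 0 \<and> (\<forall>\<theta>. norm (g \<theta>) \<le> C * (1 + \<bar>\<theta>\<bar>) ^ d)"
proof -
  obtain P where P: "\<And>\<theta>. g \<theta> = poly P (of_real \<theta>)" using assms by (auto simp: poly_fun_def)
  have "norm (g \<theta>) \<le> poly_l1 P * (1 + \<bar>\<theta>\<bar>) ^ degree P" for \<theta>
  proof -
    have "norm (g \<theta>) \<le> (\<Sum>i\<le>degree P. norm (coeff P i) * (1 + \<bar>\<theta>\<bar>) ^ degree P)"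
      unfolding P poly_altdef
    proof (rule sum_norm_le)
      fix i assume i: "i \<in> {..degree P}"
      have "\<bar>\<theta>\<bar> ^ i \<le> (1 + \<bar>\<theta>\<bar>) ^ i" by (intro power_mono) auto
      also have "\<dots> \<le> (1 + \<bar>\<theta>\<bar>) ^ degree P" using i by (intro power_increasing) auto
      finally show "norm (coeff P i * complex_of_real \<theta> ^ i) \<le> norm (coeff P i) * (1 + \<bar>\<theta>\<bar>) ^ degree P"
        by (simp add: norm_mult norm_power mult_left_mono)
    qed
    then show ?thesis by (simp add: poly_l1_def sum_distrib_right)
  qed
  then show ?thesis using poly_l1_nonneg by blast
qed

lemma poly_fun_measurable: "poly_fun g \<Longrightarrow> g \<in> borel_measurable borel"
proof -
  assume "poly_fun g"
  then obtain P where P: "g = (\<lambda>\<theta>. poly P (of_real \<theta>))" by (auto simp: poly_fun_def fun_eq_iff)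
  show ?thesis unfolding P
    by (intro borel_measurable_continuous_onI continuous_intros)
qed

section \<open>Gaussian Fourier integrals of polynomials\<close>

definition gauss_kernel :: "real \<Rightarrow> real \<Rightarrow> complex" where
  "gauss_kernel x \<theta> = exp (- \<i> * of_real \<theta> * of_real x - (of_real \<theta>)\<^sup>2 / 2)"

lemma gauss_kernel_eq: "gauss_kernel x \<theta> = iexp (- (\<theta> * x)) * of_real (exp (- \<theta>\<^sup>2 / 2))"
proof -
  have "- \<i> * of_real \<theta> * of_real x - (of_real \<theta>)\<^sup>2 / 2 = \<i> * of_real (- (\<theta> * x)) + complex_of_real (- \<theta>\<^sup>2 / 2)"
    by simp
  then show ?thesis unfolding gauss_kernel_def by (simp only: exp_add exp_of_real)
qed

lemma norm_gauss_kernel: "norm (gauss_kernel x \<theta>) = exp (- \<theta>\<^sup>2 / 2)"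
  by (simp add: gauss_kernel_eq norm_mult)

lemma gauss_kernel_measurable [measurable]: "gauss_kernel x \<in> borel_measurable borel"
  unfolding gauss_kernel_def[abs_def] by measurable

lemma gauss_power_integrable: "integrable lborel (\<lambda>t::real. exp (- t\<^sup>2 / 2) * t ^ k)"
proof -
  have "integrable lborel (\<lambda>t::real. sqrt (2 * pi) * (std_normal_density t * t ^ k))"
    by (intro integrable_mult_right integrable_std_normal_moment)
  moreover have "sqrt (2 * pi) * (std_normal_density t * t ^ k) = exp (- t\<^sup>2 / 2) * t ^ k" for t :: real
    by (simp add: std_normal_density_def)
  ultimately show ?thesis by simp
qed

lemma gauss_kernel_power_integrable: "integrable lborel (\<lambda>\<theta>. gauss_kernel x \<theta> * of_real \<theta> ^ k)"
proof (rule Bochner_Integration.integrable_bound[OF integrable_norm[OF gauss_power_integrable[of k]]])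
  show "(\<lambda>\<theta>. gauss_kernel x \<theta> * of_real \<theta> ^ k) \<in> borel_measurable lborel" by measurable
  have "norm (gauss_kernel x \<theta> * of_real \<theta> ^ k) = norm (norm (exp (- \<theta>\<^sup>2 / 2) * \<theta> ^ k))" for \<theta>
    by (simp only: norm_mult norm_gauss_kernel norm_power norm_of_real real_norm_def abs_mult power_abs abs_exp_cancel abs_abs)
  then show "AE \<theta> in lborel. norm (gauss_kernel x \<theta> * of_real \<theta> ^ k) \<le> norm (norm (exp (- \<theta>\<^sup>2 / 2) * \<theta> ^ k))"
    by simp
qed

text \<open>The derivative of \<open>gauss_kernel x \<theta> * \<theta> ^ l\<close> has integral 0.
  This is the three-term recurrence of the Hermite polynomials in Fourier form; at l = 0 the
  truncated exponent \<open>l - 1\<close> is harmless because its coefficient is 0.\<close>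

lemma gauss_kernel_power_rec:
  "(LINT \<theta>|lborel. gauss_kernel x \<theta> * of_real \<theta> ^ Suc l) =
    of_nat l * (LINT \<theta>|lborel. gauss_kernel x \<theta> * of_real \<theta> ^ (l - 1)) - \<i> * x * (LINT \<theta>|lborel. gauss_kernel x \<theta> * of_real \<theta> ^ l)"
proof -
  let ?E = "gauss_kernel x"
  let ?G = "\<lambda>\<theta>. (of_nat l * (?E \<theta> * of_real \<theta> ^ (l - 1)) - \<i> * x * (?E \<theta> * of_real \<theta> ^ l)) - ?E \<theta> * of_real \<theta> ^ Suc l"
  note int = gauss_kernel_power_integrable[of x]
  have G: "integrable lborel ?G" by (intro Bochner_Integration.integrable_diff integrable_mult_right int)
  have lim: "((\<lambda>\<theta>. ?E \<theta> * of_real \<theta> ^ l) \<longlongrightarrow> 0) at_top" "((\<lambda>\<theta>. ?E \<theta> * of_real \<theta> ^ l) \<longlongrightarrow> 0) at_bot"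
  proof -
    have le: "norm (?E \<theta> * of_real \<theta> ^ l) \<le> fact l * exp 2 * exp (- \<theta>\<^sup>2 / 4)" for \<theta>
    proof -
      have "norm (?E \<theta> * of_real \<theta> ^ l) = (\<bar>\<theta>\<bar> ^ l * exp (- \<theta>\<^sup>2 / 4)) * exp (- \<theta>\<^sup>2 / 4)"
        by (simp add: norm_mult norm_gauss_kernel norm_power exp_add[symmetric])
      also have "\<dots> \<le> ((1 + \<bar>\<theta>\<bar>) ^ l * exp (- \<theta>\<^sup>2 / 4)) * exp (- \<theta>\<^sup>2 / 4)"
        by (intro mult_right_mono power_mono) auto
      also have "\<dots> \<le> (fact l * exp 2) * exp (- \<theta>\<^sup>2 / 4)"
        by (intro mult_right_mono power_gauss_bound) auto
      finally show ?thesis .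
    qed
    have cmp: "((\<lambda>\<theta>. ?E \<theta> * of_real \<theta> ^ l) \<longlongrightarrow> 0) A"
      if "((\<lambda>\<theta>::real. exp (- \<theta>\<^sup>2 / 4)) \<longlongrightarrow> 0) A" for A
    proof (rule Lim_null_comparison)
      show "\<forall>\<^sub>F \<theta> in A. norm (?E \<theta> * of_real \<theta> ^ l) \<le> fact l * exp 2 * exp (- \<theta>\<^sup>2 / 4)"
        using le by (rule always_eventually[OF allI])
      show "((\<lambda>\<theta>::real. fact l * exp 2 * exp (- \<theta>\<^sup>2 / 4)) \<longlongrightarrow> 0) A"
        using that by (rule tendsto_mult_right_zero)
    qed
    show "((\<lambda>\<theta>. ?E \<theta> * of_real \<theta> ^ l) \<longlongrightarrow> 0) at_top" by (rule cmp) real_asymp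
    show "((\<lambda>\<theta>. ?E \<theta> * of_real \<theta> ^ l) \<longlongrightarrow> 0) at_bot" by (rule cmp) real_asymp
  qed
  have "(LBINT \<theta>=-\<infinity>..\<infinity>. ?G \<theta>) = 0 - 0"
  proof (rule interval_integral_FTC_integrable)
    fix t :: real
    let ?H = "\<lambda>z. exp (- \<i> * z * of_real x - z\<^sup>2 / 2) * z ^ l"
    have deriv: "(?H has_field_derivative exp (- \<i> * of_real t * of_real x - (of_real t)\<^sup>2 / 2) * (- \<i> * of_real x - of_real t) * of_real t ^ l
        + of_nat l * of_real t ^ (l - 1) * exp (- \<i> * of_real t * of_real x - (of_real t)\<^sup>2 / 2)) (at (complex_of_real t))"
      by (rule DERIV_mult) (auto intro!: derivative_eq_intros)
    show "((\<lambda>\<theta>. ?E \<theta> * of_real \<theta> ^ l) has_vector_derivative ?G t) (at t)"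
    proof -
      have "e * (- \<i> * of_real x - z) * z ^ l + of_nat l * z ^ (l - 1) * e
          = (of_nat l * (e * z ^ (l - 1)) - \<i> * x * (e * z ^ l)) - e * z ^ Suc l" for e z
        by (simp add: algebra_simps)
      then show ?thesis using has_vector_derivative_real_field[OF deriv] by (simp only: gauss_kernel_def)
    qed
    have "isCont ?E t" unfolding gauss_kernel_def by (intro continuous_intros) simp
    then show "isCont ?G t" by (intro isCont_diff isCont_mult isCont_power continuous_const isCont_of_real continuous_ident)
  next
    show "set_integrable lborel (einterval (- \<infinity>) \<infinity>) ?G"
      using G by (simp add: set_integrable_def einterval_def)
    show "(((\<lambda>\<theta>. ?E \<theta> * of_real \<theta> ^ l) \<circ> real_of_ereal) \<longlongrightarrow> 0) (at_right (-\<infinity>))"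
      unfolding ereal_tendsto_simps by (rule lim(2))
    show "(((\<lambda>\<theta>. ?E \<theta> * of_real \<theta> ^ l) \<circ> real_of_ereal) \<longlongrightarrow> 0) (at_left \<infinity>)"
      unfolding ereal_tendsto_simps by (rule lim(1))
  qed simp
  then have "(LINT \<theta>|lborel. ?G \<theta>) = 0"
    by (simp add: interval_lebesgue_integral_def set_lebesgue_integral_def einterval_def)
  then show ?thesis using int by (simp del: power_Suc)
qed

lemma gauss_kernel_power_0: "(LINT \<theta>|lborel. gauss_kernel x \<theta>) = sqrt (2 * pi) * exp (- x\<^sup>2 / 2)"
proof -
  have "char std_normal_distribution (-x) = (LINT \<theta>|lborel. std_normal_density \<theta> *\<^sub>R iexp (-x * \<theta>))"
    unfolding char_def by (subst integral_density) auto
  then have "complex_of_real (exp (- x\<^sup>2 / 2)) = (LINT \<theta>|lborel. std_normal_density \<theta> *\<^sub>R iexp (-x * \<theta>))"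
    by (simp add: char_std_normal_distribution)
  also have "\<dots> = (LINT \<theta>|lborel. complex_of_real (1 / sqrt (2 * pi)) * gauss_kernel x \<theta>)"
    by (simp add: gauss_kernel_eq std_normal_density_def scaleR_conv_of_real mult_ac)
  also have "\<dots> = complex_of_real (1 / sqrt (2 * pi)) * (LINT \<theta>|lborel. gauss_kernel x \<theta>)"
    by (rule integral_mult_right_zero)
  finally have "complex_of_real (sqrt (2 * pi)) * complex_of_real (exp (- x\<^sup>2 / 2)) = (LINT \<theta>|lborel. gauss_kernel x \<theta>)"
    by (simp add: field_simps)
  then show ?thesis by simp
qed

definition gauss_poly :: "(real \<Rightarrow> complex) \<Rightarrow> bool" where
  "gauss_poly h \<longleftrightarrow> (\<exists>R. poly_fun R \<and> (\<forall>x. h x = R x * exp (- x\<^sup>2 / 2)))"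

lemma gauss_poly_add: "gauss_poly g \<Longrightarrow> gauss_poly h \<Longrightarrow> gauss_poly (\<lambda>x. g x + h x)"
  unfolding gauss_poly_def by (metis (no_types, lifting) distrib_right poly_fun_add)

lemma gauss_poly_mult: "poly_fun g \<Longrightarrow> gauss_poly h \<Longrightarrow> gauss_poly (\<lambda>x. g x * h x)"
  unfolding gauss_poly_def by (metis (no_types, lifting) mult.assoc poly_fun_mult)

text \<open>The recurrence steps two orders down, hence strong induction. Up to constants the
  polynomial factor is a Hermite polynomial, but only its existence matters.\<close>

lemma gauss_poly_kernel_power: "gauss_poly (\<lambda>x. LINT \<theta>|lborel. gauss_kernel x \<theta> * of_real \<theta> ^ l)"
proof (induction l rule: less_induct)
  case (less l)
  show ?case
  proof (cases l)
    case 0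
    then show ?thesis unfolding gauss_poly_def
      by (intro exI[of _ "\<lambda>x. of_real (sqrt (2 * pi))"]) (simp add: gauss_kernel_power_0 poly_fun_const)
  next
    case (Suc k)
    have "gauss_poly (\<lambda>x. of_nat k * (LINT \<theta>|lborel. gauss_kernel x \<theta> * of_real \<theta> ^ (k - 1)) + (- \<i> * of_real x) * (LINT \<theta>|lborel. gauss_kernel x \<theta> * of_real \<theta> ^ k))"
      by (intro gauss_poly_add gauss_poly_mult poly_fun_mult poly_fun_const poly_fun_id less) (simp_all add: Suc)
    then show ?thesis unfolding Suc gauss_kernel_power_rec by simp
  qed
qed

lemma gauss_kernel_poly_fun:
  assumes "poly_fun g"
  shows "integrable lborel (\<lambda>\<theta>. gauss_kernel x \<theta> * g \<theta>)"
    and "gauss_poly (\<lambda>x. LINT \<theta>|lborel. gauss_kernel x \<theta> * g \<theta>)"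
proof -
  obtain P where P: "g = (\<lambda>\<theta>. poly P (of_real \<theta>))" using assms by (auto simp: poly_fun_def fun_eq_iff)
  \<comment> \<open>The additional power \<open>\<theta> ^ l\<close> is the induction parameter:
    peeling off one coefficient of P multiplies the rest by \<theta>.\<close>
  have "(\<forall>x. integrable lborel (\<lambda>\<theta>. gauss_kernel x \<theta> * (of_real \<theta> ^ l * poly P (of_real \<theta>)))) \<and>
     gauss_poly (\<lambda>x. LINT \<theta>|lborel. gauss_kernel x \<theta> * (of_real \<theta> ^ l * poly P (of_real \<theta>)))" for l
  proof (induction P arbitrary: l)
    case 0
    then show ?case by (auto simp: gauss_poly_def intro!: exI[of _ "\<lambda>x. 0"] poly_fun_const)
  next
    case (pCons a P)
    have eq: "gauss_kernel x \<theta> * (of_real \<theta> ^ l * poly (pCons a P) (of_real \<theta>))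
       = a * (gauss_kernel x \<theta> * of_real \<theta> ^ l) + gauss_kernel x \<theta> * (of_real \<theta> ^ Suc l * poly P (of_real \<theta>))" for x \<theta>
      by (simp add: algebra_simps)
    have i: "integrable lborel (\<lambda>\<theta>. a * (gauss_kernel x \<theta> * of_real \<theta> ^ l))" for x
      by (intro integrable_mult_right gauss_kernel_power_integrable)
    note i' = pCons.IH[of "Suc l", THEN conjunct1, rule_format]
    have "gauss_poly (\<lambda>x. a * (LINT \<theta>|lborel. gauss_kernel x \<theta> * of_real \<theta> ^ l) + (LINT \<theta>|lborel. gauss_kernel x \<theta> * (of_real \<theta> ^ Suc l * poly P (of_real \<theta>))))"
      using pCons.IH[of "Suc l"] by (intro gauss_poly_add gauss_poly_mult poly_fun_const gauss_poly_kernel_power) auto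
    then show ?case unfolding eq using Bochner_Integration.integrable_add[OF i i'] Bochner_Integration.integral_add[OF i i'] by simp
  qed
  from this[of 0]
  show "integrable lborel (\<lambda>\<theta>. gauss_kernel x \<theta> * g \<theta>)"
    and "gauss_poly (\<lambda>x. LINT \<theta>|lborel. gauss_kernel x \<theta> * g \<theta>)"
    by (simp_all add: P)
qed

lemma gauss_poly_decay:
  assumes "gauss_poly h"
  shows "\<exists>C\<ge>0. \<forall>x. norm (h x) * \<bar>x\<bar> ^ K \<le> C"
proof -
  obtain R where R: "poly_fun R" "\<And>x. h x = R x * exp (- x\<^sup>2 / 2)" using assms by (auto simp: gauss_poly_def)
  obtain C d where C: "C \<ge> 0" "\<And>x. norm (R x) \<le> C * (1 + \<bar>x\<bar>) ^ d" using poly_fun_bound[OF R(1)] by auto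
  have "norm (h x) * \<bar>x\<bar> ^ K \<le> C * (fact (d + K) * exp 2)" for x
  proof -
    have "norm (h x) * \<bar>x\<bar> ^ K \<le> (C * (1 + \<bar>x\<bar>) ^ d * exp (- x\<^sup>2 / 4)) * (1 + \<bar>x\<bar>) ^ K"
    proof (intro mult_mono)
      have "norm (h x) = norm (R x) * exp (- x\<^sup>2 / 2)" by (simp add: R norm_mult)
      also have "\<dots> \<le> (C * (1 + \<bar>x\<bar>) ^ d) * exp (- x\<^sup>2 / 4)"
        using C by (intro mult_mono) auto
      finally show "norm (h x) \<le> C * (1 + \<bar>x\<bar>) ^ d * exp (- x\<^sup>2 / 4)" .
    qed (use C in \<open>auto intro!: power_mono\<close>)
    also have "\<dots> = C * ((1 + \<bar>x\<bar>) ^ (d + K) * exp (- x\<^sup>2 / 4))" by (simp add: power_add)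
    also have "\<dots> \<le> C * (fact (d + K) * exp 2)" by (intro mult_left_mono power_gauss_bound C)
    finally show ?thesis .
  qed
  then show ?thesis using C(1) by (intro exI[of _ "C * (fact (d + K) * exp 2)"]) auto
qed

section \<open>Edgeworth terms as coefficients of an exponential\<close>

definition edgeworth_poly :: "(nat \<Rightarrow> real) \<Rightarrow> nat \<Rightarrow> real \<Rightarrow> complex" where
  "edgeworth_poly \<kappa> j \<theta> = (\<Sum>k=1..j. edgeworth_xi \<kappa> k j \<theta> / fact k)"

text \<open>The polynomial in t = n^(-1/2) inside \<open>edgeworth_xi\<close>. Its upper limit is a
  parameter because the order-j term uses j, whereas the characteristic function uses one limit for
  all orders.\<close>

definition cumulant_poly :: "(nat \<Rightarrow> real) \<Rightarrow> nat \<Rightarrow> real \<Rightarrow> complex poly" where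
  "cumulant_poly \<kappa> j \<theta> = (\<Sum>l=3..j. monom (of_real (\<kappa> l) * (\<i> * of_real \<theta>) ^ l / fact l) (l - 2))"

lemma coeff_cumulant_poly:
  "coeff (cumulant_poly \<kappa> j \<theta>) i =
    (if 1 \<le> i \<and> i + 2 \<le> j then of_real (\<kappa> (i + 2)) * (\<i> * of_real \<theta>) ^ (i + 2) / fact (i + 2) else 0)"
proof -
  have "coeff (cumulant_poly \<kappa> j \<theta>) i = (\<Sum>l\<in>{3..j}. if l = i + 2 then of_real (\<kappa> l) * (\<i> * of_real \<theta>) ^ l / fact l else 0)"
    unfolding cumulant_poly_def coeff_sum coeff_monom by (rule sum.cong) auto
  also have "\<dots> = (if i + 2 \<in> {3..j} then of_real (\<kappa> (i + 2)) * (\<i> * of_real \<theta>) ^ (i + 2) / fact (i + 2) else 0)"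
    by (rule sum.delta) simp
  finally show ?thesis by (simp del: fact_Suc)
qed

lemma poly_fun_edgeworth_poly: "poly_fun (edgeworth_poly \<kappa> j)"
proof -
  have "poly_fun (\<lambda>\<theta>. coeff (cumulant_poly \<kappa> j \<theta>) i)" for i
  proof (cases "1 \<le> i \<and> i + 2 \<le> j")
    case True
    have "poly_fun (\<lambda>\<theta>. (of_real (\<kappa> (i + 2)) / fact (i + 2)) * (\<i> * of_real \<theta>) ^ (i + 2))"
      by (intro poly_fun_mult poly_fun_power poly_fun_const poly_fun_id)
    then show ?thesis unfolding coeff_cumulant_poly using True by (simp only: if_True simp_thms times_divide_eq_left)
  next
    case False
    show ?thesis unfolding coeff_cumulant_poly by (simp only: False if_False poly_fun_const)
  qed
  then have "poly_fun (\<lambda>\<theta>. edgeworth_xi \<kappa> k j \<theta>)" for k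
    unfolding edgeworth_xi_def cumulant_poly_def[symmetric] by (rule poly_fun_coeff_power)
  then have "poly_fun (\<lambda>\<theta>. edgeworth_xi \<kappa> k j \<theta> * (1 / fact k))" for k
    by (intro poly_fun_mult poly_fun_const)
  then show ?thesis unfolding edgeworth_poly_def[abs_def]
    by (intro poly_fun_sum) simp
qed

lemma edgeworth_G_eq:
  "std_normal_density x * edgeworth_G \<kappa> j x = Re (1 / (2 * of_real pi) * (LINT \<theta>|lborel. gauss_kernel x \<theta> * edgeworth_poly \<kappa> j \<theta>))"
proof -
  have "std_normal_density x \<noteq> 0" using normal_density_pos[of 1 0 x] by simp
  then have "std_normal_density x * (r / std_normal_density x) = r" for r by simp
  moreover have "edgeworth_G \<kappa> j x = Re (1 / (2 * of_real pi) * (LINT \<theta>|lborel. gauss_kernel x \<theta> * edgeworth_poly \<kappa> j \<theta>)) / std_normal_density x"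
    unfolding edgeworth_G_def edgeworth_poly_def gauss_kernel_def by (rule refl)
  ultimately show ?thesis by metis
qed

text \<open>Degree j - 2 involves only cumulants up to order j and only powers from 1 to j - 2. The
  cut-offs in the definition of the Edgeworth term and those of a common exponential expansion
  therefore agree.\<close>

lemma edgeworth_poly_coeff:
  assumes "3 \<le> j" "j \<le> J" "j - 2 \<le> M"
  shows "(\<Sum>k\<le>M. coeff (cumulant_poly \<kappa> J \<theta> ^ k) (j - 2) / fact k) = edgeworth_poly \<kappa> j \<theta>"
proof -
  let ?m = "j - 2"
  have w0: "coeff (cumulant_poly \<kappa> J \<theta>) 0 = 0" for J by (simp add: coeff_cumulant_poly)
  have "(\<Sum>k\<le>M. coeff (cumulant_poly \<kappa> J \<theta> ^ k) ?m / fact k) = (\<Sum>k=1..?m. coeff (cumulant_poly \<kappa> J \<theta> ^ k) ?m / fact k)"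
  proof (rule sum.mono_neutral_right)
    show "\<forall>k\<in>{..M} - {1..?m}. coeff (cumulant_poly \<kappa> J \<theta> ^ k) ?m / fact k = 0"
    proof
      fix k assume "k \<in> {..M} - {1..?m}"
      then consider "k = 0" | "k > ?m" by fastforce
      then show "coeff (cumulant_poly \<kappa> J \<theta> ^ k) ?m / fact k = 0"
        using assms(1) by cases (auto simp: coeff_power_low[OF w0])
    qed
  qed (use assms in auto)
  also have "\<dots> = (\<Sum>k=1..?m. coeff (cumulant_poly \<kappa> j \<theta> ^ k) ?m / fact k)"
    using assms by (intro sum.cong refl arg_cong2[where f="(/)"] coeff_power_cong) (auto simp: coeff_cumulant_poly)
  also have "\<dots> = (\<Sum>k=1..j. coeff (cumulant_poly \<kappa> j \<theta> ^ k) ?m / fact k)"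
    by (rule sum.mono_neutral_left) (auto simp: coeff_power_low[OF w0])
  finally show ?thesis by (simp add: edgeworth_poly_def edgeworth_xi_def cumulant_poly_def)
qed

lemma exp_coeff_0:
  assumes "coeff w 0 = 0"
  shows "(\<Sum>k\<le>M. coeff (w ^ k) 0 / fact k) = (1 :: complex)"
proof -
  have "(\<Sum>k\<le>M. coeff (w ^ k) 0 / fact k) = (\<Sum>k\<in>{0}. coeff (w ^ k) 0 / fact k)"
    by (rule sum.mono_neutral_right) (auto simp: coeff_power_low[OF assms])
  then show ?thesis by simp
qed

section \<open>The characteristic function near the origin\<close>

text \<open>\<open>0 powr p\<close> is 0 for every p, so a power bound at the origin would force g
  to vanish there. Excluding that null point admits functions that are positive at 0.\<close>

lemma integrable_dominated_powr':
  fixes g :: "real \<Rightarrow> real"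
  assumes "p > -1" "q < -1" and [measurable]: "g \<in> borel_measurable borel"
    and 1: "\<And>x. x \<noteq> 0 \<Longrightarrow> \<bar>x\<bar> \<le> 1 \<Longrightarrow> \<bar>g x\<bar> \<le> A * \<bar>x\<bar> powr p"
    and 2: "\<And>x. \<bar>x\<bar> > 1 \<Longrightarrow> \<bar>g x\<bar> \<le> A * \<bar>x\<bar> powr q"
  shows "integrable lborel g"
proof -
  have "integrable lborel (\<lambda>x. if x = 0 then 0 else g x)"
    by (rule integrable_dominated_powr[OF assms(1,2), of _ A]) (use 1 2 in auto)
  moreover have "AE x in lborel. (if x = 0 then 0 else g x) = g x"
    using AE_lborel_singleton[of "0::real"] by eventually_elim simp
  ultimately show ?thesis
    by (subst (asm) integrable_cong_AE[where g=g]) auto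
qed

locale pareto_order = pareto +
  fixes N :: nat
  assumes N_even: "even N" and N_bounds: "real N - 2 < \<alpha>" "\<alpha> < real N"
begin

lemma N_ge_4: "N \<ge> 4"
proof -
  have "N > 2" using N_bounds(2) alpha_gt_2 by linarith
  then show ?thesis using N_even by (cases "N = 3") auto
qed

lemma f_integrable: "integrable lborel f"
  using F_mass f_nonneg by (intro integrableI_nonneg) auto

lemma f_integral: "(LINT x|lborel. f x) = 1"
  using F_mass f_nonneg by (subst integral_eq_nn_integral) auto

lemma f_power_integrable:
  assumes "k \<le> N - 2" shows "integrable lborel (\<lambda>x. f x * x ^ k)"
proof (rule integrable_dominated_powr'[where p="real k" and q="real N - 2 - \<alpha> - 1" and A="a / b + a"])
  fix x :: real assume x: "x \<noteq> 0"
  have "\<bar>f x * x ^ k\<bar> \<le> (a / b) * \<bar>x\<bar> ^ k"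
    using mult_right_mono[OF f_le[of x], of "\<bar>x\<bar> ^ k"] f_nonneg[of x]
    by (simp only: abs_mult power_abs abs_of_nonneg zero_le_power abs_ge_zero)
  also have "\<dots> \<le> (a / b + a) * \<bar>x\<bar> ^ k"
    using a_pos by (intro mult_right_mono) auto
  also have "\<bar>x\<bar> ^ k = \<bar>x\<bar> powr real k"
    using x by (simp add: powr_realpow)
  finally show "\<bar>f x * x ^ k\<bar> \<le> (a / b + a) * \<bar>x\<bar> powr real k" .
next
  fix x :: real assume x: "\<bar>x\<bar> > 1"
  have "\<bar>f x * x ^ k\<bar> \<le> a * \<bar>x\<bar> powr (- (\<alpha> + 1)) * \<bar>x\<bar> powr (real N - 2)"
  proof -
    have "\<bar>x\<bar> ^ k = \<bar>x\<bar> powr real k" using x by (simp add: powr_realpow)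
    also have "\<dots> \<le> \<bar>x\<bar> powr (real N - 2)" using x assms N_ge_4 by (intro powr_mono) auto
    finally show ?thesis
      using f_le_powr[of x] f_nonneg[of x] x a_pos unfolding abs_mult power_abs
      by (intro mult_mono) auto
  qed
  also have "\<dots> = a * \<bar>x\<bar> powr (real N - 2 - \<alpha> - 1)"
  proof -
    have "- (\<alpha> + 1) + (real N - 2) = real N - 2 - \<alpha> - 1" by simp
    then show ?thesis by (simp only: mult.assoc powr_add[symmetric])
  qed
  also have "\<dots> \<le> (a / b + a) * \<bar>x\<bar> powr (real N - 2 - \<alpha> - 1)"
    using a_pos b_pos by (intro mult_right_mono) auto
  finally show "\<bar>f x * x ^ k\<bar> \<le> (a / b + a) * \<bar>x\<bar> powr (real N - 2 - \<alpha> - 1)" .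
qed (use N_bounds in auto)

definition moment :: "nat \<Rightarrow> real" where
  "moment k = (LINT x|lborel. f x * x ^ k)"

lemma moment_0: "moment 0 = 1" by (simp add: moment_def f_integral)

lemma moment_2: "moment 2 = 1"
proof -
  have "moment 2 = enn2real (\<integral>\<^sup>+x. ennreal (f x * x\<^sup>2) \<partial>lborel)"
    unfolding moment_def using f_nonneg by (intro integral_eq_nn_integral) auto
  also have "(\<integral>\<^sup>+x. ennreal (f x * x\<^sup>2) \<partial>lborel) = (\<integral>\<^sup>+x. ennreal (x\<^sup>2) * F x \<partial>lborel)"
    using f_nonneg by (intro nn_integral_cong) (simp add: ennreal_mult mult.commute)
  finally show ?thesis by (simp add: F_second_moment)
qed

text \<open>Reflection covers every odd k, including orders whose moment does not exist and whose
  Bochner integral is 0 by convention. The symmetry argument for the formal logarithm asks for all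
  odd coefficients.\<close>

lemma moment_odd: "odd k \<Longrightarrow> moment k = 0"
  using lborel_integral_real_affine[of "-1" "\<lambda>x. f x * x ^ k" 0]
  by (simp add: moment_def f_even)

text \<open>The characteristic function, which is real because the density is even.\<close>

definition phi :: "real \<Rightarrow> real" where
  "phi s = (LINT x|lborel. f x * cos (s * x))"

lemma f_cos_integrable: "integrable lborel (\<lambda>x. f x * cos (s * x))"
  by (rule Bochner_Integration.integrable_bound[OF f_integrable])
     (auto simp: abs_mult mult_left_le f_nonneg)

definition sing :: real where "sing = a * cos_kernel_const N \<alpha>"

text \<open>The excess of the leading power over f, in a form without cancellation that displays the
  decay \<bar>x\<bar>^(-2\<alpha>-2) at infinity.\<close>

definition remainder :: "real \<Rightarrow> real" where
  "remainder x = a * b * \<bar>x\<bar> powr (- \<alpha> - 1) / (b + \<bar>x\<bar> powr (\<alpha> + 1))"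

lemma remainder_measurable [measurable]: "remainder \<in> borel_measurable borel"
  unfolding remainder_def[abs_def] by measurable

lemma remainder_nonneg: "remainder x \<ge> 0"
  using a_pos b_pos denominator_pos[of x] by (simp add: remainder_def)

lemma f_eq_remainder: "x \<noteq> 0 \<Longrightarrow> f x = a * \<bar>x\<bar> powr (- \<alpha> - 1) - remainder x"
proof -
  assume x: "x \<noteq> 0"
  define X where "X = \<bar>x\<bar> powr (\<alpha> + 1)"
  have X: "X > 0" using x by (simp add: X_def)
  have "\<bar>x\<bar> powr (- \<alpha> - 1) = \<bar>x\<bar> powr - (\<alpha> + 1)" by simp
  also have "\<dots> = 1 / X" unfolding X_def by (rule powr_minus_divide)
  finally have "\<bar>x\<bar> powr (- \<alpha> - 1) = 1 / X" .
  moreover have "f x = a / (b + X)" by (simp add: f_def pareto_density_def X_def)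
  ultimately show ?thesis
    using X b_pos unfolding remainder_def X_def[symmetric] by (simp add: divide_simps) (simp add: algebra_simps)
qed

text \<open>At 0 the exponent N - \<alpha> - 1 exceeds -1; at infinity N - 2\<alpha> - 2 is below -1
  because N < \<alpha> + 2. The moment of order \<open>N\<close>, infinite for f, is finite for the
  remainder.\<close>

lemma remainder_power_integrable: "integrable lborel (\<lambda>x. remainder x * \<bar>x\<bar> ^ N)"
proof (rule integrable_dominated_powr'[where p="real N - \<alpha> - 1" and q="real N - 2 * \<alpha> - 2" and A="a + a * b"])
  fix x :: real assume x: "x \<noteq> 0"
  have N: "\<bar>x\<bar> ^ N = \<bar>x\<bar> powr real N" using x by (simp add: powr_realpow)
  have "remainder x \<le> a * \<bar>x\<bar> powr (- \<alpha> - 1)"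
    using f_eq_remainder[OF x] f_nonneg[of x] by linarith
  then have "\<bar>remainder x * \<bar>x\<bar> ^ N\<bar> \<le> a * \<bar>x\<bar> powr (- \<alpha> - 1) * \<bar>x\<bar> powr real N"
    using remainder_nonneg[of x] by (simp add: N mult_right_mono)
  also have "\<dots> = a * \<bar>x\<bar> powr (real N - \<alpha> - 1)"
  proof -
    have "(- \<alpha> - 1) + real N = real N - \<alpha> - 1" by simp
    then show ?thesis by (simp only: mult.assoc powr_add[symmetric])
  qed
  also have "\<dots> \<le> (a + a * b) * \<bar>x\<bar> powr (real N - \<alpha> - 1)"
    using a_pos b_pos by (intro mult_right_mono) auto
  finally show "\<bar>remainder x * \<bar>x\<bar> ^ N\<bar> \<le> (a + a * b) * \<bar>x\<bar> powr (real N - \<alpha> - 1)" .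
next
  fix x :: real assume x: "\<bar>x\<bar> > 1"
  then have x0: "x \<noteq> 0" by auto
  have N: "\<bar>x\<bar> ^ N = \<bar>x\<bar> powr real N" using x by (simp add: powr_realpow)
  have "remainder x \<le> a * b * \<bar>x\<bar> powr (- \<alpha> - 1) / \<bar>x\<bar> powr (\<alpha> + 1)"
    unfolding remainder_def using a_pos b_pos denominator_pos[of x] x0
    by (intro divide_left_mono mult_pos_pos mult_nonneg_nonneg) auto
  then have "\<bar>remainder x * \<bar>x\<bar> ^ N\<bar> \<le> a * b * (\<bar>x\<bar> powr (- \<alpha> - 1) / \<bar>x\<bar> powr (\<alpha> + 1)) * \<bar>x\<bar> powr real N"
    using remainder_nonneg[of x] mult_right_mono[of "remainder x" _ "\<bar>x\<bar> powr real N"]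
    by (simp only: N abs_mult abs_of_nonneg powr_ge_zero times_divide_eq_right)
  also have "\<dots> = a * b * \<bar>x\<bar> powr (real N - 2 * \<alpha> - 2)"
  proof -
    have "(- \<alpha> - 1) - (\<alpha> + 1) + real N = real N - 2 * \<alpha> - 2" by simp
    then show ?thesis by (simp only: mult.assoc powr_add[symmetric] powr_diff[symmetric])
  qed
  also have "\<dots> \<le> (a + a * b) * \<bar>x\<bar> powr (real N - 2 * \<alpha> - 2)"
    using a_pos b_pos by (intro mult_right_mono) auto
  finally show "\<bar>remainder x * \<bar>x\<bar> ^ N\<bar> \<le> (a + a * b) * \<bar>x\<bar> powr (real N - 2 * \<alpha> - 2)" .
qed (use N_bounds alpha_gt_2 in auto)

lemma phi_expansion:
  "\<exists>C\<ge>0. \<forall>s. \<bar>phi s - (\<Sum>k<N. cos_coeff k * s ^ k * moment k) - sing * \<bar>s\<bar> powr \<alpha>\<bar> \<le> C * \<bar>s\<bar> ^ N"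
proof -
  define R where "R = (LINT x|lborel. remainder x * \<bar>x\<bar> ^ N)"
  have R: "R \<ge> 0" unfolding R_def by (intro integral_nonneg_AE) (auto simp: remainder_nonneg)
  have "\<bar>phi s - (\<Sum>k<N. cos_coeff k * s ^ k * moment k) - sing * \<bar>s\<bar> powr \<alpha>\<bar> \<le> R * \<bar>s\<bar> ^ N" for s
  proof -
    let ?c = "\<lambda>x. cos (s * x) - cos_taylor N (s * x)"
    \<comment> \<open>Order \<open>N - 1\<close> may have no moment, but it is odd and its cosine
      coefficient is 0; every other order is at most \<open>N - 2\<close> or odd.\<close>
    have int: "integrable lborel (\<lambda>x. (cos_coeff k * s ^ k) * (f x * x ^ k))" if "k < N" for k
    proof (cases "odd k")
      case True then show ?thesis by (simp add: cos_coeff_odd)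
    next
      case False
      then have "k \<le> N - 2" using that N_even by (cases "k = N - 1") auto
      then show ?thesis by (intro integrable_mult_right f_power_integrable)
    qed
    have ft: "f x * cos_taylor N (s * x) = (\<Sum>k<N. (cos_coeff k * s ^ k) * (f x * x ^ k))" for x
      by (simp add: cos_taylor_def sum_distrib_left power_mult_distrib mult_ac)
    have it: "integrable lborel (\<lambda>x. f x * cos_taylor N (s * x))"
      unfolding ft by (rule Bochner_Integration.integrable_sum) (use int in auto)
    have key: "\<bar>remainder x * ?c x\<bar> \<le> \<bar>s\<bar> ^ N * (remainder x * \<bar>x\<bar> ^ N)" for x
    proof -
      have "\<bar>remainder x * ?c x\<bar> = remainder x * \<bar>?c x\<bar>"
        by (simp add: abs_mult remainder_nonneg)
      also have "\<dots> \<le> remainder x * \<bar>s * x\<bar> ^ N"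
        by (intro mult_left_mono cos_taylor_error remainder_nonneg)
      finally show ?thesis by (simp add: abs_mult power_mult_distrib mult_ac)
    qed
    have int_R: "integrable lborel (\<lambda>x. \<bar>s\<bar> ^ N * (remainder x * \<bar>x\<bar> ^ N))"
      by (intro integrable_mult_right remainder_power_integrable)
    have int_r: "integrable lborel (\<lambda>x. remainder x * ?c x)"
    proof (rule Bochner_Integration.integrable_bound[OF int_R])
      show "AE x in lborel. norm (remainder x * ?c x) \<le> norm (\<bar>s\<bar> ^ N * (remainder x * \<bar>x\<bar> ^ N))"
        using key by (intro AE_I2) (simp only: real_norm_def, rule order_trans[OF _ abs_ge_self])
    qed measurable
    have "(\<Sum>k<N. cos_coeff k * s ^ k * moment k) = (LINT x|lborel. f x * cos_taylor N (s * x))"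
      unfolding ft using int by (subst Bochner_Integration.integral_sum) (auto simp: moment_def)
    then have "phi s - (\<Sum>k<N. cos_coeff k * s ^ k * moment k) = (LINT x|lborel. f x * ?c x)"
      using f_cos_integrable it by (simp add: phi_def right_diff_distrib)
    also have "\<dots> = (LINT x|lborel. a * (\<bar>x\<bar> powr (- \<alpha> - 1) * ?c x) - remainder x * ?c x)"
      using AE_lborel_singleton[of "0::real"]
      by (intro integral_cong_AE) (auto elim!: eventually_mono simp: f_eq_remainder algebra_simps)
    also have "\<dots> = a * (LINT x|lborel. \<bar>x\<bar> powr (- \<alpha> - 1) * ?c x) - (LINT x|lborel. remainder x * ?c x)"
    proof -
      have "integrable lborel (\<lambda>x. a * (\<bar>x\<bar> powr (- \<alpha> - 1) * ?c x))"
        using N_even N_ge_4 N_bounds by (intro integrable_mult_right integrable_cos_kernel) auto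
      then show ?thesis using int_r by simp
    qed
    also have "a * (LINT x|lborel. \<bar>x\<bar> powr (- \<alpha> - 1) * ?c x) = sing * \<bar>s\<bar> powr \<alpha>"
    proof (cases "s = 0")
      case True
      then show ?thesis using cos_taylor_error[of 0 N] N_ge_4 by (simp add: power_0_left)
    next
      case False
      then show ?thesis using cos_kernel_scale[of s \<alpha> N] by (simp add: sing_def)
    qed
    finally have "\<bar>phi s - (\<Sum>k<N. cos_coeff k * s ^ k * moment k) - sing * \<bar>s\<bar> powr \<alpha>\<bar> = \<bar>LINT x|lborel. remainder x * ?c x\<bar>"
      by simp
    also have "\<dots> \<le> (LINT x|lborel. \<bar>s\<bar> ^ N * (remainder x * \<bar>x\<bar> ^ N))"
      by (rule integral_abs_bound_integral[OF int_r int_R key])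
    also have "\<dots> = R * \<bar>s\<bar> ^ N" by (simp add: R_def)
    finally show ?thesis .
  qed
  then show ?thesis using R by auto
qed

end

text \<open>All binomial coefficients are nonnegative, so the error is dominated by the same
  expression at the real number norm z, where the exponential and its quadratic bound apply.\<close>

lemma one_add_power_error:
  fixes z :: complex
  assumes "real n * norm z \<le> 1"
  shows "norm ((1 + z) ^ n - 1 - of_nat n * z) \<le> (real n * norm z)\<^sup>2"
proof -
  have "norm ((1 + z) ^ n - 1 - of_nat n * z) \<le> (1 + norm z) ^ n - 1 - real n * norm z"
  proof (induction n)
    case (Suc n)
    have "(1 + z) ^ Suc n - 1 - of_nat (Suc n) * z = ((1 + z) ^ n - 1 - of_nat n * z) + z * ((1 + z) ^ n - 1)"
      by (simp add: algebra_simps)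
    also have "norm \<dots> \<le> ((1 + norm z) ^ n - 1 - real n * norm z) + norm z * ((1 + norm z) ^ n - 1)"
    proof (rule order_trans[OF norm_triangle_ineq add_mono[OF Suc]])
      have "norm ((1 + z) ^ n - 1) \<le> (1 + norm z) ^ n - 1"
      proof -
        have "norm ((1 + z) ^ n - 1) = norm (((1 + z) ^ n - 1 - of_nat n * z) + of_nat n * z)" by simp
        also have "\<dots> \<le> ((1 + norm z) ^ n - 1 - real n * norm z) + real n * norm z"
          by (rule order_trans[OF norm_triangle_ineq add_mono[OF Suc]]) (simp add: norm_mult)
        finally show ?thesis by simp
      qed
      then show "norm (z * ((1 + z) ^ n - 1)) \<le> norm z * ((1 + norm z) ^ n - 1)"
        by (simp add: norm_mult mult_left_mono)
    qed
    also have "\<dots> = (1 + norm z) ^ Suc n - 1 - real (Suc n) * norm z" by (simp add: algebra_simps)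
    finally show ?case .
  qed simp
  also have "(1 + norm z) ^ n \<le> exp (norm z) ^ n"
    by (intro power_mono exp_ge_add_one_self) simp
  also have "exp (norm z) ^ n = exp (real n * norm z)" by (simp add: exp_of_nat_mult)
  also have "exp (real n * norm z) \<le> 1 + real n * norm z + (real n * norm z)\<^sup>2"
    by (rule exp_bound) (use assms in auto)
  finally show ?thesis by simp
qed

lemma exp_minus_one_bound:
  fixes z :: complex
  assumes "norm z \<le> 1" shows "norm (exp z - 1) \<le> 3 * norm z"
proof -
  have "norm (exp z - 1) \<le> exp (norm z) * norm z" using Taylor_exp_field[of z 0] by simp
  also have "\<dots> \<le> 3 * norm z"
    using order_trans[OF _ exp_le, of "exp (norm z)"] assms by (intro mult_right_mono) auto
  finally show ?thesis .
qed

section \<open>The logarithm and the n-th power of the characteristic function\<close>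

context pareto_order
begin

text \<open>A purely formal series: moments that do not exist enter as 0 by convention. The
  coefficients below \<open>N\<close> are the ones that carry information.\<close>

definition mgf :: "real fps" where "mgf = Abs_fps (\<lambda>k. moment k / fact k)"

lemma mgf_0: "fps_nth mgf 0 = 1" by (simp add: mgf_def moment_0)
lemma mgf_2: "fps_nth mgf 2 = 1 / 2" by (simp add: mgf_def moment_2)
lemma mgf_odd: "odd k \<Longrightarrow> fps_nth mgf k = 0" by (simp add: mgf_def moment_odd)

definition kappa :: "nat \<Rightarrow> real" where "kappa l = fact l * fps_nth (formal_log mgf) l"

lemma log_mgf_odd: "odd l \<Longrightarrow> fps_nth (formal_log mgf) l = 0"
  by (rule formal_log_odd[OF mgf_0 mgf_odd])

lemma log_mgf_2: "fps_nth (formal_log mgf) 2 = 1 / 2"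
  using formal_log_2[OF mgf_0] mgf_odd[of 1] mgf_2 by simp

definition log_poly :: "complex poly" where
  "log_poly = (\<Sum>l<N. monom (complex_of_real (fps_nth (formal_log mgf) l)) l)"

lemma coeff_log_poly: "coeff log_poly l = (if l < N then complex_of_real (fps_nth (formal_log mgf) l) else 0)"
  by (simp add: log_poly_def coeff_sum if_distrib cong: if_cong)

lemma taylor_phi_eq:
  "(\<Sum>m<N. complex_of_real (fps_nth mgf m) * (\<i> * of_real s) ^ m) = of_real (\<Sum>k<N. cos_coeff k * s ^ k * moment k)"
  unfolding of_real_sum
proof (rule sum.cong[OF refl])
  fix k
  show "complex_of_real (fps_nth mgf k) * (\<i> * of_real s) ^ k = of_real (cos_coeff k * s ^ k * moment k)"
  proof (cases "odd k")
    case True then show ?thesis by (simp add: mgf_odd cos_coeff_odd)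
  next
    case False
    then obtain h where "k = 2 * h" by blast
    then show ?thesis
      by (simp add: mgf_def cos_coeff_def power_mult power_mult_distrib power_minus[of "(complex_of_real s)\<^sup>2"])
  qed
qed

definition sing_term :: "real \<Rightarrow> complex" where
  "sing_term s = of_real (sing * \<bar>s\<bar> powr \<alpha>)"

lemma norm_sing_term: "norm (sing_term s) = \<bar>sing\<bar> * \<bar>s\<bar> powr \<alpha>"
  by (simp only: sing_term_def norm_of_real abs_mult of_real_mult[symmetric]) simp

lemma power_N_le_powr: "\<bar>s\<bar> \<le> 1 \<Longrightarrow> \<bar>s\<bar> ^ N \<le> \<bar>s\<bar> powr \<alpha>"
  using N_bounds N_ge_4 by (cases "s = 0") (auto simp: powr_realpow[symmetric] power_0_left intro!: powr_mono')

text \<open>A product form is chosen because it passes directly to the n-th power. Dividing by the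
  exponential changes the singular term only by a factor 1 + O(s^2), since the logarithm begins at
  degree 2, and that change is within the error of order \<open>N\<close>.\<close>

lemma phi_factor:
  "\<exists>C r. 1 \<le> C \<and> 0 < r \<and> r \<le> 1 \<and> (\<forall>s. \<bar>s\<bar> \<le> r \<longrightarrow>
     (\<exists>\<rho>. complex_of_real (phi s) = exp (poly log_poly (\<i> * s)) * (1 + \<rho>) \<and> norm (\<rho> - sing_term s) \<le> C * \<bar>s\<bar> ^ N))"
proof -
  obtain C0 where C0: "C0 \<ge> 0" "\<And>s. \<bar>phi s - (\<Sum>k<N. cos_coeff k * s ^ k * moment k) - sing * \<bar>s\<bar> powr \<alpha>\<bar> \<le> C0 * \<bar>s\<bar> ^ N"
    using phi_expansion by blast
  let ?w = log_poly
  define A where "A = poly_l1 ?w"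
  have A0: "A \<ge> 0" by (simp add: A_def poly_l1_nonneg)
  define C1 where "C1 = 4 * (1 + A) ^ Suc N"
  define C where "C = 1 + 3 * (C0 + C1) + 3 * A * \<bar>sing\<bar>"
  \<comment> \<open>This radius gives both \<bar>s\<bar> \<le> 1 and \<bar>s\<bar> A \<le> 1, as
    truncating the exponential of \<open>log_poly\<close> requires.\<close>
  define r where "r = 1 / (1 + A)"
  have r: "0 < r" "r \<le> 1" using A0 by (auto simp: r_def)
  have C1: "C1 \<ge> 0" using A0 by (simp add: C1_def)
  have w0: "coeff ?w 0 = 0" by (simp add: coeff_log_poly)
  have w1: "coeff ?w 1 = 0" by (simp add: coeff_log_poly log_mgf_odd)
  have "\<exists>\<rho>. complex_of_real (phi s) = exp (poly ?w (\<i> * s)) * (1 + \<rho>) \<and> norm (\<rho> - sing_term s) \<le> C * \<bar>s\<bar> ^ N"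
    if s: "\<bar>s\<bar> \<le> r" for s
  proof -
    let ?t = "\<i> * complex_of_real s" and ?W = "poly ?w (\<i> * complex_of_real s)"
    have s1: "\<bar>s\<bar> \<le> 1" using s r by simp
    have nt: "norm ?t = \<bar>s\<bar>" by (simp add: norm_mult)
    have "\<bar>s\<bar> * (1 + A) \<le> 1" using s A0 by (simp add: r_def field_simps)
    then have sA: "\<bar>s\<bar> * A \<le> 1" using mult_left_mono[of A "1 + A" "\<bar>s\<bar>"] by simp
    have tr: "norm (exp ?W - (\<Sum>m<N. complex_of_real (fps_nth mgf m) * ?t ^ m)) \<le> C1 * \<bar>s\<bar> ^ N"
    proof -
      have "(\<Sum>m<N. (\<Sum>k\<le>N. coeff (?w ^ k) m / fact k) * ?t ^ m) = (\<Sum>m<N. complex_of_real (fps_nth mgf m) * ?t ^ m)"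
        unfolding log_poly_def by (intro sum.cong refl) (simp add: exp_formal_log_coeff[OF mgf_0])
      then show ?thesis
        using exp_poly_truncation(2)[OF w0, of ?t N] s1 sA unfolding nt by (simp add: C1_def A_def mult_ac)
    qed
    have W2: "norm ?W \<le> A * \<bar>s\<bar>\<^sup>2"
      using poly_truncation[of ?t ?w 2] s1 w0 w1 unfolding nt by (simp add: A_def numeral_2_eq_2 mult_ac)
    have W1: "norm ?W \<le> 1"
      using exp_poly_truncation(1)[OF w0, of ?t] s1 sA unfolding nt by (simp add: A_def)
    have em: "norm (exp (- ?W)) \<le> 3"
      using order_trans[OF norm_exp, of "- ?W" 3] order_trans[OF _ exp_le, of "exp (norm ?W)"] W1 by simp
    have em1: "norm (exp (- ?W) - 1) \<le> 3 * (A * \<bar>s\<bar>\<^sup>2)"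
      using exp_minus_one_bound[of "- ?W"] W1 W2 by simp
    have d: "norm (of_real (phi s) - exp ?W - sing_term s) \<le> (C0 + C1) * \<bar>s\<bar> ^ N"
    proof -
      have "norm (complex_of_real (phi s) - of_real (\<Sum>k<N. cos_coeff k * s ^ k * moment k) - sing_term s) \<le> C0 * \<bar>s\<bar> ^ N"
        unfolding sing_term_def of_real_diff[symmetric] norm_of_real by (rule C0(2))
      then show ?thesis
        using tr norm_triangle_ineq4[of "complex_of_real (phi s) - of_real (\<Sum>k<N. cos_coeff k * s ^ k * moment k) - sing_term s"
          "exp ?W - of_real (\<Sum>k<N. cos_coeff k * s ^ k * moment k)"]
        unfolding taylor_phi_eq by (simp add: algebra_simps)
    qed
    define \<rho> where "\<rho> = complex_of_real (phi s) * exp (- ?W) - 1"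
    have ee: "exp ?W * exp (- ?W) = 1" by (simp add: exp_minus)
    have 1: "complex_of_real (phi s) = exp ?W * (1 + \<rho>)"
      using ee by (simp add: \<rho>_def algebra_simps)
    have eq: "\<rho> - sing_term s = (of_real (phi s) - exp ?W - sing_term s) * exp (- ?W) + sing_term s * (exp (- ?W) - 1)"
      using ee by (simp add: \<rho>_def algebra_simps)
    have "norm (\<rho> - sing_term s) \<le> (C0 + C1) * \<bar>s\<bar> ^ N * 3 + \<bar>sing\<bar> * \<bar>s\<bar> powr \<alpha> * (3 * (A * \<bar>s\<bar>\<^sup>2))"
      unfolding eq
    proof (rule order_trans[OF norm_triangle_ineq add_mono])
      show "norm ((of_real (phi s) - exp ?W - sing_term s) * exp (- ?W)) \<le> (C0 + C1) * \<bar>s\<bar> ^ N * 3"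
        unfolding norm_mult using C0(1) C1 by (intro mult_mono d em) auto
      show "norm (sing_term s * (exp (- ?W) - 1)) \<le> \<bar>sing\<bar> * \<bar>s\<bar> powr \<alpha> * (3 * (A * \<bar>s\<bar>\<^sup>2))"
        unfolding norm_mult norm_sing_term by (intro mult_left_mono em1) auto
    qed
    also have "\<bar>sing\<bar> * \<bar>s\<bar> powr \<alpha> * (3 * (A * \<bar>s\<bar>\<^sup>2)) \<le> 3 * A * \<bar>sing\<bar> * \<bar>s\<bar> ^ N"
    proof -
      \<comment> \<open>Here \<open>N\<close> being the next even number above \<alpha> matters:
        \<alpha> + 2 exceeds \<open>N\<close>.\<close>
      have "\<bar>s\<bar> powr \<alpha> * \<bar>s\<bar>\<^sup>2 \<le> \<bar>s\<bar> ^ N"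
      proof (cases "s = 0")
        case False
        have "\<bar>s\<bar> powr \<alpha> * \<bar>s\<bar>\<^sup>2 = \<bar>s\<bar> powr (\<alpha> + 2)" using False by (simp add: powr_add)
        also have "\<dots> \<le> \<bar>s\<bar> powr real N" using False s1 N_bounds by (intro powr_mono') auto
        finally show ?thesis using False by (simp add: powr_realpow)
      qed simp
      then have "(3 * A * \<bar>sing\<bar>) * (\<bar>s\<bar> powr \<alpha> * \<bar>s\<bar>\<^sup>2) \<le> (3 * A * \<bar>sing\<bar>) * \<bar>s\<bar> ^ N"
        using A0 by (intro mult_left_mono) auto
      then show ?thesis by (simp add: mult_ac)
    qed
    also have "(C0 + C1) * \<bar>s\<bar> ^ N * 3 + 3 * A * \<bar>sing\<bar> * \<bar>s\<bar> ^ N \<le> C * \<bar>s\<bar> ^ N"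
    proof -
      have "p * u * 3 + q * u \<le> (1 + 3 * p + q) * u" if "u \<ge> 0" for p q u :: real
        using that by (simp add: algebra_simps)
      then show ?thesis unfolding C_def by this simp
    qed
    finally have "norm (\<rho> - sing_term s) \<le> C * \<bar>s\<bar> ^ N" by simp
    with 1 show ?thesis by (intro exI[of _ \<rho>] conjI)
  qed
  moreover have "C \<ge> 1" using A0 C0 C1 by (simp add: C_def)
  ultimately show ?thesis using r by blast
qed

definition edgeworth_exponent :: "real \<Rightarrow> complex poly" where "edgeworth_exponent \<theta> = cumulant_poly kappa (N - 1) \<theta>"

text \<open>Unit variance makes the quadratic term -\<theta>^2 / 2. After t^2 is factored out the
  l-th cumulant carries t^(l-2), exactly as in \<open>edgeworth_xi\<close>; with n t^2 = 1 the n-th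
  power removes the factor.\<close>

lemma log_poly_scale:
  assumes "t > 0"
  shows "poly log_poly (\<i> * of_real (\<theta> * t)) = of_real (t\<^sup>2) * (of_real (- \<theta>\<^sup>2 / 2) + poly (edgeworth_exponent \<theta>) (of_real t))"
proof -
  let ?L = "\<lambda>l. complex_of_real (fps_nth (formal_log mgf) l) * (\<i> * of_real \<theta>) ^ l"
  have "poly log_poly (\<i> * of_real (\<theta> * t)) = (\<Sum>l<N. ?L l * of_real t ^ l)"
    by (simp add: log_poly_def poly_sum poly_monom power_mult_distrib mult_ac)
  also have "{..<N} = {0, 1, 2} \<union> {3..N - 1}" using N_ge_4 by auto
  also have "(\<Sum>l\<in>{0, 1, 2} \<union> {3..N - 1}. ?L l * of_real t ^ l) = (\<Sum>l\<in>{0, 1, 2}. ?L l * of_real t ^ l) + (\<Sum>l=3..N - 1. ?L l * of_real t ^ l)"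
    by (rule sum.union_disjoint) auto
  also have "(\<Sum>l\<in>{0, 1, 2}. ?L l * of_real t ^ l) = of_real (t\<^sup>2) * of_real (- \<theta>\<^sup>2 / 2)"
    using log_mgf_odd[of 1] by (simp add: log_mgf_2 power_mult_distrib)
  also have "(\<Sum>l=3..N - 1. ?L l * of_real t ^ l) = of_real (t\<^sup>2) * poly (edgeworth_exponent \<theta>) (of_real t)"
  proof -
    have "of_real (t\<^sup>2) * poly (edgeworth_exponent \<theta>) (of_real t) = (\<Sum>l=3..N - 1. of_real (t\<^sup>2) * (?L l * of_real t ^ (l - 2)))"
      by (simp add: edgeworth_exponent_def cumulant_poly_def poly_sum poly_monom sum_distrib_left kappa_def)
    also have "\<dots> = (\<Sum>l=3..N - 1. ?L l * of_real t ^ l)"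
    proof (rule sum.cong[OF refl])
      fix l assume "l \<in> {3..N - 1}"
      then have "2 + (l - 2) = l" by (intro le_add_diff_inverse) auto
      then have "of_real t ^ l = complex_of_real t ^ (2 + (l - 2))" by (simp only:)
      then have "of_real t ^ l = (of_real t)\<^sup>2 * complex_of_real t ^ (l - 2)"
        by (simp only: power_add)
      then show "of_real (t\<^sup>2) * (?L l * of_real t ^ (l - 2)) = ?L l * of_real t ^ l" by simp
    qed
    finally show ?thesis by simp
  qed
  finally show ?thesis by (simp only: distrib_left)
qed

lemma poly_l1_edgeworth_exponent: "\<exists>C\<ge>0. \<forall>\<theta> B. \<bar>\<theta>\<bar> \<le> B \<longrightarrow> 1 \<le> B \<longrightarrow> poly_l1 (edgeworth_exponent \<theta>) \<le> C * B ^ N"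
proof -
  define C where "C = (\<Sum>l=3..N - 1. \<bar>kappa l\<bar>)"
  have "poly_l1 (edgeworth_exponent \<theta>) \<le> C * B ^ N" if B: "\<bar>\<theta>\<bar> \<le> B" "1 \<le> B" for \<theta> B
  proof -
    have "poly_l1 (edgeworth_exponent \<theta>) \<le> (\<Sum>l=3..N - 1. \<bar>kappa l\<bar> * B ^ N)"
      unfolding edgeworth_exponent_def cumulant_poly_def
    proof (rule order_trans[OF poly_l1_sum sum_mono])
      fix l assume l: "l \<in> {3..N - 1}"
      have "\<bar>\<theta>\<bar> ^ l \<le> B ^ l" using B by (intro power_mono) auto
      also have "\<dots> \<le> B ^ N" using B l by (intro power_increasing) auto
      finally have "\<bar>kappa l\<bar> * \<bar>\<theta>\<bar> ^ l / fact l \<le> \<bar>kappa l\<bar> * B ^ N / 1"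
        using B by (intro frac_le mult_left_mono) (auto simp: fact_ge_1)
      then show "poly_l1 (monom (of_real (kappa l) * (\<i> * of_real \<theta>) ^ l / fact l) (l - 2)) \<le> \<bar>kappa l\<bar> * B ^ N"
        by (simp add: poly_l1_monom norm_mult norm_divide norm_power)
    qed
    then show ?thesis by (simp add: C_def sum_distrib_right)
  qed
  then show ?thesis by (intro exI[of _ C]) (auto simp: C_def sum_nonneg)
qed

definition orders :: "nat set" where "orders = {j. 3 \<le> j \<and> real j < \<alpha> \<and> even j}"

lemma orders_eq: "orders = {j. 3 \<le> j \<and> j < N \<and> even j}"
proof -
  have "real j < \<alpha>" if "j < N" "even j" for j
  proof -
    have "j \<noteq> N - 1" using that N_even N_ge_4 by auto
    then have "j \<le> N - 2" using that by linarith
    then have "real j \<le> real N - 2" using N_ge_4 by linarith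
    then show ?thesis using N_bounds by linarith
  qed
  moreover have "j < N" if "real j < \<alpha>" for j using that N_bounds by linarith
  ultimately show ?thesis unfolding orders_def by blast
qed

definition edge_sum :: "real \<Rightarrow> real \<Rightarrow> complex" where
  "edge_sum t \<theta> = 1 + (\<Sum>j\<in>orders. edgeworth_poly kappa j \<theta> * of_real t ^ (j - 2))"

text \<open>The shift m = j - 2 matches powers of t with Edgeworth orders. Odd m drop out because
  odd cumulants vanish, and the even orders below \<open>N\<close> are exactly those below
  \<alpha>.\<close>

lemma edge_sum_coeff:
  "(\<Sum>m<N - 2. (\<Sum>k\<le>N - 2. coeff (edgeworth_exponent \<theta> ^ k) m / fact k) * of_real t ^ m) = edge_sum t \<theta>"
proof -
  let ?c = "\<lambda>m. (\<Sum>k\<le>N - 2. coeff (edgeworth_exponent \<theta> ^ k) m / fact k)"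
  have odd0: "?c m = 0" if "odd m" for m
  proof (rule sum.neutral, rule ballI)
    fix k
    have "coeff (edgeworth_exponent \<theta>) i = 0" if "odd i" for i
      unfolding edgeworth_exponent_def coeff_cumulant_poly using that log_mgf_odd[of "i + 2"] by (simp add: kappa_def)
    from coeff_power_odd[OF this \<open>odd m\<close>] show "coeff (edgeworth_exponent \<theta> ^ k) m / fact k = 0" by simp
  qed
  have "{..<N - 2} = insert 0 {1..<N - 2}" using N_ge_4 by auto
  then have "(\<Sum>m<N - 2. ?c m * of_real t ^ m) = ?c 0 + (\<Sum>m\<in>{1..<N - 2}. ?c m * of_real t ^ m)" by simp
  also have "?c 0 = 1" by (rule exp_coeff_0) (simp add: edgeworth_exponent_def coeff_cumulant_poly)
  also have "(\<Sum>m\<in>{1..<N - 2}. ?c m * of_real t ^ m) = (\<Sum>j\<in>{3..<N}. ?c (j - 2) * of_real t ^ (j - 2))"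
    by (rule sum.reindex_bij_witness[where i="\<lambda>j. j - 2" and j="\<lambda>m. m + 2"]) auto
  also have "\<dots> = (\<Sum>j\<in>orders. ?c (j - 2) * of_real t ^ (j - 2))"
  proof (rule sum.mono_neutral_right)
    show "\<forall>j\<in>{3..<N} - orders. ?c (j - 2) * complex_of_real t ^ (j - 2) = 0"
      using odd0 by (auto simp: orders_eq)
  qed (auto simp: orders_eq)
  also have "\<dots> = (\<Sum>j\<in>orders. edgeworth_poly kappa j \<theta> * of_real t ^ (j - 2))"
    unfolding edgeworth_exponent_def by (intro sum.cong refl) (subst edgeworth_poly_coeff, auto simp: orders_eq)
  finally show ?thesis by (simp add: edge_sum_def)
qed

text \<open>The three entries limit the saving beyond t^(\<alpha>-2): N - \<alpha> from the Taylor
  remainder t^(N-2), 1 from the singular term times the first Edgeworth correction, and \<alpha> - 2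
  from the square of the singular term.\<close>

definition gain :: real where "gain = min (real N - \<alpha>) (min 1 (\<alpha> - 2))"

lemma gain: "0 < gain" "gain \<le> real N - \<alpha>" "gain \<le> 1" "gain \<le> \<alpha> - 2"
  using N_bounds alpha_gt_2 by (auto simp: gain_def)

definition fourier_expansion :: "real \<Rightarrow> real \<Rightarrow> complex" where
  "fourier_expansion t \<theta> = edge_sum t \<theta> + sing_term \<theta> * of_real (t powr (\<alpha> - 2))"

text \<open>The n-th power equals exp (- \<theta>^2 / 2) times X times Y, where X exponentiates the
  higher cumulants and Y = (1 + \<rho>)^n. X is compared with \<open>edge_sum\<close>, and Y with 1
  plus the singular term. The window \<open>B\<close> stays free so that it can later grow with
  n.\<close>

lemma central_expansion:
  "\<exists>C\<ge>1. \<forall>n \<theta> B. 1 \<le> n \<longrightarrow> 1 \<le> B \<longrightarrow> \<bar>\<theta>\<bar> \<le> B \<longrightarrow> C * B ^ N * (1 / sqrt (real n)) powr gain \<le> 1 \<longrightarrow>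
    norm (of_real (phi (\<theta> / sqrt (real n)) ^ n) - of_real (exp (- \<theta>\<^sup>2 / 2)) * fourier_expansion (1 / sqrt (real n)) \<theta>)
      \<le> exp (- \<theta>\<^sup>2 / 2) * (C * B ^ (N * N) * (1 / sqrt (real n)) powr (\<alpha> - 2 + gain))"
proof -
  obtain C0 r where C0: "1 \<le> C0" and r: "0 < r" "r \<le> 1" and fac: "\<And>s. \<bar>s\<bar> \<le> r \<Longrightarrow>
     \<exists>\<rho>. complex_of_real (phi s) = exp (poly log_poly (\<i> * s)) * (1 + \<rho>) \<and> norm (\<rho> - sing_term s) \<le> C0 * \<bar>s\<bar> ^ N"
    using phi_factor by blast
  obtain CV where CV: "CV \<ge> 0" "\<And>\<theta> B. \<bar>\<theta>\<bar> \<le> B \<Longrightarrow> 1 \<le> B \<Longrightarrow> poly_l1 (edgeworth_exponent \<theta>) \<le> CV * B ^ N"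
    using poly_l1_edgeworth_exponent by blast
  define S where "S = \<bar>sing\<bar> + C0"
  have S: "S \<ge> 1" "\<bar>sing\<bar> \<le> S" "C0 \<le> S" using C0 by (auto simp: S_def)
  define C1 where "C1 = 4 * (1 + CV) ^ (N - 1)"
  have C1: "C1 \<ge> 0" using CV by (simp add: C1_def)
  \<comment> \<open>The first three summands make the single smallness condition imply \<bar>s\<bar>
    \<le> r, t times the coefficient norm at most 1, and n times norm \<rho> at most 1. The other
    summands are the coefficients of the four error terms.\<close>
  define C where "C = 1 / r + CV + S + C1 + 3 * CV * S + 3 * S + 3 * S\<^sup>2"
  have "norm (of_real (phi (\<theta> / sqrt (real n)) ^ n) - of_real (exp (- \<theta>\<^sup>2 / 2)) * fourier_expansion (1 / sqrt (real n)) \<theta>)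
      \<le> exp (- \<theta>\<^sup>2 / 2) * (C * B ^ (N * N) * (1 / sqrt (real n)) powr (\<alpha> - 2 + gain))"
    if n: "1 \<le> n" and B: "1 \<le> B" "\<bar>\<theta>\<bar> \<le> B" and small: "C * B ^ N * (1 / sqrt (real n)) powr gain \<le> 1" for n \<theta> B
  proof -
    define t where "t = 1 / sqrt (real n)"
    have t: "0 < t" "t \<le> 1" using n by (auto simp: t_def)
    have nt: "real n * t\<^sup>2 = 1" using n by (simp add: t_def power_divide)
    define b where "b = B ^ N"
    have b: "b \<ge> 1" "B \<le> b" using B N_ge_4 self_le_power[of B N] by (auto simp: b_def)
    define \<tau> where "\<tau> = t powr (\<alpha> - 2 + gain)"
    have tg: "t \<le> t powr gain" "t powr (\<alpha> - 2) \<le> t powr gain"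
      using t gain powr_mono'[of gain 1 t] by (auto intro!: powr_mono')
    have bt: "b * t powr gain * k \<le> 1" if "0 \<le> k" "k \<le> C" for k
    proof -
      have "b * t powr gain * k \<le> b * t powr gain * C" using that b by (intro mult_left_mono) auto
      then show ?thesis using small by (simp add: b_def t_def mult_ac)
    qed
    have rest: "0 \<le> 1 / r" "0 \<le> CV" "0 \<le> S" "0 \<le> C1" "0 \<le> 3 * CV * S" "0 \<le> 3 * S\<^sup>2"
      using r CV S C1 by auto
    define s where "s = \<theta> * t"
    have sbt: "\<bar>s\<bar> \<le> b * t powr gain"
      using B b t tg by (auto simp: s_def abs_mult intro!: mult_mono)
    have "b * t powr gain * (1 / r) \<le> 1" by (rule bt) (use rest in \<open>auto simp: C_def\<close>)
    then have sr: "\<bar>s\<bar> \<le> r" using sbt r by (simp add: divide_le_eq)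
    have s1: "\<bar>s\<bar> \<le> 1" using sr r by simp
    from fac[OF sr] obtain \<rho> where \<rho>: "complex_of_real (phi s) = exp (poly log_poly (\<i> * s)) * (1 + \<rho>)"
      "norm (\<rho> - sing_term s) \<le> C0 * \<bar>s\<bar> ^ N" by blast
    have \<theta>\<alpha>: "\<bar>\<theta>\<bar> powr \<alpha> \<le> b"
    proof -
      have "\<bar>\<theta>\<bar> powr \<alpha> \<le> B powr \<alpha>" using B alpha_gt_2 by (intro powr_mono2) auto
      also have "\<dots> \<le> B powr real N" using B N_bounds by (intro powr_mono) auto
      finally show ?thesis using B by (simp add: b_def powr_realpow)
    qed
    have \<theta>N: "\<bar>\<theta>\<bar> ^ N \<le> b" unfolding b_def using B by (intro power_mono) auto
    have s\<alpha>: "real n * \<bar>s\<bar> powr \<alpha> = \<bar>\<theta>\<bar> powr \<alpha> * t powr (\<alpha> - 2)"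
    proof -
      have "\<bar>s\<bar> powr \<alpha> = \<bar>\<theta>\<bar> powr \<alpha> * t powr (\<alpha> - 2) * t\<^sup>2"
        using t by (simp add: s_def abs_mult powr_mult mult.assoc powr_diff)
      then show ?thesis using nt by (simp add: mult_ac)
    qed
    have sN: "real n * \<bar>s\<bar> ^ N = \<bar>\<theta>\<bar> ^ N * t ^ (N - 2)"
    proof -
      have "2 + (N - 2) = N" using N_ge_4 by simp
      then have "t ^ N = t\<^sup>2 * t ^ (N - 2)" by (metis power_add)
      then have "\<bar>s\<bar> ^ N = \<bar>\<theta>\<bar> ^ N * t ^ (N - 2) * t\<^sup>2"
        using t by (simp add: s_def abs_mult power_mult_distrib mult_ac)
      then show ?thesis using nt by (simp add: mult_ac)
    qed
    define u where "u = sing_term \<theta> * of_real (t powr (\<alpha> - 2))"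
    have u: "of_nat n * sing_term s = u"
    proof -
      have "of_nat n * sing_term s = complex_of_real (sing * (real n * \<bar>s\<bar> powr \<alpha>))" by (simp add: sing_term_def)
      also have "\<dots> = u" unfolding s\<alpha> u_def sing_term_def by simp
      finally show ?thesis .
    qed
    have nu: "norm u \<le> S * (b * t powr (\<alpha> - 2))"
    proof -
      have "norm u = \<bar>sing\<bar> * (\<bar>\<theta>\<bar> powr \<alpha> * t powr (\<alpha> - 2))"
        by (simp add: u_def norm_mult norm_sing_term)
      also have "\<dots> \<le> S * (b * t powr (\<alpha> - 2))"
        using S \<theta>\<alpha> b by (intro mult_mono mult_right_mono) auto
      finally show ?thesis .
    qed
    have n\<rho>: "norm (of_nat n * \<rho> - u) \<le> S * (b * t ^ (N - 2))"
    proof -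
      have "norm (of_nat n * \<rho> - u) = real n * norm (\<rho> - sing_term s)"
        unfolding u[symmetric] by (simp add: right_diff_distrib[symmetric] norm_mult)
      also have "\<dots> \<le> real n * (C0 * \<bar>s\<bar> ^ N)" using \<rho>(2) by (intro mult_left_mono) auto
      also have "\<dots> = C0 * (\<bar>\<theta>\<bar> ^ N * t ^ (N - 2))" using sN by simp
      also have "\<dots> \<le> S * (b * t ^ (N - 2))"
        using S C0 \<theta>N b t by (intro mult_mono mult_right_mono) auto
      finally show ?thesis .
    qed
    have n\<rho>': "real n * norm \<rho> \<le> S * (b * t powr (\<alpha> - 2))"
    proof -
      have "norm \<rho> \<le> C0 * \<bar>s\<bar> ^ N + \<bar>sing\<bar> * \<bar>s\<bar> powr \<alpha>"
        using \<rho>(2) norm_triangle_ineq[of "\<rho> - sing_term s" "sing_term s"] by (simp add: norm_sing_term)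
      also have "\<dots> \<le> C0 * \<bar>s\<bar> powr \<alpha> + \<bar>sing\<bar> * \<bar>s\<bar> powr \<alpha>"
        using power_N_le_powr[OF s1] C0 by simp
      also have "\<dots> = S * \<bar>s\<bar> powr \<alpha>" by (simp add: S_def distrib_right)
      finally have "real n * norm \<rho> \<le> real n * (S * \<bar>s\<bar> powr \<alpha>)" by (intro mult_left_mono) auto
      also have "\<dots> = S * (\<bar>\<theta>\<bar> powr \<alpha> * t powr (\<alpha> - 2))" using s\<alpha> by simp
      also have "\<dots> \<le> S * (b * t powr (\<alpha> - 2))"
        using S \<theta>\<alpha> by (intro mult_left_mono mult_right_mono) auto
      finally show ?thesis .
    qed
    have "S * (b * t powr (\<alpha> - 2)) \<le> S * (b * t powr gain)"
      using S b tg by (intro mult_left_mono) auto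
    also have "\<dots> = b * t powr gain * S" by simp
    also have "\<dots> \<le> 1" by (rule bt) (use rest in \<open>auto simp: C_def\<close>)
    finally have le1: "real n * norm \<rho> \<le> 1" using n\<rho>' by linarith
    define Y where "Y = (1 + \<rho>) ^ n"
    have Y: "norm (Y - 1 - of_nat n * \<rho>) \<le> (S * (b * t powr (\<alpha> - 2)))\<^sup>2"
      unfolding Y_def
      by (rule order_trans[OF one_add_power_error[OF le1]]) (intro power_mono n\<rho>', simp)
    let ?w = "edgeworth_exponent \<theta>" and ?t = "complex_of_real t"
    have lV: "poly_l1 ?w \<le> CV * b" unfolding b_def by (rule CV(2)[OF B(2,1)])
    have nt': "norm ?t = t" using t by simp
    have tl: "t * poly_l1 ?w \<le> 1"
    proof -
      have "t * poly_l1 ?w \<le> t powr gain * (CV * b)"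
        using t tg lV by (intro mult_mono poly_l1_nonneg) auto
      also have "\<dots> = b * t powr gain * CV" by simp
      also have "\<dots> \<le> 1" by (rule bt) (use rest in \<open>auto simp: C_def\<close>)
      finally show ?thesis .
    qed
    have w0: "coeff ?w 0 = 0" by (simp add: edgeworth_exponent_def coeff_cumulant_poly)
    define X where "X = exp (poly ?w ?t)"
    have pw: "norm (poly ?w ?t) \<le> CV * b * t"
    proof -
      have "norm (poly ?w ?t) \<le> t * poly_l1 ?w"
        using exp_poly_truncation(1)[OF w0, of ?t] t tl unfolding nt' by simp
      also have "\<dots> \<le> t * (CV * b)" using t lV by (intro mult_left_mono) auto
      finally show ?thesis by (simp only: mult_ac)
    qed
    have pw1: "norm (poly ?w ?t) \<le> 1"
      using exp_poly_truncation(1)[OF w0, of ?t] t tl unfolding nt' by simp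
    have X3: "norm X \<le> 3"
      unfolding X_def using order_trans[OF norm_exp, of "poly ?w ?t" 3] order_trans[OF _ exp_le, of "exp (norm (poly ?w ?t))"] pw1 by simp
    have X1: "norm (X - 1) \<le> 3 * (CV * b * t)"
      unfolding X_def using exp_minus_one_bound[OF pw1] pw by simp
    have XS: "norm (X - edge_sum t \<theta>) \<le> C1 * b ^ (N - 1) * t ^ (N - 2)"
    proof -
      have "norm (X - edge_sum t \<theta>) \<le> 4 * t ^ (N - 2) * (1 + poly_l1 ?w) ^ Suc (N - 2)"
        using exp_poly_truncation(2)[OF w0, of ?t "N - 2"] t tl unfolding nt' edge_sum_coeff X_def by simp
      also have "\<dots> \<le> 4 * t ^ (N - 2) * ((1 + CV) * b) ^ Suc (N - 2)"
      proof (intro mult_left_mono power_mono)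
        show "1 + poly_l1 ?w \<le> (1 + CV) * b" using lV b by (simp add: distrib_right)
      qed (use t poly_l1_nonneg[of ?w] in auto)
      also have "Suc (N - 2) = N - 1" using N_ge_4 by simp
      finally show ?thesis by (simp add: C1_def power_mult_distrib mult_ac)
    qed
    have main: "of_real (phi s ^ n) = of_real (exp (- \<theta>\<^sup>2 / 2)) * (X * Y)"
    proof -
      have "complex_of_real (phi s ^ n) = exp (poly log_poly (\<i> * s)) ^ n * Y"
        by (simp only: of_real_power \<rho>(1) power_mult_distrib Y_def)
      also have "exp (poly log_poly (\<i> * s)) ^ n = exp (of_nat n * poly log_poly (\<i> * s))"
        by (simp add: exp_of_nat_mult)
      also have "of_nat n * poly log_poly (\<i> * s) = of_real (real n * t\<^sup>2) * (of_real (- \<theta>\<^sup>2 / 2) + poly ?w ?t)"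
        unfolding s_def log_poly_scale[OF t(1)] by simp
      also have "exp \<dots> = of_real (exp (- \<theta>\<^sup>2 / 2)) * X"
        unfolding nt X_def by (simp only: of_real_1 mult_1 exp_add exp_of_real)
      finally show ?thesis by (simp only: mult.assoc)
    qed
    have "norm (X * Y - (edge_sum t \<theta> + u)) \<le> C * B ^ (N * N) * \<tau>"
    proof -
      \<comment> \<open>Four errors: truncating X, letting the singular term meet X - 1, replacing n
        \<rho> by its leading part, and linearising Y. Three of them fix the entries of
        \<open>gain\<close>; the third is again of order t^(N-2).\<close>
      have split: "X * Y - (edge_sum t \<theta> + u) = (X - edge_sum t \<theta>) + (X - 1) * u + X * (of_nat n * \<rho> - u) + X * (Y - 1 - of_nat n * \<rho>)"
        by (simp add: algebra_simps)
      define \<beta> where "\<beta> = B ^ (N * N)"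
      have bk: "b ^ k \<le> \<beta>" if "k \<le> N" for k
        unfolding \<beta>_def b_def power_mult[symmetric] using B that by (intro power_increasing) auto
      have bb: "b \<le> \<beta>" "b\<^sup>2 \<le> \<beta>" "b ^ (N - 1) \<le> \<beta>" using bk[of 1] bk[of 2] bk[of "N - 1"] N_ge_4 by auto
      have tN: "t ^ (N - 2) \<le> \<tau>"
      proof -
        have "t ^ (N - 2) = t powr (real N - 2)" using t N_ge_4 by (simp add: powr_realpow[symmetric] of_nat_diff)
        also have "\<dots> \<le> \<tau>" unfolding \<tau>_def using t gain by (intro powr_mono') auto
        finally show ?thesis .
      qed
      have t1: "t * t powr (\<alpha> - 2) \<le> \<tau>"
      proof -
        have "t * t powr (\<alpha> - 2) = t powr (1 + (\<alpha> - 2))" using t by (simp only: powr_add) simp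
        also have "\<dots> \<le> \<tau>" unfolding \<tau>_def using t gain by (intro powr_mono') auto
        finally show ?thesis .
      qed
      have t2: "(t powr (\<alpha> - 2))\<^sup>2 \<le> \<tau>"
      proof -
        have "(t powr (\<alpha> - 2))\<^sup>2 = t powr ((\<alpha> - 2) + (\<alpha> - 2))" by (simp only: powr_add power2_eq_square)
        also have "\<dots> \<le> \<tau>" unfolding \<tau>_def using t gain by (intro powr_mono') auto
        finally show ?thesis .
      qed
      have \<tau>0: "\<tau> \<ge> 0" by (simp add: \<tau>_def)
      have \<beta>0: "\<beta> \<ge> 0" using B by (simp add: \<beta>_def)
      have b1: "norm (X - edge_sum t \<theta>) \<le> C1 * (\<beta> * \<tau>)"
      proof (rule order_trans[OF XS])
        show "C1 * b ^ (N - 1) * t ^ (N - 2) \<le> C1 * (\<beta> * \<tau>)"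
          unfolding mult.assoc using C1 bb tN t b \<beta>0 by (intro mult_left_mono mult_mono) auto
      qed
      have b2: "norm ((X - 1) * u) \<le> 3 * CV * S * (\<beta> * \<tau>)"
      proof -
        have "norm ((X - 1) * u) \<le> (3 * (CV * b * t)) * (S * (b * t powr (\<alpha> - 2)))"
          unfolding norm_mult using X1 nu CV b t by (intro mult_mono) auto
        also have "\<dots> = 3 * CV * S * (b\<^sup>2 * (t * t powr (\<alpha> - 2)))" by (simp add: power2_eq_square)
        also have "\<dots> \<le> 3 * CV * S * (\<beta> * \<tau>)"
          using rest bb t1 t \<beta>0 by (intro mult_left_mono mult_mono) auto
        finally show ?thesis .
      qed
      have b3: "norm (X * (of_nat n * \<rho> - u)) \<le> 3 * S * (\<beta> * \<tau>)"
      proof -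
        have "norm (X * (of_nat n * \<rho> - u)) \<le> 3 * (S * (b * t ^ (N - 2)))"
          unfolding norm_mult using X3 n\<rho> by (intro mult_mono) auto
        also have "\<dots> \<le> 3 * (S * (\<beta> * \<tau>))"
          using S bb tN t \<beta>0 by (intro mult_left_mono mult_mono) auto
        finally show ?thesis by simp
      qed
      have b4: "norm (X * (Y - 1 - of_nat n * \<rho>)) \<le> 3 * S\<^sup>2 * (\<beta> * \<tau>)"
      proof -
        have "norm (X * (Y - 1 - of_nat n * \<rho>)) \<le> 3 * (S * (b * t powr (\<alpha> - 2)))\<^sup>2"
          unfolding norm_mult using X3 Y by (intro mult_mono) auto
        also have "\<dots> = 3 * S\<^sup>2 * (b\<^sup>2 * (t powr (\<alpha> - 2))\<^sup>2)" by (simp add: power_mult_distrib)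
        also have "\<dots> \<le> 3 * S\<^sup>2 * (\<beta> * \<tau>)"
          using bb t2 \<beta>0 by (intro mult_left_mono mult_mono) auto
        finally show ?thesis .
      qed
      have "norm (X * Y - (edge_sum t \<theta> + u)) \<le> C1 * (\<beta> * \<tau>) + 3 * CV * S * (\<beta> * \<tau>) + 3 * S * (\<beta> * \<tau>) + 3 * S\<^sup>2 * (\<beta> * \<tau>)"
        unfolding split by (intro order_trans[OF norm_triangle_ineq] add_mono b1 b2 b3 b4)
      also have "\<dots> = (C1 + 3 * CV * S + 3 * S + 3 * S\<^sup>2) * (\<beta> * \<tau>)" by (simp only: distrib_right)
      also have "\<dots> \<le> C * (\<beta> * \<tau>)"
        using rest \<beta>0 \<tau>0 by (intro mult_right_mono) (auto simp: C_def)
      finally show ?thesis by (simp add: \<beta>_def mult.assoc)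
    qed
    then have fin: "exp (- \<theta>\<^sup>2 / 2) * norm (X * Y - (edge_sum t \<theta> + u)) \<le> exp (- \<theta>\<^sup>2 / 2) * (C * B ^ (N * N) * \<tau>)"
      by (intro mult_left_mono) auto
    have "of_real (phi s ^ n) - of_real (exp (- \<theta>\<^sup>2 / 2)) * fourier_expansion t \<theta> = of_real (exp (- \<theta>\<^sup>2 / 2)) * (X * Y - (edge_sum t \<theta> + u))"
      by (simp only: main fourier_expansion_def u_def right_diff_distrib)
    then have "norm (of_real (phi s ^ n) - of_real (exp (- \<theta>\<^sup>2 / 2)) * fourier_expansion t \<theta>) = exp (- \<theta>\<^sup>2 / 2) * norm (X * Y - (edge_sum t \<theta> + u))"
      by (simp only: norm_mult norm_of_real abs_exp_cancel)
    with fin show ?thesis by (simp add: t_def s_def \<tau>_def)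
  qed
  moreover have "C \<ge> 1"
  proof -
    have "1 / r \<ge> 1" using r by simp
    moreover have "0 \<le> CV * S" "0 \<le> S\<^sup>2" using CV S by auto
    ultimately show ?thesis unfolding C_def using CV(1) S(1) C1 by linarith
  qed
  ultimately show ?thesis by blast
qed

end

section \<open>The error of the Fourier expansion\<close>

lemma open_AE_empty:
  fixes U :: "real set"
  assumes "open U" "AE x in lborel. x \<notin> U"
  shows "U = {}"
proof (rule ccontr)
  assume "U \<noteq> {}"
  then obtain x where "x \<in> U" by blast
  with assms(1) obtain e where e: "e > 0" "ball x e \<subseteq> U" by (auto simp: open_contains_ball)
  have "AE y in lborel. y \<notin> {x - e<..<x + e}"
    using assms(2) by eventually_elim (use e in \<open>auto simp: ball_def dist_real_def subset_iff abs_if\<close>)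
  then have "emeasure lborel {x - e<..<x + e} = 0"
    by (subst (asm) AE_iff_measurable[of "{x - e<..<x + e}"]) auto
  then show False using e(1) by simp
qed

lemma gauss8_integrable: "integrable lborel (\<lambda>\<theta>::real. exp (- \<theta>\<^sup>2 / 8))"
proof -
  have "integrable lborel (\<lambda>\<theta>::real. sqrt (2 * pi * 2\<^sup>2) * normal_density 0 2 \<theta>)"
    by (intro integrable_mult_right) simp
  then show ?thesis by (simp add: normal_density_def)
qed

lemma gauss_tail_le:
  fixes \<theta> B :: real
  assumes "\<bar>\<theta>\<bar> > B" "B \<ge> 0"
  shows "exp (- \<theta>\<^sup>2 / 4) \<le> exp (- B\<^sup>2 / 8) * exp (- \<theta>\<^sup>2 / 8)"
proof -
  have "B\<^sup>2 \<le> \<theta>\<^sup>2" using assms by (simp add: abs_le_square_iff[symmetric])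
  then show ?thesis by (simp add: exp_add[symmetric])
qed

section \<open>Decay of the characteristic function and the integrated error\<close>

context pareto_order
begin

lemma phi_le_1: "\<bar>phi s\<bar> \<le> 1"
proof -
  have "\<bar>phi s\<bar> \<le> (LINT x|lborel. f x)"
    unfolding phi_def
    by (rule integral_abs_bound_integral[OF f_cos_integrable f_integrable]) (simp add: abs_mult f_nonneg mult_left_le)
  then show ?thesis by (simp add: f_integral)
qed

lemma phi_continuous: "continuous_on UNIV phi"
proof -
  define L where "L = (LINT x|lborel. \<bar>f x * x\<bar>)"
  have i: "integrable lborel (\<lambda>x. \<bar>f x * x\<bar>)"
    using f_power_integrable[of 1] N_ge_4 by simp
  have "dist (phi s) (phi s') \<le> L * dist s s'" for s s'
  proof -
    have "phi s - phi s' = (LINT x|lborel. f x * cos (s * x) - f x * cos (s' * x))"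
      using f_cos_integrable by (simp add: phi_def)
    also have "\<bar>\<dots>\<bar> \<le> (LINT x|lborel. \<bar>s - s'\<bar> * \<bar>f x * x\<bar>)"
    proof (rule integral_abs_bound_integral)
      show "integrable lborel (\<lambda>x. f x * cos (s * x) - f x * cos (s' * x))"
        by (intro Bochner_Integration.integrable_diff f_cos_integrable)
      show "integrable lborel (\<lambda>x. \<bar>s - s'\<bar> * \<bar>f x * x\<bar>)" by (intro integrable_mult_right i)
      fix x
      have "\<bar>cos (s * x) - cos (s' * x)\<bar> \<le> \<bar>s * x - s' * x\<bar>"
      proof -
        have "\<bar>cos (s * x) - cos (s' * x)\<bar> = 2 * (\<bar>sin ((s * x + s' * x) / 2)\<bar> * \<bar>sin ((s' * x - s * x) / 2)\<bar>)"
          by (simp add: cos_diff_cos abs_mult)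
        also have "\<dots> \<le> 2 * (1 * \<bar>(s' * x - s * x) / 2\<bar>)"
          by (intro mult_left_mono mult_mono abs_sin_x_le_abs_x) auto
        finally show ?thesis by simp
      qed
      then have "f x * \<bar>cos (s * x) - cos (s' * x)\<bar> \<le> f x * \<bar>s * x - s' * x\<bar>"
        by (rule mult_left_mono[OF _ f_nonneg])
      moreover have "\<bar>s * x - s' * x\<bar> = \<bar>s - s'\<bar> * \<bar>x\<bar>" by (simp add: abs_mult[symmetric] left_diff_distrib)
      moreover have "\<bar>f x * cos (s * x) - f x * cos (s' * x)\<bar> = f x * \<bar>cos (s * x) - cos (s' * x)\<bar>"
        unfolding right_diff_distrib[symmetric] abs_mult abs_of_nonneg[OF f_nonneg] ..
      moreover have "f x * (\<bar>s - s'\<bar> * \<bar>x\<bar>) = \<bar>s - s'\<bar> * \<bar>f x * x\<bar>"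
        unfolding abs_mult[of "f x"] abs_of_nonneg[OF f_nonneg] by (rule mult.left_commute)
      ultimately show "\<bar>f x * cos (s * x) - f x * cos (s' * x)\<bar> \<le> \<bar>s - s'\<bar> * \<bar>f x * x\<bar>"
        by simp
    qed
    finally show ?thesis by (simp add: L_def dist_real_def mult.commute)
  qed
  then have "L-lipschitz_on UNIV phi"
    by (intro lipschitz_onI) (auto simp: L_def intro!: integral_nonneg_AE)
  then show ?thesis by (rule lipschitz_on_continuous_on)
qed

lemma phi_measurable [measurable]: "phi \<in> borel_measurable borel"
  using phi_continuous by (rule borel_measurable_continuous_onI)

text \<open>If phi s were 1 or -1, a nonnegative continuous integrand with the positive weight f
  would vanish identically. Then 1 + \<sigma> cos (s x) is 0 both at x = 0 and at x = pi / s, which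
  is contradictory.\<close>

lemma phi_less_1:
  assumes "s \<noteq> 0" shows "\<bar>phi s\<bar> < 1"
proof -
  have pos: "(LINT x|lborel. f x * (1 + \<sigma> * cos (s * x))) \<noteq> 0" if "\<bar>\<sigma>\<bar> = 1" for \<sigma> :: real
  proof
    assume z: "(LINT x|lborel. f x * (1 + \<sigma> * cos (s * x))) = 0"
    have nn: "0 \<le> 1 + \<sigma> * cos u" for u
    proof -
      have "\<sigma> = 1 \<or> \<sigma> = -1" using that by linarith
      then show ?thesis
      proof
        assume "\<sigma> = 1"
        then have "1 + \<sigma> * cos u = 1 + cos u" by simp
        then show ?thesis using cos_ge_minus_one[of u] by linarith
      next
        assume "\<sigma> = -1"
        then have "1 + \<sigma> * cos u = 1 - cos u" by simp
        then show ?thesis using cos_le_one[of u] by linarith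
      qed
    qed
    have i: "integrable lborel (\<lambda>x. f x * (1 + \<sigma> * cos (s * x)))"
      using Bochner_Integration.integrable_add[OF f_integrable integrable_mult_right[OF f_cos_integrable, of \<sigma> s]]
      by (simp add: algebra_simps)
    have "AE x in lborel. f x * (1 + \<sigma> * cos (s * x)) = 0"
      using integral_nonneg_eq_0_iff_AE[OF i] z nn f_nonneg by simp
    then have "AE x in lborel. x \<notin> {x. 1 + \<sigma> * cos (s * x) \<noteq> 0}"
    proof eventually_elim
      fix x assume "f x * (1 + \<sigma> * cos (s * x)) = 0"
      moreover have "f x \<noteq> 0" using f_pos[of x] by simp
      ultimately show "x \<notin> {x. 1 + \<sigma> * cos (s * x) \<noteq> 0}" by simp
    qed
    moreover have "open {x. 1 + \<sigma> * cos (s * x) \<noteq> 0}"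
      by (intro open_Collect_neq continuous_intros)
    ultimately have "{x. 1 + \<sigma> * cos (s * x) \<noteq> 0} = {}" by (rule open_AE_empty[rotated])
    then have all: "1 + \<sigma> * cos (s * x) = 0" for x by auto
    have "1 + \<sigma> = 0" using all[of 0] by simp
    moreover have "1 - \<sigma> = 0" using all[of "pi / s"] assms by simp
    ultimately show False by simp
  qed
  have eq: "(LINT x|lborel. f x * (1 + \<sigma> * cos (s * x))) = 1 + \<sigma> * phi s" for \<sigma>
  proof -
    have "(LINT x|lborel. f x * (1 + \<sigma> * cos (s * x))) = (LINT x|lborel. f x + \<sigma> * (f x * cos (s * x)))"
      by (simp add: algebra_simps)
    also have "\<dots> = 1 + \<sigma> * phi s"
      by (subst Bochner_Integration.integral_add) (auto simp: f_integrable f_cos_integrable f_integral phi_def)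
    finally show ?thesis .
  qed
  have "phi s \<noteq> 1" "phi s \<noteq> -1" using pos[of "-1", unfolded eq] pos[of 1, unfolded eq] by auto
  then show ?thesis using phi_le_1[of s] by linarith
qed

lemma f_has_derivative:
  assumes "x > 0"
  shows "(f has_field_derivative - (a * (\<alpha> + 1) * x powr \<alpha> / (b + x powr (\<alpha> + 1))\<^sup>2)) (at x)"
proof -
  have p: "b + x powr (\<alpha> + 1) > 0" using b_pos by (simp add: add_pos_nonneg)
  have "((\<lambda>x. a / (b + x powr (\<alpha> + 1))) has_field_derivative - (a * (\<alpha> + 1) * x powr \<alpha> / (b + x powr (\<alpha> + 1))\<^sup>2)) (at x)"
    using assms p by (auto intro!: derivative_eq_intros simp: power2_eq_square)
  then show ?thesis
    by (rule DERIV_cong_ev[THEN iffD1, rotated -1])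
       (auto simp: f_def pareto_density_def intro!: eventually_mono[OF eventually_nhds_in_open[of "{0<..}" x]] assms)
qed

lemma f_tendsto_0: "(f \<longlongrightarrow> 0) at_top"
proof (rule Lim_null_comparison)
  show "\<forall>\<^sub>F x in at_top. norm (f x) \<le> a * x powr - (\<alpha> + 1)"
    using eventually_gt_at_top[of 0] by eventually_elim (use f_le_powr f_nonneg in \<open>auto simp del: minus_add_distrib\<close>, metis abs_of_pos f_le_powr less_irrefl)
  show "((\<lambda>x. a * x powr - (\<alpha> + 1)) \<longlongrightarrow> 0) at_top"
    using alpha_gt_2 by (intro tendsto_mult_right_zero tendsto_neg_powr filterlim_ident) auto
qed

text \<open>Integration by parts on the half line: f falls monotonically from a / b to 0, so the
  absolute value of its derivative integrates to a / b. Evenness accounts for the factor 2.\<close>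

lemma phi_decay:
  assumes "s \<noteq> 0" shows "\<bar>phi s\<bar> \<le> 2 * (a / b) / \<bar>s\<bar>"
proof -
  define h where "h = (\<lambda>x. a * (\<alpha> + 1) * x powr \<alpha> / (b + x powr (\<alpha> + 1))\<^sup>2)"
  have h0: "h x \<ge> 0" for x using a_pos alpha_gt_2 by (simp add: h_def)
  have p: "b + x powr (\<alpha> + 1) > 0" for x using b_pos by (simp add: add_pos_nonneg)
  have ch: "isCont h x" if "x > 0" for x
    unfolding h_def using that p[of x] by (intro continuous_intros) auto
  have df: "(f has_field_derivative - h x) (at x)" if "x > 0" for x
    using f_has_derivative[OF that] by (simp add: h_def)
  have f0: "(f \<longlongrightarrow> a / b) (at_right 0)"
  proof -
    have "((\<lambda>x. a / (b + \<bar>x\<bar> powr (\<alpha> + 1))) \<longlongrightarrow> a / (b + 0)) (at_right 0)"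
      using b_pos alpha_gt_2 by (intro tendsto_intros) (auto intro!: tendsto_eq_intros simp: eventually_at_filter)
    then show ?thesis by (simp add: f_def pareto_density_def[abs_def])
  qed
  have H: "set_integrable lborel (einterval 0 \<infinity>) h" "(LBINT x=0..\<infinity>. h x) = 0 - (- (a / b))"
  proof -
    have 1: "(((\<lambda>x. - f x) \<circ> real_of_ereal) \<longlongrightarrow> - (a / b)) (at_right 0)"
      unfolding zero_ereal_def ereal_tendsto_simps using f0 by (rule tendsto_minus)
    have 2: "(((\<lambda>x. - f x) \<circ> real_of_ereal) \<longlongrightarrow> 0) (at_left \<infinity>)"
      unfolding ereal_tendsto_simps using tendsto_minus[OF f_tendsto_0] by simp
    have 3: "((\<lambda>x. - f x) has_field_derivative h x) (at x)" if "0 < ereal x" for x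
      using DERIV_minus[OF df[of x]] that by (simp add: zero_ereal_def)
    have 4: "isCont h x" if "0 < ereal x" for x using ch that by (simp add: zero_ereal_def)
    show "set_integrable lborel (einterval 0 \<infinity>) h" "(LBINT x=0..\<infinity>. h x) = 0 - (- (a / b))"
      using interval_integral_FTC_nonneg[of 0 \<infinity> "\<lambda>x. - f x" h, OF _ 3 4 _ 1 2] h0 by auto
  qed
  have Hi: "set_integrable lborel {0<..} h" "(LBINT x:{0<..}. h x) = a / b"
    using H by (simp_all add: zero_ereal_def interval_lebesgue_integral_def)
  have Hs: "set_integrable lborel {0<..} (\<lambda>x. h x * sin (s * x) / s)"
  proof -
    have "integrable lborel (\<lambda>x. (indicator {0<..} x * h x) * sin (s * x))"
      by (rule Bochner_Integration.integrable_bound[OF Hi(1)[unfolded set_integrable_def]])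
         (use borel_measurable_integrable[OF Hi(1)[unfolded set_integrable_def]] in \<open>auto simp: abs_mult mult_left_le\<close>)
    from integrable_divide[OF this, of s] show ?thesis by (simp add: set_integrable_def mult.assoc)
  qed
  have fc: "set_integrable lborel {0<..} (\<lambda>x. f x * cos (s * x))"
    unfolding set_integrable_def by (rule integrable_mult_indicator[OF _ f_cos_integrable]) simp
  have "(LBINT x=0..\<infinity>. - (h x * sin (s * x) / s) + f x * cos (s * x)) = 0 - 0"
  proof (rule interval_integral_FTC_integrable[where F="\<lambda>x. f x * sin (s * x) / s"])
    fix x :: real assume "0 < ereal x"
    then have x: "x > 0" by (simp add: zero_ereal_def)
    have "((\<lambda>x. f x * (sin (s * x) / s)) has_field_derivative - h x * (sin (s * x) / s) + (cos (s * x)) * f x) (at x)"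
      by (rule DERIV_mult[OF df[OF x]]) (use assms in \<open>auto intro!: derivative_eq_intros\<close>)
    then show "((\<lambda>x. f x * sin (s * x) / s) has_vector_derivative - (h x * sin (s * x) / s) + f x * cos (s * x)) (at x)"
      unfolding has_real_derivative_iff_has_vector_derivative[symmetric] by (simp add: mult.commute)
    have "isCont f x" using df[OF x] by (rule DERIV_isCont)
    then show "isCont (\<lambda>x. - (h x * sin (s * x) / s) + f x * cos (s * x)) x"
      using ch[OF x] assms by (intro continuous_intros) auto
  next
    show "set_integrable lborel (einterval 0 \<infinity>) (\<lambda>x. - (h x * sin (s * x) / s) + f x * cos (s * x))"
      using set_integral_add(1)[OF set_integrable_mult_right[OF Hs, of "-1"] fc] by (simp add: zero_ereal_def)
    show "(((\<lambda>x. f x * sin (s * x) / s) \<circ> real_of_ereal) \<longlongrightarrow> 0) (at_right 0)"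
    proof -
      have "((\<lambda>x. f x * sin (s * x) / s) \<longlongrightarrow> a / b * sin (s * 0) / s) (at_right 0)"
        by (intro tendsto_intros f0 assms)
      then show ?thesis unfolding zero_ereal_def ereal_tendsto_simps by simp
    qed
    show "(((\<lambda>x. f x * sin (s * x) / s) \<circ> real_of_ereal) \<longlongrightarrow> 0) (at_left \<infinity>)"
      unfolding ereal_tendsto_simps
    proof (rule Lim_null_comparison)
      show "\<forall>\<^sub>F x in at_top. norm (f x * sin (s * x) / s) \<le> f x * (1 / \<bar>s\<bar>)"
        using f_nonneg by (intro always_eventually allI) (simp add: abs_mult divide_right_mono mult_left_le)
      show "((\<lambda>x. f x * (1 / \<bar>s\<bar>)) \<longlongrightarrow> 0) at_top" using tendsto_mult_left_zero[OF f_tendsto_0] .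
    qed
  qed simp
  then have "(LBINT x:{0<..}. (-1) * (h x * sin (s * x) / s) + f x * cos (s * x)) = 0"
    by (simp add: zero_ereal_def interval_lebesgue_integral_def)
  then have "(LBINT x:{0<..}. f x * cos (s * x)) = (LBINT x:{0<..}. h x * sin (s * x) / s)"
    by (subst (asm) set_integral_add(2)[OF set_integrable_mult_right[OF Hs] fc]) (simp add: set_lebesgue_integral_def)
  also have "\<bar>\<dots>\<bar> \<le> (LBINT x:{0<..}. h x * (1 / \<bar>s\<bar>))"
    unfolding set_lebesgue_integral_def
  proof (rule integral_abs_bound_integral)
    show "integrable lborel (\<lambda>x. indicator {0<..} x *\<^sub>R (h x * sin (s * x) / s))" using Hs by (simp add: set_integrable_def)
    show "integrable lborel (\<lambda>x. indicator {0<..} x *\<^sub>R (h x * (1 / \<bar>s\<bar>)))"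
      using set_integrable_mult_left[OF Hi(1), of "1 / \<bar>s\<bar>"] by (simp add: set_integrable_def)
    fix x
    have "\<bar>h x * sin (s * x) / s\<bar> \<le> h x * (1 / \<bar>s\<bar>)"
      using h0[of x] by (simp add: abs_mult divide_right_mono mult_left_le)
    then show "\<bar>indicator {0<..} x *\<^sub>R (h x * sin (s * x) / s)\<bar> \<le> indicator {0<..} x *\<^sub>R (h x * (1 / \<bar>s\<bar>))"
      by (simp add: indicator_def)
  qed
  also have "(LBINT x:{0<..}. h x * (1 / \<bar>s\<bar>)) = a / b * (1 / \<bar>s\<bar>)"
    unfolding Hi(2)[symmetric] by (rule set_integral_mult_left)
  finally have *: "\<bar>LBINT x:{0<..}. f x * cos (s * x)\<bar> \<le> a / b * (1 / \<bar>s\<bar>)" .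
  have "phi s = 2 * (LBINT x:{0..}. f x * cos (s * x))"
  proof -
    have "phi s = (LINT x|lborel. f \<bar>x\<bar> * cos (s * \<bar>x\<bar>))"
      unfolding phi_def by (intro Bochner_Integration.integral_cong) (auto simp: abs_if f_even)
    also have "\<dots> = 2 * (LBINT x:{0..}. f x * cos (s * x))"
    proof (rule integral_even(2))
      show "set_integrable lborel {0..} (\<lambda>x. f x * cos (s * x))"
        unfolding set_integrable_def by (rule integrable_mult_indicator[OF _ f_cos_integrable]) simp
    qed
    finally show ?thesis .
  qed
  also have "(LBINT x:{0..}. f x * cos (s * x)) = (LBINT x:{0<..}. f x * cos (s * x))"
    unfolding set_lebesgue_integral_def
    using AE_lborel_singleton[of "0::real"]
    by (intro integral_cong_AE) (auto elim!: eventually_mono simp: indicator_def)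
  finally show ?thesis using * by (simp add: abs_mult)
qed

text \<open>phi is 1 - s^2 / 2 up to order \<bar>s\<bar>^\<gamma> with \<gamma> > 2; giving up half
  of the quadratic term absorbs that error.\<close>

lemma phi_near_0: "\<exists>r>0. \<forall>s. \<bar>s\<bar> \<le> r \<longrightarrow> \<bar>phi s\<bar> \<le> exp (- s\<^sup>2 / 4)"
proof -
  obtain C where C: "C \<ge> 0" "\<And>s. \<bar>phi s - (\<Sum>k<N. cos_coeff k * s ^ k * moment k) - sing * \<bar>s\<bar> powr \<alpha>\<bar> \<le> C * \<bar>s\<bar> ^ N"
    using phi_expansion by blast
  define D1 where "D1 = (\<Sum>k=3..<N. \<bar>cos_coeff k * moment k\<bar>)"
  define D where "D = D1 + \<bar>sing\<bar> + C"
  have D: "D \<ge> 0" using C by (simp add: D_def D1_def sum_nonneg)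
  define \<gamma> where "\<gamma> = min 3 \<alpha>"
  have \<gamma>: "2 < \<gamma>" "\<gamma> \<le> 3" "\<gamma> \<le> \<alpha>" using alpha_gt_2 by (auto simp: \<gamma>_def)
  have q: "\<bar>phi s - (1 - s\<^sup>2 / 2)\<bar> \<le> D * \<bar>s\<bar> powr \<gamma>" if s: "\<bar>s\<bar> \<le> 1" "s \<noteq> 0" for s
  proof -
    have "{..<N} = {0, 1, 2} \<union> {3..<N}" using N_ge_4 by auto
    then have "(\<Sum>k<N. cos_coeff k * s ^ k * moment k) = (\<Sum>k\<in>{0, 1, 2}. cos_coeff k * s ^ k * moment k) + (\<Sum>k=3..<N. cos_coeff k * s ^ k * moment k)"
      by (simp only:) (rule sum.union_disjoint, auto)
    also have "(\<Sum>k\<in>{0, 1, 2}. cos_coeff k * s ^ k * moment k) = 1 - s\<^sup>2 / 2"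
      by (simp add: moment_0 moment_2 cos_coeff_def)
    finally have S: "(\<Sum>k<N. cos_coeff k * s ^ k * moment k) = 1 - s\<^sup>2 / 2 + (\<Sum>k=3..<N. cos_coeff k * s ^ k * moment k)" .
    have pw: "\<bar>s\<bar> ^ k \<le> \<bar>s\<bar> powr \<gamma>" if "k \<ge> 3" for k
      using s \<gamma> that by (simp add: powr_realpow[symmetric] powr_mono')
    have "\<bar>\<Sum>k=3..<N. cos_coeff k * s ^ k * moment k\<bar> \<le> (\<Sum>k=3..<N. \<bar>cos_coeff k * moment k\<bar> * \<bar>s\<bar> powr \<gamma>)"
    proof (rule order_trans[OF sum_abs sum_mono])
      fix k assume "k \<in> {3..<N}"
      then show "\<bar>cos_coeff k * s ^ k * moment k\<bar> \<le> \<bar>cos_coeff k * moment k\<bar> * \<bar>s\<bar> powr \<gamma>"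
        using mult_left_mono[OF pw[of k], of "\<bar>cos_coeff k * moment k\<bar>"] by (simp add: abs_mult power_abs mult_ac)
    qed
    then have 1: "\<bar>\<Sum>k=3..<N. cos_coeff k * s ^ k * moment k\<bar> \<le> D1 * \<bar>s\<bar> powr \<gamma>"
      by (simp add: D1_def sum_distrib_right)
    have 2: "\<bar>sing * \<bar>s\<bar> powr \<alpha>\<bar> \<le> \<bar>sing\<bar> * \<bar>s\<bar> powr \<gamma>"
      unfolding abs_mult using s \<gamma> by (intro mult_left_mono) (auto intro!: powr_mono')
    have 3: "C * \<bar>s\<bar> ^ N \<le> C * \<bar>s\<bar> powr \<gamma>" using C N_ge_4 by (intro mult_left_mono pw) auto
    show ?thesis using C(2)[of s] 1 2 3 unfolding S D_def distrib_right by linarith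
  qed
  \<comment> \<open>Solves D r^(\<gamma>-2) \<le> 1/4; writing D + 1 avoids a division by
    zero.\<close>
  define r where "r = min 1 ((1 / (4 * (D + 1))) powr (1 / (\<gamma> - 2)))"
  have r: "0 < r" "r \<le> 1" using D by (auto simp: r_def)
  have "\<bar>phi s\<bar> \<le> exp (- s\<^sup>2 / 4)" if s: "\<bar>s\<bar> \<le> r" for s
  proof (cases "s = 0")
    case True then show ?thesis using phi_le_1[of 0] by simp
  next
    case False
    have "\<bar>s\<bar> powr (\<gamma> - 2) \<le> ((1 / (4 * (D + 1))) powr (1 / (\<gamma> - 2))) powr (\<gamma> - 2)"
      using s \<gamma> by (intro powr_mono2) (auto simp: r_def)
    also have "\<dots> = 1 / (4 * (D + 1))" using \<gamma> D by (simp add: powr_powr)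
    finally have "D * \<bar>s\<bar> powr (\<gamma> - 2) \<le> D * (1 / (4 * (D + 1)))" using D by (intro mult_left_mono)
    also have "\<dots> \<le> 1 / 4" using D by (simp add: field_simps)
    finally have d: "D * \<bar>s\<bar> powr (\<gamma> - 2) * s\<^sup>2 \<le> 1 / 4 * s\<^sup>2" by (rule mult_right_mono) simp
    have "\<bar>s\<bar> powr \<gamma> = \<bar>s\<bar> powr (\<gamma> - 2) * s\<^sup>2"
      using False by (simp add: powr_diff)
    then have "D * \<bar>s\<bar> powr \<gamma> = D * \<bar>s\<bar> powr (\<gamma> - 2) * s\<^sup>2" by simp
    moreover have "\<bar>phi s - (1 - s\<^sup>2 / 2)\<bar> \<le> D * \<bar>s\<bar> powr \<gamma>"
      using s r False by (intro q) auto
    ultimately have k: "\<bar>phi s - (1 - s\<^sup>2 / 2)\<bar> \<le> s\<^sup>2 / 4"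
      using d by linarith
    have "s\<^sup>2 \<le> 1" using s r by (simp add: abs_square_le_1)
    then have "\<bar>phi s\<bar> \<le> 1 + - s\<^sup>2 / 4" using k \<open>s\<^sup>2 \<le> 1\<close> by linarith
    also have "\<dots> \<le> exp (- s\<^sup>2 / 4)" by (rule exp_ge_add_one_self)
    finally show ?thesis .
  qed
  then show ?thesis using r by blast
qed

text \<open>On the compact set r \<le> \<bar>s\<bar> \<le> R the maximum is attained and is below 1;
  beyond R = 4 a / b the decay bound already gives 1/2.\<close>

lemma phi_away:
  assumes "r > 0"
  shows "\<exists>\<rho>. 0 < \<rho> \<and> \<rho> < 1 \<and> (\<forall>s. \<bar>s\<bar> \<ge> r \<longrightarrow> \<bar>phi s\<bar> \<le> \<rho>)"
proof -
  define R where "R = max r (4 * (a / b))"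
  define K where "K = {s. r \<le> \<bar>s\<bar> \<and> \<bar>s\<bar> \<le> R}"
  have K: "compact K"
  proof -
    have "K = {-R..-r} \<union> {r..R}" using assms by (auto simp: K_def abs_if)
    then show ?thesis by (simp add: compact_Un)
  qed
  have "r \<in> K" using assms by (simp add: K_def R_def)
  then have ne: "K \<noteq> {}" by blast
  have "continuous_on K (\<lambda>s. \<bar>phi s\<bar>)"
    by (intro continuous_intros continuous_on_subset[OF phi_continuous]) auto
  from continuous_attains_sup[OF K ne this]
  obtain s0 where s0: "s0 \<in> K" "\<And>s. s \<in> K \<Longrightarrow> \<bar>phi s\<bar> \<le> \<bar>phi s0\<bar>" by blast
  have "s0 \<noteq> 0" using s0(1) assms by (auto simp: K_def)
  then have l: "\<bar>phi s0\<bar> < 1" by (rule phi_less_1)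
  have "\<bar>phi s\<bar> \<le> max (1 / 2) \<bar>phi s0\<bar>" if s: "\<bar>s\<bar> \<ge> r" for s
  proof (cases "\<bar>s\<bar> \<le> R")
    case True
    then show ?thesis using s0(2)[of s] s by (auto simp: K_def)
  next
    case False
    then have le: "4 * (a / b) \<le> \<bar>s\<bar>" "s \<noteq> 0" using s assms by (auto simp: R_def)
    have "2 * c / m \<le> 1 / 2" if "4 * c \<le> m" "m > 0" for c m :: real
      using that by (simp add: divide_le_eq)
    from this[OF le(1)] le(2) have "2 * (a / b) / \<bar>s\<bar> \<le> 1 / 2" by simp
    then show ?thesis using phi_decay[OF le(2)] by simp
  qed
  then show ?thesis using l by (intro exI[of _ "max (1 / 2) \<bar>phi s0\<bar>"]) auto
qed

text \<open>Two factors decaying like 1 / \<bar>\<theta>\<bar> suffice, hence n \<ge> 2; the others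
  are at most 1.\<close>

lemma phi_power_integrable:
  assumes "n \<ge> 2"
  shows "integrable lborel (\<lambda>\<theta>. phi (\<theta> / sqrt (real n)) ^ n)"
proof (rule integrable_dominated_powr'[where p=0 and q="-2" and A="1 + (2 * (a / b))\<^sup>2 * real n"])
  let ?A = "1 + (2 * (a / b))\<^sup>2 * real n"
  have A: "?A \<ge> 1" by simp
  have le: "\<bar>phi u ^ n\<bar> \<le> 1" for u unfolding power_abs by (rule power_le_one) (auto simp: phi_le_1)
  show "\<bar>phi (x / sqrt (real n)) ^ n\<bar> \<le> ?A * \<bar>x\<bar> powr 0" if "x \<noteq> 0" for x
    using order_trans[OF le A] that by simp
  show "\<bar>phi (x / sqrt (real n)) ^ n\<bar> \<le> ?A * \<bar>x\<bar> powr - 2" if x: "\<bar>x\<bar> > 1" for x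
  proof -
    have x0: "x \<noteq> 0" using x by auto
    have s0: "x / sqrt (real n) \<noteq> 0" using x0 assms by simp
    have "\<bar>phi (x / sqrt (real n)) ^ n\<bar> \<le> \<bar>phi (x / sqrt (real n))\<bar>\<^sup>2"
      unfolding power_abs by (rule power_decreasing) (use assms phi_le_1 in auto)
    also have "\<dots> \<le> (2 * (a / b) / \<bar>x / sqrt (real n)\<bar>)\<^sup>2"
      by (rule power_mono[OF phi_decay[OF s0]]) simp
    also have "\<dots> = (2 * (a / b))\<^sup>2 * real n * \<bar>x\<bar> powr - 2"
      using x0 assms by (simp add: power_divide powr_minus_divide power_mult_distrib)
    also have "\<dots> \<le> ?A * \<bar>x\<bar> powr - 2" by (intro mult_right_mono) auto
    finally show ?thesis .
  qed
qed auto

lemma poly_fun_edge_sum: "poly_fun (edge_sum t)"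
  unfolding edge_sum_def[abs_def]
  by (intro poly_fun_add poly_fun_sum poly_fun_mult poly_fun_const poly_fun_edgeworth_poly)

lemma sing_term_measurable [measurable]: "sing_term \<in> borel_measurable borel"
  unfolding sing_term_def[abs_def] by measurable

lemma fourier_expansion_measurable [measurable]: "fourier_expansion t \<in> borel_measurable borel"
  unfolding fourier_expansion_def[abs_def]
  using poly_fun_measurable[OF poly_fun_edge_sum] by measurable

text \<open>The Gaussian is split in two: one half absorbs the polynomial growth of all terms,
  uniformly for t between 0 and 1, and the other is retained as an integrable majorant.\<close>

lemma fourier_expansion_bound:
  "\<exists>K\<ge>0. \<forall>t \<theta>. 0 < t \<longrightarrow> t \<le> 1 \<longrightarrow> exp (- \<theta>\<^sup>2 / 2) * norm (fourier_expansion t \<theta>) \<le> K * exp (- \<theta>\<^sup>2 / 4)"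
proof -
  have "\<forall>j. \<exists>c\<ge>0. \<forall>\<theta>. norm (edgeworth_poly kappa j \<theta>) * exp (- \<theta>\<^sup>2 / 4) \<le> c"
  proof
    fix j
    obtain C d where C: "C \<ge> 0" "\<And>\<theta>. norm (edgeworth_poly kappa j \<theta>) \<le> C * (1 + \<bar>\<theta>\<bar>) ^ d"
      using poly_fun_bound[OF poly_fun_edgeworth_poly[of kappa j]] by auto
    have "norm (edgeworth_poly kappa j \<theta>) * exp (- \<theta>\<^sup>2 / 4) \<le> C * (fact d * exp 2)" for \<theta>
    proof -
      have "norm (edgeworth_poly kappa j \<theta>) * exp (- \<theta>\<^sup>2 / 4) \<le> C * (1 + \<bar>\<theta>\<bar>) ^ d * exp (- \<theta>\<^sup>2 / 4)"
        by (intro mult_right_mono C) simp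
      also have "\<dots> \<le> C * (fact d * exp 2)"
        unfolding mult.assoc by (intro mult_left_mono power_gauss_bound C)
      finally show ?thesis .
    qed
    then show "\<exists>c\<ge>0. \<forall>\<theta>. norm (edgeworth_poly kappa j \<theta>) * exp (- \<theta>\<^sup>2 / 4) \<le> c"
      using C(1) by (intro exI[of _ "C * (fact d * exp 2)"]) auto
  qed
  then obtain c where c: "\<And>j. c j \<ge> 0" "\<And>j \<theta>. norm (edgeworth_poly kappa j \<theta>) * exp (- \<theta>\<^sup>2 / 4) \<le> c j"
    by metis
  define K where "K = 1 + (\<Sum>j\<in>orders. c j) + \<bar>sing\<bar> * (fact N * exp 2)"
  have "exp (- \<theta>\<^sup>2 / 2) * norm (fourier_expansion t \<theta>) \<le> K * exp (- \<theta>\<^sup>2 / 4)" if t: "0 < t" "t \<le> 1" for t \<theta>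
  proof -
    let ?e = "exp (- \<theta>\<^sup>2 / 4)"
    have "norm (edge_sum t \<theta>) \<le> 1 + (\<Sum>j\<in>orders. norm (edgeworth_poly kappa j \<theta>))"
      unfolding edge_sum_def
    proof (rule order_trans[OF norm_triangle_ineq], intro add_mono)
      show "norm (\<Sum>j\<in>orders. edgeworth_poly kappa j \<theta> * of_real t ^ (j - 2)) \<le> (\<Sum>j\<in>orders. norm (edgeworth_poly kappa j \<theta>))"
      proof (rule sum_norm_le)
        fix j
        have "t ^ (j - 2) \<le> 1" using t by (intro power_le_one) auto
        then show "norm (edgeworth_poly kappa j \<theta> * of_real t ^ (j - 2)) \<le> norm (edgeworth_poly kappa j \<theta>)"
          using t by (simp add: norm_mult norm_power mult_left_le)
      qed
    qed simp
    moreover have "norm (sing_term \<theta> * of_real (t powr (\<alpha> - 2))) \<le> \<bar>sing\<bar> * (1 + \<bar>\<theta>\<bar>) ^ N"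
    proof -
      have "\<bar>\<theta>\<bar> powr \<alpha> \<le> (1 + \<bar>\<theta>\<bar>) powr \<alpha>" using alpha_gt_2 by (intro powr_mono2) auto
      also have "\<dots> \<le> (1 + \<bar>\<theta>\<bar>) powr real N" using N_bounds by (intro powr_mono) auto
      finally have "\<bar>\<theta>\<bar> powr \<alpha> \<le> (1 + \<bar>\<theta>\<bar>) ^ N" by (simp add: powr_realpow)
      moreover have "t powr (\<alpha> - 2) \<le> 1" using t alpha_gt_2 by (intro powr_le1) auto
      ultimately have "\<bar>sing\<bar> * \<bar>\<theta>\<bar> powr \<alpha> * t powr (\<alpha> - 2) \<le> \<bar>sing\<bar> * (1 + \<bar>\<theta>\<bar>) ^ N * 1"
        by (intro mult_mono) auto
      then show ?thesis by (simp add: norm_mult norm_sing_term)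
    qed
    ultimately have n: "norm (fourier_expansion t \<theta>) \<le> 1 + (\<Sum>j\<in>orders. norm (edgeworth_poly kappa j \<theta>)) + \<bar>sing\<bar> * (1 + \<bar>\<theta>\<bar>) ^ N"
      unfolding fourier_expansion_def by (intro order_trans[OF norm_triangle_ineq add_mono])
    have "?e * norm (fourier_expansion t \<theta>) \<le> ?e * (1 + (\<Sum>j\<in>orders. norm (edgeworth_poly kappa j \<theta>)) + \<bar>sing\<bar> * (1 + \<bar>\<theta>\<bar>) ^ N)"
      by (intro mult_left_mono n) simp
    also have "\<dots> = ?e + (\<Sum>j\<in>orders. norm (edgeworth_poly kappa j \<theta>) * ?e) + \<bar>sing\<bar> * ((1 + \<bar>\<theta>\<bar>) ^ N * ?e)"
      by (simp only: distrib_left sum_distrib_left mult_1_right) (simp only: mult_ac)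
    also have "\<dots> \<le> K"
      unfolding K_def by (intro add_mono sum_mono c mult_left_mono power_gauss_bound) auto
    finally have "?e * (?e * norm (fourier_expansion t \<theta>)) \<le> ?e * K" by (intro mult_left_mono) auto
    moreover have ee: "exp (- \<theta>\<^sup>2 / 2) = ?e * ?e" by (simp add: exp_add[symmetric])
    ultimately show ?thesis unfolding ee by (simp only: mult.assoc mult.commute[of K])
  qed
  moreover have "K \<ge> 0" using c(1) by (simp add: K_def sum_nonneg)
  ultimately show ?thesis by blast
qed

definition fourier_error :: "nat \<Rightarrow> real \<Rightarrow> complex" where
  "fourier_error n \<theta> = of_real (phi (\<theta> / sqrt (real n)) ^ n)
     - of_real (exp (- \<theta>\<^sup>2 / 2)) * fourier_expansion (1 / sqrt (real n)) \<theta>"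

lemma fourier_error_measurable [measurable]: "fourier_error n \<in> borel_measurable borel"
  unfolding fourier_error_def[abs_def] by measurable

lemma integrable_inverse_square_tail: "integrable lborel (\<lambda>\<theta>::real. if \<bar>\<theta>\<bar> \<le> 1 then 0 else \<bar>\<theta>\<bar> powr - 2)"
  by (rule integrable_dominated_powr'[where p=0 and q="-2" and A=1]) auto

text \<open>Three ranges: the expansion for \<open>\<bar>\<theta>\<bar> \<le> B\<close>, the Gaussian bound on \<open>phi\<close> up to a multiple of
  \<open>sqrt n\<close>, and a bound below \<open>1\<close> beyond, where two factors are spent on integrability.\<close>

lemma fourier_error_integral:
  "\<exists>K \<rho> C. 0 \<le> K \<and> 0 < \<rho> \<and> \<rho> < 1 \<and> 1 \<le> C \<and> (\<forall>n B. 2 \<le> n \<longrightarrow> 1 \<le> B \<longrightarrow> C * B ^ N * (1 / sqrt (real n)) powr gain \<le> 1 \<longrightarrow>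
     integrable lborel (fourier_error n) \<and>
     (LINT \<theta>|lborel. norm (fourier_error n \<theta>)) \<le> K * (B ^ (N * N) * (1 / sqrt (real n)) powr (\<alpha> - 2 + gain) + exp (- B\<^sup>2 / 8) + real n * \<rho> ^ n))"
proof -
  obtain C where C: "1 \<le> C" and cent: "\<And>n \<theta> B. 1 \<le> n \<Longrightarrow> 1 \<le> B \<Longrightarrow> \<bar>\<theta>\<bar> \<le> B \<Longrightarrow> C * B ^ N * (1 / sqrt (real n)) powr gain \<le> 1 \<Longrightarrow>
    norm (fourier_error n \<theta>) \<le> exp (- \<theta>\<^sup>2 / 2) * (C * B ^ (N * N) * (1 / sqrt (real n)) powr (\<alpha> - 2 + gain))"
    using central_expansion unfolding fourier_error_def by blast
  obtain K0 where K0: "K0 \<ge> 0" "\<And>t \<theta>. 0 < t \<Longrightarrow> t \<le> 1 \<Longrightarrow> exp (- \<theta>\<^sup>2 / 2) * norm (fourier_expansion t \<theta>) \<le> K0 * exp (- \<theta>\<^sup>2 / 4)"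
    using fourier_expansion_bound by blast
  obtain r where r: "r > 0" "\<And>s. \<bar>s\<bar> \<le> r \<Longrightarrow> \<bar>phi s\<bar> \<le> exp (- s\<^sup>2 / 4)" using phi_near_0 by blast
  obtain \<rho> where \<rho>: "0 < \<rho>" "\<rho> < 1" "\<And>s. \<bar>s\<bar> \<ge> r \<Longrightarrow> \<bar>phi s\<bar> \<le> \<rho>" using phi_away[OF r(1)] by blast
  \<comment> \<open>The square is the decay bound of the two factors set aside; division by \<rho>^2
    compensates for writing \<rho>^n in place of \<rho>^(n-2).\<close>
  define D where "D = (2 * (a / b))\<^sup>2 / \<rho>\<^sup>2"
  have D: "D \<ge> 0" by (simp add: D_def)
  define I1 where "I1 = (LINT \<theta>|lborel. exp (- (\<theta>::real)\<^sup>2 / 8))"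
  define I2 where "I2 = (LINT \<theta>|lborel. (if \<bar>\<theta>::real\<bar> \<le> 1 then 0 else \<bar>\<theta>\<bar> powr - 2))"
  have I: "I1 \<ge> 0" "I2 \<ge> 0" by (auto simp: I1_def I2_def intro!: integral_nonneg_AE)
  define K where "K = (C + 1 + K0) * I1 + D * I2"
  have "integrable lborel (fourier_error n) \<and>
     (LINT \<theta>|lborel. norm (fourier_error n \<theta>)) \<le> K * (B ^ (N * N) * (1 / sqrt (real n)) powr (\<alpha> - 2 + gain) + exp (- B\<^sup>2 / 8) + real n * \<rho> ^ n)"
    if n: "2 \<le> n" and B: "1 \<le> B" and small: "C * B ^ N * (1 / sqrt (real n)) powr gain \<le> 1" for n B
  proof -
    define t where "t = 1 / sqrt (real n)"
    have t: "0 < t" "t \<le> 1" using n by (auto simp: t_def)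
    define p where "p = B ^ (N * N) * t powr (\<alpha> - 2 + gain)"
    have p: "p \<ge> 0" using B by (simp add: p_def)
    define q where "q = exp (- B\<^sup>2 / 8)"
    have q: "q \<ge> 0" by (simp add: q_def)
    define w where "w = (\<lambda>\<theta>::real. if \<bar>\<theta>\<bar> \<le> 1 then 0 else \<bar>\<theta>\<bar> powr - 2)"
    have w: "w \<theta> \<ge> 0" for \<theta> by (simp add: w_def)
    have Dw: "0 \<le> D * (real n * \<rho> ^ n) * w \<theta>" for \<theta>
      using D \<rho> w by (intro mult_nonneg_nonneg) auto
    have ph: "\<bar>phi (\<theta> / sqrt (real n)) ^ n\<bar> \<le> exp (- \<theta>\<^sup>2 / 4) + D * (real n * \<rho> ^ n) * w \<theta>" if "\<bar>\<theta>\<bar> > 1" for \<theta>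
    proof (cases "\<bar>\<theta> / sqrt (real n)\<bar> \<le> r")
      case True
      have "\<bar>phi (\<theta> / sqrt (real n)) ^ n\<bar> \<le> exp (- (\<theta> / sqrt (real n))\<^sup>2 / 4) ^ n"
        unfolding power_abs by (intro power_mono r True) auto
      also have "\<dots> = exp (real n * (- (\<theta> / sqrt (real n))\<^sup>2 / 4))" by (simp only: exp_of_nat_mult)
      also have "real n * (- (\<theta> / sqrt (real n))\<^sup>2 / 4) = - \<theta>\<^sup>2 / 4" using n by (simp add: power_divide)
      finally show ?thesis using Dw[of \<theta>] by linarith
    next
      case False
      have s0: "\<theta> / sqrt (real n) \<noteq> 0" using that n by auto
      have th0: "\<theta> \<noteq> 0" using that by auto
      have "\<bar>phi (\<theta> / sqrt (real n)) ^ n\<bar> = \<bar>phi (\<theta> / sqrt (real n))\<bar> ^ (n - 2) * \<bar>phi (\<theta> / sqrt (real n))\<bar>\<^sup>2"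
        using le_add_diff_inverse2[OF n] by (metis power_abs power_add)
      also have "\<dots> \<le> \<rho> ^ (n - 2) * (2 * (a / b) / \<bar>\<theta> / sqrt (real n)\<bar>)\<^sup>2"
        using False \<rho> by (intro mult_mono power_mono phi_decay[OF s0]) auto
      also have "(2 * (a / b) / \<bar>\<theta> / sqrt (real n)\<bar>)\<^sup>2 = (2 * (a / b))\<^sup>2 * real n * \<bar>\<theta>\<bar> powr - 2"
        using th0 n by (simp add: power_divide powr_minus_divide power_mult_distrib)
      also have "\<rho> ^ (n - 2) = \<rho> ^ n / \<rho>\<^sup>2" using \<rho> n by (simp add: power_diff)
      also have "\<rho> ^ n / \<rho>\<^sup>2 * ((2 * (a / b))\<^sup>2 * real n * \<bar>\<theta>\<bar> powr - 2) = D * (real n * \<rho> ^ n) * w \<theta>"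
        using that by (simp add: D_def w_def)
      finally show ?thesis by (simp add: add_increasing)
    qed
    have bnd: "norm (fourier_error n \<theta>) \<le> (C * p + (1 + K0) * q) * exp (- \<theta>\<^sup>2 / 8) + D * (real n * \<rho> ^ n) * w \<theta>" for \<theta>
    proof (cases "\<bar>\<theta>\<bar> \<le> B")
      case True
      have "norm (fourier_error n \<theta>) \<le> exp (- \<theta>\<^sup>2 / 2) * (C * p)"
        using cent[OF _ B True small] n by (simp add: p_def t_def mult.assoc)
      also have "\<dots> \<le> exp (- \<theta>\<^sup>2 / 8) * (C * p)" using C p by (intro mult_right_mono) auto
      also have "\<dots> \<le> (C * p + (1 + K0) * q) * exp (- \<theta>\<^sup>2 / 8)"
        using K0 q by (simp add: distrib_right mult.commute)
      finally show ?thesis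
        using Dw[of \<theta>] by linarith
    next
      case False
      have "norm (fourier_error n \<theta>) \<le> \<bar>phi (\<theta> / sqrt (real n)) ^ n\<bar> + exp (- \<theta>\<^sup>2 / 2) * norm (fourier_expansion t \<theta>)"
        unfolding fourier_error_def t_def[symmetric]
        by (rule order_trans[OF norm_triangle_ineq4]) (simp add: norm_mult norm_power power_abs)
      also have "\<dots> \<le> (exp (- \<theta>\<^sup>2 / 4) + D * (real n * \<rho> ^ n) * w \<theta>) + K0 * exp (- \<theta>\<^sup>2 / 4)"
        using False B t by (intro add_mono ph K0) auto
      also have "\<dots> = (1 + K0) * exp (- \<theta>\<^sup>2 / 4) + D * (real n * \<rho> ^ n) * w \<theta>" by (simp add: distrib_right)
      also have "(1 + K0) * exp (- \<theta>\<^sup>2 / 4) \<le> (1 + K0) * (q * exp (- \<theta>\<^sup>2 / 8))"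
        unfolding q_def using K0 False B by (intro mult_left_mono gauss_tail_le) auto
      also have "\<dots> \<le> (C * p + (1 + K0) * q) * exp (- \<theta>\<^sup>2 / 8)"
        using C p by (simp add: distrib_right)
      finally show ?thesis by simp
    qed
    have gi: "integrable lborel (\<lambda>\<theta>. (C * p + (1 + K0) * q) * exp (- \<theta>\<^sup>2 / 8) + D * (real n * \<rho> ^ n) * w \<theta>)"
      unfolding w_def by (intro Bochner_Integration.integrable_add integrable_mult_right gauss8_integrable integrable_inverse_square_tail)
    have int: "integrable lborel (fourier_error n)"
      by (rule Bochner_Integration.integrable_bound[OF gi])
         (auto intro!: AE_I2 order_trans[OF bnd] simp del: times_divide_eq_left)
    have "(LINT \<theta>|lborel. norm (fourier_error n \<theta>)) \<le> (LINT \<theta>|lborel. (C * p + (1 + K0) * q) * exp (- \<theta>\<^sup>2 / 8) + D * (real n * \<rho> ^ n) * w \<theta>)"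
      by (intro integral_mono integrable_norm int gi bnd)
    also have "\<dots> = (C * p + (1 + K0) * q) * I1 + D * (real n * \<rho> ^ n) * I2"
    proof -
      have "(LINT \<theta>|lborel. (C * p + (1 + K0) * q) * exp (- \<theta>\<^sup>2 / 8) + D * (real n * \<rho> ^ n) * w \<theta>)
          = (LINT \<theta>|lborel. (C * p + (1 + K0) * q) * exp (- \<theta>\<^sup>2 / 8)) + (LINT \<theta>|lborel. D * (real n * \<rho> ^ n) * w \<theta>)"
        unfolding w_def by (intro Bochner_Integration.integral_add integrable_mult_right gauss8_integrable integrable_inverse_square_tail)
      then show ?thesis by (simp only: I1_def I2_def w_def integral_mult_right_zero)
    qed
    also have "\<dots> \<le> K * (p + q + real n * \<rho> ^ n)"
    proof -
      define m where "m = real n * \<rho> ^ n"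
      have m: "m \<ge> 0" using \<rho> by (simp add: m_def)
      have "K * (p + q + m) - ((C * p + (1 + K0) * q) * I1 + D * m * I2)
        = (1 + K0) * (I1 * p) + C * (I1 * q) + (C + 1 + K0) * (I1 * m) + D * (I2 * (p + q))"
        by (simp add: K_def algebra_simps)
      also have "\<dots> \<ge> 0" using C K0 I p q m D by simp
      finally show ?thesis unfolding m_def by simp
    qed
    finally show ?thesis using int by (simp add: p_def q_def t_def)
  qed
  moreover have "K \<ge> 0" using C K0 I D by (simp add: K_def)
  ultimately show ?thesis using C \<rho> by blast
qed

text \<open>The window is B = n^\<epsilon> with \<epsilon> = gain / (4 N^2), so B^(N N) costs
  n^(gain/4) against the n^(-gain/2) gained. Of the remaining gain/4, half becomes \<delta> and half
  absorbs the constant 3 K; the other two errors decay faster than any power.\<close>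

lemma fourier_error_rate:
  "\<exists>\<delta>>0. \<forall>\<^sub>F n in sequentially. integrable lborel (fourier_error n) \<and>
     (LINT \<theta>|lborel. norm (fourier_error n \<theta>)) \<le> real n powr (- (\<alpha> / 2 - 1) - \<delta>)"
proof -
  obtain K \<rho> C where K: "0 \<le> K" "0 < \<rho>" "\<rho> < 1" "1 \<le> C" and bnd: "\<And>n B. 2 \<le> n \<Longrightarrow> 1 \<le> B \<Longrightarrow> C * B ^ N * (1 / sqrt (real n)) powr gain \<le> 1 \<Longrightarrow>
     integrable lborel (fourier_error n) \<and>
     (LINT \<theta>|lborel. norm (fourier_error n \<theta>)) \<le> K * (B ^ (N * N) * (1 / sqrt (real n)) powr (\<alpha> - 2 + gain) + exp (- B\<^sup>2 / 8) + real n * \<rho> ^ n)"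
    using fourier_error_integral by blast
  define \<epsilon> where "\<epsilon> = gain / (4 * real N * real N)"
  have Npos: "real N \<ge> 1" using N_ge_4 by simp
  have \<epsilon>: "\<epsilon> > 0" using gain(1) Npos by (simp add: \<epsilon>_def)
  have \<epsilon>NN: "\<epsilon> * (real N * real N) = gain / 4" using Npos by (simp add: \<epsilon>_def)
  have \<epsilon>N: "\<epsilon> * real N \<le> gain / 4"
  proof -
    have "(\<epsilon> * real N) * 1 \<le> (\<epsilon> * real N) * real N" using \<epsilon> Npos by (intro mult_left_mono) auto
    then show ?thesis using \<epsilon>NN by (simp add: mult.assoc)
  qed
  define \<delta> where "\<delta> = gain / 8"
  define s where "s = \<alpha> / 2 - 1 + gain / 8"
  define c where "c = - ln \<rho>"
  have c: "c > 0" using K by (simp add: c_def)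
  have rs: "filterlim real at_top sequentially" by (rule filterlim_real_sequentially)
  have e1: "\<forall>\<^sub>F n in sequentially. C * real n powr - (gain / 4) \<le> 1"
    using eventually_compose_filterlim[OF eventually_powr_less[of "gain / 4" 1 C] rs] gain by simp
  have e2: "\<forall>\<^sub>F n in sequentially. (3 * K) * real n powr - (gain / 8) \<le> 1"
    using eventually_compose_filterlim[OF eventually_powr_less[of "gain / 8" 1 "3 * K"] rs] gain by simp
  have "((\<lambda>x. exp (- (x powr (2 * \<epsilon>) / 8)) * x powr s) \<longlongrightarrow> 0) at_top" using \<epsilon> by real_asymp
  then have "((\<lambda>x. 3 * K * (exp (- (x powr (2 * \<epsilon>) / 8)) * x powr s)) \<longlongrightarrow> 0) at_top" by (rule tendsto_mult_right_zero)
  then have "\<forall>\<^sub>F x in at_top. 3 * K * (exp (- (x powr (2 * \<epsilon>) / 8)) * x powr s) < 1" by (rule order_tendstoD) simp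
  from eventually_compose_filterlim[OF this rs]
  have e3: "\<forall>\<^sub>F n in sequentially. 3 * K * (exp (- (real n powr (2 * \<epsilon>) / 8)) * real n powr s) < 1" .
  have "((\<lambda>x. x * exp (- c * x) * x powr s) \<longlongrightarrow> 0) at_top" using c by real_asymp
  then have "((\<lambda>x. 3 * K * (x * exp (- c * x) * x powr s)) \<longlongrightarrow> 0) at_top" by (rule tendsto_mult_right_zero)
  then have "\<forall>\<^sub>F x in at_top. 3 * K * (x * exp (- c * x) * x powr s) < 1" by (rule order_tendstoD) simp
  from eventually_compose_filterlim[OF this rs]
  have e4: "\<forall>\<^sub>F n in sequentially. 3 * K * (real n * exp (- c * real n) * real n powr s) < 1" .
  have "\<forall>\<^sub>F n in sequentially. integrable lborel (fourier_error n) \<and>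
     (LINT \<theta>|lborel. norm (fourier_error n \<theta>)) \<le> real n powr (- (\<alpha> / 2 - 1) - \<delta>)"
    using e1 e2 e3 e4 eventually_ge_at_top[of 2]
  proof eventually_elim
    case (elim n)
    define x where "x = real n"
    have x: "x \<ge> 2" "x > 0" "x \<noteq> 0" using elim by (auto simp: x_def)
    define B where "B = x powr \<epsilon>"
    have B: "B \<ge> 1" unfolding B_def using x \<epsilon> by (intro ge_one_powr_ge_zero) auto
    have t: "(1 / sqrt x) powr r = x powr (- (r / 2))" for r
    proof -
      have "1 / sqrt x = x powr (- (1 / 2))" using x by (simp add: powr_half_sqrt powr_minus_divide)
      then show ?thesis by (simp add: powr_powr)
    qed
    have Bk: "B ^ k = x powr (\<epsilon> * real k)" for k
      unfolding B_def using x by (simp add: powr_realpow[symmetric] powr_powr)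
    have "C * B ^ N * (1 / sqrt x) powr gain = C * x powr (\<epsilon> * real N - gain / 2)"
      unfolding Bk t by (simp add: powr_add[symmetric])
    also have "\<dots> \<le> C * x powr - (gain / 4)"
      using K x \<epsilon>N gain by (intro mult_left_mono powr_mono) auto
    also have "\<dots> \<le> 1" using elim by (simp add: x_def)
    finally have small: "C * B ^ N * (1 / sqrt x) powr gain \<le> 1" .
    define R where "R = x powr - s"
    have R: "R > 0" using x by (simp add: R_def)
    have xs: "x powr s * R = 1" using x by (simp add: R_def powr_add[symmetric])
    have p: "3 * (K * (B ^ (N * N) * (1 / sqrt x) powr (\<alpha> - 2 + gain))) \<le> R"
    proof -
      have "B ^ (N * N) * (1 / sqrt x) powr (\<alpha> - 2 + gain) = x powr (gain / 4 + - ((\<alpha> - 2 + gain) / 2))"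
        unfolding Bk t of_nat_mult \<epsilon>NN by (rule powr_add[symmetric])
      also have "gain / 4 + - ((\<alpha> - 2 + gain) / 2) = - (gain / 8) + - s" by (simp add: s_def field_simps)
      finally have "3 * (K * (B ^ (N * N) * (1 / sqrt x) powr (\<alpha> - 2 + gain))) = (3 * K * x powr - (gain / 8)) * R"
        by (simp only: powr_add R_def mult.assoc)
      also have "\<dots> \<le> 1 * R" using elim R by (intro mult_right_mono) (auto simp: x_def)
      finally show ?thesis by simp
    qed
    have q: "3 * (K * exp (- B\<^sup>2 / 8)) \<le> R"
    proof -
      have "B\<^sup>2 = x powr (2 * \<epsilon>)" using Bk[of 2] by (simp add: mult.commute)
      then have "3 * (K * exp (- B\<^sup>2 / 8)) = (3 * K * (exp (- (x powr (2 * \<epsilon>) / 8)) * x powr s)) * R"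
        using xs by (simp add: mult.assoc)
      also have "\<dots> \<le> 1 * R" using elim R by (intro mult_right_mono) (auto simp: x_def)
      finally show ?thesis by simp
    qed
    have w: "3 * (K * (x * \<rho> ^ n)) \<le> R"
    proof -
      have "\<rho> ^ n = exp (ln \<rho>) ^ n" using K by simp
      also have "\<dots> = exp (- c * x)" by (simp only: exp_of_nat_mult[symmetric] c_def x_def) (simp add: mult.commute)
      finally have "3 * (K * (x * \<rho> ^ n)) = (3 * K * (x * exp (- c * x) * x powr s)) * R"
        using xs by (simp add: mult.assoc)
      also have "\<dots> \<le> 1 * R" using elim R by (intro mult_right_mono) (auto simp: x_def)
      finally show ?thesis by simp
    qed
    have "K * (B ^ (N * N) * (1 / sqrt x) powr (\<alpha> - 2 + gain) + exp (- B\<^sup>2 / 8) + x * \<rho> ^ n) \<le> R"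
      using p q w by (simp add: distrib_left)
    moreover have "R = x powr (- (\<alpha> / 2 - 1) - \<delta>)" by (simp add: R_def s_def \<delta>_def)
    ultimately show ?case
      using bnd[of n B] elim(5) B small unfolding x_def by (auto intro: order_trans)
  qed
  moreover have "\<delta> > 0" using gain by (simp add: \<delta>_def)
  ultimately show ?thesis by blast
qed

section \<open>Inverting the expansion term by term\<close>

lemma alpha_not_even: "\<not> (\<exists>m::int. even m \<and> \<alpha> = of_int m)"
proof
  assume "\<exists>m::int. even m \<and> \<alpha> = of_int m"
  then obtain m :: int where m: "even m" "\<alpha> = of_int m" by blast
  have "real_of_int (int N - 2) < of_int m" "of_int m < real_of_int (int N)" using N_bounds m by auto
  then have "int N - 2 < m" "m < int N" by (simp_all only: of_int_less_iff)
  then have "m = int N - 1" by linarith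
  then show False using m(1) N_even by simp
qed

lemma half_gauss_powr_power_integrable: "integrable lborel (\<lambda>t. (half_gauss t * t powr (\<alpha> - 1)) * t ^ k)"
proof -
  have eq: "(half_gauss t * t powr (\<alpha> - 1)) * t ^ k = half_gauss t * t powr (\<alpha> - 1 + real k)" for t
    by (cases "t > 0") (auto simp: half_gauss_def powr_add powr_realpow)
  show ?thesis unfolding eq by (rule half_gauss_integrable_powr) (use alpha_gt_2 in simp)
qed

text \<open>With weight t^(\<alpha>-1) this cosine transform is a \<open>sin_transform\<close> of
  order 1, since the phase pi / 2 turns sine into cosine. It is therefore differentiable.\<close>

lemma cos_gauss_continuous: "continuous_on UNIV (cos_gauss \<alpha>)"
proof -
  let ?g = "\<lambda>t. half_gauss t * t powr (\<alpha> - 1)"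
  have "cos_gauss \<alpha> x = sin_transform ?g 1 x" for x
    unfolding cos_gauss_def sin_transform_def
  proof (rule Bochner_Integration.integral_cong[OF refl])
    fix t
    have "half_gauss t * t powr \<alpha> = ?g t * t ^ 1"
    proof (cases "t > 0")
      case True
      have "t powr (\<alpha> - 1) * t = t powr (\<alpha> - 1) * t powr 1" using True by simp
      also have "\<dots> = t powr \<alpha>" by (simp only: powr_add[symmetric]) simp
      finally show ?thesis by (simp add: mult.assoc)
    qed (simp add: half_gauss_def)
    moreover have "sin (x * t + real 1 * pi / 2) = cos (x * t)" by (simp add: sin_add)
    ultimately show "half_gauss t * t powr \<alpha> * cos (x * t) = ?g t * t ^ 1 * sin (x * t + real 1 * pi / 2)"
      by simp
  qed
  then have eq: "cos_gauss \<alpha> = sin_transform ?g 1" by (rule ext)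
  show ?thesis unfolding eq
    by (intro continuous_at_imp_continuous_on ballI DERIV_isCont[OF sin_transform_deriv] half_gauss_powr_power_integrable)
qed

lemma pareto_G_cos: "pareto_G \<alpha> x = - cos_gauss \<alpha> x / (Gamma (\<alpha> + 1) * sin (\<alpha> * pi / 2))"
  by (rule pareto_G_eq[OF _ alpha_not_even]) (use alpha_gt_2 in simp)

lemma pareto_G_continuous: "continuous_on UNIV (pareto_G \<alpha>)"
  unfolding pareto_G_cos[abs_def] divide_inverse
  by (intro continuous_intros cos_gauss_continuous)

lemma pareto_G_even: "pareto_G \<alpha> (- x) = pareto_G \<alpha> x"
  by (simp add: pareto_G_cos cos_gauss_def)

text \<open>The constant computed through the Beta integral meets the normalisation of
  \<open>pareto_G\<close>: the Gamma and sine factors agree and pi cancels.\<close>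

lemma sing_cos_gauss: "sing * cos_gauss \<alpha> x / pi = a * pareto_G \<alpha> x"
proof -
  have "cos_kernel_const N \<alpha> = - pi / (Gamma (\<alpha> + 1) * sin (\<alpha> * pi / 2))"
    using N_even N_ge_4 N_bounds alpha_gt_2 by (intro cos_kernel_const_eq) auto
  then show ?thesis by (simp add: sing_def pareto_G_cos)
qed

lemma gauss_abs_powr_integrable: "set_integrable lborel {0..} (\<lambda>t. exp (- t\<^sup>2 / 2) * t powr \<alpha> * cos (x * t))"
proof -
  have "integrable lborel (\<lambda>t. half_gauss t * t powr \<alpha> * cos (x * t))"
    by (rule integrable_mult_bounded[OF half_gauss_integrable_powr]) (use alpha_gt_2 in auto)
  moreover have "half_gauss t * t powr \<alpha> * cos (x * t) = indicator {0..} t *\<^sub>R (exp (- t\<^sup>2 / 2) * t powr \<alpha> * cos (x * t))" for t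
    by (cases "t = 0") (auto simp: half_gauss_def indicator_def)
  ultimately show ?thesis by (simp add: set_integrable_def)
qed

text \<open>The singular term is even, so the real part of its Fourier integral is twice the
  half-line cosine integral; the 2 cancels against 2 pi.\<close>

lemma gauss_kernel_sing_term:
  "integrable lborel (\<lambda>\<theta>. gauss_kernel x \<theta> * sing_term \<theta>)"
  "Re (1 / (2 * of_real pi) * (LINT \<theta>|lborel. gauss_kernel x \<theta> * sing_term \<theta>)) = a * pareto_G \<alpha> x"
proof -
  have nrm: "norm (gauss_kernel x \<theta> * sing_term \<theta>) = \<bar>sing\<bar> * (exp (- \<bar>\<theta>\<bar>\<^sup>2 / 2) * \<bar>\<theta>\<bar> powr \<alpha> * cos (0 * \<bar>\<theta>\<bar>))" for \<theta>
    by (simp add: norm_mult norm_gauss_kernel norm_sing_term)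
  have "integrable lborel (\<lambda>\<theta>. \<bar>sing\<bar> * (exp (- \<bar>\<theta>\<bar>\<^sup>2 / 2) * \<bar>\<theta>\<bar> powr \<alpha> * cos (0 * \<bar>\<theta>\<bar>)))"
    by (rule integrable_mult_right[OF integral_even(1)[OF gauss_abs_powr_integrable]])
  then show int: "integrable lborel (\<lambda>\<theta>. gauss_kernel x \<theta> * sing_term \<theta>)"
    unfolding nrm[symmetric] by (rule integrable_norm_cancel) measurable
  have "Re (LINT \<theta>|lborel. gauss_kernel x \<theta> * sing_term \<theta>) = (LINT \<theta>|lborel. Re (gauss_kernel x \<theta> * sing_term \<theta>))"
    by (rule integral_Re[OF int, symmetric])
  also have "\<dots> = (LINT \<theta>|lborel. sing * (exp (- \<bar>\<theta>\<bar>\<^sup>2 / 2) * \<bar>\<theta>\<bar> powr \<alpha> * cos (x * \<bar>\<theta>\<bar>)))"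
  proof (rule Bochner_Integration.integral_cong[OF refl])
    fix \<theta>
    have c: "cos (x * \<bar>\<theta>\<bar>) = cos (\<theta> * x)" by (auto simp: abs_if mult.commute)
    have "Re (gauss_kernel x \<theta>) = exp (- \<theta>\<^sup>2 / 2) * cos (\<theta> * x)"
      by (simp add: gauss_kernel_eq Re_exp mult.commute)
    then show "Re (gauss_kernel x \<theta> * sing_term \<theta>) = sing * (exp (- \<bar>\<theta>\<bar>\<^sup>2 / 2) * \<bar>\<theta>\<bar> powr \<alpha> * cos (x * \<bar>\<theta>\<bar>))"
      unfolding c by (simp add: sing_term_def)
  qed
  also have "\<dots> = sing * (2 * (LBINT t:{0..}. exp (- t\<^sup>2 / 2) * t powr \<alpha> * cos (x * t)))"
    by (simp only: integral_mult_right_zero integral_even(2)[OF gauss_abs_powr_integrable])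
  also have "(LBINT t:{0..}. exp (- t\<^sup>2 / 2) * t powr \<alpha> * cos (x * t)) = cos_gauss \<alpha> x"
    unfolding set_lebesgue_integral_def cos_gauss_def
    by (rule Bochner_Integration.integral_cong) (auto simp: half_gauss_def indicator_def)
  finally have "Re (LINT \<theta>|lborel. gauss_kernel x \<theta> * sing_term \<theta>) = 2 * (sing * cos_gauss \<alpha> x)" by simp
  moreover have "Re (1 / (2 * of_real pi) * z) = Re z / (2 * pi)" for z
    using Re_divide_of_real[of z "2 * pi"] by simp
  ultimately show "Re (1 / (2 * of_real pi) * (LINT \<theta>|lborel. gauss_kernel x \<theta> * sing_term \<theta>)) = a * pareto_G \<alpha> x"
    using sing_cos_gauss[of x] by simp
qed

definition gauss_part :: "nat \<Rightarrow> real \<Rightarrow> real" where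
  "gauss_part n x = std_normal_density x *
     (1 + (\<Sum>j\<in>orders. edgeworth_G kappa j x / real n powr (real j / 2 - 1)))"

lemma pareto_expansion_eq:
  "pareto_expansion kappa a \<alpha> n x = gauss_part n x + a * pareto_G \<alpha> x / real n powr (\<alpha> / 2 - 1)"
  by (simp add: pareto_expansion_def gauss_part_def orders_def)

lemma inverse_sqrt_powr:
  assumes "n \<ge> 1" shows "(1 / sqrt (real n)) powr r = 1 / real n powr (r / 2)"
proof -
  have eq: "1 / sqrt (real n) = real n powr (- (1 / 2))" using assms by (simp add: powr_half_sqrt powr_minus_divide)
  show ?thesis unfolding eq by (simp only: powr_powr) (simp add: powr_minus_divide)
qed

lemma pareto_expansion_fourier:
  assumes n: "n \<ge> 1"
  shows "integrable lborel (\<lambda>\<theta>. gauss_kernel x \<theta> * fourier_expansion (1 / sqrt (real n)) \<theta>)"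
    and "pareto_expansion kappa a \<alpha> n x =
      Re (1 / (2 * of_real pi) * (LINT \<theta>|lborel. gauss_kernel x \<theta> * fourier_expansion (1 / sqrt (real n)) \<theta>))"
proof -
  define t where "t = 1 / sqrt (real n)"
  let ?c = "1 / (2 * complex_of_real pi)"
  have tj: "complex_of_real t ^ (j - 2) = of_real (1 / real n powr (real j / 2 - 1))" if "j \<in> orders" for j
  proof -
    have "t ^ (j - 2) = t powr (real (j - 2))" using n by (simp add: t_def powr_realpow)
    also have "\<dots> = 1 / real n powr (real (j - 2) / 2)" unfolding t_def by (rule inverse_sqrt_powr[OF n])
    also have "real (j - 2) / 2 = real j / 2 - 1" using that by (simp add: orders_def of_nat_diff field_simps)
    finally show ?thesis by (simp only: of_real_power[symmetric])
  qed
  have ta: "t powr (\<alpha> - 2) = 1 / real n powr (\<alpha> / 2 - 1)"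
    using inverse_sqrt_powr[OF n, of "\<alpha> - 2"] by (simp add: t_def diff_divide_distrib)
  have i0: "integrable lborel (gauss_kernel x)"
    using gauss_kernel_power_integrable[of x 0] by simp
  have ij: "integrable lborel (\<lambda>\<theta>. of_real t ^ (j - 2) * (gauss_kernel x \<theta> * edgeworth_poly kappa j \<theta>))" for j
    by (intro integrable_mult_right gauss_kernel_poly_fun(1) poly_fun_edgeworth_poly)
  have ia: "integrable lborel (\<lambda>\<theta>. of_real (t powr (\<alpha> - 2)) * (gauss_kernel x \<theta> * sing_term \<theta>))"
    by (intro integrable_mult_right gauss_kernel_sing_term)
  have eq: "gauss_kernel x \<theta> * fourier_expansion t \<theta> = gauss_kernel x \<theta>
      + (\<Sum>j\<in>orders. of_real t ^ (j - 2) * (gauss_kernel x \<theta> * edgeworth_poly kappa j \<theta>))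
      + of_real (t powr (\<alpha> - 2)) * (gauss_kernel x \<theta> * sing_term \<theta>)" for \<theta>
    by (simp add: fourier_expansion_def edge_sum_def distrib_left sum_distrib_left mult_ac)
  have isum: "integrable lborel (\<lambda>\<theta>. \<Sum>j\<in>orders. of_real t ^ (j - 2) * (gauss_kernel x \<theta> * edgeworth_poly kappa j \<theta>))"
    by (intro Bochner_Integration.integrable_sum ij)
  show "integrable lborel (\<lambda>\<theta>. gauss_kernel x \<theta> * fourier_expansion (1 / sqrt (real n)) \<theta>)"
    unfolding t_def[symmetric] eq by (intro Bochner_Integration.integrable_add i0 isum ia)
  have "(LINT \<theta>|lborel. gauss_kernel x \<theta> * fourier_expansion t \<theta>) = (LINT \<theta>|lborel. gauss_kernel x \<theta>)
      + (\<Sum>j\<in>orders. of_real t ^ (j - 2) * (LINT \<theta>|lborel. gauss_kernel x \<theta> * edgeworth_poly kappa j \<theta>))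
      + of_real (t powr (\<alpha> - 2)) * (LINT \<theta>|lborel. gauss_kernel x \<theta> * sing_term \<theta>)"
    unfolding eq
    by (simp only: Bochner_Integration.integral_add[OF Bochner_Integration.integrable_add[OF i0 isum] ia]
      Bochner_Integration.integral_add[OF i0 isum] Bochner_Integration.integral_sum[OF ij] integral_mult_right_zero)
  also have "(\<Sum>j\<in>orders. of_real t ^ (j - 2) * (LINT \<theta>|lborel. gauss_kernel x \<theta> * edgeworth_poly kappa j \<theta>))
     = (\<Sum>j\<in>orders. of_real (1 / real n powr (real j / 2 - 1)) * (LINT \<theta>|lborel. gauss_kernel x \<theta> * edgeworth_poly kappa j \<theta>))"
    by (intro sum.cong refl) (simp only: tj)
  finally have L: "?c * (LINT \<theta>|lborel. gauss_kernel x \<theta> * fourier_expansion t \<theta>) = ?c * (LINT \<theta>|lborel. gauss_kernel x \<theta>)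
      + (\<Sum>j\<in>orders. of_real (1 / real n powr (real j / 2 - 1)) * (?c * (LINT \<theta>|lborel. gauss_kernel x \<theta> * edgeworth_poly kappa j \<theta>)))
      + of_real (1 / real n powr (\<alpha> / 2 - 1)) * (?c * (LINT \<theta>|lborel. gauss_kernel x \<theta> * sing_term \<theta>))"
    unfolding ta by (simp only: distrib_left sum_distrib_left mult.left_commute[of ?c])
  have Re_scale: "Re (of_real r * z) = r * Re z" for r z by simp
  have g0: "Re (?c * (LINT \<theta>|lborel. gauss_kernel x \<theta>)) = std_normal_density x"
  proof -
    have "?c * (LINT \<theta>|lborel. gauss_kernel x \<theta>) = of_real (sqrt (2 * pi) * exp (- x\<^sup>2 / 2) / (2 * pi))"
      unfolding gauss_kernel_power_0 by simp
    moreover have "sqrt (2 * pi) * exp (- x\<^sup>2 / 2) / (2 * pi) = std_normal_density x"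
    proof -
      have "sqrt (2 * pi) * sqrt (2 * pi) = 2 * pi" by simp
      then have "sqrt (2 * pi) / (2 * pi) = 1 / sqrt (2 * pi)" by (simp add: divide_eq_eq eq_divide_eq)
      moreover have "sqrt (2 * pi) * E / (2 * pi) = sqrt (2 * pi) / (2 * pi) * E" for E by simp
      ultimately show ?thesis by (simp only: std_normal_density_def)
    qed
    ultimately show ?thesis by (simp only: Re_complex_of_real)
  qed
  have "Re (?c * (LINT \<theta>|lborel. gauss_kernel x \<theta> * fourier_expansion t \<theta>))
     = std_normal_density x + (\<Sum>j\<in>orders. 1 / real n powr (real j / 2 - 1) * (std_normal_density x * edgeworth_G kappa j x))
       + 1 / real n powr (\<alpha> / 2 - 1) * (a * pareto_G \<alpha> x)"
    unfolding L by (simp only: plus_complex.sel Re_sum Re_scale g0 edgeworth_G_eq[symmetric] gauss_kernel_sing_term(2))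
  also have "\<dots> = pareto_expansion kappa a \<alpha> n x"
    unfolding pareto_expansion_eq gauss_part_def by (simp add: distrib_left sum_distrib_left mult_ac)
  finally show "pareto_expansion kappa a \<alpha> n x =
      Re (1 / (2 * of_real pi) * (LINT \<theta>|lborel. gauss_kernel x \<theta> * fourier_expansion (1 / sqrt (real n)) \<theta>))"
    unfolding t_def by (rule sym)
qed

text \<open>Each term is a polynomial times a Gaussian, and negative powers of n are at most 1, so
  any power of \<bar>x\<bar> is absorbed uniformly in n.\<close>

lemma gauss_part_decay: "\<exists>C\<ge>0. \<forall>n x. 1 \<le> n \<longrightarrow> \<bar>gauss_part n x\<bar> * \<bar>x\<bar> ^ K \<le> C"
proof -
  have "\<forall>j. \<exists>c\<ge>0. \<forall>x. \<bar>std_normal_density x * edgeworth_G kappa j x\<bar> * \<bar>x\<bar> ^ K \<le> c"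
  proof
    fix j
    obtain c where c: "c \<ge> 0" "\<And>x. norm (LINT \<theta>|lborel. gauss_kernel x \<theta> * edgeworth_poly kappa j \<theta>) * \<bar>x\<bar> ^ K \<le> c"
      using gauss_poly_decay[OF gauss_kernel_poly_fun(2)[OF poly_fun_edgeworth_poly[of kappa j]]] by blast
    have "\<bar>std_normal_density x * edgeworth_G kappa j x\<bar> * \<bar>x\<bar> ^ K \<le> c" for x
    proof -
      let ?z = "LINT \<theta>|lborel. gauss_kernel x \<theta> * edgeworth_poly kappa j \<theta>"
      have "\<bar>std_normal_density x * edgeworth_G kappa j x\<bar> \<le> norm (1 / (2 * complex_of_real pi) * ?z)"
        unfolding edgeworth_G_eq by (rule abs_Re_le_cmod)
      also have "\<dots> = 1 / (2 * pi) * norm ?z" by (simp add: norm_mult norm_divide)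
      also have "\<dots> \<le> 1 * norm ?z" using pi_gt3 by (intro mult_right_mono) auto
      finally have "\<bar>std_normal_density x * edgeworth_G kappa j x\<bar> * \<bar>x\<bar> ^ K \<le> norm ?z * \<bar>x\<bar> ^ K"
        by (intro mult_right_mono) auto
      also have "\<dots> \<le> c" by (rule c)
      finally show ?thesis .
    qed
    then show "\<exists>c\<ge>0. \<forall>x. \<bar>std_normal_density x * edgeworth_G kappa j x\<bar> * \<bar>x\<bar> ^ K \<le> c" using c(1) by blast
  qed
  then obtain c where c: "\<And>j. c j \<ge> 0" "\<And>j x. \<bar>std_normal_density x * edgeworth_G kappa j x\<bar> * \<bar>x\<bar> ^ K \<le> c j"
    by metis
  have "gauss_poly (\<lambda>x. LINT \<theta>|lborel. gauss_kernel x \<theta> * 1)"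
    by (rule gauss_kernel_poly_fun(2)[OF poly_fun_const])
  then obtain c0 where c0: "c0 \<ge> 0" "\<And>x. norm (LINT \<theta>|lborel. gauss_kernel x \<theta> * 1) * \<bar>x\<bar> ^ K \<le> c0"
    using gauss_poly_decay by blast
  have d: "std_normal_density x * \<bar>x\<bar> ^ K \<le> c0" for x
  proof -
    have "1 / sqrt (2 * pi) \<le> sqrt (2 * pi)" using pi_gt3 by (simp add: divide_le_eq)
    then have "std_normal_density x \<le> sqrt (2 * pi) * exp (- x\<^sup>2 / 2)"
      unfolding std_normal_density_def by (intro mult_right_mono) auto
    also have "\<dots> = norm (LINT \<theta>|lborel. gauss_kernel x \<theta> * 1)"
      unfolding mult_1_right gauss_kernel_power_0 by (simp add: norm_mult)
    finally have "std_normal_density x * \<bar>x\<bar> ^ K \<le> norm (LINT \<theta>|lborel. gauss_kernel x \<theta> * 1) * \<bar>x\<bar> ^ K"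
      by (rule mult_right_mono) simp
    then show ?thesis using c0(2)[of x] by linarith
  qed
  have "\<bar>gauss_part n x\<bar> * \<bar>x\<bar> ^ K \<le> c0 + (\<Sum>j\<in>orders. c j)" if n: "1 \<le> n" for n x
  proof -
    have "\<bar>gauss_part n x\<bar> \<le> std_normal_density x + (\<Sum>j\<in>orders. \<bar>std_normal_density x * edgeworth_G kappa j x\<bar>)"
    proof -
      have "gauss_part n x = std_normal_density x + (\<Sum>j\<in>orders. std_normal_density x * edgeworth_G kappa j x * (1 / real n powr (real j / 2 - 1)))"
        by (simp add: gauss_part_def distrib_left sum_distrib_left)
      moreover have "\<bar>\<Sum>j\<in>orders. std_normal_density x * edgeworth_G kappa j x * (1 / real n powr (real j / 2 - 1))\<bar>
          \<le> (\<Sum>j\<in>orders. \<bar>std_normal_density x * edgeworth_G kappa j x\<bar>)"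
      proof (rule order_trans[OF sum_abs sum_mono])
        fix j assume j: "j \<in> orders"
        have "real n powr (real j / 2 - 1) \<ge> 1" using n j by (intro ge_one_powr_ge_zero) (auto simp: orders_def)
        then have "1 / real n powr (real j / 2 - 1) \<le> 1" by (simp add: divide_le_eq)
        from mult_left_mono[OF this, of "\<bar>std_normal_density x * edgeworth_G kappa j x\<bar>"]
        show "\<bar>std_normal_density x * edgeworth_G kappa j x * (1 / real n powr (real j / 2 - 1))\<bar> \<le> \<bar>std_normal_density x * edgeworth_G kappa j x\<bar>"
          by (simp add: abs_mult)
      qed
      ultimately show ?thesis using normal_density_nonneg[of 0 1 x] by linarith
    qed
    then have "\<bar>gauss_part n x\<bar> * \<bar>x\<bar> ^ K \<le> (std_normal_density x + (\<Sum>j\<in>orders. \<bar>std_normal_density x * edgeworth_G kappa j x\<bar>)) * \<bar>x\<bar> ^ K"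
      by (rule mult_right_mono) simp
    also have "\<dots> = std_normal_density x * \<bar>x\<bar> ^ K + (\<Sum>j\<in>orders. \<bar>std_normal_density x * edgeworth_G kappa j x\<bar> * \<bar>x\<bar> ^ K)"
      by (simp only: distrib_right sum_distrib_right)
    also have "\<dots> \<le> c0 + (\<Sum>j\<in>orders. c j)" by (intro add_mono sum_mono d c)
    finally show ?thesis .
  qed
  then show ?thesis using c0(1) c(1) by (intro exI[of _ "c0 + (\<Sum>j\<in>orders. c j)"]) (auto simp: sum_nonneg)
qed

end

section \<open>The density of the normalised sum\<close>

text \<open>The points of U that violate the inequality form an open null set, which must be
  empty.\<close>

lemma closed_AE_all:
  fixes U C :: "real set"
  assumes "open U" "AE x in lborel. x \<in> U \<longrightarrow> g x \<le> h x" "continuous_on U g" "continuous_on U (h :: real \<Rightarrow> real)" "x \<in> U"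
  shows "g x \<le> h x"
proof -
  have "open (U \<inter> (\<lambda>y. g y - h y) -` {0<..})"
    by (intro continuous_open_preimage continuous_intros assms(1,3,4))
  moreover have "U \<inter> (\<lambda>y. g y - h y) -` {0<..} = {y \<in> U. h y < g y}" by auto
  ultimately have "open {y \<in> U. h y < g y}" by simp
  moreover have "AE y in lborel. y \<notin> {y \<in> U. h y < g y}"
    using assms(2) by eventually_elim auto
  ultimately have "{y \<in> U. h y < g y} = {}" by (rule open_AE_empty)
  then show ?thesis using assms(5) by (auto simp: not_less[symmetric])
qed

text \<open>Continuity of \<open>d n\<close> singles out one version of the density, so that
  estimates at individual points have a meaning.\<close>

locale pareto_sum = pareto_order a b \<alpha> N + prob_space M
  for a b \<alpha> :: real and N :: nat and M :: "'a measure" +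
  fixes X :: "nat \<Rightarrow> 'a \<Rightarrow> real" and d :: "nat \<Rightarrow> real \<Rightarrow> real"
  assumes indep: "indep_vars (\<lambda>_. borel) X {1..}"
    and X_dist: "\<And>k. k \<ge> 1 \<Longrightarrow> distributed M lborel (X k) F"
    and sum_dist: "\<And>n. n \<ge> 1 \<Longrightarrow> distributed M lborel (\<lambda>\<omega>. (\<Sum>k=1..n. X k \<omega>) / sqrt (real n)) (\<lambda>x. ennreal (d n x))"
    and d_nonneg: "\<And>n x. n \<ge> 1 \<Longrightarrow> d n x \<ge> 0"
    and d_cont: "\<And>n. n \<ge> 1 \<Longrightarrow> continuous_on UNIV (d n)"
begin

lemma X_rv [measurable]: "k \<ge> 1 \<Longrightarrow> random_variable borel (X k)"
  using distributed_measurable[OF X_dist] by (simp cong: measurable_cong_sets)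

lemma sum_rv: "random_variable borel (\<lambda>\<omega>. \<Sum>k=1..n. X k \<omega>)"
  by (rule borel_measurable_sum) (auto intro: X_rv)

lemma sum_density: "distributed M lborel (\<lambda>\<omega>. \<Sum>k=1..Suc m. X k \<omega>) (conv_pow F m)"
proof (induction m)
  case 0
  then show ?case using X_dist[of 1] by simp
next
  case (Suc m)
  have "indep_var borel (X (Suc (Suc m))) borel (\<lambda>\<omega>. \<Sum>k\<in>{1..Suc m}. X k \<omega>)"
    by (rule indep_vars_sum) (auto intro: indep_vars_subset[OF indep])
  from distributed_convolution[OF this X_dist Suc]
  have "distributed M lborel (\<lambda>\<omega>. X (Suc (Suc m)) \<omega> + (\<Sum>k=1..Suc m. X k \<omega>)) (\<lambda>x. \<integral>\<^sup>+y. F (x - y) * conv_pow F m y \<partial>lborel)"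
    by simp
  moreover have "(\<lambda>x. \<integral>\<^sup>+y. F (x - y) * conv_pow F m y \<partial>lborel) = conv_pow F (Suc m)"
  proof
    fix x
    have "(\<integral>\<^sup>+y. F (x - y) * conv_pow F m y \<partial>lborel) = conv (conv_pow F m) F x"
      by (simp add: conv_def mult.commute)
    also have "\<dots> = conv F (conv_pow F m) x" by (subst conv_commute) auto
    finally show "(\<integral>\<^sup>+y. F (x - y) * conv_pow F m y \<partial>lborel) = conv_pow F (Suc m) x" by simp
  qed
  moreover have "(\<lambda>\<omega>. X (Suc (Suc m)) \<omega> + (\<Sum>k=1..Suc m. X k \<omega>)) = (\<lambda>\<omega>. \<Sum>k=1..Suc (Suc m). X k \<omega>)"
    by (simp add: add.commute)
  ultimately show ?case by simp
qed

lemma density_AE: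
  "AE y in lborel. ennreal (d (Suc m) (y / sqrt (real (Suc m))) / sqrt (real (Suc m))) = conv_pow F m y"
proof -
  let ?s = "sqrt (real (Suc m))"
  have s: "?s > 0" by simp
  have "distributed M lborel (\<lambda>\<omega>. 0 + ?s * ((\<Sum>k=1..Suc m. X k \<omega>) / ?s)) (\<lambda>x. ennreal (d (Suc m) ((x - 0) / ?s)) / ennreal \<bar>?s\<bar>)"
    by (rule distributed_affine[OF sum_dist]) (use s in auto)
  then have "distributed M lborel (\<lambda>\<omega>. \<Sum>k=1..Suc m. X k \<omega>) (\<lambda>x. ennreal (d (Suc m) (x / ?s)) / ennreal ?s)"
    using s by simp
  from distributed_unique[OF this sum_density]
  show ?thesis using s d_nonneg[of "Suc m"] by (simp add: divide_ennreal)
qed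

lemma char_X:
  assumes "k \<ge> 1"
  shows "char (distr M borel (X k)) s = of_real (phi s)"
proof -
  have D: "distr M borel (X k) = density lborel F"
    using distributed_distr_eq_density[OF X_dist[OF assms]] by (simp cong: distr_cong)
  have i: "integrable lborel (\<lambda>x. f x * sin (s * x))"
    by (rule integrable_mult_bounded[OF f_integrable]) auto
  have o: "(LINT x|lborel. f x * sin (s * x)) = 0"
    using lborel_integral_real_affine[of "-1" "\<lambda>x. f x * sin (s * x)" 0] by (simp add: f_even)
  have "char (distr M borel (X k)) s = (LINT x|lborel. f x *\<^sub>R iexp (s * x))"
    unfolding char_def D by (subst integral_density) (auto simp: f_nonneg)
  also have "\<dots> = (LINT x|lborel. complex_of_real (f x * cos (s * x)) + \<i> * complex_of_real (f x * sin (s * x)))"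
    by (intro Bochner_Integration.integral_cong refl)
       (simp add: complex_eq_iff Re_exp Im_exp)
  also have "\<dots> = complex_of_real (phi s) + \<i> * complex_of_real 0"
  proof -
    have 1: "integrable lborel (\<lambda>x. complex_of_real (f x * cos (s * x)))" by (rule integrable_of_real[OF f_cos_integrable])
    have 2: "integrable lborel (\<lambda>x. \<i> * complex_of_real (f x * sin (s * x)))" by (rule integrable_mult_right[OF integrable_of_real[OF i]])
    show ?thesis
      unfolding Bochner_Integration.integral_add[OF 1 2] integral_mult_right_zero integral_complex_of_real o phi_def ..
  qed
  finally show ?thesis by simp
qed

lemma char_sum:
  assumes "n \<ge> 1"
  shows "char (distr M borel (\<lambda>\<omega>. (\<Sum>k=1..n. X k \<omega>) / sqrt (real n))) t = of_real (phi (t / sqrt (real n)) ^ n)"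
proof -
  note [measurable] = sum_rv
  have "char (distr M borel (\<lambda>\<omega>. (\<Sum>k=1..n. X k \<omega>) / sqrt (real n))) t = char (distr M borel (\<lambda>\<omega>. \<Sum>k=1..n. X k \<omega>)) (t / sqrt (real n))"
    unfolding char_def by (simp add: integral_distr)
  also have "\<dots> = (\<Prod>k\<in>{1..n}. char (distr M borel (X k)) (t / sqrt (real n)))"
    by (rule char_distr_sum) (auto intro: indep_vars_subset[OF indep])
  also have "\<dots> = of_real (phi (t / sqrt (real n)) ^ n)"
    by (simp add: char_X)
  finally show ?thesis .
qed

lemma density_inversion:
  assumes "n \<ge> 2"
  shows "complex_of_real (d n x) = 1 / (2 * pi) * (CLINT \<theta>|lborel. iexp (- (\<theta> * x)) * of_real (phi (\<theta> / sqrt (real n)) ^ n))"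
proof -
  have n: "n \<ge> 1" using assms by simp
  let ?S = "\<lambda>\<omega>. (\<Sum>k=1..n. X k \<omega>) / sqrt (real n)"
  have rv: "random_variable borel ?S" using sum_rv by measurable
  interpret S: real_distribution "distr M borel ?S" using rv by (rule real_distribution_distr)
  have c: "char (distr M borel ?S) = (\<lambda>\<theta>. of_real (phi (\<theta> / sqrt (real n)) ^ n))"
    by (rule ext) (rule char_sum[OF n])
  have "complex_of_real (d n x) = 1 / (2 * pi) * (CLINT \<theta>|lborel. iexp (- (\<theta> * x)) * char (distr M borel ?S) \<theta>)"
  proof (rule S.continuous_density_inversion)
    show "distr M borel ?S = density lborel (\<lambda>x. ennreal (d n x))"
      using distributed_distr_eq_density[OF sum_dist[OF n]] by (simp cong: distr_cong)
    show "integrable lborel (char (distr M borel ?S))"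
      unfolding c by (intro integrable_of_real phi_power_integrable assms)
  qed (use d_nonneg[OF n] d_cont[OF n] in auto)
  then show ?thesis by (simp only: c)
qed

lemma density_even: "n \<ge> 2 \<Longrightarrow> d n (- x) = d n x"
proof -
  assume n: "n \<ge> 2"
  have ph: "phi (- s) = phi s" for s by (simp add: phi_def)
  have "(CLINT \<theta>|lborel. iexp (- (\<theta> * - x)) * of_real (phi (\<theta> / sqrt (real n)) ^ n)) = (CLINT \<theta>|lborel. iexp (- (\<theta> * x)) * of_real (phi (\<theta> / sqrt (real n)) ^ n))"
    using lborel_integral_real_affine[of "-1" "\<lambda>\<theta>. iexp (- (\<theta> * x)) * of_real (phi (\<theta> / sqrt (real n)) ^ n)" 0]
    by (simp add: ph)
  then have "complex_of_real (d n (- x)) = complex_of_real (d n x)" by (simp only: density_inversion[OF n])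
  then show ?thesis by (simp only: of_real_eq_iff)
qed

text \<open>The difference is the inverse Fourier transform of \<open>fourier_error\<close>, hence
  at most its integrated norm over 2 pi for every x at once.\<close>

lemma uniform_error:
  "\<exists>\<delta>>0. \<forall>\<^sub>F n in sequentially. \<forall>x. \<bar>d n x - pareto_expansion kappa a \<alpha> n x\<bar> \<le> real n powr (- (\<alpha> / 2 - 1) - \<delta>)"
proof -
  obtain \<delta> where \<delta>: "\<delta> > 0" and ev: "\<forall>\<^sub>F n in sequentially. integrable lborel (fourier_error n) \<and>
     (LINT \<theta>|lborel. norm (fourier_error n \<theta>)) \<le> real n powr (- (\<alpha> / 2 - 1) - \<delta>)"
    using fourier_error_rate by blast
  have "\<forall>\<^sub>F n in sequentially. \<forall>x. \<bar>d n x - pareto_expansion kappa a \<alpha> n x\<bar> \<le> real n powr (- (\<alpha> / 2 - 1) - \<delta>)"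
    using ev eventually_ge_at_top[of 2]
  proof eventually_elim
    case (elim n)
    show ?case
    proof
      fix x
      have n1: "n \<ge> 1" using elim by simp
      let ?c = "1 / (2 * complex_of_real pi)"
      let ?P = "\<lambda>\<theta>. iexp (- (\<theta> * x)) * complex_of_real (phi (\<theta> / sqrt (real n)) ^ n)"
      let ?Q = "\<lambda>\<theta>. gauss_kernel x \<theta> * fourier_expansion (1 / sqrt (real n)) \<theta>"
      have iP: "integrable lborel ?P"
      proof (rule Bochner_Integration.integrable_bound[OF phi_power_integrable[of n]])
        show "AE \<theta> in lborel. norm (?P \<theta>) \<le> norm (phi (\<theta> / sqrt (real n)) ^ n)" by (simp add: norm_mult norm_power power_abs)
      qed (use elim in auto)
      have iQ: "integrable lborel ?Q" by (rule pareto_expansion_fourier(1)[OF n1])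
      have PQ: "?P \<theta> - ?Q \<theta> = iexp (- (\<theta> * x)) * fourier_error n \<theta>" for \<theta>
        by (simp only: gauss_kernel_eq fourier_error_def right_diff_distrib mult.assoc)
      have "d n x - pareto_expansion kappa a \<alpha> n x = Re (?c * (LINT \<theta>|lborel. ?P \<theta>)) - Re (?c * (LINT \<theta>|lborel. ?Q \<theta>))"
      proof -
        have "d n x = Re (complex_of_real (d n x))" by simp
        also have "\<dots> = Re (?c * (LINT \<theta>|lborel. ?P \<theta>))" using density_inversion[of n x] elim by simp
        finally show ?thesis using pareto_expansion_fourier(2)[OF n1, of x] by simp
      qed
      also have "\<dots> = Re (?c * (LINT \<theta>|lborel. ?P \<theta> - ?Q \<theta>))"
        unfolding Bochner_Integration.integral_diff[OF iP iQ] by (simp add: right_diff_distrib)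
      finally have "\<bar>d n x - pareto_expansion kappa a \<alpha> n x\<bar> \<le> norm (?c * (LINT \<theta>|lborel. ?P \<theta> - ?Q \<theta>))"
        by (simp only: abs_Re_le_cmod)
      also have "\<dots> \<le> 1 * norm (LINT \<theta>|lborel. ?P \<theta> - ?Q \<theta>)"
        unfolding norm_mult using pi_gt3 by (intro mult_right_mono) (auto simp: norm_divide)
      also have "norm (LINT \<theta>|lborel. ?P \<theta> - ?Q \<theta>) \<le> (LINT \<theta>|lborel. norm (?P \<theta> - ?Q \<theta>))"
        by (rule integral_norm_bound)
      also have "(LINT \<theta>|lborel. norm (?P \<theta> - ?Q \<theta>)) = (LINT \<theta>|lborel. norm (fourier_error n \<theta>))"
        unfolding PQ norm_mult by simp
      finally show "\<bar>d n x - pareto_expansion kappa a \<alpha> n x\<bar> \<le> real n powr (- (\<alpha> / 2 - 1) - \<delta>)"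
        using elim by simp
    qed
  qed
  then show ?thesis using \<delta> by blast
qed

text \<open>Convolution powers determine the density almost everywhere only; continuity extends the
  bounds to every point.\<close>

lemma density_far:
  assumes \<delta>: "0 < \<delta>" and e: "0 < e" "e < 1"
  shows "\<forall>\<^sub>F n in sequentially. \<forall>x. \<bar>x\<bar> > real n powr \<delta> \<longrightarrow>
    \<bar>d n x - a * \<bar>x\<bar> powr - (\<alpha> + 1) / real n powr (\<alpha> / 2 - 1)\<bar> \<le> e * (a * \<bar>x\<bar> powr - (\<alpha> + 1) / real n powr (\<alpha> / 2 - 1))"
proof -
  \<comment> \<open>Fixed by (1/2 + \<delta>) (2 - \<kappa>) = 1: for x > n^\<delta> the
    unnormalised point y = sqrt n x then satisfies n \<le> y^(2-\<kappa>).\<close>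
  define \<kappa> where "\<kappa> = 2 - 1 / (1 / 2 + \<delta>)"
  have "1 / (1 / 2 + \<delta>) < 2" using \<delta> by (simp add: divide_less_eq)
  then have \<kappa>: "0 < \<kappa>" "\<kappa> < 2" using \<delta> by (auto simp: \<kappa>_def)
  have \<kappa>': "(1 / 2 + \<delta>) * (2 - \<kappa>) = 1" using \<delta> by (simp add: \<kappa>_def)
  \<comment> \<open>One half pays for the one-jump approximation, the other for replacing f by its
    leading power; (1 - e/2)^2 \<ge> 1 - e combines them from below.\<close>
  define e' where "e' = e / 2"
  have e': "0 < e'" "e' < 1" using e by (auto simp: e'_def)
  obtain Y where Y: "Y \<ge> 1" "\<And>y k. y \<ge> Y \<Longrightarrow> real (k + 3) \<le> y powr (2 - \<kappa>) \<Longrightarrow>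
    ennreal ((1 - e') * (real (k + 3) * f y)) \<le> conv_pow F (k + 2) y \<and>
    conv_pow F (k + 2) y \<le> ennreal ((1 + e') * (real (k + 3) * f y))"
    using big_jump_density[OF \<kappa> e'] by blast
  have "filterlim (\<lambda>n. sqrt (real n)) at_top sequentially"
    by (intro filterlim_compose[OF sqrt_at_top filterlim_real_sequentially])
  then have ev1: "\<forall>\<^sub>F n in sequentially. sqrt (real n) \<ge> Y" by (simp add: filterlim_at_top)
  have ev2: "\<forall>\<^sub>F n in sequentially. b * real n powr - (1 / 2) \<le> e'"
    using eventually_compose_filterlim[OF eventually_powr_less[of "1 / 2" e' b] filterlim_real_sequentially] e' by simp
  show ?thesis
    using ev1 ev2 eventually_ge_at_top[of 3]
  proof eventually_elim
    case (elim n)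
    obtain k where k: "n = Suc (k + 2)" using elim(3) by (metis add_2_eq_Suc' le_Suc_ex numeral_3_eq_3 add.commute add_Suc_right add_Suc)
    let ?s = "sqrt (real n)"
    have n1: "real n \<ge> 1" "n \<ge> 1" using elim(3) by auto
    have s: "?s \<ge> 1" using n1 by simp
    define A where "A = (\<lambda>x. a * x powr - (\<alpha> + 1) / real n powr (\<alpha> / 2 - 1))"
    define U where "U = {real n powr \<delta><..}"
    have nd: "real n powr \<delta> \<ge> 1" using n1 \<delta> by (intro ge_one_powr_ge_zero) auto
    have ae: "AE x in lborel. ennreal (d n x / ?s) = conv_pow F (k + 2) (?s * x)"
    proof -
      have "AE y in lborel. ennreal (d n (y / ?s) / ?s) = conv_pow F (k + 2) y"
        using density_AE[of "k + 2"] unfolding k[symmetric] .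
      moreover have "Measurable.pred borel (\<lambda>y. ennreal (d n (y / ?s) / ?s) = conv_pow F (k + 2) y)"
      proof -
        have [measurable]: "d n \<in> borel_measurable borel" by (rule borel_measurable_continuous_onI[OF d_cont[OF n1(2)]])
        show ?thesis by measurable
      qed
      ultimately have "AE x in lborel. ennreal (d n ((0 + ?s * x) / ?s) / ?s) = conv_pow F (k + 2) (0 + ?s * x)"
        using s by (intro AE_borel_affine[of ?s _ 0]) auto
      then show ?thesis using s by simp
    qed
    have bnd: "AE x in lborel. x \<in> U \<longrightarrow> (1 - e') * (real n * ?s * f (?s * x)) \<le> d n x \<and> d n x \<le> (1 + e') * (real n * ?s * f (?s * x))"
      using ae
    proof eventually_elim
      case (elim x)
      show ?case
      proof
        assume "x \<in> U"
        then have x: "x > real n powr \<delta>" "x > 1" using nd by (auto simp: U_def)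
        have y: "?s * x \<ge> Y" using \<open>Y \<le> ?s\<close> x s mult_left_mono[of 1 x ?s] by linarith
        have "real (k + 3) = (real n powr (1 / 2 + \<delta>)) powr (2 - \<kappa>)"
          unfolding powr_powr \<kappa>' using n1 k by simp
        also have "\<dots> \<le> (?s * x) powr (2 - \<kappa>)"
          using x \<kappa> n1 by (intro powr_mono2) (auto simp: powr_add powr_half_sqrt intro!: mult_left_mono)
        finally have c: "real (k + 3) \<le> (?s * x) powr (2 - \<kappa>)" .
        have dn: "d n x \<ge> 0" using d_nonneg[OF n1(2)] .
        have kn: "real (k + 3) = real n" using k by simp
        have f0: "0 \<le> real n * f (?s * x)" using f_nonneg by simp
        from Y(2)[OF y c] have "ennreal ((1 - e') * (real n * f (?s * x))) \<le> ennreal (d n x / ?s)"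
          "ennreal (d n x / ?s) \<le> ennreal ((1 + e') * (real n * f (?s * x)))"
          unfolding elim kn by auto
        then have "(1 - e') * (real n * f (?s * x)) \<le> d n x / ?s" "d n x / ?s \<le> (1 + e') * (real n * f (?s * x))"
          using dn s e' f0 by (auto simp: ennreal_le_iff)
        then show "(1 - e') * (real n * ?s * f (?s * x)) \<le> d n x \<and> d n x \<le> (1 + e') * (real n * ?s * f (?s * x))"
          using s by (simp add: pos_le_divide_eq pos_divide_le_eq mult_ac)
      qed
    qed
    have fA: "(1 - e') * A x \<le> real n * ?s * f (?s * x) \<and> real n * ?s * f (?s * x) \<le> A x" if "x > 1" for x
    proof -
      have y1: "?s * x > 0" using s that by simp
      \<comment> \<open>Here n counts the possible jumps and sqrt n is the Jacobian of the
        normalisation; the total exponent of n is 3/2 - (\<alpha> + 1)/2 = 1 - \<alpha>/2.\<close>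
      have Ax: "real n * ?s * (a * (?s * x) powr - (\<alpha> + 1)) = A x"
      proof -
        have "real n * ?s = real n powr (3 / 2)"
          using n1 powr_add[of "real n" 1 "1 / 2"] by (simp add: powr_half_sqrt)
        moreover have "(?s * x) powr - (\<alpha> + 1) = real n powr (- (\<alpha> + 1) / 2) * x powr - (\<alpha> + 1)"
          using n1 that by (simp add: powr_mult powr_half_sqrt[symmetric] powr_powr del: minus_add_distrib)
        ultimately have "real n * ?s * (a * (?s * x) powr - (\<alpha> + 1)) = a * x powr - (\<alpha> + 1) * (real n powr (3 / 2) * real n powr (- (\<alpha> + 1) / 2))"
          by (simp only: mult_ac)
        also have "real n powr (3 / 2) * real n powr (- (\<alpha> + 1) / 2) = real n powr (- (\<alpha> / 2 - 1))"
        proof -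
          have "3 / 2 + - (\<alpha> + 1) / 2 = - (\<alpha> / 2 - 1)" by (simp add: field_simps)
          then show ?thesis by (simp only: powr_add[symmetric])
        qed
        also have "a * x powr - (\<alpha> + 1) * real n powr (- (\<alpha> / 2 - 1)) = A x"
          unfolding A_def powr_minus_divide[of "real n"] by simp
        finally show ?thesis .
      qed
      have A0: "A x \<ge> 0" using a_pos by (simp add: A_def)
      have up: "f (?s * x) \<le> a * (?s * x) powr - (\<alpha> + 1)" using f_le_powr[OF less_imp_neq[OF y1, symmetric]] y1 by (simp only: abs_of_pos)
      have lo: "(1 - e') * (a * (?s * x) powr - (\<alpha> + 1)) \<le> f (?s * x)"
      proof -
        define Z where "Z = (?s * x) powr (\<alpha> + 1)"
        have Z0: "Z > 0" unfolding Z_def powr_gt_zero using y1 by (metis less_irrefl)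
        have "b \<le> e' * Z"
        proof -
          have "b \<le> e' * ?s"
            using elim(2) n1 by (simp add: powr_minus_divide powr_half_sqrt divide_le_eq)
          also have "?s \<le> Z"
          proof -
            have "?s = ?s powr 1" using s by simp
            also have "\<dots> \<le> (?s * x) powr 1" using s that by (intro powr_mono2) auto
            also have "\<dots> \<le> Z" unfolding Z_def using s that alpha_gt_2 mult_mono[of 1 ?s 1 x] by (intro powr_mono) auto
            finally show ?thesis .
          qed
          finally show ?thesis using e' by (simp add: mult_left_mono)
        qed
        moreover have "0 \<le> e' * b" using b_pos e' by simp
        moreover have "(1 - e') * (b + Z) = b + Z - e' * b - e' * Z" by (simp add: algebra_simps)
        ultimately have "(1 - e') * (b + Z) \<le> Z" by linarith
        then have "(1 - e') / Z \<le> 1 / (b + Z)" using Z0 b_pos by (simp add: divide_le_eq le_divide_eq)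
        then have "a * ((1 - e') / Z) \<le> a * (1 / (b + Z))" using a_pos by (intro mult_left_mono) auto
        moreover have "f (?s * x) = a / (b + Z)"
          unfolding f_def pareto_density_def abs_of_pos[OF y1] Z_def ..
        moreover have "(?s * x) powr - (\<alpha> + 1) = 1 / Z" unfolding Z_def by (rule powr_minus_divide)
        ultimately show ?thesis by (simp only: times_divide_eq_right mult_1_right mult.commute[of a])
      qed
      have "real n * ?s * ((1 - e') * (a * (?s * x) powr - (\<alpha> + 1))) \<le> real n * ?s * f (?s * x)"
        by (intro mult_left_mono lo) auto
      then have "(1 - e') * A x \<le> real n * ?s * f (?s * x)" unfolding Ax[symmetric] by (simp only: mult_ac)
      moreover have "real n * ?s * f (?s * x) \<le> A x" unfolding Ax[symmetric] by (intro mult_left_mono up) auto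
      ultimately show ?thesis by blast
    qed
    have A_nonneg: "A x \<ge> 0" for x using a_pos by (simp add: A_def)
    have lo: "AE x in lborel. x \<in> U \<longrightarrow> (1 - e) * A x \<le> d n x"
      using bnd
    proof eventually_elim
      case (elim x)
      show ?case
      proof
        assume xU: "x \<in> U"
        then have x: "x > 1" using nd by (auto simp: U_def)
        have "(1 - e) * A x \<le> (1 - e') * ((1 - e') * A x)"
        proof -
          have "1 - e \<le> (1 - e') * (1 - e')" by (simp add: e'_def algebra_simps)
          then show ?thesis unfolding mult.assoc[symmetric] by (rule mult_right_mono) (rule A_nonneg)
        qed
        also have "\<dots> \<le> (1 - e') * (real n * ?s * f (?s * x))" using fA[OF x] e' by (intro mult_left_mono) auto
        finally show "(1 - e) * A x \<le> d n x" using elim xU by linarith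
      qed
    qed
    have up: "AE x in lborel. x \<in> U \<longrightarrow> d n x \<le> (1 + e) * A x"
      using bnd
    proof eventually_elim
      case (elim x)
      show ?case
      proof
        assume xU: "x \<in> U"
        then have x: "x > 1" using nd by (auto simp: U_def)
        have "(1 + e') * (real n * ?s * f (?s * x)) \<le> (1 + e') * A x" using fA[OF x] e' by (intro mult_left_mono) auto
        also have "\<dots> \<le> (1 + e) * A x" using A_nonneg e by (intro mult_right_mono) (auto simp: e'_def)
        finally show "d n x \<le> (1 + e) * A x" using elim xU by linarith
      qed
    qed
    have cA: "continuous_on U A"
      unfolding A_def U_def using nd n1 by (intro continuous_intros) auto
    have cd: "continuous_on U (d n)" by (rule continuous_on_subset[OF d_cont[OF n1(2)]]) simp
    have U: "open U" by (simp add: U_def)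
    have pos: "\<bar>d n x - A x\<bar> \<le> e * A x" if "x \<in> U" for x
    proof -
      have "(1 - e) * A x \<le> d n x"
        by (rule closed_AE_all[OF U lo _ cd that]) (intro continuous_intros cA)
      moreover have "d n x \<le> (1 + e) * A x"
        by (rule closed_AE_all[OF U up cd _ that]) (intro continuous_intros cA)
      ultimately show ?thesis by (simp add: abs_le_iff algebra_simps)
    qed
    show ?case
    proof (intro allI impI)
      fix x assume x: "\<bar>x\<bar> > real n powr \<delta>"
      have "d n x = d n \<bar>x\<bar>" using density_even[of n x] elim(3) by (auto simp: abs_if)
      then show "\<bar>d n x - a * \<bar>x\<bar> powr - (\<alpha> + 1) / real n powr (\<alpha> / 2 - 1)\<bar> \<le> e * (a * \<bar>x\<bar> powr - (\<alpha> + 1) / real n powr (\<alpha> / 2 - 1))"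
        using pos[of "\<bar>x\<bar>"] x by (simp add: A_def U_def)
    qed
  qed
qed

text \<open>The decay of \<open>pareto_G\<close> comes for free: at \<open>x\<close> slightly above \<open>n powr \<delta>'\<close> the
  density is described both by the Edgeworth expansion and by the big-jump asymptotics.\<close>

lemma pareto_G_asymp:
  assumes e: "0 < e" "e < 1"
  shows "\<exists>x0\<ge>1. \<forall>x. \<bar>x\<bar> \<ge> x0 \<longrightarrow> \<bar>pareto_G \<alpha> x - \<bar>x\<bar> powr - (\<alpha> + 1)\<bar> \<le> e * \<bar>x\<bar> powr - (\<alpha> + 1)"
proof -
  define p where "p = \<alpha> / 2 - 1"
  have p: "p > 0" using alpha_gt_2 by (simp add: p_def)
  obtain \<delta> where \<delta>: "\<delta> > 0" and un: "\<forall>\<^sub>F n in sequentially. \<forall>x. \<bar>d n x - pareto_expansion kappa a \<alpha> n x\<bar> \<le> real n powr (- (\<alpha> / 2 - 1) - \<delta>)"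
    using uniform_error by blast
  \<comment> \<open>At x near n^\<eta> the saving n^(-\<delta>) is of order x^(-2(\<alpha>+1)), the
    square of the decay to be proved.\<close>
  define \<eta> where "\<eta> = \<delta> / (2 * (\<alpha> + 1))"
  have \<eta>: "\<eta> > 0" using \<delta> alpha_gt_2 by (simp add: \<eta>_def)
  have \<delta>\<eta>: "\<delta> = 2 * (\<alpha> + 1) * \<eta>" using alpha_gt_2 by (simp add: \<eta>_def)
  \<comment> \<open>Large enough that the Gaussian part, multiplied by n^p with n at most
    x^(1/\<eta>), is also of order x^(-2(\<alpha>+1)).\<close>
  define K where "K = nat \<lceil>p / \<eta> + 2 * (\<alpha> + 1)\<rceil>"
  have K: "real K \<ge> p / \<eta> + 2 * (\<alpha> + 1)" unfolding K_def by (rule real_nat_ceiling_ge)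
  obtain C where C: "C \<ge> 0" "\<And>n x. 1 \<le> n \<Longrightarrow> \<bar>gauss_part n x\<bar> * \<bar>x\<bar> ^ K \<le> C"
    using gauss_part_decay[of K] by blast
  have e2: "0 < e / 2" "e / 2 < 1" using e by auto
  obtain n0 where n0: "\<And>n. n \<ge> n0 \<Longrightarrow> 1 \<le> n \<and> (\<forall>x. \<bar>d n x - pareto_expansion kappa a \<alpha> n x\<bar> \<le> real n powr (- p - \<delta>)) \<and>
     (\<forall>x. \<bar>x\<bar> > real n powr \<eta> \<longrightarrow> \<bar>d n x - a * \<bar>x\<bar> powr - (\<alpha> + 1) / real n powr p\<bar> \<le> e / 2 * (a * \<bar>x\<bar> powr - (\<alpha> + 1) / real n powr p))"
    using eventually_conj[OF eventually_ge_at_top[of 1] eventually_conj[OF un density_far[OF \<eta> e2]]]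
    unfolding p_def eventually_sequentially by blast
  have "\<forall>\<^sub>F x in at_top. (2 powr \<delta> + C) * x powr - (\<alpha> + 1) \<le> e / 2 * a"
    by (rule eventually_powr_less) (use alpha_gt_2 e a_pos in auto)
  then obtain x1 where x1: "\<And>x. x \<ge> x1 \<Longrightarrow> (2 powr \<delta> + C) * x powr - (\<alpha> + 1) \<le> e / 2 * a"
    unfolding eventually_at_top_linorder by blast
  define x0 where "x0 = max (max 1 x1) ((real n0 + 2) powr \<eta>)"
  have pos: "\<bar>pareto_G \<alpha> x - x powr - (\<alpha> + 1)\<bar> \<le> e * x powr - (\<alpha> + 1)" if x: "x \<ge> x0" for x
  proof -
    have xx: "x \<ge> 1" "x \<ge> x1" "x \<ge> (real n0 + 2) powr \<eta>" using x by (auto simp: x0_def)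
    define v where "v = x powr (1 / \<eta>)"
    have v: "v \<ge> real n0 + 2"
    proof -
      have "real n0 + 2 = ((real n0 + 2) powr \<eta>) powr (1 / \<eta>)" using \<eta> by (simp add: powr_powr)
      also have "\<dots> \<le> v" unfolding v_def using xx \<eta> by (intro powr_mono2) auto
      finally show ?thesis .
    qed
    have vx: "v powr \<eta> = x" using \<eta> xx by (simp add: v_def powr_powr)
    \<comment> \<open>The largest integer strictly below v = x^(1/\<eta>). Strictness puts x in the
      one-jump range, while n \<ge> v / 2 keeps n^(-\<delta>) comparable to v^(-\<delta>).\<close>
    define n where "n = nat \<lceil>v\<rceil> - 1"
    have n: "real n < v" "v \<le> real n + 1" "real n \<ge> 1"
    proof -
      have c: "\<lceil>v\<rceil> \<ge> 2" using v by linarith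
      have "nat \<lceil>v\<rceil> \<ge> 1" using c by linarith
      then have "real n = real (nat \<lceil>v\<rceil>) - 1" unfolding n_def by (subst of_nat_diff) auto
      moreover have "real (nat \<lceil>v\<rceil>) = of_int \<lceil>v\<rceil>" using c by (intro of_nat_nat) linarith
      ultimately have rn: "real n = of_int \<lceil>v\<rceil> - 1" by linarith
      show "real n < v" "v \<le> real n + 1" "real n \<ge> 1" unfolding rn using c by linarith+
    qed
    have "n \<ge> n0" using n(2) v by linarith
    note N = n0[OF this]
    have far: "\<bar>x\<bar> > real n powr \<eta>"
    proof -
      have "real n powr \<eta> < v powr \<eta>" using n \<eta> by (intro powr_less_mono2) auto
      then show ?thesis using vx xx by simp
    qed
    define w where "w = x powr - (\<alpha> + 1)"
    have w0: "w > 0" using xx by (simp add: w_def)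
    define np where "np = real n powr p"
    have np: "np > 0" using n by (simp add: np_def)
    have A: "\<bar>d n x - pareto_expansion kappa a \<alpha> n x\<bar> \<le> real n powr (- p - \<delta>)"
      "\<bar>d n x - a * w / np\<bar> \<le> e / 2 * (a * w / np)"
    proof -
      show "\<bar>d n x - pareto_expansion kappa a \<alpha> n x\<bar> \<le> real n powr (- p - \<delta>)" using N by blast
      have "\<bar>x\<bar> = x" using xx by simp
      moreover have "\<bar>d n x - a * \<bar>x\<bar> powr - (\<alpha> + 1) / real n powr p\<bar> \<le> e / 2 * (a * \<bar>x\<bar> powr - (\<alpha> + 1) / real n powr p)"
        using N far by blast
      ultimately show "\<bar>d n x - a * w / np\<bar> \<le> e / 2 * (a * w / np)" by (simp only: w_def np_def)
    qed
    have G: "pareto_expansion kappa a \<alpha> n x = gauss_part n x + a * pareto_G \<alpha> x / np"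
      unfolding pareto_expansion_eq np_def p_def ..
    have "\<bar>a * pareto_G \<alpha> x / np - a * w / np\<bar> \<le> real n powr (- p - \<delta>) + e / 2 * (a * w / np) + \<bar>gauss_part n x\<bar>"
      using A unfolding G by linarith
    then have "np * \<bar>a * pareto_G \<alpha> x / np - a * w / np\<bar> \<le> np * (real n powr (- p - \<delta>) + e / 2 * (a * w / np) + \<bar>gauss_part n x\<bar>)"
      using np by (intro mult_left_mono) auto
    moreover have "np * \<bar>a * pareto_G \<alpha> x / np - a * w / np\<bar> = a * \<bar>pareto_G \<alpha> x - w\<bar>"
    proof -
      have "a * pareto_G \<alpha> x / np - a * w / np = a * (pareto_G \<alpha> x - w) / np"
        by (simp add: diff_divide_distrib right_diff_distrib)
      then show ?thesis using np a_pos by (simp add: abs_mult)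
    qed
    moreover have "np * (real n powr (- p - \<delta>) + e / 2 * (a * w / np) + \<bar>gauss_part n x\<bar>) = real n powr - \<delta> + e / 2 * (a * w) + np * \<bar>gauss_part n x\<bar>"
    proof -
      have "np * real n powr (- p - \<delta>) = real n powr - \<delta>" unfolding np_def by (simp add: powr_add[symmetric])
      then show ?thesis using np by (simp add: distrib_left)
    qed
    ultimately have B: "a * \<bar>pareto_G \<alpha> x - w\<bar> \<le> real n powr - \<delta> + e / 2 * (a * w) + np * \<bar>gauss_part n x\<bar>" by simp
    have B1: "real n powr - \<delta> \<le> 2 powr \<delta> * (w * w)"
    proof -
      have "v / 2 \<le> real n" using n by linarith
      then have "real n powr - \<delta> \<le> (v / 2) powr - \<delta>" using \<delta> v by (intro powr_mono2') auto
      also have "\<dots> = 2 powr \<delta> * v powr - \<delta>" using v by (simp add: powr_divide powr_minus_divide)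
      also have "v powr - \<delta> = x powr (- (\<alpha> + 1) + - (\<alpha> + 1))"
      proof -
        have "1 / \<eta> * - \<delta> = - (\<alpha> + 1) + - (\<alpha> + 1)" using \<eta> unfolding \<delta>\<eta> by (simp add: field_simps)
        then show ?thesis unfolding v_def powr_powr by (simp only:)
      qed
      also have "\<dots> = w * w" by (simp only: powr_add w_def)
      finally show ?thesis .
    qed
    have B2: "np * \<bar>gauss_part n x\<bar> \<le> C * (w * w)"
    proof -
      have xK: "x ^ K > 0" using xx by simp
      have "\<bar>gauss_part n x\<bar> \<le> C / x ^ K"
        using C(2)[of n x] N xx xK by (simp add: pos_le_divide_eq)
      moreover have "np \<le> x powr (p / \<eta>)"
      proof -
        have "np \<le> v powr p" unfolding np_def using n p by (intro powr_mono2) auto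
        then show ?thesis by (simp add: v_def powr_powr)
      qed
      ultimately have "np * \<bar>gauss_part n x\<bar> \<le> x powr (p / \<eta>) * (C / x ^ K)"
        using np by (intro mult_mono) auto
      also have "\<dots> = C * x powr (p / \<eta> - real K)" using xx by (simp add: powr_diff powr_realpow)
      also have "\<dots> \<le> C * x powr (- (\<alpha> + 1) + - (\<alpha> + 1))"
        using C(1) K xx by (intro mult_left_mono powr_mono) auto
      finally show ?thesis by (simp only: powr_add w_def)
    qed
    have "(2 powr \<delta> + C) * w * w \<le> e / 2 * a * w"
      using x1[OF xx(2)] w0 by (intro mult_right_mono) (auto simp: w_def)
    then have "a * \<bar>pareto_G \<alpha> x - w\<bar> \<le> a * (e * w)"
      using B B1 B2 by (simp add: algebra_simps)
    then show ?thesis using a_pos by (simp add: w_def)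
  qed
  have "\<bar>pareto_G \<alpha> x - \<bar>x\<bar> powr - (\<alpha> + 1)\<bar> \<le> e * \<bar>x\<bar> powr - (\<alpha> + 1)" if "\<bar>x\<bar> \<ge> x0" for x
  proof -
    have "pareto_G \<alpha> \<bar>x\<bar> = pareto_G \<alpha> x" using pareto_G_even[of x] by (auto simp: abs_if)
    then show ?thesis using pos[OF that] by simp
  qed
  moreover have "x0 \<ge> 1" by (simp add: x0_def)
  ultimately show ?thesis by blast
qed

text \<open>A zero-free substitute for \<open>pareto_G\<close> with the same tail order and no
  singularity at 0.\<close>

definition weight :: "real \<Rightarrow> real" where "weight x = (1 + \<bar>x\<bar>) powr - (\<alpha> + 1)"

lemma weight_pos: "weight x > 0"
  unfolding weight_def powr_gt_zero by linarith

lemma weight_le_1: "weight x \<le> 1"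
proof -
  have "(1 + \<bar>x\<bar>) powr (\<alpha> + 1) \<ge> 1" using alpha_gt_2 by (intro ge_one_powr_ge_zero) auto
  then show ?thesis unfolding weight_def powr_minus_divide by (simp add: divide_le_eq)
qed

lemma powr_le_weight: "\<bar>x\<bar> \<ge> 1 \<Longrightarrow> \<bar>x\<bar> powr - (\<alpha> + 1) \<le> 2 powr (\<alpha> + 1) * weight x"
proof -
  assume x: "\<bar>x\<bar> \<ge> 1"
  have "(2 * \<bar>x\<bar>) powr - (\<alpha> + 1) \<le> weight x"
    unfolding weight_def using x alpha_gt_2 by (intro powr_mono2') auto
  then have "2 powr (\<alpha> + 1) * (2 * \<bar>x\<bar>) powr - (\<alpha> + 1) \<le> 2 powr (\<alpha> + 1) * weight x" by (intro mult_left_mono) auto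
  moreover have "2 powr (\<alpha> + 1) * (2 * \<bar>x\<bar>) powr - (\<alpha> + 1) = \<bar>x\<bar> powr - (\<alpha> + 1)"
  proof -
    have "(2::real) powr (\<alpha> + 1) * 2 powr - (\<alpha> + 1) = 1" by (simp only: powr_add[symmetric]) simp
    moreover have "(2 * \<bar>x\<bar>) powr - (\<alpha> + 1) = 2 powr - (\<alpha> + 1) * \<bar>x\<bar> powr - (\<alpha> + 1)" by (rule powr_mult)
    ultimately show ?thesis by (simp only: mult.assoc[symmetric] mult_1)
  qed
  ultimately show ?thesis by linarith
qed

text \<open>The ranges meet at \<bar>x\<bar> = n^\<eta>. Inside, \<open>weight\<close> is at least
  of order n^(-\<delta>/2), so the uniform saving n^(-\<delta>) suffices. Outside, the density and
  the scaled \<open>pareto_G\<close> term are both close to the same power of \<bar>x\<bar>, and the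
  Gaussian part is negligible.\<close>

lemma weighted_error:
  assumes e: "e > 0"
  shows "\<forall>\<^sub>F n in sequentially. \<forall>x. \<bar>d n x - pareto_expansion kappa a \<alpha> n x\<bar> \<le> e * weight x / real n powr (\<alpha> / 2 - 1)"
proof -
  define p where "p = \<alpha> / 2 - 1"
  have p: "p > 0" using alpha_gt_2 by (simp add: p_def)
  obtain \<delta> where \<delta>: "\<delta> > 0" and un: "\<forall>\<^sub>F n in sequentially. \<forall>x. \<bar>d n x - pareto_expansion kappa a \<alpha> n x\<bar> \<le> real n powr (- (\<alpha> / 2 - 1) - \<delta>)"
    using uniform_error by blast
  define \<eta> where "\<eta> = \<delta> / (2 * (\<alpha> + 1))"
  have \<eta>: "\<eta> > 0" using \<delta> alpha_gt_2 by (simp add: \<eta>_def)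
  have "\<alpha> + 1 \<noteq> 0" using alpha_gt_2 by simp
  then have "\<delta> * (\<alpha> + 1) / (2 * (\<alpha> + 1)) = \<delta> / 2" by (rule nonzero_mult_divide_mult_cancel_right)
  then have \<delta>\<eta>: "\<eta> * (\<alpha> + 1) = \<delta> / 2" by (simp only: \<eta>_def times_divide_eq_left)
  define c where "c = 2 powr (\<alpha> + 1)"
  have c: "c > 0" by (simp add: c_def)
  \<comment> \<open>Outside, three errors of relative size e1 add up; the factor a c converts the
    power of \<bar>x\<bar> into \<open>weight\<close>. The cap 1/2 keeps e1 below 1 for the
    asymptotic lemmas.\<close>
  define e1 where "e1 = min (1 / 2) (e / (3 * a * c))"
  have e1: "0 < e1" "e1 < 1" "3 * (e1 * (a * c)) \<le> e"
  proof -
    show "0 < e1" "e1 < 1" using e a_pos c by (auto simp: e1_def)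
    have "e1 * (a * c) \<le> e / (3 * a * c) * (a * c)" using a_pos c by (intro mult_right_mono) (auto simp: e1_def)
    also have "\<dots> = e / 3" using a_pos c by simp
    finally show "3 * (e1 * (a * c)) \<le> e" by simp
  qed
  \<comment> \<open>Beyond n^\<eta>, the part (p + \<delta>) / \<eta> of this exponent yields
    n^(-p-\<delta>), and the part \<alpha> + 1 yields the tail power.\<close>
  define K where "K = nat \<lceil>(p + \<delta>) / \<eta> + (\<alpha> + 1)\<rceil>"
  have K: "real K \<ge> (p + \<delta>) / \<eta> + (\<alpha> + 1)" unfolding K_def by (rule real_nat_ceiling_ge)
  obtain C where C: "C \<ge> 0" "\<And>n x. 1 \<le> n \<Longrightarrow> \<bar>gauss_part n x\<bar> * \<bar>x\<bar> ^ K \<le> C"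
    using gauss_part_decay[of K] by blast
  obtain x0 where x0: "x0 \<ge> 1" "\<And>x. \<bar>x\<bar> \<ge> x0 \<Longrightarrow> \<bar>pareto_G \<alpha> x - \<bar>x\<bar> powr - (\<alpha> + 1)\<bar> \<le> e1 * \<bar>x\<bar> powr - (\<alpha> + 1)"
    using pareto_G_asymp[OF e1(1,2)] by blast
  have rs: "filterlim real at_top sequentially" by (rule filterlim_real_sequentially)
  have ev1: "\<forall>\<^sub>F n in sequentially. c * real n powr - (\<delta> / 2) \<le> e"
    using eventually_compose_filterlim[OF eventually_powr_less[of "\<delta> / 2" e c] rs] \<delta> e by simp
  have ev2: "\<forall>\<^sub>F n in sequentially. C * real n powr - \<delta> \<le> e1 * a"
    using eventually_compose_filterlim[OF eventually_powr_less[of \<delta> "e1 * a" C] rs] \<delta> e1 a_pos by simp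
  have ev3: "\<forall>\<^sub>F n in sequentially. x0 * real n powr - \<eta> \<le> 1"
    using eventually_compose_filterlim[OF eventually_powr_less[of \<eta> 1 x0] rs] \<eta> by simp
  show ?thesis
    using un density_far[OF \<eta> e1(1,2)] ev1 ev2 ev3 eventually_ge_at_top[of 1]
  proof eventually_elim
    case (elim n)
    have n: "real n \<ge> 1" using elim(6) by simp
    define np where "np = real n powr p"
    have np: "np > 0" using n by (simp add: np_def)
    have split: "real n powr (- p - \<delta>) = real n powr - \<delta> / np"
      unfolding np_def using n by (simp add: powr_diff powr_minus_divide)
    show ?case
    proof
      fix x
      show "\<bar>d n x - pareto_expansion kappa a \<alpha> n x\<bar> \<le> e * weight x / real n powr (\<alpha> / 2 - 1)"
      proof (cases "\<bar>x\<bar> > real n powr \<eta>")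
        case False
        have "real n powr - \<delta> \<le> e * weight x"
        proof -
          have n\<eta>: "real n powr \<eta> \<ge> 1" using n \<eta> by (intro ge_one_powr_ge_zero) auto
          have "(2 * real n powr \<eta>) powr - (\<alpha> + 1) \<le> weight x"
            unfolding weight_def using False n\<eta> alpha_gt_2 by (intro powr_mono2') auto
          moreover have "(2 * real n powr \<eta>) powr - (\<alpha> + 1) = real n powr - (\<delta> / 2) / c"
          proof -
            have "\<eta> * - (\<alpha> + 1) = - (\<delta> / 2)" using \<delta>\<eta> by (simp add: algebra_simps)
            then have "(real n powr \<eta>) powr - (\<alpha> + 1) = real n powr - (\<delta> / 2)" by (simp only: powr_powr)
            moreover have "(2 * real n powr \<eta>) powr - (\<alpha> + 1) = 2 powr - (\<alpha> + 1) * (real n powr \<eta>) powr - (\<alpha> + 1)" by (rule powr_mult)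
            ultimately show ?thesis unfolding c_def by (simp only: powr_minus_divide[of 2]) simp
          qed
          ultimately have we: "real n powr - (\<delta> / 2) / c \<le> weight x" by simp
          have "real n powr - \<delta> = real n powr (- (\<delta> / 2) + - (\<delta> / 2))" by simp
          also have "\<dots> = (c * real n powr - (\<delta> / 2)) * (real n powr - (\<delta> / 2) / c)"
            using c by (simp only: powr_add) simp
          also have "\<dots> \<le> e * weight x"
            using elim(3) we e c by (intro mult_mono) auto
          finally show ?thesis .
        qed
        then have "real n powr (- p - \<delta>) \<le> e * weight x / np" unfolding split using np by (intro divide_right_mono) auto
        then show ?thesis using elim(1) unfolding np_def p_def by (auto intro: order_trans)
      next
        case True
        have x0n: "x0 \<le> real n powr \<eta>"
          using elim(5) n by (simp add: powr_minus_divide divide_le_eq)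
        then have x: "\<bar>x\<bar> \<ge> x0" "\<bar>x\<bar> \<ge> 1" using True x0(1) by auto
        define w where "w = \<bar>x\<bar> powr - (\<alpha> + 1)"
        have w0: "w > 0" unfolding w_def powr_gt_zero using x by linarith
        have t1: "\<bar>d n x - a * w / np\<bar> \<le> e1 * (a * w / np)"
          using elim(2) True unfolding w_def np_def p_def by blast
        have t2: "\<bar>a * pareto_G \<alpha> x / np - a * w / np\<bar> \<le> e1 * (a * w / np)"
        proof -
          have "a * pareto_G \<alpha> x / np - a * w / np = a / np * (pareto_G \<alpha> x - w)"
            by (simp add: diff_divide_distrib right_diff_distrib)
          then have "\<bar>a * pareto_G \<alpha> x / np - a * w / np\<bar> = a / np * \<bar>pareto_G \<alpha> x - w\<bar>"
            using a_pos np by (simp add: abs_mult)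
          also have "\<dots> \<le> a / np * (e1 * w)" using x0(2)[OF x(1)] a_pos np by (intro mult_left_mono) (auto simp: w_def)
          finally show ?thesis by (simp add: mult_ac)
        qed
        have t3: "\<bar>gauss_part n x\<bar> \<le> e1 * (a * w / np)"
        proof -
          have xK: "\<bar>x\<bar> ^ K > 0" using x by simp
          have "\<bar>gauss_part n x\<bar> \<le> C / \<bar>x\<bar> ^ K" using C(2)[of n x] elim(6) xK by (simp only: pos_le_divide_eq)
          also have "\<dots> = C * \<bar>x\<bar> powr - real K" using x by (simp add: powr_minus_divide powr_realpow)
          also have "\<dots> \<le> C * \<bar>x\<bar> powr (- ((p + \<delta>) / \<eta>) + - (\<alpha> + 1))"
            using K x C by (intro mult_left_mono powr_mono) auto
          also have "\<dots> = C * \<bar>x\<bar> powr - ((p + \<delta>) / \<eta>) * w" by (simp only: powr_add w_def mult.assoc)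
          also have "\<bar>x\<bar> powr - ((p + \<delta>) / \<eta>) \<le> (real n powr \<eta>) powr - ((p + \<delta>) / \<eta>)"
            using True n \<eta> p \<delta> by (intro powr_mono2') auto
          also have "(real n powr \<eta>) powr - ((p + \<delta>) / \<eta>) = real n powr - \<delta> / np"
            unfolding split[symmetric] powr_powr using \<eta> by simp
          finally have "\<bar>gauss_part n x\<bar> \<le> C * (real n powr - \<delta> / np) * w" using C w0 by (simp add: mult_left_mono mult_right_mono)
          also have "\<dots> = (C * real n powr - \<delta>) * (w / np)" by simp
          also have "\<dots> \<le> (e1 * a) * (w / np)" using elim(4) w0 np by (intro mult_right_mono) auto
          finally show ?thesis by simp
        qed
        have "\<bar>d n x - pareto_expansion kappa a \<alpha> n x\<bar> \<le> 3 * (e1 * (a * w / np))"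
          using t1 t2 t3 unfolding pareto_expansion_eq p_def[symmetric] np_def[symmetric] by linarith
        also have "\<dots> = 3 * (e1 * a) / np * w" by simp
        also have "\<dots> \<le> 3 * (e1 * a) / np * (c * weight x)"
          using powr_le_weight[OF x(2)] e1 a_pos np by (intro mult_left_mono) (auto simp: w_def c_def)
        also have "\<dots> = 3 * (e1 * (a * c)) * weight x / np" by simp
        also have "\<dots> \<le> e * weight x / np"
          using e1(3) weight_pos[of x] np by (intro divide_right_mono mult_right_mono) auto
        finally show ?thesis by (simp add: np_def p_def)
      qed
    qed
  qed
qed

text \<open>The tail asymptotics settle large \<bar>x\<bar>. The rest, with open
  \<delta>-neighbourhoods of the zeros removed, is compact, so the continuous nonzero function is
  bounded away from 0 there.\<close>

lemma pareto_G_lower: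
  assumes "\<delta> > 0"
  shows "\<exists>c>0. \<forall>x. (\<forall>z. pareto_G \<alpha> z = 0 \<longrightarrow> \<delta> \<le> \<bar>x - z\<bar>) \<longrightarrow> c * weight x \<le> \<bar>pareto_G \<alpha> x\<bar>"
proof -
  obtain x0 where x0: "x0 \<ge> 1" "\<And>x. \<bar>x\<bar> \<ge> x0 \<Longrightarrow> \<bar>pareto_G \<alpha> x - \<bar>x\<bar> powr - (\<alpha> + 1)\<bar> \<le> 1 / 2 * \<bar>x\<bar> powr - (\<alpha> + 1)"
    using pareto_G_asymp[of "1 / 2"] by auto
  define S where "S = {-x0..x0} \<inter> (\<Inter>z\<in>{z. pareto_G \<alpha> z = 0}. {x. \<delta> \<le> \<bar>x - z\<bar>})"
  have "closed (\<Inter>z\<in>{z. pareto_G \<alpha> z = 0}. {x. \<delta> \<le> \<bar>x - z\<bar>})"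
    by (intro closed_INT ballI closed_Collect_le continuous_intros)
  then have S: "compact S" unfolding S_def by (intro compact_Int_closed) auto
  have nz: "pareto_G \<alpha> x \<noteq> 0" if "x \<in> S" for x
    using that assms by (auto simp: S_def)
  have "\<exists>c>0. \<forall>x\<in>S. c \<le> \<bar>pareto_G \<alpha> x\<bar>"
  proof (cases "S = {}")
    case False
    have "continuous_on S (\<lambda>x. \<bar>pareto_G \<alpha> x\<bar>)"
      by (intro continuous_intros continuous_on_subset[OF pareto_G_continuous]) auto
    from continuous_attains_inf[OF S False this] obtain s where "s \<in> S" "\<forall>x\<in>S. \<bar>pareto_G \<alpha> s\<bar> \<le> \<bar>pareto_G \<alpha> x\<bar>" by blast
    then show ?thesis using nz[of s] by (intro exI[of _ "\<bar>pareto_G \<alpha> s\<bar>"]) auto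
  qed (auto intro: exI[of _ 1])
  then obtain c where c: "c > 0" "\<And>x. x \<in> S \<Longrightarrow> c \<le> \<bar>pareto_G \<alpha> x\<bar>" by blast
  have "min c (1 / 2) * weight x \<le> \<bar>pareto_G \<alpha> x\<bar>" if far: "\<forall>z. pareto_G \<alpha> z = 0 \<longrightarrow> \<delta> \<le> \<bar>x - z\<bar>" for x
  proof (cases "\<bar>x\<bar> \<ge> x0")
    case True
    have "weight x \<le> \<bar>x\<bar> powr - (\<alpha> + 1)"
      unfolding weight_def using True x0(1) alpha_gt_2 by (intro powr_mono2') auto
    moreover have "1 / 2 * \<bar>x\<bar> powr - (\<alpha> + 1) \<le> \<bar>pareto_G \<alpha> x\<bar>" using x0(2)[OF True] by linarith
    moreover have "min c (1 / 2) * weight x \<le> 1 / 2 * weight x"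
      using weight_pos[of x] by (intro mult_right_mono) auto
    ultimately show ?thesis by linarith
  next
    case False
    then have "x \<in> S" using far by (auto simp: S_def abs_le_iff)
    then have "c \<le> \<bar>pareto_G \<alpha> x\<bar>" by (rule c(2))
    moreover have "min c (1 / 2) * weight x \<le> c * 1"
      using weight_pos[of x] weight_le_1[of x] c(1) by (intro mult_mono) auto
    ultimately show ?thesis by simp
  qed
  then show ?thesis using c(1) by (intro exI[of _ "min c (1 / 2)"]) auto
qed

lemma edgeworth_expansion:
  assumes e: "e > 0" and \<delta>: "\<delta> > 0"
  shows "\<forall>\<^sub>F n in sequentially. \<forall>x.
     ((\<forall>z. pareto_G \<alpha> z = 0 \<longrightarrow> \<delta> \<le> \<bar>x - z\<bar>) \<longrightarrow>
        \<bar>d n x - pareto_expansion kappa a \<alpha> n x\<bar> \<le> e * (\<bar>pareto_G \<alpha> x\<bar> / real n powr (\<alpha> / 2 - 1))) \<and>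
     \<bar>d n x - pareto_expansion kappa a \<alpha> n x\<bar> \<le> e / real n powr (\<alpha> / 2 - 1)"
proof -
  obtain c where c: "c > 0" "\<And>x. (\<forall>z. pareto_G \<alpha> z = 0 \<longrightarrow> \<delta> \<le> \<bar>x - z\<bar>) \<Longrightarrow> c * weight x \<le> \<bar>pareto_G \<alpha> x\<bar>"
    using pareto_G_lower[OF \<delta>] by blast
  \<comment> \<open>The entry e c serves the relative bound through \<open>pareto_G_lower\<close>;
    the entry e serves the absolute bound, as \<open>weight\<close> is at most 1.\<close>
  define e' where "e' = min e (e * c)"
  have "e' > 0" using e c by (simp add: e'_def)
  from weighted_error[OF this] show ?thesis
  proof eventually_elim
    case (elim n)
    show ?case
    proof (intro allI conjI impI)
      fix x
      assume "\<forall>z. pareto_G \<alpha> z = 0 \<longrightarrow> \<delta> \<le> \<bar>x - z\<bar>"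
      from c(2)[OF this] have "e * (c * weight x) \<le> e * \<bar>pareto_G \<alpha> x\<bar>" using e by (intro mult_left_mono) auto
      moreover have "e' * weight x \<le> e * c * weight x" using weight_pos[of x] by (intro mult_right_mono) (auto simp: e'_def)
      ultimately have "e' * weight x / real n powr (\<alpha> / 2 - 1) \<le> e * \<bar>pareto_G \<alpha> x\<bar> / real n powr (\<alpha> / 2 - 1)"
        by (intro divide_right_mono) auto
      with elim[rule_format, of x] show "\<bar>d n x - pareto_expansion kappa a \<alpha> n x\<bar> \<le> e * (\<bar>pareto_G \<alpha> x\<bar> / real n powr (\<alpha> / 2 - 1))"
        by simp
    next
      fix x
      have "e' * weight x \<le> e * 1" using weight_pos[of x] weight_le_1[of x] e by (intro mult_mono) (auto simp: e'_def)
      then have "e' * weight x / real n powr (\<alpha> / 2 - 1) \<le> e / real n powr (\<alpha> / 2 - 1)"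
        by (intro divide_right_mono) auto
      with elim[rule_format, of x] show "\<bar>d n x - pareto_expansion kappa a \<alpha> n x\<bar> \<le> e / real n powr (\<alpha> / 2 - 1)"
        by simp
    qed
  qed
qed

end

text \<open>For \<alpha> \<le> 2 the integrand exceeds a multiple of 1 / x beyond some point, and
  the logarithm diverges. The centre m is arbitrary because \<alpha> > 2 is derived before the mean
  is computed.\<close>

lemma pareto_finite_variance:
  fixes a b \<alpha> m :: real
  assumes ab: "a > 0" "b > 0" and int: "integrable lborel (\<lambda>x. pareto_density a b \<alpha> x * (x - m)\<^sup>2)"
  shows "\<alpha> > 2"
proof (rule ccontr)
  assume "\<not> \<alpha> > 2"
  then have \<alpha>: "\<alpha> \<le> 2" by simp
  \<comment> \<open>The 4 comes from (x - m)^2 \<ge> (x / 2)^2 for x \<ge> 2 \<bar>m\<bar>, and b +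
    1 from bounding the denominator by (b + 1) x^3.\<close>
  define c where "c = a / (4 * (b + 1))"
  have c: "c > 0" using ab by (simp add: c_def)
  define x0 where "x0 = max 1 (2 * \<bar>m\<bar>)"
  have x0: "x0 \<ge> 1" by (simp add: x0_def)
  let ?h = "\<lambda>x. pareto_density a b \<alpha> x * (x - m)\<^sup>2"
  have h0: "?h x \<ge> 0" for x using ab by (simp add: pareto_density_def)
  have low: "c * inverse x \<le> ?h x" if x: "x \<ge> x0" for x
  proof -
    have x1: "x \<ge> 1" "x \<ge> 2 * \<bar>m\<bar>" using x by (auto simp: x0_def)
    have "\<bar>x\<bar> powr (\<alpha> + 1) \<le> \<bar>x\<bar> powr 3" using x1 \<alpha> by (intro powr_mono) auto
    also have "\<bar>x\<bar> powr 3 = x ^ 3" using x1 by simp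
    moreover have "b * 1 \<le> b * x ^ 3" using x1 ab by (intro mult_left_mono one_le_power) auto
    ultimately have "b + \<bar>x\<bar> powr (\<alpha> + 1) \<le> b * x ^ 3 + x ^ 3" by linarith
    then have "a / (b * x ^ 3 + x ^ 3) \<le> pareto_density a b \<alpha> x"
      unfolding pareto_density_def using ab x1 by (intro divide_left_mono mult_pos_pos add_pos_nonneg) auto
    moreover have "(x / 2)\<^sup>2 \<le> (x - m)\<^sup>2" using x1 by (intro power_mono) auto
    ultimately have "a / (b * x ^ 3 + x ^ 3) * (x / 2)\<^sup>2 \<le> ?h x"
      using ab by (intro mult_mono) (auto simp: pareto_density_def)
    moreover have "a / (b * x ^ 3 + x ^ 3) * (x / 2)\<^sup>2 = c * inverse x"
    proof -
      have "b * x ^ 3 + x ^ 3 = (b + 1) * x * x\<^sup>2" by (simp add: power3_eq_cube power2_eq_square algebra_simps)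
      moreover have "b + 1 \<noteq> 0" "x \<noteq> 0" using x1 ab by auto
      ultimately show ?thesis unfolding c_def by (simp add: divide_simps power2_eq_square)
    qed
    ultimately show ?thesis by simp
  qed
  define V where "V = (LINT x|lborel. ?h x)"
  \<comment> \<open>The endpoint makes the logarithmic lower bound equal to V + c, just above the
    integral V.\<close>
  define T where "T = x0 * exp (V / c + 1)"
  have V: "V \<ge> 0" unfolding V_def using h0 by (intro integral_nonneg_AE) auto
  have T: "T \<ge> x0" unfolding T_def using mult_left_mono[of 1 "exp (V / c + 1)" x0] x0 V c by simp
  have fc: "has_bochner_integral lborel (\<lambda>x. c * inverse x * indicator {x0..T} x) (c * ln T - c * ln x0)"
    using x0 T c
    by (intro has_bochner_integral_FTC_Icc_nonneg)
       (auto intro!: derivative_eq_intros continuous_intros simp: field_simps)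
  have "c * ln T - c * ln x0 \<le> V"
    unfolding V_def has_bochner_integral_integral_eq[OF fc, symmetric]
    using low h0 by (intro integral_mono fc[THEN integrable.intros] int) (auto simp: indicator_def)
  moreover have "c * ln T - c * ln x0 = V + c"
    unfolding T_def using x0 c by (simp add: ln_mult algebra_simps)
  ultimately show False using c by simp
qed

text \<open>Reflection shows that the integral equals its own negative; without integrability the
  Bochner integral is 0 by convention, so the mean can be computed directly.\<close>

lemma lborel_integral_odd:
  fixes g :: "real \<Rightarrow> real"
  assumes "\<And>x. g (- x) = - g x"
  shows "(LINT x|lborel. g x) = 0"
  using lborel_integral_real_affine[of "-1" g 0] assms by simp

theorem theorem3:
  fixes M :: "'a measure"
    and X :: "nat \<Rightarrow> 'a \<Rightarrow> real"
    and \<alpha> a b :: real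
    and f :: "nat \<Rightarrow> real \<Rightarrow> real"
  assumes "prob_space M"
    and "a > 0" and "b > 0"
    and "\<not> (\<exists>m::int. even m \<and> \<alpha> = of_int m)"
    and "prob_space.indep_vars M (\<lambda>_. borel) X {1..}"
    and "\<And>k. k \<ge> 1 \<Longrightarrow> distributed M lborel (X k) (\<lambda>x. ennreal (pareto_density a b \<alpha> x))"
    and "\<And>k. k \<ge> 1 \<Longrightarrow> prob_space.variance M (X k) = 1"
    and "\<And>n. n \<ge> 1 \<Longrightarrow>
           distributed M lborel (\<lambda>\<omega>. (\<Sum>k=1..n. X k \<omega>) / sqrt (real n)) (\<lambda>x. ennreal (f n x))"
    and "\<And>n x. n \<ge> 1 \<Longrightarrow> f n x \<ge> 0"
    and "\<And>n. n \<ge> 1 \<Longrightarrow> continuous_on UNIV (f n)"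
  shows "\<forall>\<epsilon>>0. \<forall>\<delta>>0. \<forall>\<^sub>F n in sequentially. \<forall>x \<le> sqrt ((\<alpha> - 2) * ln (real n)).
           ((\<forall>z. pareto_G \<alpha> z = 0 \<longrightarrow> \<delta> \<le> \<bar>x - z\<bar>) \<longrightarrow>
              \<bar>f n x - pareto_expansion (cumulant M (X 1)) a \<alpha> n x\<bar>
                \<le> \<epsilon> * (\<bar>pareto_G \<alpha> x\<bar> / real n powr (\<alpha> / 2 - 1))) \<and>
           \<bar>f n x - pareto_expansion (cumulant M (X 1)) a \<alpha> n x\<bar>
             \<le> \<epsilon> / real n powr (\<alpha> / 2 - 1)"
proof -
  interpret prob_space M by fact
  let ?f = "pareto_density a b \<alpha>"
  have f0: "?f x \<ge> 0" for x using \<open>a > 0\<close> \<open>b > 0\<close> by (simp add: pareto_density_def)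
  have dist: "distributed M lborel (X 1) (\<lambda>x. ennreal (?f x))" using assms(6) by simp
  note E = distributed_integral[OF dist, symmetric] and I = distributed_integrable[OF dist, symmetric]
  define m where "m = expectation (X 1)"
  have var: "variance (X 1) = 1" using assms(7) by simp
  \<comment> \<open>A non-integrable square would have integral 0 by convention, contradicting
    variance 1; the equation therefore carries finiteness of the variance.\<close>
  then have "integrable M (\<lambda>\<omega>. (X 1 \<omega> - m)\<^sup>2)"
    unfolding m_def using not_integrable_integral_eq by fastforce
  then have int: "integrable lborel (\<lambda>x. ?f x * (x - m)\<^sup>2)"
    using f0 by (subst (asm) I) auto
  have \<alpha>: "\<alpha> > 2" by (rule pareto_finite_variance[OF \<open>a > 0\<close> \<open>b > 0\<close> int])
  have "m = (LINT x|lborel. ?f x * x)"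
    unfolding m_def using f0 by (subst E) auto
  also have "\<dots> = 0" by (rule lborel_integral_odd) (simp add: pareto_density_def)
  finally have m: "m = 0" .
  have "1 = (LINT x|lborel. ?f x * x\<^sup>2)"
    unfolding var[symmetric] m_def[symmetric] m using f0 by (subst E) auto
  then have "(\<integral>\<^sup>+x. ennreal (?f x * x\<^sup>2) \<partial>lborel) = 1"
    using int f0 by (subst nn_integral_eq_integral) (auto simp: m)
  then have second: "(\<integral>\<^sup>+x. ennreal (x\<^sup>2) * ennreal (?f x) \<partial>lborel) = 1"
    using f0 by (simp add: ennreal_mult mult.commute)
  have mass: "(\<integral>\<^sup>+x. ennreal (?f x) \<partial>lborel) = 1"
    using distributed_nn_integral[OF dist, of "\<lambda>_. 1"] by (simp add: emeasure_space_1)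
  \<comment> \<open>The ceiling gives the smallest even integer not below \<alpha>; as \<alpha> is
    not an even integer, the inequality is strict.\<close>
  define N where "N = 2 * nat \<lceil>\<alpha> / 2\<rceil>"
  have N: "real N - 2 < \<alpha>" "\<alpha> < real N"
  proof -
    have N': "real N = 2 * of_int \<lceil>\<alpha> / 2\<rceil>" using \<alpha> by (simp add: N_def)
    have "\<alpha> \<noteq> 2 * of_int \<lceil>\<alpha> / 2\<rceil>"
      using assms(4) by (metis dvd_triv_left of_int_mult of_int_numeral)
    then show "real N - 2 < \<alpha>" "\<alpha> < real N"
      unfolding N' using le_of_int_ceiling[of "\<alpha> / 2"] of_int_ceiling_le_add_one[of "\<alpha> / 2"]
        ceiling_correct[of "\<alpha> / 2"] by linarith+
  qed
  have par: "pareto a b \<alpha>"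
    by unfold_locales (use assms(2,3) \<alpha> mass second in auto)
  interpret P: pareto_sum a b \<alpha> N M X f
    by unfold_locales (use assms(2,3,5,6,8-) \<alpha> mass second N in \<open>auto simp: N_def pareto.f_def[OF par]\<close>)
  \<comment> \<open>The transfer of integrals to the density holds for every order: moments that do
    not exist are 0 on both sides, so even the junk coefficients agree.\<close>
  have "cumulant M (X 1) = P.kappa"
  proof
    fix l
    have "(\<integral>\<omega>. X 1 \<omega> ^ k \<partial>M) = P.moment k" for k
      unfolding P.moment_def P.f_def using f0 by (subst E) auto
    then show "cumulant M (X 1) l = P.kappa l"
      by (simp add: cumulant_def P.kappa_def formal_log_def P.mgf_def)
  qed
  moreover have "\<forall>\<^sub>F n in sequentially. \<forall>x \<le> sqrt ((\<alpha> - 2) * ln (real n)). R n x"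
    if "\<forall>\<^sub>F n in sequentially. \<forall>x. R n x" for R :: "nat \<Rightarrow> real \<Rightarrow> bool"
    using that by (rule eventually_mono) blast
  ultimately show ?thesis using P.edgeworth_expansion by simp
qed

end
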